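(* Let $n\ge1$ and let $\{M_k\}_k$ be a log convex sequence of positive real numbers. Let $\mathcal{C}(\{M_k\}_k,\mathcal{L},\mathbb{H}^n)$ be the class of all smooth functions $f$ on the Heisenberg group $\mathbb{H}^n$ satisfying $$f(\rho\,\omega\sqrt{\sin\theta},\,\rho^2\cos\theta)=f(\rho\,\omega,0)\qquad\text{for all }\rho>0,\ \omega\in S^{2n-1}\subset\mathbb{C}^n,\ 0\le\theta\le\pi,$$ such that $\mathcal{L}^kf\in L^2(\mathbb{H}^n)$ for all $k\in\mathbb{N}$ and $\|\mathcal{L}^kf\|_2\le M_k\lambda^k$ for all $k\in\mathbb{N}$, for some constant $\lambda>0$ (which may depend on $f$). Suppose that $\sum_{k=1}^\infty M_k^{-\frac1{2k}}=\infty$. Then the class is quasi-analytic: if $f\in\mathcal{C}(\{M_k\}_k,\mathcal{L},\mathbb{H}^n)$ and $f$ and all its partial derivatives vanish at $0$, then $f$ is identically zero.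
   Context: $\mathbb{H}^n=\mathbb{C}^n\times\mathbb{R}$ is the Heisenberg group with group law $(z,t)(w,s)=\big(z+w,\,t+s+\tfrac12\operatorname{Im}(z\cdot\bar w)\big)$; Haar measure is Lebesgue measure $dz\,dt$ and $\|\cdot\|_2$ is the norm of $L^2(\mathbb{H}^n)$. Writing $z=x+iy$, the left invariant vector fields are $X_j=\frac{\partial}{\partial x_j}+\frac12 y_j\frac{\partial}{\partial t}$, $Y_j=\frac{\partial}{\partial y_j}-\frac12 x_j\frac{\partial}{\partial t}$ ($j=1,\dots,n$), and the sublaplacian is $\mathcal{L}=-\sum_{j=1}^n(X_j^2+Y_j^2)$. Here $\mathbb{N}=\{0,1,2,\dots\}$. A positive sequence is log convex if $M_k^2\le M_{k-1}M_{k+1}$ for all $k\ge1$. *)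

theory Defs
  imports "HOL-Analysis.Analysis"
begin

definition partial_deriv :: "'a::euclidean_space \<Rightarrow> ('a \<Rightarrow> complex) \<Rightarrow> 'a \<Rightarrow> complex" where
  "partial_deriv b f x = frechet_derivative f (at x) b"

primrec iter_partial :: "'a::euclidean_space list \<Rightarrow> ('a \<Rightarrow> complex) \<Rightarrow> 'a \<Rightarrow> complex" where
  "iter_partial [] f = f"
| "iter_partial (b # bs) f = partial_deriv b (iter_partial bs f)"

(* C^infinity: the function and all its partial derivatives, of every order and in every
   sequence of coordinate directions, are Frechet differentiable everywhere.  Differentiability
   one order higher makes all of them continuous, so this is the usual notion, and the
   underspecified value of frechet_derivative at a point of non-differentiability is never used. *)
definition smooth :: "('a::euclidean_space \<Rightarrow> complex) \<Rightarrow> bool" where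
  "smooth f \<longleftrightarrow> (\<forall>bs\<in>lists Basis. \<forall>x. iter_partial bs f differentiable (at x))"

definition vanishes_to_infinite_order_at ::
    "('a::euclidean_space \<Rightarrow> complex) \<Rightarrow> 'a \<Rightarrow> bool" where
  "vanishes_to_infinite_order_at f x \<longleftrightarrow> (\<forall>bs\<in>lists Basis. iter_partial bs f x = 0)"

definition in_L2 :: "('a::euclidean_space \<Rightarrow> complex) \<Rightarrow> bool" where
  "in_L2 f \<longleftrightarrow> f \<in> borel_measurable lborel \<and> integrable lborel (\<lambda>x. (cmod (f x))\<^sup>2)"

definition L2_norm :: "('a::euclidean_space \<Rightarrow> complex) \<Rightarrow> real" where
  "L2_norm f = sqrt (\<integral>x. (cmod (f x))\<^sup>2 \<partial>lborel)"

(* The underlying manifold C^n x R of the Heisenberg group, with n = CARD('n).  The group law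
   (z,t)(w,s) = (z + w, t + s + Im (z . cnj w) / 2) enters only through the left invariant vector
   fields below; Haar measure is Lebesgue measure, i.e. lborel on this Euclidean space. *)
type_synonym 'n heis = "(complex ^ 'n) \<times> real"

(* The coordinates of (z, t) are x_j = Re (z $ j), y_j = Im (z $ j) and t, with unit vectors
   (axis j 1, 0), (axis j \<i>, 0) and (0, 1). *)
definition heis_X :: "'n::finite \<Rightarrow> ('n heis \<Rightarrow> complex) \<Rightarrow> 'n heis \<Rightarrow> complex" where
  "heis_X j f p =
     partial_deriv (axis j 1, 0) f p
       + complex_of_real (Im (fst p $ j) / 2) * partial_deriv (0, 1) f p"

definition heis_Y :: "'n::finite \<Rightarrow> ('n heis \<Rightarrow> complex) \<Rightarrow> 'n heis \<Rightarrow> complex" where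
  "heis_Y j f p =
     partial_deriv (axis j \<i>, 0) f p
       - complex_of_real (Re (fst p $ j) / 2) * partial_deriv (0, 1) f p"

definition sublaplacian :: "('n::finite heis \<Rightarrow> complex) \<Rightarrow> 'n heis \<Rightarrow> complex" where
  "sublaplacian f p = - (\<Sum>j\<in>UNIV. heis_X j (heis_X j f) p + heis_Y j (heis_Y j f) p)"

definition log_convex :: "(nat \<Rightarrow> real) \<Rightarrow> bool" where
  "log_convex M \<longleftrightarrow> (\<forall>k\<ge>1. (M k)\<^sup>2 \<le> M (k - 1) * M (k + 1))"

(* The norm of complex ^ 'n is the Euclidean one, so sphere 0 1 is the sphere S^(2n-1). *)
definition heis_class :: "(nat \<Rightarrow> real) \<Rightarrow> ('n::finite heis \<Rightarrow> complex) set" where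
  "heis_class M = {f. smooth f
     \<and> (\<forall>\<rho>>0. \<forall>\<omega>\<in>sphere 0 1. \<forall>\<theta>\<in>{0..pi}.
           f ((\<rho> * sqrt (sin \<theta>)) *\<^sub>R \<omega>, \<rho>\<^sup>2 * cos \<theta>) = f (\<rho> *\<^sub>R \<omega>, 0))
     \<and> (\<forall>k. in_L2 ((sublaplacian ^^ k) f))
     \<and> (\<exists>c>0. \<forall>k. L2_norm ((sublaplacian ^^ k) f) \<le> M k * c ^ k)}"

end

theory Submission
  imports Defs "HOL-Real_Asymp.Real_Asymp" "HOL-Probability.Probability" "HOL-Complex_Analysis.Complex_Analysis"
begin

text \<open>
  Write \<open>L\<close> for the sublaplacian, \<open>N (z, t) = (|z|^4 + t^2)^(1/2)\<close> and let \<open>p s\<close> be the heat kernel of \<open>L\<close>,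
  given by Mehler's formula. The invariance condition says \<open>f = g \<circ> N\<close> with \<open>g s = f (0, s)\<close>. Since every
  \<open>L^k f\<close> is flat at \<open>0\<close> and \<open>p s\<close> has Gaussian decay, \<open>Y q s = \<integral> q(L) f \<cdot> p s\<close> is \<open>O(s^m)\<close> for all \<open>m\<close>
  as \<open>s \<rightarrow> 0\<close>, and \<open>(Y q)' = - Y (X q)\<close>. Hence the Laplace transform at \<open>c\<close> of \<open>Y q\<close> depends on \<open>q\<close> only
  through \<open>q(-c)\<close>; it is bounded by a multiple of the norm of \<open>(L + c)^J q(L) f\<close>. Carleman's condition for
  the Stieltjes functional \<open>q \<mapsto> \<langle>q(L) f, f\<rangle>\<close> (with weight \<open>(X + c)^(2J + 1)\<close>) makes that norm
  arbitrarily small under \<open>q(-c) = 1\<close>, so that \<open>Y 1\<close> vanishes identically.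

  By homogeneity this reads \<open>\<integral> g(s N x) p 1 x dx = 0\<close> for all \<open>s > 0\<close>. Integrating against
  \<open>s^(-\<alpha> - 1)\<close> factors it as a product of the Mellin transforms of \<open>g\<close> and of \<open>p 1\<close> along \<open>N\<close>, one of which
  therefore vanishes for infinitely many \<open>\<alpha>\<close> in a compact interval, hence identically. As \<open>p 1\<close> is
  positive near the origin, it must be the one of \<open>g\<close>.
\<close>

subsection \<open>Stieltjes functionals and Carleman's condition\<close>

text \<open>The spectral measure of \<open>f\<close> enters only through a functional on
  polynomials, whose positivity comes from integration by parts. Two obstacles shape the estimates.
  First, the L^2 norm of the heat kernel is of size \<open>s^(-(n+1)/2)\<close> as \<open>s\<close>
  tends to 0, which is not integrable for \<open>n >= 1\<close>, so Cauchy-Schwarz cannot be applied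
  to the Laplace transform directly. Inserting \<open>s^J\<close> with \<open>J = n + 1\<close>
  repairs this, and integrating by parts \<open>J\<close> times shows that the price is a factor
  \<open>(L + c)^J\<close>. Second, the Carleman argument makes either \<open>S(q^2)\<close> or
  \<open>S(X q^2)\<close> small, without saying which. The odd extra factor \<open>X + c\<close> in
  the weight makes either outcome control a norm; in the second case \<open>q\<close> is replaced by
  \<open>- X q / c\<close>, which also has value 1 at \<open>-c\<close>. The heat equation is
  checked on the separate Fourier modes in \<open>t\<close> and used in weak form, so that spatial
  derivatives never fall on the kernel.\<close>

abbreviation polyX :: "real poly" where "polyX \<equiv> [:0, 1:]"

locale stieltjes_functional =
  fixes S :: "real poly \<Rightarrow> real"
  assumes add: "S (p + q) = S p + S q"
    and smult: "S (smult a p) = a * S p"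
    and pos: "S (p * p) \<ge> 0"
    and posX: "S (polyX * (p * p)) \<ge> 0"
begin

text \<open>Two families of monic orthogonal polynomials are interleaved: \<open>Q (2 * a)\<close>
  has degree \<open>a\<close> and belongs to \<open>S\<close>, \<open>Q (2 * a + 1)\<close> has
  degree \<open>a\<close> and belongs to the functional weighted by \<open>polyX\<close>. Written in
  \<open>x^2\<close>, with an extra factor \<open>x\<close> at odd indices, they are the orthogonal
  polynomials of the symmetrised functional, and the recursion is its three-term recursion.\<close>

fun Q :: "nat \<Rightarrow> real poly" where
  "Q 0 = 1"
| "Q (Suc 0) = 1"
| "Q (Suc (Suc k)) = polyX ^ (Suc k mod 2) * Q (Suc k)
     - smult (S (polyX ^ (Suc k mod 2 + Suc k div 2) * Q (Suc k)) / S (polyX ^ (k mod 2 + k div 2) * Q k)) (Q k)"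

text \<open>The squared norm of \<open>Q k\<close> in its own form, by \<open>h_eq_form\<close>.
  Only the leading monomial of the second factor is written, since orthogonality removes the
  rest.\<close>

definition h :: "nat \<Rightarrow> real" where "h k = S (polyX ^ (k mod 2 + k div 2) * Q k)"

lemma Q_rec: "Q (Suc (Suc k)) = polyX ^ (Suc k mod 2) * Q (Suc k) - smult (h (Suc k) / h k) (Q k)"
  by (simp only: Q.simps h_def)

declare Q.simps(3) [simp del]

lemma diff: "S (p - q) = S p - S q"
  using add[of p "smult (- 1) q"] smult[of "-1" q] by simp

lemma zero: "S 0 = 0"
  using smult[of 0 0] by simp

lemma sum: "S (sum g A) = (\<Sum>i\<in>A. S (g i))"
  by (induction A rule: infinite_finite_induct) (auto simp: zero add)

lemma mod_div_Suc: "Suc k mod 2 + k mod 2 = 1" "Suc k div 2 = k div 2 + k mod 2"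
  by (presburger, presburger)

lemma mod_Suc_Suc_2: "Suc (Suc k) mod 2 = k mod 2" for k :: nat
  by presburger

lemma form_nonneg: "S (polyX ^ (k mod 2) * (p * p)) \<ge> 0"
proof (cases "even k")
  case True then show ?thesis using pos by (simp add: even_iff_mod_2_eq_zero)
next
  case False then show ?thesis using posX by (simp add: odd_iff_mod_2_eq_one)
qed

text \<open>Strong induction through the recursion. For \<open>i\<close> below
  \<open>k2 div 2\<close> both terms on the right vanish; at \<open>i = k2 div 2\<close> they are
  \<open>h (Suc k2)\<close> and the recursion coefficient times \<open>h k2\<close>, and that
  coefficient was chosen so that they cancel.\<close>

lemma orthogonal_monomials:
  assumes "\<And>j. j < k \<Longrightarrow> h j > 0" "i < k div 2"
  shows "S (polyX ^ (k mod 2 + i) * Q k) = 0"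
  using assms
proof (induction k arbitrary: i rule: less_induct)
  case (less k)
  show ?case
  proof (cases k)
    case 0 then show ?thesis using less.prems by simp
  next
    case (Suc k1)
    show ?thesis
    proof (cases k1)
      case 0 then show ?thesis using less.prems Suc by simp
    next
      case (Suc k2)
      have k: "k = Suc (Suc k2)" using \<open>k = Suc k1\<close> Suc by simp
      let ?\<beta> = "h (Suc k2) / h k2"
      have hp: "h k2 > 0" "h (Suc k2) > 0" using less.prems(1) k by auto
      have i: "i \<le> k2 div 2" using less.prems(2) k by simp
      have "polyX ^ (k mod 2 + i) * (polyX ^ (Suc k2 mod 2) * Q (Suc k2))
          = polyX ^ (k mod 2 + i + Suc k2 mod 2) * Q (Suc k2)"
        by (simp add: power_add mult_ac)
      also have "k mod 2 + i + Suc k2 mod 2 = Suc i"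
        using k by presburger
      finally have "polyX ^ (k mod 2 + i) * Q k
          = polyX ^ Suc i * Q (Suc k2) - smult ?\<beta> (polyX ^ (k2 mod 2 + i) * Q k2)"
        unfolding k Q_rec by (simp only: right_diff_distrib mult_smult_right mod_Suc_Suc_2)
      then have e1: "S (polyX ^ (k mod 2 + i) * Q k)
          = S (polyX ^ Suc i * Q (Suc k2)) - ?\<beta> * S (polyX ^ (k2 mod 2 + i) * Q k2)"
        by (simp only: diff smult)
      have A: "S (polyX ^ Suc i * Q (Suc k2)) = (if i < k2 div 2 then 0 else h (Suc k2))"
      proof (cases "i < k2 div 2")
        case True
        have "S (polyX ^ (Suc k2 mod 2 + (i + k2 mod 2)) * Q (Suc k2)) = 0"
          using True less.prems k by (intro less.IH) (auto simp: mod_div_Suc(2))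
        then show ?thesis using True mod_div_Suc(1)[of k2] by (simp add: add_ac del: power_Suc)
      next
        case False
        then have "Suc i = Suc k2 mod 2 + Suc k2 div 2" using i by presburger
        then show ?thesis using False by (simp add: h_def del: power_Suc)
      qed
      have B: "S (polyX ^ (k2 mod 2 + i) * Q k2) = (if i < k2 div 2 then 0 else h k2)"
        using less.IH[of k2 i] less.prems i k by (auto simp: h_def)
      show ?thesis unfolding e1 A B using hp by auto
    qed
  qed
qed

text \<open>The second alternative covers degree 0, where no remainder can have a smaller
  degree.\<close>

lemma Q_monic: "degree (Q k - monom 1 (k div 2)) < k div 2 \<or> Q k = monom 1 (k div 2)"
proof (induction k rule: Q.induct)
  case (3 k)
  let ?a = "k div 2"
  define r1 where "r1 = Q (Suc k) - monom 1 (Suc k div 2)"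
  define r2 where "r2 = smult (h (Suc k) / h k) (Q k)"
  have dk: "degree (Q k) \<le> ?a"
  proof -
    have "Q k = monom 1 ?a + (Q k - monom 1 ?a)" by simp
    then show ?thesis using 3(3) degree_add_le[of "monom 1 ?a" ?a "Q k - monom 1 ?a"]
      by (auto simp: degree_monom_eq)
  qed
  have r2: "degree r2 \<le> ?a" unfolding r2_def using dk degree_smult_le le_trans by blast
  have r1: "degree r1 < Suc k div 2 \<or> r1 = 0" using 3 unfolding r1_def by auto
  have "polyX ^ (Suc k mod 2) * monom 1 (Suc k div 2) = monom 1 (Suc (Suc k) div 2)"
  proof -
    have "polyX ^ (Suc k mod 2) = monom 1 (Suc k mod 2)" by (simp add: monom_altdef)
    moreover have "Suc k mod 2 + Suc k div 2 = Suc (Suc k) div 2" by presburger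
    ultimately show ?thesis by (simp add: mult_monom)
  qed
  then have eq: "Q (Suc (Suc k)) - monom 1 (Suc (Suc k) div 2) = polyX ^ (Suc k mod 2) * r1 - r2"
    unfolding Q_rec r1_def r2_def by (simp add: algebra_simps)
  have d1: "degree (polyX ^ (Suc k mod 2) * r1) \<le> ?a"
  proof (cases "r1 = 0")
    case False
    have "degree (polyX ^ (Suc k mod 2) * r1) = Suc k mod 2 + degree r1"
      using False by (subst degree_mult_eq) (auto simp: degree_power_eq)
    also have "\<dots> \<le> ?a" using r1 False by presburger
    finally show ?thesis .
  qed simp
  have "degree (Q (Suc (Suc k)) - monom 1 (Suc (Suc k) div 2)) \<le> ?a"
    unfolding eq using degree_diff_le[OF d1 r2] .
  then show ?case by (simp add: less_Suc_eq_le)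
qed (auto simp: monom_0 one_pCons)

lemma degree_Q: "degree (Q k) \<le> k div 2"
proof -
  have "Q k = monom 1 (k div 2) + (Q k - monom 1 (k div 2))" by simp
  then show ?thesis
    using Q_monic[of k] degree_add_le[of "monom 1 (k div 2)" "k div 2" "Q k - monom 1 (k div 2)"]
    by (auto simp: degree_monom_eq)
qed

lemma poly_as_powers: "p = (\<Sum>i\<le>degree p. smult (coeff p i) (polyX ^ i))"
  by (subst poly_as_sum_of_monoms[symmetric]) (simp add: monom_altdef)

lemma orthogonal_lower:
  assumes "\<And>j. j < k \<Longrightarrow> h j > 0" "degree p < k div 2"
  shows "S (polyX ^ (k mod 2) * (Q k * p)) = 0"
proof -
  have "polyX ^ (k mod 2) * (Q k * p)
      = (\<Sum>i\<le>degree p. smult (coeff p i) (polyX ^ (k mod 2 + i) * Q k))"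
    by (subst (1) poly_as_powers[of p]) (simp add: sum_distrib_left power_add mult_ac)
  then show ?thesis
    using orthogonal_monomials[OF assms(1)] assms(2) by (simp add: sum smult)
qed

text \<open>Replacing one factor by its leading monomial costs a polynomial of degree below
  \<open>k div 2\<close>, to which \<open>Q k\<close> is orthogonal.\<close>

lemma h_eq_form:
  assumes "\<And>j. j < k \<Longrightarrow> h j > 0"
  shows "S (polyX ^ (k mod 2) * (Q k * Q k)) = h k"
proof -
  let ?r = "Q k - monom 1 (k div 2)"
  have "polyX ^ (k mod 2) * (Q k * Q k)
     = polyX ^ (k mod 2) * (Q k * ?r) + polyX ^ (k mod 2 + k div 2) * Q k"
    by (simp add: algebra_simps power_add monom_altdef)
  moreover have "S (polyX ^ (k mod 2) * (Q k * ?r)) = 0"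
    using Q_monic[of k] orthogonal_lower[OF assms] by (auto simp: zero)
  ultimately show ?thesis by (simp add: add h_def)
qed

lemma h_nonneg: "(\<And>j. j < k \<Longrightarrow> h j > 0) \<Longrightarrow> h k \<ge> 0"
  using h_eq_form form_nonneg by metis

text \<open>Among the monic polynomials of its degree \<open>Q k\<close> has the least norm. The
  proof expands the form at \<open>X^(k div 2) - Q k\<close>, where the cross terms contribute
  \<open>- 2 * h k\<close> and the square \<open>h k\<close>.\<close>

lemma h_le_moment:
  assumes "\<And>j. j < k \<Longrightarrow> h j > 0"
  shows "h k \<le> S (polyX ^ k)"
proof -
  let ?x = "polyX ^ (k div 2)" and ?w = "polyX ^ (k mod 2)"
  have "0 \<le> S (?w * ((?x - Q k) * (?x - Q k)))" by (rule form_nonneg)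
  also have "?w * ((?x - Q k) * (?x - Q k)) =
      polyX ^ (k mod 2 + k div 2 + k div 2) - smult 2 (polyX ^ (k mod 2 + k div 2) * Q k) + ?w * (Q k * Q k)"
    by (simp add: algebra_simps power_add numeral_poly flip: mult_2)
  also have "k mod 2 + k div 2 + k div 2 = k" by presburger
  finally show ?thesis using h_eq_form[OF assms] by (simp add: add diff smult h_def)
qed

lemma orthogonal:
  assumes "\<And>j. h j > 0" "j \<noteq> k" "j mod 2 = k mod 2"
  shows "S (polyX ^ (k mod 2) * (Q k * Q j)) = 0"
proof -
  have *: "S (polyX ^ (k mod 2) * (Q k * Q j)) = 0" if "j < k" "j mod 2 = k mod 2" for j k
  proof (rule orthogonal_lower)
    have "j div 2 < k div 2" using that by presburger
    then show "degree (Q j) < k div 2" using degree_Q le_less_trans by blast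
  qed (use assms in auto)
  show ?thesis using *[of j k] *[of k j] assms(2,3) by (cases "j < k") (auto simp: mult_ac)
qed

section \<open>Values of the orthogonal polynomials at a negative point\<close>

context
  fixes c :: real
  assumes c: "c > 0"
begin

text \<open>At the negative point \<open>- c\<close> each factor \<open>polyX\<close> contributes a
  sign. Taking it out turns the subtraction in the recursion of \<open>Q\<close> into the addition
  of \<open>R_rec\<close>, which makes positivity immediate.\<close>

definition R :: "nat \<Rightarrow> real" where "R k = (- 1) ^ (k div 2) * poly (Q k) (- c)"

lemma R_0: "R 0 = 1" and R_1: "R (Suc 0) = 1"
  by (simp_all add: R_def)

lemma R_rec: "R (Suc (Suc k)) = c ^ (Suc k mod 2) * R (Suc k) + h (Suc k) / h k * R k"
proof (cases "even k")
  case True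
  then obtain a where "k = 2 * a" by (elim evenE)
  then show ?thesis by (simp add: R_def Q_rec algebra_simps)
next
  case False
  then obtain a where "k = 2 * a + 1" by (elim oddE)
  then show ?thesis by (simp add: R_def Q_rec algebra_simps)
qed

lemma R_pos:
  assumes "\<And>j. j < k \<Longrightarrow> h j > 0"
  shows "R k > 0"
  using assms
proof (induction k rule: Q.induct)
  case (3 k)
  have "R k > 0" "R (Suc k) > 0" "h k > 0" "h (Suc k) > 0" using 3 by auto
  then show ?case unfolding R_rec using c by (intro add_pos_nonneg) auto
qed (auto simp: R_0 R_1)

lemma R_square: "(R k)\<^sup>2 = (poly (Q k) (- c))\<^sup>2"
  by (simp add: R_def power_mult_distrib flip: power_mult)

text \<open>The quotient \<open>R (Suc k) * R k / h k\<close> is non-decreasing in \<open>k\<close>: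
  multiplying \<open>R_rec\<close> by \<open>R (Suc k)\<close> adds a nonnegative square at every
  step, as in the Christoffel-Darboux formula.\<close>

lemma R_product:
  assumes hp: "\<And>j. h j > 0"
  shows "R (Suc k) * R k \<ge> h k / h 0"
proof -
  have "R (Suc k) * R k / h k \<ge> 1 / h 0"
  proof (induction k)
    case 0 then show ?case by (simp add: R_0 R_1)
  next
    case (Suc k)
    have "R (Suc (Suc k)) * R (Suc k) / h (Suc k)
        = c ^ (Suc k mod 2) * (R (Suc k))\<^sup>2 / h (Suc k) + R (Suc k) * R k / h k"
      using hp[of k] hp[of "Suc k"] unfolding R_rec by (simp add: field_simps power2_eq_square)
    moreover have "c ^ (Suc k mod 2) * (R (Suc k))\<^sup>2 / h (Suc k) \<ge> 0"
      using c hp[of "Suc k"] by simp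
    ultimately show ?case using Suc by linarith
  qed
  then show ?thesis using hp[of k] hp[of 0] by (simp add: field_simps)
qed

text \<open>The number \<open>sqrt (h (Suc k) / h k)\<close> is an off-diagonal entry of the Jacobi
  matrix of the symmetrised functional. \<open>R_product\<close> and the inequality between
  geometric and arithmetic mean bound its inverse by two neighbouring terms of the Christoffel
  sum.\<close>

lemma inverse_offdiagonal_le:
  assumes hp: "\<And>j. h j > 0"
  shows "sqrt (h k / h (Suc k)) \<le> h 0 / 2 * ((R (Suc k))\<^sup>2 / h (Suc k) + (R k)\<^sup>2 / h k)"
proof -
  define u v where "u = R (Suc k) / sqrt (h (Suc k))" and "v = R k / sqrt (h k)"
  have s: "sqrt (h k) > 0" "sqrt (h (Suc k)) > 0" using hp by auto
  have "sqrt (h k / h (Suc k)) = sqrt (h k) * sqrt (h k) / (sqrt (h k) * sqrt (h (Suc k)))"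
    using s by (simp add: real_sqrt_divide del: real_sqrt_mult_self)
  also have "\<dots> \<le> h 0 * (R (Suc k) * R k) / (sqrt (h k) * sqrt (h (Suc k)))"
    using R_product[OF hp, of k] s hp[of 0] hp[of k]
    by (intro divide_right_mono) (auto simp: field_simps)
  also have "\<dots> = h 0 * (u * v)" using s by (simp add: u_def v_def field_simps)
  also have "u * v \<le> (u\<^sup>2 + v\<^sup>2) / 2" using sum_squares_bound[of u v] by simp
  finally show ?thesis using hp[of 0] hp[of k] hp[of "Suc k"]
    by (simp add: u_def v_def power_divide field_simps)
qed

text \<open>This is the extremal problem of the Christoffel function: among the combinations of the
  first \<open>n\<close> orthogonal polynomials with value 1 at \<open>- c\<close>, the least
  squared norm is the inverse of the sum of \<open>?w\<close>. It is attained at coefficients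
  proportional to the values at \<open>- c\<close> divided by \<open>h\<close>.\<close>

lemma small_of_diverging:
  assumes hp: "\<And>j. h j > 0" and e: "e < 2"
    and div: "\<not> summable (\<lambda>k. (R (2 * k + e))\<^sup>2 / h (2 * k + e))" and eps: "\<epsilon> > 0"
  shows "\<exists>q. poly q (- c) = 1 \<and> S (polyX ^ e * (q * q)) < \<epsilon>"
proof -
  let ?w = "\<lambda>k. (R (2 * k + e))\<^sup>2 / h (2 * k + e)" and ?P = "\<lambda>k. Q (2 * k + e)"
  have wn: "?w k \<ge> 0" for k using hp[of "2 * k + e"] by simp
  have "\<exists>n. (\<Sum>k<n. ?w k) > 1 / \<epsilon>"
  proof (rule ccontr)
    assume "\<not> ?thesis"
    then have "\<And>n. (\<Sum>k<n. ?w k) \<le> 1 / \<epsilon>" by (auto simp: not_less)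
    then have "summable ?w" using wn by (intro summableI_nonneg_bounded)
    then show False using div by simp
  qed
  then obtain n where n: "(\<Sum>k<n. ?w k) > 1 / \<epsilon>" by blast
  define s where "s = (\<Sum>k<n. ?w k)"
  have s: "s > 1 / \<epsilon>" "s > 0" using n eps unfolding s_def
    by (auto intro: less_trans[OF _ n])
  define a where "a k = poly (?P k) (- c) / h (2 * k + e)" for k
  define q where "q = smult (1 / s) (\<Sum>k<n. smult (a k) (?P k))"
  have aw: "a k * poly (?P k) (- c) = ?w k" for k
    by (simp add: a_def R_square power2_eq_square[of "poly p (- c)" for p])
  have "poly q (- c) = 1 / s * (\<Sum>k<n. a k * poly (?P k) (- c))"
    by (simp add: q_def poly_sum)
  also have "\<dots> = 1" using s by (simp add: aw s_def)
  finally have q1: "poly q (- c) = 1" .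
  have em: "(2 * k + e) mod 2 = e" for k using e by simp
  have F: "S (polyX ^ e * (?P k * ?P j)) = (if j = k then h (2 * k + e) else 0)" for j k
    using orthogonal[OF hp, of "2 * j + e" "2 * k + e"] h_eq_form[OF hp, of "2 * k + e"]
    unfolding em by auto
  have "polyX ^ e * (q * q) = smult (1 / s\<^sup>2)
      (\<Sum>k<n. \<Sum>j<n. smult (a k * a j) (polyX ^ e * (?P k * ?P j)))"
    unfolding q_def
    by (simp only: mult_smult_left mult_smult_right smult_smult sum_product sum_distrib_left
        power2_eq_square divide_divide_eq_left times_divide_eq_left mult_1_left mult_1_right mult.commute)
  then have "S (polyX ^ e * (q * q)) = 1 / s\<^sup>2 * (\<Sum>k<n. \<Sum>j<n. a k * a j * (if j = k then h (2 * k + e) else 0))"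
    by (simp add: smult sum F)
  also have "(\<Sum>k<n. \<Sum>j<n. a k * a j * (if j = k then h (2 * k + e) else 0)) = (\<Sum>k<n. a k * a k * h (2 * k + e))"
    by (intro sum.cong) (auto simp: if_distrib cong: if_cong)
  also have "\<dots> = s" unfolding s_def
  proof (intro sum.cong refl)
    fix k show "a k * a k * h (2 * k + e) = ?w k"
      using hp[of "2 * k + e"] unfolding R_square a_def by (simp add: power2_eq_square)
  qed
  also have "1 / s\<^sup>2 * s = 1 / s" using s(2) by (simp add: power2_eq_square)
  also have "\<dots> < \<epsilon>"
    using s eps mult_strict_left_mono[OF s(1), of \<epsilon>] by (simp add: pos_divide_less_eq mult.commute)
  finally show ?thesis using q1 by blast
qed

text \<open>The functional behaves like a measure with finitely many atoms: \<open>Q k\<close> is a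
  null vector of its form, yet it does not vanish at \<open>- c\<close>, because positivity of
  \<open>R k\<close> depends only on the \<open>h j\<close> with \<open>j < k\<close>.\<close>

lemma small_of_degenerate:
  assumes "\<And>j. j < k \<Longrightarrow> h j > 0" "h k = 0"
  shows "\<exists>q. poly q (- c) = 1 \<and> S (polyX ^ (k mod 2) * (q * q)) = 0"
proof -
  define q where "q = smult (1 / poly (Q k) (- c)) (Q k)"
  have "poly (Q k) (- c) \<noteq> 0" using R_pos[of k, OF assms(1)] unfolding R_def by fastforce
  then have "poly q (- c) = 1" by (simp add: q_def)
  moreover have "S (polyX ^ (k mod 2) * (q * q)) = 0"
    using h_eq_form[OF assms(1)] assms(2) by (simp add: q_def smult)
  ultimately show ?thesis by blast
qed

end

end

lemma summable_even_odd:
  fixes f :: "nat \<Rightarrow> real"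
  assumes "summable (\<lambda>k. f (2 * k))" "summable (\<lambda>k. f (2 * k + 1))" "\<And>k. f k \<ge> 0"
  shows "summable f"
proof (rule summableI_nonneg_bounded)
  fix n
  have 1: "(\<Sum>k<2 * n. f k) = (\<Sum>k<n. f (2 * k)) + (\<Sum>k<n. f (2 * k + 1))" for n
    by (induction n) auto
  have 2: "(\<Sum>k<n. f k) \<le> (\<Sum>k<2 * n. f k)" using assms(3) by (intro sum_mono2) auto
  have 3: "(\<Sum>k<n. f (2 * k)) \<le> (\<Sum>k. f (2 * k))" "(\<Sum>k<n. f (2 * k + 1)) \<le> (\<Sum>k. f (2 * k + 1))"
    using assms by (auto intro!: sum_le_suminf)
  show "(\<Sum>k<n. f k) \<le> (\<Sum>k. f (2 * k)) + (\<Sum>k. f (2 * k + 1))"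
    using 1[of n] 2 3 by linarith
qed (use assms in auto)

lemma carleman_inequality:
  fixes a :: "nat \<Rightarrow> real"
  assumes pos: "\<And>k. a k > 0" and sm: "summable a"
  shows "summable (\<lambda>k. (\<Prod>j<Suc k. a j) powr (1 / real (Suc k)))"
proof (rule summableI_nonneg_bounded)
  \<comment> \<open>Polya's weights: their partial products are \<open>(m + 1) ^ m\<close>.\<close>
  define c where "c j = real (j + 2) ^ (j + 1) / real (j + 1) ^ j" for j
  have cpos: "c j > 0" for j by (simp add: c_def)
  have pc: "(\<Prod>j<m. c j) = real (m + 1) ^ m" for m
    by (induction m) (simp_all add: c_def field_simps)
  define T where "T m = (\<Sum>j<m. a j * c j)" for m
  have Tn: "T m \<ge> 0" for m unfolding T_def using pos cpos by (intro sum_nonneg) (simp add: less_imp_le)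
  \<comment> \<open>The geometric mean of the first \<open>m\<close> weights is exactly
    \<open>m + 1\<close>. Dividing by it leaves \<open>T m / (m (m + 1))\<close>, and
    \<open>1 / (m (m + 1))\<close> is written as a difference in view of the summation by
    parts.\<close>
  have G: "(\<Prod>j<Suc k. a j) powr (1 / real (Suc k)) \<le> T (Suc k) * (1 / real (Suc k) - 1 / real (Suc (Suc k)))" for k
  proof -
    let ?m = "Suc k"
    have "(\<Prod>j<?m. a j * c j) powr (1 / real (card {..<?m})) \<le> (\<Sum>j<?m. a j * c j / real (card {..<?m}))"
      by (rule arith_geom_mean) (use pos cpos in \<open>auto intro: less_imp_le\<close>)
    moreover have "(\<Prod>j<?m. a j * c j) powr (1 / real ?m)
        = (\<Prod>j<?m. a j) powr (1 / real ?m) * (real (?m + 1) ^ ?m) powr (1 / real ?m)"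
      unfolding prod.distrib pc by (rule powr_mult)
    moreover have "(real (?m + 1) ^ ?m) powr (1 / real ?m) = real (?m + 1)"
    proof -
      have "real (?m + 1) ^ ?m = real (?m + 1) powr real ?m" by (intro powr_realpow[symmetric]) simp
      then show ?thesis by (simp only: powr_powr) simp
    qed
    ultimately have "(\<Prod>j<?m. a j) powr (1 / real ?m) * real (?m + 1) \<le> T ?m / real ?m"
      unfolding T_def sum_divide_distrib by (simp del: prod.lessThan_Suc sum.lessThan_Suc)
    then have "(\<Prod>j<?m. a j) powr (1 / real ?m) \<le> T ?m / real ?m / real (?m + 1)"
      by (simp only: pos_le_divide_eq of_nat_0_less_iff zero_less_Suc add_Suc_right add_0_right Suc_eq_plus1)
    also have "\<dots> = T ?m * (1 / real ?m - 1 / real (Suc ?m))"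
      by (simp add: divide_simps)
    finally show ?thesis .
  qed
  \<comment> \<open>Summation by parts. The boundary term stays on the left and is dropped later as
    nonnegative.\<close>
  have abel: "(\<Sum>k<n. T (Suc k) * (1 / real (Suc k) - 1 / real (Suc (Suc k)))) + T n / real (Suc n)
      = (\<Sum>j<n. a j * c j / real (Suc j))" for n
  proof (induction n)
    case (Suc n)
    have "T (Suc n) = T n + a n * c n" by (simp add: T_def)
    then have "T (Suc n) * (x - y) + T (Suc n) * y = T n * x + a n * c n * x" for x y
      by (simp add: algebra_simps)
    from this[of "1 / real (Suc n)" "1 / real (Suc (Suc n))"] show ?case using Suc by simp
  qed (simp add: T_def)
  have ce: "c j / real (Suc j) \<le> exp 1" for j
  proof -
    have "c j / real (Suc j) = (1 + 1 / real (Suc j)) ^ Suc j"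
      by (simp add: c_def field_simps power_divide)
    also have "\<dots> \<le> exp 1" using exp_ge_one_plus_x_over_n_power_n[of "Suc j" 1] by simp
    finally show ?thesis .
  qed
  fix n
  have "(\<Sum>k<n. (\<Prod>j<Suc k. a j) powr (1 / real (Suc k)))
      \<le> (\<Sum>k<n. T (Suc k) * (1 / real (Suc k) - 1 / real (Suc (Suc k))))"
    by (intro sum_mono G)
  also have "\<dots> \<le> (\<Sum>j<n. a j * (c j / real (Suc j)))" using abel[of n] divide_nonneg_nonneg[OF Tn[of n], of "real (Suc n)"] by simp
  also have "\<dots> \<le> (\<Sum>j<n. a j * exp 1)"
    using pos ce by (intro sum_mono mult_left_mono) (auto intro: less_imp_le)
  also have "\<dots> \<le> suminf a * exp 1" unfolding sum_distrib_right[symmetric]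
    using pos sm by (intro mult_right_mono sum_le_suminf) (auto intro: less_imp_le)
  finally show "(\<Sum>k<n. (\<Prod>j<Suc k. a j) powr (1 / real (Suc k))) \<le> suminf a * exp 1" .
qed (use powr_ge_zero in auto)

context stieltjes_functional
begin

text \<open>The products of the inverse off-diagonal entries telescope to
  \<open>sqrt (h 0 / h m)\<close>, so their geometric means are the \<open>2 m\<close>-th roots of
  \<open>h 0 / h m\<close>, and \<open>h m\<close> is at most the \<open>m\<close>-th moment. If the
  entries were summable, Carleman's inequality would make the series of moments converge.\<close>

lemma carleman_diverging:
  assumes hp: "\<And>j. h j > 0"
    and div: "\<not> summable (\<lambda>k. S (polyX ^ k) powr (- 1 / (2 * real k)))"
  shows "\<not> summable (\<lambda>k. sqrt (h k / h (Suc k)))"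
proof
  let ?a = "\<lambda>k. sqrt (h k / h (Suc k))"
  assume "summable ?a"
  then have sm: "summable (\<lambda>k. (\<Prod>j<Suc k. ?a j) powr (1 / real (Suc k)))"
    using hp by (intro carleman_inequality) auto
  have pr: "(\<Prod>j<m. ?a j) = sqrt (h 0 / h m)" for m
    using hp[THEN less_imp_neq] by (induction m) (auto simp: simp flip: real_sqrt_mult)
  \<comment> \<open>Dominates \<open>(1 / h 0) powr r\<close> for all exponents
    \<open>0 < r <= 1\<close>, hence uniformly in \<open>k\<close>.\<close>
  define C where "C = max 1 (1 / h 0)"
  have "summable (\<lambda>k. S (polyX ^ Suc k) powr (- 1 / (2 * real (Suc k))))"
  proof (rule summable_comparison_test')
    show "summable (\<lambda>k. C * (\<Prod>j<Suc k. ?a j) powr (1 / real (Suc k)))"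
      using sm by (rule summable_mult)
    fix k :: nat assume "k \<ge> 0"
    let ?m = "Suc k" and ?r = "1 / (2 * real (Suc k))"
    have r: "0 < ?r" "?r \<le> 1" by (auto simp: field_simps)
    have "S (polyX ^ ?m) powr (- ?r) \<le> h ?m powr (- ?r)"
      using h_le_moment[of ?m] hp r by (intro powr_mono2') (auto simp del: power_Suc)
    also have "\<dots> = (1 / h 0) powr ?r * (h 0 / h ?m) powr ?r"
    proof -
      have "(1 / h 0) powr ?r * (h 0 / h ?m) powr ?r = (1 / h 0 * (h 0 / h ?m)) powr ?r"
        by (rule powr_mult[symmetric])
      also have "1 / h 0 * (h 0 / h ?m) = 1 / h ?m" using hp[of 0] by simp
      also have "(1 / h ?m) powr ?r = h ?m powr (- ?r)"
        using hp[of ?m] by (simp only: powr_divide powr_one_eq_one powr_minus_divide)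
      finally show ?thesis ..
    qed
    also have "(1 / h 0) powr ?r \<le> C"
    proof -
      have "(1 / h 0) powr ?r \<le> C powr ?r" using hp[of 0] r by (intro powr_mono2) (auto simp: C_def)
      also have "\<dots> \<le> C powr 1" using r by (intro powr_mono) (auto simp: C_def)
      finally show ?thesis by (simp add: C_def)
    qed
    also have "(h 0 / h ?m) powr ?r = (\<Prod>j<?m. ?a j) powr (1 / real ?m)"
      unfolding pr using hp[of 0] hp[of ?m]
      by (simp add: powr_powr powr_half_sqrt[symmetric] less_imp_le)
    finally show "norm (S (polyX ^ Suc k) powr (- 1 / (2 * real (Suc k)))) \<le> C * (\<Prod>j<Suc k. ?a j) powr (1 / real (Suc k))"
      by (simp add: mult_right_mono del: prod.lessThan_Suc power_Suc)
  qed
  then show False using div summable_Suc_iff[of "\<lambda>k. S (polyX ^ k) powr (- 1 / (2 * real k))"] by blast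
qed

text \<open>The Christoffel sum over both interleaved families diverges, hence so does its part of
  one parity; this is why the conclusion leaves open which form becomes small. If some
  \<open>h j\<close> fails to be positive, the first such one is 0 and its \<open>Q j\<close>
  settles the claim. If all are positive, so are the moments by \<open>h_le_moment\<close>, which
  activates the guarded premise on the series; the guard keeps \<open>powr\<close> away from the
  base 0.\<close>

theorem stieltjes_carleman_density:
  assumes c: "c > 0" and eps: "\<epsilon> > 0"
    and div: "(\<And>k. S (polyX ^ k) > 0) \<Longrightarrow> \<not> summable (\<lambda>k. S (polyX ^ k) powr (- 1 / (2 * real k)))"
  shows "\<exists>q. poly q (- c) = 1 \<and> (S (q * q) < \<epsilon> \<or> S (polyX * (q * q)) < \<epsilon>)"
proof (cases "\<forall>j. h j > 0")
  case True
  then have hp: "\<And>j. h j > 0" by simp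
  have div: "\<not> summable (\<lambda>k. S (polyX ^ k) powr (- 1 / (2 * real k)))"
    using div h_le_moment[OF hp] hp less_le_trans by blast
  let ?w = "\<lambda>k. (R c k)\<^sup>2 / h k"
  have "\<not> summable ?w"
  proof
    assume s: "summable ?w"
    have "summable (\<lambda>k. sqrt (h k / h (Suc k)))"
    proof (rule summable_comparison_test')
      show "summable (\<lambda>k. h 0 / 2 * (?w (Suc k) + ?w k))"
        using s summable_Suc_iff[of ?w] by (intro summable_mult summable_add) simp_all
      show "norm (sqrt (h k / h (Suc k))) \<le> h 0 / 2 * (?w (Suc k) + ?w k)" for k
        using inverse_offdiagonal_le[OF c hp, of k] hp[of k] hp[of "Suc k"] by simp
    qed
    then show False using carleman_diverging[OF hp div] by simp
  qed
  then have "\<not> summable (\<lambda>k. ?w (2 * k)) \<or> \<not> summable (\<lambda>k. ?w (2 * k + 1))"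
    using summable_even_odd[of ?w] hp[THEN less_imp_le] by (metis divide_nonneg_nonneg zero_le_power2)
  then consider "\<not> summable (\<lambda>k. ?w (2 * k + 0))" | "\<not> summable (\<lambda>k. ?w (2 * k + 1))" by auto
  then show ?thesis
  proof cases
    case 1
    from small_of_diverging[OF c hp _ this eps] show ?thesis by auto
  next
    case 2
    from small_of_diverging[OF c hp _ this eps] show ?thesis by auto
  qed
next
  case False
  then have "\<exists>j. \<not> h j > 0" by simp
  then obtain k where k: "\<not> h k > 0" and lt: "\<And>j. j < k \<Longrightarrow> h j > 0"
    using exists_least_iff[of "\<lambda>j. \<not> h j > 0"] by metis
  have "h k = 0" using h_nonneg[of k, OF lt] k by linarith
  then obtain q where "poly q (- c) = 1" "S (polyX ^ (k mod 2) * (q * q)) = 0"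
    using small_of_degenerate[OF c lt] by blast
  moreover have "k mod 2 = 0 \<or> k mod 2 = 1" by presburger
  ultimately show ?thesis using eps by (metis mult_1 power_0 power_one_right)
qed

end

subsection \<open>Log convex sequences and parameter integrals\<close>

text \<open>Log convexity says that the quotients \<open>M (k + 1) / M k\<close> are non-decreasing,
  so one quotient above 1 keeps all later ones above 1.\<close>

lemma log_convex_increasing:
  assumes M: "\<And>k. M k > 0" and lc: "log_convex M" and k0: "M k0 < M (Suc k0)" and k: "k0 \<le> k" "k \<le> l"
  shows "M k \<le> M l"
proof -
  have incr: "M k < M (Suc k)" if "k0 \<le> k" for k
    using that
  proof (induction k rule: dec_induct)
    case (step k)
    have "(M (Suc k))\<^sup>2 \<le> M k * M (Suc (Suc k))"
      using lc[unfolded log_convex_def, rule_format, of "Suc k"] by simp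
    also have "\<dots> < M (Suc k) * M (Suc (Suc k))"
      using step M by (intro mult_strict_right_mono) auto
    finally show ?case using M[of "Suc k"] by (simp add: power2_eq_square)
  qed (use k0 in simp)
  show ?thesis using k(2)
  proof (induction l rule: dec_induct)
    case (step l)
    then show ?case using incr[of l] k(1) by linarith
  qed simp
qed

lemma powr_inverse_ge:
  fixes B :: real
  assumes "k \<ge> 1" "B \<ge> 1"
  shows "B powr (- 1 / (2 * real k)) \<ge> B powr (- 1 / 2)"
  using assms by (intro powr_mono) (auto simp: field_simps)

text \<open>Needed because \<open>(L + c)^J\<close> mixes the bounds of a block of consecutive
  indices. Either \<open>M\<close> is non-increasing, and then the terms \<open>?g k\<close> stay
  away from 0; or \<open>M\<close> increases from some index on, the block is dominated by a
  multiple of \<open>M (k + D)\<close>, and it remains to compare the exponents \<open>1 / k\<close>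
  and \<open>1 / (k + D)\<close>.\<close>

lemma carleman_shift:
  assumes M: "\<And>k. M k > 0" and lc: "log_convex M" and C: "C > 0"
    and div: "\<not> summable (\<lambda>k. M k powr (- 1 / (2 * real k)))"
  shows "\<not> summable (\<lambda>k. (C * (\<Sum>i\<le>D. M (k + i))) powr (- 1 / (2 * real k)))"
proof
  let ?g = "\<lambda>k. (C * (\<Sum>i\<le>D. M (k + i))) powr (- 1 / (2 * real k))"
  assume sg: "summable ?g"
  have W: "C * (\<Sum>i\<le>D. M (k + i)) > 0" for k
    using C M by (intro mult_pos_pos sum_pos) auto
  show False
  proof (cases "\<exists>k0. M k0 < M (Suc k0)")
    case False
    then have dec: "decseq M" by (intro decseq_SucI) (auto simp: not_less)
    define B where "B = max 1 (C * (real (D + 1) * M 0))"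
    have "?g k \<ge> B powr (- 1 / 2)" if "k \<ge> 1" for k
    proof -
      have "(\<Sum>i\<le>D. M (k + i)) \<le> (\<Sum>i\<le>D. M 0)"
        using decseqD[OF dec] by (intro sum_mono) auto
      then have "C * (\<Sum>i\<le>D. M (k + i)) \<le> C * (real (D + 1) * M 0)"
        using C by (intro mult_left_mono) auto
      then have "C * (\<Sum>i\<le>D. M (k + i)) \<le> B" by (simp add: B_def)
      then have "?g k \<ge> B powr (- 1 / (2 * real k))"
        using W[of k] that by (intro powr_mono2') auto
      then show ?thesis using powr_inverse_ge[OF that, of B] by (simp add: B_def)
    qed
    then have "\<forall>k\<ge>1. B powr (- 1 / 2) \<le> ?g k" by blast
    moreover have "?g \<longlonglongrightarrow> 0" using sg by (rule summable_LIMSEQ_zero)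
    ultimately have "B powr (- 1 / 2) \<le> 0" by (intro LIMSEQ_le_const) auto
    moreover have "B > 0" by (simp add: B_def)
    ultimately show False by simp
  next
    case True
    then obtain k0 where k0: "M k0 < M (Suc k0)" by blast
    note inc = log_convex_increasing[OF M lc k0]
    \<comment> \<open>The three lower bounds on \<open>C2\<close> serve, in this order, the final
      comparison through \<open>powr_inverse_ge\<close>, the domination of the block, and
      \<open>A i \<ge> 1\<close> beyond \<open>k0\<close>.\<close>
    define C2 where "C2 = max 1 (max (C * real (D + 1)) (1 / M k0))"
    define A where "A i = C2 * M i" for i
    define b where "b i = A i powr (- 1 / (2 * real i))" for i
    define K where "K = exp (4 * real D)"
    have A1: "A i \<ge> 1" if "i \<ge> k0" for i
    proof -
      have "1 = 1 / M k0 * M k0" using M[of k0] by simp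
      also have "\<dots> \<le> C2 * M i"
        using inc[of k0 i] that M[of k0] by (intro mult_mono) (auto simp: C2_def)
      finally show ?thesis by (simp add: A_def)
    qed
    \<comment> \<open>Raising to the exponent for \<open>k\<close> instead of \<open>k + D\<close>
      turns \<open>b\<close> into \<open>b * b powr (D / k)\<close>, so only the second factor can
      be lost. It is at least \<open>1 / K\<close> unless \<open>b\<close> is below
      \<open>1 / (k + D)^2\<close>, and such terms are summable anyway.\<close>
    have bK: "b (k + D) \<le> K * ?g k + 1 / real (k + D) ^ 2" if k: "k \<ge> max (max k0 D) 1" for k
    proof -
      let ?i = "k + D"
      have i: "real ?i \<ge> 1" "real ?i > 0" "real ?i \<le> 2 * real k" "real k > 0" using k by auto
      have Ai: "A ?i \<ge> 1" using A1 k by auto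
      have bp: "b ?i > 0" "b ?i \<le> 1"
      proof -
        show "b ?i > 0" using Ai by (simp add: b_def)
        have "b ?i \<le> A ?i powr 0" unfolding b_def using Ai by (intro powr_mono) (auto simp: field_simps)
        then show "b ?i \<le> 1" using Ai by simp
      qed
      have "(\<Sum>i\<le>D. M (k + i)) \<le> (\<Sum>i\<le>D. M ?i)"
        using inc k by (intro sum_mono) auto
      then have "C * (\<Sum>i\<le>D. M (k + i)) \<le> C * (real (D + 1) * M ?i)"
        using C by (intro mult_left_mono) auto
      also have "\<dots> \<le> A ?i"
        unfolding A_def mult.assoc[symmetric] using M[of ?i] by (intro mult_right_mono) (auto simp: C2_def)
      finally have "?g k \<ge> A ?i powr (- 1 / (2 * real k))"
        using W[of k] k by (intro powr_mono2') auto
      also have "A ?i powr (- 1 / (2 * real k)) = b ?i powr (real ?i / real k)"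
      proof -
        have "- 1 / (2 * real ?i) * (real ?i / real k) = - 1 / (2 * real k)" using i by (simp add: divide_simps)
        then show ?thesis by (simp only: b_def powr_powr)
      qed
      also have "real ?i / real k = 1 + real D / real k" using i by (simp add: field_simps)
      finally have g: "?g k \<ge> b ?i * b ?i powr (real D / real k)"
        using bp by (simp add: powr_add)
      show ?thesis
      proof (cases "b ?i \<ge> 1 / real ?i ^ 2")
        case True
        have "1 / K \<le> (1 / real ?i ^ 2) powr (real D / real k)"
        proof -
          \<comment> \<open>The crude bound \<open>ln (k + D) \<le> 2 k\<close> makes the exponent
            at most \<open>(D / k) * 2 * 2 k = 4 D\<close>, which is where \<open>K\<close> comes
            from.\<close>
          have "ln (real ?i) \<le> ln (2 * real k)" using i by simp
          also have "\<dots> \<le> 2 * real k" using i by (intro ln_bound) auto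
          finally have l: "ln (real ?i) \<le> 2 * real k" .
          have "(1 / real ?i ^ 2) powr (real D / real k) = exp (- (real D / real k * (2 * ln (real ?i))))"
            using i by (simp add: powr_def ln_div ln_realpow)
          also have "\<dots> \<ge> exp (- (real D / real k * (2 * (2 * real k))))"
          proof -
            have "real D / real k * (2 * ln (real ?i)) \<le> real D / real k * (2 * (2 * real k))"
              using l i by (intro mult_left_mono) auto
            then show ?thesis by simp
          qed
          also have "exp (- (real D / real k * (2 * (2 * real k)))) = 1 / K"
            using i by (simp add: K_def exp_minus field_simps)
          finally show ?thesis .
        qed
        also have "\<dots> \<le> b ?i powr (real D / real k)"
          using True i by (intro powr_mono2) auto
        finally have "b ?i * (1 / K) \<le> ?g k" using g bp
          by (meson less_imp_le mult_left_mono order_trans)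
        then have "b ?i \<le> K * ?g k" by (simp add: K_def field_simps)
        then show ?thesis by (simp add: add_increasing2)
      next
        case False
        moreover have "K * ?g k \<ge> 0" by (simp add: K_def)
        ultimately show ?thesis by linarith
      qed
    qed
    have "summable (\<lambda>k. b (k + D))"
    proof (rule summable_comparison_test')
      have "summable (\<lambda>n. 1 / real (n + D) ^ 2)"
        using summable_ignore_initial_segment[OF inverse_power_summable[of 2, where 'a=real], of D]
        by (simp add: inverse_eq_divide)
      then show "summable (\<lambda>k. K * ?g k + 1 / real (k + D) ^ 2)"
        by (intro summable_add summable_mult sg)
      show "norm (b (k + D)) \<le> K * ?g k + 1 / real (k + D) ^ 2" if "k \<ge> max (max k0 D) 1" for k
        using bK[OF that] by (simp add: b_def)
    qed
    then have sb: "summable b" by (rule summable_iff_shift[THEN iffD1])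
    have "summable (\<lambda>k. M k powr (- 1 / (2 * real k)))"
    proof (rule summable_comparison_test')
      show "summable (\<lambda>k. C2 powr (1 / 2) * b k)" using sb by (rule summable_mult)
      fix k :: nat assume "k \<ge> 1"
      then have "C2 powr (- 1 / 2) \<le> C2 powr (- 1 / (2 * real k))"
        by (intro powr_inverse_ge) (auto simp: C2_def)
      then have "C2 powr (- 1 / 2) * M k powr (- 1 / (2 * real k)) \<le> b k"
        unfolding b_def A_def powr_mult by (intro mult_right_mono) auto
      then have "C2 powr (1 / 2) * (C2 powr (- 1 / 2) * M k powr (- 1 / (2 * real k))) \<le> C2 powr (1 / 2) * b k"
        by (intro mult_left_mono) auto
      moreover have "C2 powr (1 / 2) * C2 powr (- 1 / 2) = 1"
        by (simp add: C2_def flip: powr_add)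
      ultimately show "norm (M k powr (- 1 / (2 * real k))) \<le> C2 powr (1 / 2) * b k"
        by (simp flip: mult.assoc)
    qed
    then show False using div by simp
  qed
qed

text \<open>Differentiation under the integral sign with a parameter in a normed space, so that it
  serves real time as well as a complex exponent. On the convex set \<open>U\<close> the mean value
  inequality bounds the difference quotients by \<open>B\<close>, and dominated convergence is
  applied along sequences tending to \<open>p0\<close>.\<close>

lemma has_derivative_integral:
  fixes f :: "'p::{real_normed_vector,perfect_space} \<Rightarrow> 'x \<Rightarrow> 'v::{banach,second_countable_topology}"
  assumes U: "open U" "convex U" "p0 \<in> U"
    and int: "\<And>p. p \<in> U \<Longrightarrow> integrable M (f p)"
    and der: "\<And>p x. p \<in> U \<Longrightarrow> x \<in> space M \<Longrightarrow> ((\<lambda>p. f p x) has_derivative f' p x) (at p)"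
    and bd: "\<And>p x h. p \<in> U \<Longrightarrow> x \<in> space M \<Longrightarrow> norm (f' p x h) \<le> B x * norm h"
    and meas: "\<And>h. (\<lambda>x. f' p0 x h) \<in> borel_measurable M"
    and B: "integrable M B"
  shows "((\<lambda>p. \<integral>x. f p x \<partial>M) has_derivative (\<lambda>h. \<integral>x. f' p0 x h \<partial>M)) (at p0)"
proof -
  have lin: "bounded_linear (f' p0 x)" if "x \<in> space M" for x
    using der[OF U(3) that] by (rule has_derivative_bounded_linear)
  have f'int: "integrable M (\<lambda>x. f' p0 x h)" for h
  proof (rule Bochner_Integration.integrable_bound)
    show "integrable M (\<lambda>x. B x * norm h)" using B by simp
    show "AE x in M. norm (f' p0 x h) \<le> norm (B x * norm h)"
      using bd[OF U(3)] by (intro AE_I2) (smt (verit) real_norm_def)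
  qed (rule meas)
  have lip: "norm (f p x - f p0 x) \<le> B x * norm (p - p0)" if p: "p \<in> U" and x: "x \<in> space M" for p x
  proof (rule differentiable_bound[of U "\<lambda>p. f p x" "\<lambda>p. f' p x"])
    show "((\<lambda>p. f p x) has_derivative f' q x) (at q within U)" if "q \<in> U" for q
      using der[OF that x] by (rule has_derivative_at_withinI)
    show "onorm (f' q x) \<le> B x" if "q \<in> U" for q
      by (rule onorm_le) (rule bd[OF that x])
  qed (use U p in auto)
  have bl: "bounded_linear (\<lambda>h. \<integral>x. f' p0 x h \<partial>M)"
  proof (rule bounded_linear_intro)
    fix h k :: 'p and r :: real
    have "(\<integral>x. f' p0 x (h + k) \<partial>M) = (\<integral>x. f' p0 x h + f' p0 x k \<partial>M)"
      by (intro Bochner_Integration.integral_cong refl) (simp add: lin linear_add bounded_linear.linear)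
    then show "(\<integral>x. f' p0 x (h + k) \<partial>M) = (\<integral>x. f' p0 x h \<partial>M) + (\<integral>x. f' p0 x k \<partial>M)"
      using f'int by simp
    have "(\<integral>x. f' p0 x (r *\<^sub>R h) \<partial>M) = (\<integral>x. r *\<^sub>R f' p0 x h \<partial>M)"
      by (intro Bochner_Integration.integral_cong refl) (simp add: lin linear_cmul bounded_linear.linear)
    then show "(\<integral>x. f' p0 x (r *\<^sub>R h) \<partial>M) = r *\<^sub>R (\<integral>x. f' p0 x h \<partial>M)" by simp
    have "norm (\<integral>x. f' p0 x h \<partial>M) \<le> (\<integral>x. B x * norm h \<partial>M)"
    proof (rule order_trans[OF integral_norm_bound])
      show "(\<integral>x. norm (f' p0 x h) \<partial>M) \<le> (\<integral>x. B x * norm h \<partial>M)"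
        using f'int B bd[OF U(3)] by (intro integral_mono) auto
    qed
    then show "norm (\<integral>x. f' p0 x h \<partial>M) \<le> norm h * (\<integral>x. B x \<partial>M)" by (simp add: mult.commute)
  qed
  define q where "q p x = norm (f p x - f p0 x - f' p0 x (p - p0)) / norm (p - p0)" for p x
  have qm: "q p \<in> borel_measurable M" if "p \<in> U" for p
    unfolding q_def using int[OF that] int[OF U(3)] f'int by (intro borel_measurable_divide) auto
  have qb: "norm (q p x) \<le> 2 * B x" if p: "p \<in> U" "p \<noteq> p0" and x: "x \<in> space M" for p x
  proof -
    have "norm (f p x - f p0 x - f' p0 x (p - p0)) \<le> 2 * B x * norm (p - p0)"
      using lip[OF p(1) x] bd[OF U(3) x, of "p - p0"] norm_triangle_ineq4[of "f p x - f p0 x" "f' p0 x (p - p0)"]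
      by linarith
    then show ?thesis using p by (simp add: q_def field_simps)
  qed
  have lim: "((\<lambda>p. \<integral>x. q p x \<partial>M) \<longlongrightarrow> 0) (at p0)"
    unfolding tendsto_at_iff_sequentially
  proof (intro allI impI, unfold comp_def)
    fix X :: "nat \<Rightarrow> 'p" assume X: "\<forall>i. X i \<in> UNIV - {p0}" and Xl: "X \<longlonglongrightarrow> p0"
    have "eventually (\<lambda>i. X i \<in> U) sequentially" using Xl U by (simp add: topological_tendstoD)
    then obtain N where N: "\<And>i. i \<ge> N \<Longrightarrow> X i \<in> U" by (auto simp: eventually_sequentially)
    have "(\<lambda>i. \<integral>x. q (X (i + N)) x \<partial>M) \<longlonglongrightarrow> (\<integral>x. 0 \<partial>M)"
    proof (rule integral_dominated_convergence[where w = "\<lambda>x. 2 * B x"])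
      show "AE x in M. (\<lambda>i. q (X (i + N)) x) \<longlonglongrightarrow> 0"
      proof (rule AE_I2)
        fix x assume x: "x \<in> space M"
        have "((\<lambda>p. q p x) \<longlongrightarrow> 0) (at p0)"
          using der[OF U(3) x] by (simp add: has_derivative_iff_norm q_def)
        then show "(\<lambda>i. q (X (i + N)) x) \<longlonglongrightarrow> 0"
          unfolding tendsto_at_iff_sequentially
          using X LIMSEQ_ignore_initial_segment[OF Xl, of N] by (auto simp: comp_def)
      qed
      show "AE x in M. norm (q (X (i + N)) x) \<le> 2 * B x" for i
        using qb[OF N] X by (intro AE_I2) auto
    qed (use qm N B in auto)
    then show "(\<lambda>i. \<integral>x. q (X i) x \<partial>M) \<longlonglongrightarrow> 0" using LIMSEQ_offset by simp
  qed
  have "((\<lambda>p. norm ((\<integral>x. f p x \<partial>M) - (\<integral>x. f p0 x \<partial>M) - (\<integral>x. f' p0 x (p - p0) \<partial>M)) / norm (p - p0)) \<longlongrightarrow> 0) (at p0)"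
  proof (rule tendsto_sandwich[OF _ _ tendsto_const lim])
    have "eventually (\<lambda>p. p \<in> U \<and> p \<noteq> p0) (at p0)"
      using U unfolding eventually_at_topological by blast
    then show "\<forall>\<^sub>F p in at p0. norm ((\<integral>x. f p x \<partial>M) - (\<integral>x. f p0 x \<partial>M) - (\<integral>x. f' p0 x (p - p0) \<partial>M)) / norm (p - p0)
        \<le> (\<integral>x. q p x \<partial>M)"
    proof eventually_elim
      case (elim p)
      have i: "integrable M (\<lambda>x. f p x - f p0 x - f' p0 x (p - p0))"
        using int elim U f'int by auto
      have "(\<integral>x. f p x \<partial>M) - (\<integral>x. f p0 x \<partial>M) - (\<integral>x. f' p0 x (p - p0) \<partial>M)
          = (\<integral>x. f p x - f p0 x - f' p0 x (p - p0) \<partial>M)"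
        using int elim U f'int by simp
      then show ?case unfolding q_def using integral_norm_bound[of M "\<lambda>x. f p x - f p0 x - f' p0 x (p - p0)"]
        by (simp add: divide_right_mono)
    qed
  qed (auto intro!: always_eventually)
  then show ?thesis using bl by (simp add: has_derivative_iff_norm)
qed

subsection \<open>Uniqueness from exponential moments\<close>

text \<open>Half of the room \<open>2 * r\<close> absorbs the distance from \<open>t\<close> to
  \<open>s\<close>, the other half absorbs the factor \<open>\<bar>u\<bar>\<close> through
  \<open>r * \<bar>u\<bar> \<le> exp (r * \<bar>u\<bar>)\<close>.\<close>

lemma exp_moment_bound:
  fixes u t s r :: real
  assumes r: "r > 0" and t: "\<bar>t - s\<bar> \<le> r"
  shows "\<bar>u\<bar> * exp (t * u) \<le> 1 / r * (exp ((s - 2 * r) * u) + exp ((s + 2 * r) * u))"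
proof -
  have "r * \<bar>u\<bar> \<le> exp (r * \<bar>u\<bar>)" using exp_ge_add_one_self[of "r * \<bar>u\<bar>"] by linarith
  then have 1: "\<bar>u\<bar> \<le> 1 / r * exp (r * \<bar>u\<bar>)" using r by (simp add: field_simps)
  have "(t - s) * u \<le> \<bar>t - s\<bar> * \<bar>u\<bar>" by (metis abs_ge_self abs_mult)
  also have "\<dots> \<le> r * \<bar>u\<bar>" using t by (intro mult_right_mono) auto
  finally have 2: "t * u \<le> s * u + r * \<bar>u\<bar>" by (simp add: algebra_simps)
  have "\<bar>u\<bar> * exp (t * u) \<le> 1 / r * exp (r * \<bar>u\<bar>) * exp (s * u + r * \<bar>u\<bar>)"
    using 1 2 r by (intro mult_mono) auto
  also have "\<dots> = 1 / r * exp (s * u + 2 * r * \<bar>u\<bar>)" by (simp flip: exp_add)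
  also have "exp (s * u + 2 * r * \<bar>u\<bar>) \<le> exp ((s - 2 * r) * u) + exp ((s + 2 * r) * u)"
    by (cases "u \<ge> 0") (auto simp: algebra_simps add_increasing add_increasing2)
  finally show ?thesis using r by (simp add: divide_right_mono)
qed

lemma moment_integral_holomorphic:
  fixes k u :: "'a \<Rightarrow> real"
  assumes [measurable]: "k \<in> borel_measurable M" "u \<in> borel_measurable M"
    and int: "\<And>s. s \<in> {a<..<b} \<Longrightarrow> integrable M (\<lambda>x. k x * exp (s * u x))"
  shows "(\<lambda>z. \<integral>x. complex_of_real (k x) * exp (z * of_real (u x)) \<partial>M) holomorphic_on {z. a < Re z \<and> Re z < b}"
proof (rule holomorphic_onI)
  fix z0 assume "z0 \<in> {z. a < Re z \<and> Re z < b}"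
  then have z0: "a < Re z0" "Re z0 < b" by auto
  \<comment> \<open>A third of the distance to the boundary keeps \<open>Re z0 - 2 * r\<close> and
    \<open>Re z0 + 2 * r\<close> inside the strip, as \<open>exp_moment_bound\<close>
    requires.\<close>
  define r where "r = min (Re z0 - a) (b - Re z0) / 3"
  have r: "r > 0" "a < Re z0 - 2 * r" "Re z0 + 2 * r < b" using z0 unfolding r_def by (auto simp: min_def field_simps)
  let ?e = "\<lambda>z x. complex_of_real (k x) * exp (z * of_real (u x))"
  have Re: "\<bar>Re z - Re z0\<bar> \<le> r" if "z \<in> ball z0 r" for z
    using that abs_Re_le_cmod[of "z - z0"] by (simp add: dist_norm norm_minus_commute)
  have i: "integrable M (?e z)" if "z \<in> ball z0 r" for z
  proof (rule Bochner_Integration.integrable_bound[OF int[of "Re z"]])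
    show "Re z \<in> {a<..<b}" using Re[OF that] r by (auto simp: abs_le_iff)
    show "AE x in M. norm (?e z x) \<le> norm (k x * exp (Re z * u x))"
      by (simp add: norm_mult)
  qed simp
  have "((\<lambda>z. \<integral>x. ?e z x \<partial>M) has_derivative (\<lambda>h. \<integral>x. ?e z0 x * of_real (u x) * h \<partial>M)) (at z0)"
  proof (rule has_derivative_integral[where U = "ball z0 r" and f' = "\<lambda>z x h. ?e z x * of_real (u x) * h"
        and B = "\<lambda>x. 1 / r * (\<bar>k x\<bar> * exp ((Re z0 - 2 * r) * u x) + \<bar>k x\<bar> * exp ((Re z0 + 2 * r) * u x))"])
    show "((\<lambda>z. ?e z x) has_derivative (\<lambda>h. ?e p x * of_real (u x) * h)) (at p)" for p x
      by (auto intro!: derivative_eq_intros simp: algebra_simps)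
    show "norm (?e p x * of_real (u x) * h)
        \<le> 1 / r * (\<bar>k x\<bar> * exp ((Re z0 - 2 * r) * u x) + \<bar>k x\<bar> * exp ((Re z0 + 2 * r) * u x)) * norm h"
      if "p \<in> ball z0 r" for p x h
    proof -
      have "\<bar>k x\<bar> * (\<bar>u x\<bar> * exp (Re p * u x))
          \<le> \<bar>k x\<bar> * (1 / r * (exp ((Re z0 - 2 * r) * u x) + exp ((Re z0 + 2 * r) * u x)))"
        using exp_moment_bound[OF r(1) Re[OF that], of "u x"] by (intro mult_left_mono) auto
      then have "\<bar>k x\<bar> * (\<bar>u x\<bar> * exp (Re p * u x)) * norm h
          \<le> \<bar>k x\<bar> * (1 / r * (exp ((Re z0 - 2 * r) * u x) + exp ((Re z0 + 2 * r) * u x))) * norm h"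
        by (intro mult_right_mono) auto
      then show ?thesis by (simp add: norm_mult algebra_simps)
    qed
    have "integrable M (\<lambda>x. \<bar>k x\<bar> * exp (s * u x))" if "s \<in> {a<..<b}" for s
      using integrable_abs[OF int[OF that]] by (simp add: abs_mult)
    from this[of "Re z0 - 2 * r"] this[of "Re z0 + 2 * r"]
    show "integrable M (\<lambda>x. 1 / r * (\<bar>k x\<bar> * exp ((Re z0 - 2 * r) * u x) + \<bar>k x\<bar> * exp ((Re z0 + 2 * r) * u x)))"
      using r z0 by (intro integrable_mult_right integrable_add) auto
  qed (use r i in auto)
  \<comment> \<open>The real derivative is multiplication by a complex number, hence a complex
    derivative.\<close>
  also have "(\<lambda>h. \<integral>x. ?e z0 x * of_real (u x) * h \<partial>M) = (*) (\<integral>x. ?e z0 x * of_real (u x) \<partial>M)"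
    by (simp add: fun_eq_iff)
  finally have "((\<lambda>z. \<integral>x. ?e z x \<partial>M) has_field_derivative (\<integral>x. ?e z0 x * of_real (u x) \<partial>M)) (at z0)"
    by (simp add: has_field_derivative_def)
  then show "(\<lambda>z. \<integral>x. ?e z x \<partial>M) field_differentiable (at z0 within {z. a < Re z \<and> Re z < b})"
    by (meson field_differentiable_at_within field_differentiable_def)
qed

text \<open>A weighted density is determined by the Fourier transform of its push-forward along \<open>u\<close>,
  which the identity theorem recovers from infinitely many real moments.\<close>

lemma exponential_moments_unique:
  fixes k u :: "'a \<Rightarrow> real"
  assumes km [measurable]: "k \<in> borel_measurable M" and um [measurable]: "u \<in> borel_measurable M"
    and int: "\<And>s. s \<in> {a<..<b} \<Longrightarrow> integrable M (\<lambda>x. k x * exp (s * u x))"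
    and inf: "infinite {s\<in>{c..d}. (\<integral>x. k x * exp (s * u x) \<partial>M) = 0}" and cd: "a < c" "d < b"
    and A [measurable]: "A \<in> sets borel" and s: "s \<in> {a<..<b}"
  shows "(\<integral>x. k x * exp (s * u x) * indicator A (u x) \<partial>M) = 0"
proof -
  define Z where "Z z = (\<integral>x. complex_of_real (k x) * exp (z * of_real (u x)) \<partial>M)" for z
  let ?S = "{z. a < Re z \<and> Re z < b}"
  have S: "?S = {z. a < Re z} \<inter> {z. Re z < b}" by auto
  have Sop: "open ?S" unfolding S by (intro open_Int open_halfspace_Re_gt open_halfspace_Re_lt)
  have "convex ?S" unfolding S by (intro convex_Int convex_halfspace_Re_gt convex_halfspace_Re_lt)
  then have Sco: "connected ?S" by (rule convex_connected)
  have ZH: "Z holomorphic_on ?S"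
    unfolding Z_def by (rule moment_integral_holomorphic[OF km um int])
  have Zr: "Z (of_real s) = of_real (\<integral>x. k x * exp (s * u x) \<partial>M)" for s
  proof -
    have "Z (of_real s) = (\<integral>x. complex_of_real (k x * exp (s * u x)) \<partial>M)"
      unfolding Z_def by (simp add: exp_of_real flip: of_real_mult)
    then show ?thesis by (simp only: integral_complex_of_real)
  qed
  define T where "T = complex_of_real ` {s\<in>{c..d}. (\<integral>x. k x * exp (s * u x) \<partial>M) = 0}"
  have Tinf: "infinite T" unfolding T_def using inf by (subst finite_image_iff) (auto simp: inj_on_def)
  have Tsub: "T \<subseteq> complex_of_real ` {c..d}" unfolding T_def by auto
  have "compact (complex_of_real ` {c..d})" by (intro compact_continuous_image continuous_intros) auto
  \<comment> \<open>Infinitely many zeros in a compact interval accumulate inside the strip, so the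
    identity theorem makes \<open>Z\<close> vanish on all of it, in particular on the vertical line
    \<open>Re z = s\<close>.\<close>
  then obtain \<xi> where \<xi>: "\<xi> \<in> complex_of_real ` {c..d}" "\<xi> islimpt T"
    using Heine_Borel_imp_Bolzano_Weierstrass[OF _ Tinf Tsub] by blast
  have Z0: "Z z = 0" if "z \<in> ?S" for z
  proof (rule analytic_continuation[OF ZH Sop Sco _ _ \<xi>(2) _ that])
    show "T \<subseteq> ?S" using Tsub cd by auto
    show "\<xi> \<in> ?S" using \<xi> cd by auto
    show "Z z = 0" if "z \<in> T" for z using that Zr by (auto simp: T_def)
  qed
  \<comment> \<open>Levy's uniqueness theorem concerns probability measures, so the signed density
    is split into its positive part \<open>w 1\<close> and its negative part \<open>w (- 1)\<close>.
    Vanishing of \<open>Z\<close> on the vertical line says that their push-forwards along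
    \<open>u\<close> have the same Fourier transform, and at \<open>t = 0\<close> that they have the
    same mass \<open>m\<close>.\<close>
  define w where "w \<sigma> x = max 0 (\<sigma> * k x) * exp (s * u x)" for \<sigma> x
  have wm [measurable]: "w \<sigma> \<in> borel_measurable M" for \<sigma> unfolding w_def by simp
  have w0: "w \<sigma> x \<ge> 0" for \<sigma> x by (simp add: w_def)
  have wi: "integrable M (w \<sigma>)" for \<sigma>
  proof (rule Bochner_Integration.integrable_bound)
    show "integrable M (\<lambda>x. \<sigma> * (k x * exp (s * u x)))" using int[OF s] by simp
    show "AE x in M. norm (w \<sigma> x) \<le> norm (\<sigma> * (k x * exp (s * u x)))"
    proof (rule AE_I2)
      fix x
      have "max 0 (\<sigma> * k x) * exp (s * u x) \<le> \<bar>\<sigma> * k x\<bar> * exp (s * u x)"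
        by (intro mult_right_mono) auto
      then show "norm (w \<sigma> x) \<le> norm (\<sigma> * (k x * exp (s * u x)))"
        by (simp add: w_def abs_mult)
    qed
  qed simp
  have wd: "w 1 x - w (- 1) x = k x * exp (s * u x)" for x
    by (simp add: w_def max_def algebra_simps)
  have wF: "integrable M (\<lambda>x. complex_of_real (w \<sigma> x) * exp (\<i> * of_real (t * u x)))" for \<sigma> t
    by (rule Bochner_Integration.integrable_bound[OF wi[of \<sigma>]]) (auto simp: norm_mult)
  have ft: "(\<integral>x. complex_of_real (w 1 x) * exp (\<i> * of_real (t * u x)) \<partial>M)
      = (\<integral>x. complex_of_real (w (- 1) x) * exp (\<i> * of_real (t * u x)) \<partial>M)" for t
  proof -
    have "(\<integral>x. complex_of_real (w 1 x) * exp (\<i> * of_real (t * u x)) \<partial>M)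
      - (\<integral>x. complex_of_real (w (- 1) x) * exp (\<i> * of_real (t * u x)) \<partial>M)
      = (\<integral>x. complex_of_real (w 1 x - w (- 1) x) * exp (\<i> * of_real (t * u x)) \<partial>M)"
      using wF by (simp add: left_diff_distrib flip: Bochner_Integration.integral_diff)
    also have "\<dots> = Z (Complex s t)"
      unfolding Z_def wd
    proof (intro Bochner_Integration.integral_cong refl)
      fix x
      have "Complex s t * of_real (u x) = of_real (s * u x) + \<i> * of_real (t * u x)"
        by (simp add: complex_eq_iff)
      then show "complex_of_real (k x * exp (s * u x)) * exp (\<i> * of_real (t * u x))
          = of_real (k x) * exp (Complex s t * of_real (u x))"
        by (simp only: exp_add exp_of_real) simp
    qed
    also have "\<dots> = 0" using s by (intro Z0) auto
    finally show ?thesis by simp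
  qed
  define m where "m = (\<integral>x. w 1 x \<partial>M)"
  have m2: "(\<integral>x. w (- 1) x \<partial>M) = m"
  proof -
    have "complex_of_real (\<integral>x. w (- 1) x \<partial>M) = of_real m" using ft[of 0] by (simp add: m_def)
    then show ?thesis by (simp only: of_real_eq_iff)
  qed
  have m\<sigma>: "(\<integral>x. w \<sigma> x \<partial>M) = m" if "\<sigma> \<in> {1, - 1}" for \<sigma> using that m2 m_def by auto
  have m0: "m \<ge> 0" unfolding m_def using w0 by simp
  have wA: "integrable M (\<lambda>x. w \<sigma> x * indicator A (u x))" for \<sigma>
    by (rule Bochner_Integration.integrable_bound[OF wi[of \<sigma>]])
       (auto simp: indicator_def abs_mult)
  have eq: "(\<integral>x. w 1 x * indicator A (u x) \<partial>M) = (\<integral>x. w (- 1) x * indicator A (u x) \<partial>M)"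
  proof (cases "m = 0")
    \<comment> \<open>Normalisation is impossible for \<open>m = 0\<close>, but then both parts
      vanish almost everywhere.\<close>
    case True
    have "(\<integral>x. w \<sigma> x * indicator A (u x) \<partial>M) = 0" if "\<sigma> \<in> {1, - 1}" for \<sigma>
    proof -
      have "AE x in M. w \<sigma> x = 0"
        using integral_nonneg_eq_0_iff_AE[OF wi[of \<sigma>]] w0 m\<sigma>[OF that] True by auto
      then have "(\<integral>x. w \<sigma> x * indicator A (u x) \<partial>M) = (\<integral>x. 0 \<partial>M)"
        by (intro integral_cong_AE) auto
      then show ?thesis by simp
    qed
    then show ?thesis by simp
  next
    case False
    then have mp: "m > 0" using m0 by simp
    define N where "N \<sigma> = distr (density M (\<lambda>x. ennreal (w \<sigma> x / m))) borel u" for \<sigma>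
    have Nint: "(\<integral>y. g y \<partial>N \<sigma>) = (\<integral>x. (w \<sigma> x / m) *\<^sub>R g (u x) \<partial>M)"
      if [measurable]: "g \<in> borel_measurable borel" for \<sigma> and g :: "real \<Rightarrow> complex"
      unfolding N_def using w0 mp
      by (subst integral_distr; (subst integral_density)?) (auto intro!: AE_I2)
    have Nr: "real_distribution (N \<sigma>)" if "\<sigma> \<in> {1, - 1}" for \<sigma>
    proof -
      have "emeasure (density M (\<lambda>x. ennreal (w \<sigma> x / m))) (space M) = (\<integral>\<^sup>+x. ennreal (w \<sigma> x / m) \<partial>M)"
        by (subst emeasure_density) (auto intro!: nn_integral_cong)
      also have "\<dots> = ennreal (\<integral>x. w \<sigma> x / m \<partial>M)"
        using wi w0 mp by (intro nn_integral_eq_integral) auto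
      also have "\<dots> = 1" using m\<sigma>[OF that] mp by simp
      finally have "prob_space (density M (\<lambda>x. ennreal (w \<sigma> x / m)))"
        by (intro prob_spaceI) simp
      then have "prob_space (N \<sigma>)" unfolding N_def by (intro prob_space.prob_space_distr) auto
      then show ?thesis unfolding real_distribution_def real_distribution_axioms_def by (simp add: N_def)
    qed
    have "char (N 1) = char (N (- 1))"
    proof
      fix t
      have "char (N \<sigma>) t = (\<integral>x. (complex_of_real (w \<sigma> x) * exp (\<i> * of_real (t * u x))) / of_real m \<partial>M)" for \<sigma>
        unfolding char_def by (subst Nint) (auto simp: scaleR_conv_of_real)
      then show "char (N 1) t = char (N (- 1)) t" using ft[of t] by simp
    qed
    then have NN: "N 1 = N (- 1)" using Levy_uniqueness[OF Nr Nr] by simp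
    have NA: "(\<integral>y. complex_of_real (indicator A y) \<partial>N \<sigma>) = of_real ((\<integral>x. w \<sigma> x * indicator A (u x) \<partial>M) / m)" for \<sigma>
    proof -
      have "(\<integral>y. complex_of_real (indicator A y) \<partial>N \<sigma>) = (\<integral>x. complex_of_real (w \<sigma> x * indicator A (u x) / m) \<partial>M)"
        by (subst Nint) (auto simp: scaleR_conv_of_real)
      also have "\<dots> = of_real (\<integral>x. w \<sigma> x * indicator A (u x) / m \<partial>M)" by (rule integral_complex_of_real)
      also have "(\<integral>x. w \<sigma> x * indicator A (u x) / m \<partial>M) = (\<integral>x. w \<sigma> x * indicator A (u x) \<partial>M) / m" by simp
      finally show ?thesis .
    qed
    have "complex_of_real ((\<integral>x. w 1 x * indicator A (u x) \<partial>M) / m) = of_real ((\<integral>x. w (- 1) x * indicator A (u x) \<partial>M) / m)"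
      using NA[of 1] NA[of "- 1"] NN by metis
    then show ?thesis using mp by (simp only: of_real_eq_iff divide_cancel_right) simp
  qed
  have "(\<integral>x. k x * exp (s * u x) * indicator A (u x) \<partial>M)
      = (\<integral>x. w 1 x * indicator A (u x) - w (- 1) x * indicator A (u x) \<partial>M)"
    by (intro Bochner_Integration.integral_cong refl) (simp add: wd flip: left_diff_distrib)
  also have "\<dots> = 0" using wA eq by simp
  finally show ?thesis .
qed

subsection \<open>Fourier transforms of functions holomorphic in a strip\<close>

lemma nn_integral_exp_abs_finite:
  assumes "a > (0::real)"
  shows "(\<integral>\<^sup>+x. ennreal (exp (- a * \<bar>x\<bar>)) \<partial>lborel) < \<infinity>"
proof -
  have half: "(\<integral>\<^sup>+x. ennreal (exp (- a * x)) * indicator {0..} x \<partial>lborel) = ennreal (1 / a)"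
  proof -
    have "(\<integral>\<^sup>+x. ennreal (exp (- a * x)) * indicator {0..} x \<partial>lborel) = ennreal (0 - (- exp (- a * 0) / a))"
    proof (rule nn_integral_FTC_atLeast[where F = "\<lambda>x. - exp (- a * x) / a"])
      show "((\<lambda>x. - exp (- a * x) / a) \<longlongrightarrow> 0) at_top"
        using assms by real_asymp
    qed (use assms in \<open>auto intro!: derivative_eq_intros\<close>)
    then show ?thesis by simp
  qed
  have "(\<integral>\<^sup>+x. ennreal (exp (- a * \<bar>x\<bar>)) \<partial>lborel)
      \<le> (\<integral>\<^sup>+x. ennreal (exp (- a * x)) * indicator {0..} x + ennreal (exp (- a * (- x))) * indicator {0..} (- x) \<partial>lborel)"
    by (intro nn_integral_mono) (auto split: split_indicator)
  also have "\<dots> = (\<integral>\<^sup>+x. ennreal (exp (- a * x)) * indicator {0..} x \<partial>lborel)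
      + (\<integral>\<^sup>+x. ennreal (exp (- a * (- x))) * indicator {0..} (- x) \<partial>lborel)"
    by (intro nn_integral_add) auto
  also have "(\<integral>\<^sup>+x. ennreal (exp (- a * (- x))) * indicator {0..} (- x) \<partial>lborel)
      = (\<integral>\<^sup>+x. ennreal (exp (- a * x)) * indicator {0..} x \<partial>lborel)"
    by (subst (2) nn_integral_real_affine[where c = "- 1" and t = 0]) auto
  finally show ?thesis unfolding half by (auto simp: less_top[symmetric] top_unique)
qed

text \<open>The norm dominates the average of the absolute coordinates, so the integrand is bounded
  by a product of one-dimensional exponentials.\<close>

lemma integrable_exp_norm:
  assumes c: "c > 0"
  shows "integrable lborel (\<lambda>x::'a::euclidean_space. exp (- c * norm x))"
proof (rule integrableI_nonneg)
  let ?a = "c / real DIM('a)"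
  have a: "?a > 0" using c by simp
  have le: "exp (- c * norm x) \<le> (\<Prod>b\<in>Basis. exp (- ?a * \<bar>x \<bullet> b\<bar>))" for x :: 'a
  proof -
    have "(\<Sum>b\<in>Basis. \<bar>x \<bullet> b\<bar>) \<le> (\<Sum>b\<in>(Basis::'a set). norm x)"
      using Basis_le_norm by (intro sum_mono) auto
    then have "?a * (\<Sum>b\<in>Basis. \<bar>x \<bullet> b\<bar>) \<le> ?a * (real DIM('a) * norm x)"
      using a by (intro mult_left_mono) auto
    also have "\<dots> = c * norm x" by simp
    finally have "- c * norm x \<le> (\<Sum>b\<in>Basis. - ?a * \<bar>x \<bullet> b\<bar>)"
      by (simp add: sum_distrib_left sum_negf)
    then show ?thesis by (simp flip: exp_sum)
  qed
  have "(\<integral>\<^sup>+x. ennreal (exp (- c * norm x)) \<partial>(lborel :: 'a measure))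
      \<le> (\<integral>\<^sup>+x. (\<Prod>b\<in>Basis. ennreal (exp (- ?a * \<bar>x \<bullet> b\<bar>))) \<partial>(lborel :: 'a measure))"
    using le by (intro nn_integral_mono) (auto simp: prod_ennreal intro!: ennreal_leI)
  also have "\<dots> = (\<Prod>b\<in>(Basis::'a set). (\<integral>\<^sup>+x. ennreal (exp (- ?a * \<bar>x\<bar>)) \<partial>lborel))"
    by (rule nn_integral_lborel_prod) auto
  also have "\<dots> < \<infinity>"
    using nn_integral_exp_abs_finite[OF a] by (simp add: power_less_top_ennreal)
  finally show "(\<integral>\<^sup>+x. ennreal (exp (- c * norm x)) \<partial>(lborel :: 'a measure)) < \<infinity>" .
qed auto

lemma continuous_on_horizontal:
  assumes "F holomorphic_on {w. 0 < Im w \<and> Im w < pi}" "0 < y" "y \<le> 1"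
  shows "continuous_on A (\<lambda>x. F (Complex x y))"
proof (rule continuous_on_compose2[OF holomorphic_on_imp_continuous_on[OF assms(1)]])
  show "continuous_on A (\<lambda>x. Complex x y)" by (intro continuous_on_Complex continuous_intros)
qed (use assms pi_gt3 in auto)

text \<open>On the convex strip \<open>G\<close> has a primitive \<open>P\<close>. The integrals
  over \<open>[-n, n]\<close> at the heights \<open>y\<close> and 1 therefore differ by the
  increments of \<open>P\<close> along two vertical segments of length at most 1, which are bounded
  by \<open>B n\<close> and \<open>B (- n)\<close>.\<close>

lemma contour_shift_integral:
  fixes G :: "complex \<Rightarrow> complex"
  assumes hol: "G holomorphic_on {w. 0 < Im w \<and> Im w < pi}"
    and bd: "\<And>x y. 0 < y \<Longrightarrow> y \<le> 1 \<Longrightarrow> norm (G (Complex x y)) \<le> B x"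
    and B: "integrable lborel B" and B0: "(\<lambda>n. B (real n)) \<longlonglongrightarrow> 0" "(\<lambda>n. B (- real n)) \<longlonglongrightarrow> 0"
    and y: "0 < y" "y \<le> 1"
  shows "(\<integral>x. G (Complex x y) \<partial>lborel) = (\<integral>x. G (Complex x 1) \<partial>lborel)"
proof -
  let ?S = "{w. 0 < Im w \<and> Im w < pi}"
  have S: "?S = {w. 0 < Im w} \<inter> {w. Im w < pi}" by auto
  have Sop: "open ?S" unfolding S by (intro open_Int open_halfspace_Im_gt open_halfspace_Im_lt)
  have Sconv: "convex ?S" unfolding S by (intro convex_Int convex_halfspace_Im_gt convex_halfspace_Im_lt)
  obtain P where P: "\<And>w. w \<in> ?S \<Longrightarrow> (P has_field_derivative G w) (at w)"
  proof -
    obtain P where P: "\<And>w. w \<in> ?S \<Longrightarrow> (P has_field_derivative G w) (at w within ?S)"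
      using holomorphic_convex_primitive'[OF Sconv Sop hol] by blast
    show ?thesis by (rule that[of P]) (use P at_within_open[OF _ Sop] in fastforce)
  qed
  have pi1: "1 < pi" using pi_gt3 by simp
  have meas: "(\<lambda>x. G (Complex x y)) \<in> borel_measurable borel" if "0 < y" "y \<le> 1" for y
    using continuous_on_horizontal[OF hol that] by (rule borel_measurable_continuous_onI)
  have Gi: "integrable lborel (\<lambda>x. G (Complex x y))" if "0 < y" "y \<le> 1" for y
    using meas[OF that] bd[OF that]
    by (intro Bochner_Integration.integrable_bound[OF B]) (auto intro!: AE_I2 order_trans[OF _ abs_ge_self])
  have trunc: "(\<lambda>n. \<integral>x. indicator {- real n..real n} x *\<^sub>R G (Complex x y) \<partial>lborel) \<longlonglongrightarrow> (\<integral>x. G (Complex x y) \<partial>lborel)"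
    if y: "0 < y" "y \<le> 1" for y
  proof (rule integral_dominated_convergence[where w = B])
    show "AE x in lborel. (\<lambda>n. indicator {- real n..real n} x *\<^sub>R G (Complex x y)) \<longlonglongrightarrow> G (Complex x y)"
    proof (rule AE_I2)
      fix x :: real
      have "eventually (\<lambda>n. indicator {- real n..real n} x *\<^sub>R G (Complex x y) = G (Complex x y)) sequentially"
        using eventually_ge_at_top[of "nat \<lceil>\<bar>x\<bar>\<rceil>"]
      proof eventually_elim
        case (elim n)
        then have "\<bar>x\<bar> \<le> real n" by linarith
        then show ?case by (auto simp: indicator_def abs_le_iff)
      qed
      then show "(\<lambda>n. indicator {- real n..real n} x *\<^sub>R G (Complex x y)) \<longlonglongrightarrow> G (Complex x y)"
        by (rule tendsto_eventually)
    qed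
    show "AE x in lborel. norm (indicator {- real n..real n} x *\<^sub>R G (Complex x y)) \<le> B x" for n
      using bd[OF y] by (intro AE_I2) (auto simp: indicator_def intro: order_trans[OF norm_ge_zero])
  qed (use meas[OF y] B in auto)
  have ftc: "(\<integral>x. indicator {- real n..real n} x *\<^sub>R G (Complex x y) \<partial>lborel) = P (Complex (real n) y) - P (Complex (- real n) y)"
    if y: "0 < y" "y \<le> 1" for y n
  proof (rule integral_FTC_atLeastAtMost)
    fix x :: real
    have "((\<lambda>x. P (Complex x y)) has_vector_derivative 1 * G (Complex x y)) (at x)"
      using y pi1
      by (intro field_vector_diff_chain_at[unfolded comp_def])
         (auto intro!: P derivative_eq_intros has_vector_derivative_real_field simp: Complex_eq)
    then show "((\<lambda>x. P (Complex x y)) has_vector_derivative G (Complex x y)) (at x within {- real n..real n})"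
      by (simp add: has_vector_derivative_at_within)
  next
    show "continuous_on {- real n..real n} (\<lambda>x. G (Complex x y))"
      by (rule continuous_on_horizontal[OF hol y])
  qed auto
  have side: "norm (P (Complex x y) - P (Complex x 1)) \<le> B x" for x
  proof -
    have "norm (P (Complex x y) - P (Complex x 1)) \<le> B x * norm (Complex x y - Complex x 1)"
    proof (rule field_differentiable_bound[where S = "closed_segment (Complex x y) (Complex x 1)"])
      fix w assume "w \<in> closed_segment (Complex x y) (Complex x 1)"
      then have w: "Re w = x" "y \<le> Im w" "Im w \<le> 1"
        using y by (auto simp: closed_segment_same_Re closed_segment_eq_real_ivl)
      show "(P has_field_derivative G w) (at w within closed_segment (Complex x y) (Complex x 1))"
      proof (rule has_field_derivative_at_within[OF P])
        show "w \<in> ?S" using w y pi1 by simp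
      qed
      show "norm (G w) \<le> B x"
      proof -
        have "w = Complex x (Im w)" using w by (simp add: complex_eq_iff)
        then show ?thesis using bd[of "Im w" x] w y by (metis less_le_trans)
      qed
    qed auto
    also have "\<dots> \<le> B x * 1"
    proof (rule mult_left_mono)
      show "norm (Complex x y - Complex x 1) \<le> 1"
      proof -
        have "Complex x y - Complex x 1 = Complex 0 (y - 1)" by (simp add: complex_eq_iff)
        then show ?thesis using y by (simp add: complex_norm)
      qed
      show "0 \<le> B x" using bd[OF y, of x] norm_ge_zero order_trans by blast
    qed
    finally show ?thesis by simp
  qed
  have "(\<lambda>n. (\<integral>x. indicator {- real n..real n} x *\<^sub>R G (Complex x y) \<partial>lborel)
      - (\<integral>x. indicator {- real n..real n} x *\<^sub>R G (Complex x 1) \<partial>lborel)) \<longlonglongrightarrow> 0"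
  proof (rule Lim_null_comparison)
    show "(\<lambda>n. B (real n) + B (- real n)) \<longlonglongrightarrow> 0" using tendsto_add[OF B0] by simp
    show "\<forall>\<^sub>F n in sequentially. norm ((\<integral>x. indicator {- real n..real n} x *\<^sub>R G (Complex x y) \<partial>lborel)
      - (\<integral>x. indicator {- real n..real n} x *\<^sub>R G (Complex x 1) \<partial>lborel)) \<le> B (real n) + B (- real n)"
    proof (intro always_eventually allI)
      fix n
      have "norm ((P (Complex (real n) y) - P (Complex (real n) 1)) - (P (Complex (- real n) y) - P (Complex (- real n) 1)))
          \<le> B (real n) + B (- real n)"
        by (rule order_trans[OF norm_triangle_ineq4 add_mono[OF side side]])
      then show "norm ((\<integral>x. indicator {- real n..real n} x *\<^sub>R G (Complex x y) \<partial>lborel)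
        - (\<integral>x. indicator {- real n..real n} x *\<^sub>R G (Complex x 1) \<partial>lborel)) \<le> B (real n) + B (- real n)"
        unfolding ftc[OF y] ftc[OF zero_less_one order_refl] by (simp add: algebra_simps)
    qed
  qed
  moreover have "(\<lambda>n. (\<integral>x. indicator {- real n..real n} x *\<^sub>R G (Complex x y) \<partial>lborel)
      - (\<integral>x. indicator {- real n..real n} x *\<^sub>R G (Complex x 1) \<partial>lborel))
      \<longlonglongrightarrow> (\<integral>x. G (Complex x y) \<partial>lborel) - (\<integral>x. G (Complex x 1) \<partial>lborel)"
    using y by (intro tendsto_diff trunc) auto
  ultimately show ?thesis using LIMSEQ_unique by fastforce
qed

text \<open>Shifting the contour to \<open>Im w = 1\<close> gains the factor \<open>exp (- \<bar>t\<bar>)\<close>.\<close>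

lemma fourier_decay_of_strip:
  fixes F :: "complex \<Rightarrow> complex"
  assumes hol: "F holomorphic_on {w. 0 < Im w \<and> Im w < pi}"
    and bd: "\<And>x y. 0 < y \<Longrightarrow> y \<le> 1 \<Longrightarrow> norm (F (Complex x y)) \<le> C * exp (- \<bar>x\<bar> / 4)"
    and lim: "\<And>x. x \<noteq> 0 \<Longrightarrow> isCont F (of_real x)"
    and Fm: "(\<lambda>x. F (of_real x)) \<in> borel_measurable borel"
    and even: "\<And>x. F (of_real (- x)) = F (of_real x)"
  shows "norm (\<integral>x. exp (\<i> * of_real (t * x)) * F (of_real x) \<partial>lborel)
     \<le> C * exp (- \<bar>t\<bar>) * (\<integral>x. exp (- \<bar>x\<bar> / 4) \<partial>lborel)"
proof -
  have Bi: "integrable lborel (\<lambda>x::real. C * exp (- \<bar>x\<bar> / 4))" for C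
    using integrable_exp_norm[of "1/4", where 'a = real] by simp
  have main: "norm (\<integral>x. exp (\<i> * of_real (t * x)) * F (of_real x) \<partial>lborel)
     \<le> C * exp (- t) * (\<integral>x. exp (- \<bar>x\<bar> / 4) \<partial>lborel)" if t: "t \<ge> 0" for t
  proof -
    define G where "G w = exp (\<i> * of_real t * w) * F w" for w
    have ne: "norm (exp (\<i> * of_real t * Complex x y)) = exp (- t * y)" for x y
      by (simp add: norm_exp_eq_Re)
    have bG: "norm (G (Complex x y)) \<le> C * exp (- \<bar>x\<bar> / 4)" if "0 < y" "y \<le> 1" for x y
    proof -
      have "norm (G (Complex x y)) \<le> 1 * (C * exp (- \<bar>x\<bar> / 4))"
        unfolding G_def norm_mult ne using bd[OF that] t that by (intro mult_mono) auto
      then show ?thesis by simp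
    qed
    have hG: "G holomorphic_on {w. 0 < Im w \<and> Im w < pi}"
      unfolding G_def by (intro holomorphic_intros hol)
    have J: "(\<integral>x. G (Complex x y) \<partial>lborel) = (\<integral>x. G (Complex x 1) \<partial>lborel)" if y: "0 < y" "y \<le> 1" for y
    proof (rule contour_shift_integral[OF hG bG Bi _ _ y])
      show "(\<lambda>n. C * exp (- \<bar>real n\<bar> / 4)) \<longlonglongrightarrow> 0" "(\<lambda>n. C * exp (- \<bar>- real n\<bar> / 4)) \<longlonglongrightarrow> 0"
        by (simp; real_asymp)+
    qed auto
    \<comment> \<open>The real axis is only the boundary of the strip, so the integral over it is
      taken as the limit of the integrals at height \<open>1 / (n + 1)\<close>. Continuity is asked
      only at \<open>x \<noteq> 0\<close>, because the functions in question carry a default value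
      at 0.\<close>
    have "(\<lambda>n. \<integral>x. G (Complex x (inverse (real (Suc n)))) \<partial>lborel) \<longlonglongrightarrow> (\<integral>x. G (of_real x) \<partial>lborel)"
    proof (rule integral_dominated_convergence[where w = "\<lambda>x. C * exp (- \<bar>x\<bar> / 4)"])
      show "AE x in lborel. (\<lambda>n. G (Complex x (inverse (real (Suc n))))) \<longlonglongrightarrow> G (of_real x)"
      proof -
        have "AE x in lborel. x \<noteq> (0::real)" by (rule AE_lborel_singleton)
        then show ?thesis
        proof eventually_elim
          case (elim x)
          have "(\<lambda>n. Complex x (inverse (real (Suc n)))) \<longlonglongrightarrow> Complex x 0"
            by (intro tendsto_Complex tendsto_const LIMSEQ_inverse_real_of_nat)
          moreover have "isCont G (of_real x)"
            unfolding G_def by (intro continuous_intros lim elim)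
          ultimately show ?case
            unfolding complex_of_real_def by (rule isCont_tendsto_compose[rotated])
        qed
      qed
      show "AE x in lborel. norm (G (Complex x (inverse (real (Suc n))))) \<le> C * exp (- \<bar>x\<bar> / 4)" for n
        using bG[of "inverse (real (Suc n))"] by (intro AE_I2) (auto simp: field_simps)
      show "(\<lambda>x. G (complex_of_real x)) \<in> borel_measurable lborel"
        unfolding G_def using Fm by simp
      show "(\<lambda>x. G (Complex x (inverse (real (Suc n))))) \<in> borel_measurable lborel" for n
      proof -
        have "inverse (real (Suc n)) \<le> 1" by (simp add: field_simps)
        then have "(\<lambda>x. G (Complex x (inverse (real (Suc n))))) \<in> borel_measurable borel"
          by (intro borel_measurable_continuous_onI continuous_on_horizontal[OF hG]) auto
        then show ?thesis by simp
      qed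
    qed (rule Bi)
    moreover have "(\<integral>x. G (Complex x (inverse (real (Suc n)))) \<partial>lborel) = (\<integral>x. G (Complex x 1) \<partial>lborel)" for n
      by (intro J) (auto simp: field_simps)
    ultimately have "(\<integral>x. G (of_real x) \<partial>lborel) = (\<integral>x. G (Complex x 1) \<partial>lborel)"
      by (simp add: LIMSEQ_const_iff)
    also have "norm \<dots> \<le> (\<integral>x. C * exp (- t) * exp (- \<bar>x\<bar> / 4) \<partial>lborel)"
    proof -
      have n1: "norm (G (Complex x 1)) \<le> C * exp (- t) * exp (- \<bar>x\<bar> / 4)" for x
        unfolding G_def norm_mult ne using mult_left_mono[OF bd[of 1 x], of "exp (- t)"]
        by (simp add: mult_ac)
      have "norm (\<integral>x. G (Complex x 1) \<partial>lborel) \<le> (\<integral>x. norm (G (Complex x 1)) \<partial>lborel)"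
        by (rule integral_norm_bound)
      also have "\<dots> \<le> (\<integral>x. C * exp (- t) * exp (- \<bar>x\<bar> / 4) \<partial>lborel)"
        by (intro integral_mono' Bi n1 order_trans[OF norm_ge_zero n1])
      finally show ?thesis .
    qed
    finally show ?thesis unfolding G_def by (simp add: mult_ac)
  qed
  show ?thesis
  proof (cases "t \<ge> 0")
    case True then show ?thesis using main[of t] by simp
  next
    \<comment> \<open>Reflecting \<open>x\<close> reduces negative \<open>t\<close> to positive
      \<open>t\<close>; this uses that \<open>F\<close> is even on the real line.\<close>
    case False
    have "(\<integral>x. exp (\<i> * of_real (t * x)) * F (of_real x) \<partial>lborel)
        = (\<integral>x. exp (\<i> * of_real (- t * x)) * F (of_real x) \<partial>lborel)"
      using lborel_integral_real_affine[of "- 1" "\<lambda>x. exp (\<i> * of_real (t * x)) * F (of_real x)" 0] even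
      by simp
    then show ?thesis using main[of "- t"] False by simp
  qed
qed

subsection \<open>Mehler's formula and the heat kernel\<close>

lemma sinh_Complex: "sinh (Complex x y) = Complex (sinh x * cos y) (cosh x * sin y)"
  and cosh_Complex: "cosh (Complex x y) = Complex (cosh x * cos y) (sinh x * sin y)"
  by (auto simp: complex_eq_iff sinh_field_def cosh_field_def Re_exp Im_exp algebra_simps diff_divide_distrib add_divide_distrib)

lemma sinh_of_real_complex: "sinh (complex_of_real x) = of_real (sinh x)"
  and cosh_of_real_complex: "cosh (complex_of_real x) = of_real (cosh x)"
  unfolding complex_of_real_def sinh_Complex cosh_Complex by simp_all

lemma norm_sinh_Complex: "(norm (sinh (Complex x y)))\<^sup>2 = (sinh x)\<^sup>2 + (sin y)\<^sup>2"
proof -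
  have "(norm (sinh (Complex x y)))\<^sup>2 = (sinh x)\<^sup>2 * (cos y)\<^sup>2 + (1 + (sinh x)\<^sup>2) * (sin y)\<^sup>2"
    by (simp add: sinh_Complex cmod_power2 power_mult_distrib cosh_square_eq)
  also have "\<dots> = (sinh x)\<^sup>2 * ((sin y)\<^sup>2 + (cos y)\<^sup>2) + (sin y)\<^sup>2" by algebra
  finally show ?thesis by simp
qed

lemma cos_ge_half:
  assumes "0 \<le> y" "y \<le> 1" shows "cos y \<ge> (1/2 :: real)"
proof -
  have "cos y \<ge> cos (pi / 3)" using assms pi_gt3 by (intro cos_monotone_0_pi_le) auto
  then show ?thesis by (simp add: cos_60)
qed

lemma sin_ge_half:
  assumes "0 \<le> y" "y \<le> 1" shows "sin y \<ge> y / (2 :: real)"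
proof -
  have "(\<lambda>y. sin y - y / 2) 0 \<le> (\<lambda>y. sin y - y / 2) y"
  proof (rule DERIV_nonneg_imp_nondecreasing[OF assms(1)])
    fix x assume "0 \<le> x" "x \<le> y"
    then have "cos x - 1 / 2 \<ge> 0" using cos_ge_half[of x] assms by simp
    moreover have "((\<lambda>y. sin y - y / 2) has_real_derivative cos x - 1 / 2) (at x)"
      by (auto intro!: derivative_eq_intros)
    ultimately show "\<exists>d. ((\<lambda>y. sin y - y / 2) has_real_derivative d) (at x) \<and> 0 \<le> d" by blast
  qed
  then show ?thesis by simp
qed

lemma abs_le_abs_sinh: "\<bar>x\<bar> \<le> \<bar>sinh (x::real)\<bar>"
  using real_le_abs_sinh[of x] by (simp add: sinh_field_def exp_minus)

text \<open>Doubling formula: \<open>sinh (x / 2)\<close> supplies the factor \<open>x / 2\<close>,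
  and \<open>cosh (x / 2)\<close> supplies half of \<open>exp (\<bar>x\<bar> / 2)\<close>.\<close>

lemma sinh_square_ge: "(sinh x)\<^sup>2 \<ge> x\<^sup>2 * exp \<bar>x\<bar> / (4 :: real)"
proof -
  have c: "cosh (x / 2) \<ge> exp (\<bar>x\<bar> / 2) / 2"
    by (cases "x \<ge> 0") (auto simp: cosh_field_def)
  have "\<bar>sinh x\<bar> = 2 * (\<bar>sinh (x / 2)\<bar> * cosh (x / 2))"
    using sinh_double[of "x / 2"] by (simp add: abs_mult)
  also have "\<dots> \<ge> 2 * (\<bar>x / 2\<bar> * (exp (\<bar>x\<bar> / 2) / 2))"
    using abs_le_abs_sinh[of "x / 2"] c by (intro mult_left_mono mult_mono) auto
  finally have "(\<bar>x\<bar> * exp (\<bar>x\<bar> / 2) / 2)\<^sup>2 \<le> \<bar>sinh x\<bar>\<^sup>2" by (intro power_mono) auto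
  moreover have "(\<bar>x\<bar> * exp (\<bar>x\<bar> / 2) / 2)\<^sup>2 = x\<^sup>2 * exp \<bar>x\<bar> / 4"
    by (simp add: power_mult_distrib power_divide flip: exp_double)
  ultimately show ?thesis by simp
qed

text \<open>The bound keeps both the simple zero at the origin and the growth of
  \<open>sinh\<close>, so that it controls \<open>w / sinh w\<close> everywhere in the strip. For
  \<open>\<bar>x\<bar> \<ge> 1\<close> the term \<open>sinh x\<close> suffices; otherwise
  \<open>exp \<bar>x\<bar> \<le> 3\<close> and \<open>sin y \<ge> y / 2\<close> take care of
  \<open>y\<close>.\<close>

lemma norm_sinh_Complex_ge:
  assumes "0 \<le> y" "y \<le> 1"
  shows "(norm (sinh (Complex x y)))\<^sup>2 \<ge> (x\<^sup>2 + y\<^sup>2) * exp \<bar>x\<bar> / 16"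
proof (cases "\<bar>x\<bar> \<ge> 1")
  case True
  have "y\<^sup>2 \<le> 1" using assms by (simp add: power_le_one)
  also have "1 \<le> x\<^sup>2" using power_mono[OF True, of 2] by simp
  finally have "(x\<^sup>2 + y\<^sup>2) * exp \<bar>x\<bar> \<le> (x\<^sup>2 + x\<^sup>2) * exp \<bar>x\<bar>" by (intro mult_right_mono) auto
  moreover have "0 \<le> x\<^sup>2 * exp \<bar>x\<bar>" by simp
  ultimately show ?thesis using sinh_square_ge[of x] zero_le_power2[of "sin y"]
    unfolding norm_sinh_Complex distrib_right add_divide_distrib by linarith
next
  case False
  have "exp \<bar>x\<bar> \<le> exp 1" using False by simp
  also have "\<dots> \<le> 3" by (rule exp_le)
  finally have e: "exp \<bar>x\<bar> \<le> 3" .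
  have "(y / 2)\<^sup>2 \<le> (sin y)\<^sup>2" using sin_ge_half[OF assms] assms by (intro power_mono) auto
  moreover have "y\<^sup>2 * exp \<bar>x\<bar> \<le> y\<^sup>2 * 3" using e by (intro mult_left_mono) auto
  ultimately have "y\<^sup>2 * exp \<bar>x\<bar> / 16 \<le> (sin y)\<^sup>2" by (simp add: power_divide) (use zero_le_power2[of y] in linarith)
  moreover have "x\<^sup>2 * exp \<bar>x\<bar> \<ge> 0" by simp
  ultimately show ?thesis using sinh_square_ge[of x]
    unfolding norm_sinh_Complex distrib_right add_divide_distrib by linarith
qed

text \<open>The coefficients of Mehler's formula at time 1, continued to complex frequency
  \<open>w\<close>; \<open>hb w\<close> is \<open>w coth w / 4\<close>. At \<open>w = 0\<close> both
  take the default value 0 instead of their limits 1 and \<open>1 / 4\<close>. Other times are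
  reached by scaling, see \<open>mP_scale\<close>.\<close>

definition ha :: "complex \<Rightarrow> complex" where "ha w = w / sinh w"
definition hb :: "complex \<Rightarrow> complex" where "hb w = w * cosh w / (4 * sinh w)"

lemma sinh_Complex_nonzero:
  assumes "0 \<le> y" "y \<le> 1" "Complex x y \<noteq> 0"
  shows "sinh (Complex x y) \<noteq> 0"
proof
  assume "sinh (Complex x y) = 0"
  then have "(x\<^sup>2 + y\<^sup>2) * exp \<bar>x\<bar> / 16 \<le> 0" using norm_sinh_Complex_ge[OF assms(1,2), of x] by simp
  then have "x\<^sup>2 + y\<^sup>2 \<le> 0" by (simp add: mult_le_0_iff not_le[symmetric])
  then show False using assms(3) by (simp add: sum_power2_le_zero_iff complex_eq_iff)
qed

lemma ha_bound:
  assumes "0 \<le> y" "y \<le> 1"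
  shows "norm (ha (Complex x y)) \<le> 4 * exp (- \<bar>x\<bar> / 2)"
proof (cases "Complex x y = 0")
  case False
  have nz: "norm (sinh (Complex x y)) > 0" using sinh_Complex_nonzero[OF assms False] by simp
  have "(norm (Complex x y))\<^sup>2 = (x\<^sup>2 + y\<^sup>2) * exp \<bar>x\<bar> / 16 * (16 * exp (- \<bar>x\<bar>))"
  proof -
    have "exp \<bar>x\<bar> * exp (- \<bar>x\<bar>) = 1" by (simp flip: exp_add)
    moreover have "(x\<^sup>2 + y\<^sup>2) * exp \<bar>x\<bar> / 16 * (16 * exp (- \<bar>x\<bar>)) = (x\<^sup>2 + y\<^sup>2) * (exp \<bar>x\<bar> * exp (- \<bar>x\<bar>))"
      by simp
    ultimately show ?thesis by (simp only: cmod_power2 complex.sel mult_1_right)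
  qed
  also have "\<dots> \<le> (norm (sinh (Complex x y)))\<^sup>2 * (16 * exp (- \<bar>x\<bar>))"
    using norm_sinh_Complex_ge[OF assms] by (intro mult_right_mono) auto
  also have "\<dots> = (4 * exp (- \<bar>x\<bar> / 2) * norm (sinh (Complex x y)))\<^sup>2"
    by (simp add: power_mult_distrib flip: exp_double)
  finally have "norm (Complex x y) \<le> 4 * exp (- \<bar>x\<bar> / 2) * norm (sinh (Complex x y))"
    by (rule power2_le_imp_le) simp
  then show ?thesis using nz by (simp add: ha_def norm_divide pos_divide_le_eq)
qed (simp add: ha_def)

lemma ha_bound0:
  assumes "0 \<le> y" "y \<le> 1" shows "norm (ha (Complex x y)) \<le> 4"
proof -
  have "exp (- \<bar>x\<bar> / 2) \<le> 1" by simp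
  then show ?thesis using ha_bound[OF assms, of x] by linarith
qed

text \<open>The identity \<open>coth^2 = 1 + 1 / sinh^2\<close>, multiplied by \<open>w^2\<close>.
  It lets the bound for \<open>ha\<close> carry over to \<open>hb\<close>.\<close>

lemma hb_square:
  assumes "sinh w \<noteq> 0" shows "16 * (hb w)\<^sup>2 = w\<^sup>2 + (ha w)\<^sup>2"
  using assms by (simp add: hb_def ha_def power_divide power_mult_distrib cosh_square_eq field_simps)

lemma hb_bound:
  assumes "0 \<le> y" "y \<le> 1"
  shows "norm (hb (Complex x y)) \<le> 2 * exp (\<bar>x\<bar> / 4)"
proof (cases "Complex x y = 0")
  case False
  let ?w = "Complex x y"
  have "(4 * norm (hb ?w))\<^sup>2 = norm (16 * (hb ?w)\<^sup>2)" by (simp add: norm_mult norm_power power_mult_distrib)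
  also have "\<dots> = norm (?w\<^sup>2 + (ha ?w)\<^sup>2)" using hb_square[OF sinh_Complex_nonzero[OF assms False]] by simp
  also have "\<dots> \<le> (norm ?w)\<^sup>2 + (norm (ha ?w))\<^sup>2" by (intro order_trans[OF norm_triangle_ineq]) (simp add: norm_power)
  also have "\<dots> \<le> (norm ?w + norm (ha ?w))\<^sup>2" by (simp add: power2_sum)
  finally have "4 * norm (hb ?w) \<le> norm ?w + norm (ha ?w)"
    by (rule power2_le_imp_le) simp
  also have "norm ?w \<le> \<bar>x\<bar> + 1" using cmod_le[of ?w] assms by simp
  also have "norm (ha ?w) \<le> 4"
    using ha_bound0[OF assms] .
  finally have "4 * norm (hb ?w) \<le> \<bar>x\<bar> + 5" by simp
  moreover have "1 + \<bar>x\<bar> / 4 \<le> exp (\<bar>x\<bar> / 4)" by (rule exp_ge_add_one_self)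
  ultimately show ?thesis by linarith
qed (simp add: hb_def)

lemma sinh_le_x_cosh: "x \<ge> 0 \<Longrightarrow> sinh x \<le> x * cosh (x :: real)"
proof -
  assume x: "x \<ge> 0"
  have "(\<lambda>x. x * cosh x - sinh x) 0 \<le> (\<lambda>x. x * cosh x - sinh x) x"
  proof (rule DERIV_nonneg_imp_nondecreasing[OF x])
    fix u :: real assume "0 \<le> u"
    moreover have "((\<lambda>x. x * cosh x - sinh x) has_real_derivative u * sinh u) (at u)"
      by (auto intro!: derivative_eq_intros)
    ultimately show "\<exists>d. ((\<lambda>x. x * cosh x - sinh x) has_real_derivative d) (at u) \<and> 0 \<le> d"
      by (intro exI[of _ "u * sinh u"]) auto
  qed
  then show ?thesis by simp
qed

text \<open>The source of the Gaussian decay in \<open>z\<close>, uniformly up to height 1. The real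
  part of \<open>w coth w\<close> is \<open>(x sinh x cosh x + y sin y cos y) / |sinh w|^2\<close>.
  Its first summand beats \<open>(sinh x)^2\<close>; the second is at least half of
  \<open>(sin y)^2\<close> as long as \<open>cos y \<ge> 1 / 2\<close>, which limits the admissible
  height.\<close>

lemma Re_hb_ge:
  assumes "0 \<le> y" "y \<le> 1" "Complex x y \<noteq> 0"
  shows "Re (hb (Complex x y)) \<ge> 1 / 8"
proof -
  let ?w = "Complex x y"
  have nz: "norm (sinh ?w) > 0" using sinh_Complex_nonzero[OF assms] by simp
  have "hb ?w = ?w * cosh ?w * cnj (sinh ?w) / of_real (4 * (norm (sinh ?w))\<^sup>2)"
    using nz by (simp add: hb_def complex_div_cnj[of _ "sinh _"] complex_norm_square field_simps)
  then have Re: "Re (hb ?w) = Re (?w * cosh ?w * cnj (sinh ?w)) / (4 * (norm (sinh ?w))\<^sup>2)"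
    by (simp only: Re_divide_of_real)
  have "Re (?w * cosh ?w * cnj (sinh ?w))
     = x * sinh x * cosh x * ((sin y)\<^sup>2 + (cos y)\<^sup>2) + y * sin y * cos y * ((cosh x)\<^sup>2 - (sinh x)\<^sup>2)"
    unfolding sinh_Complex cosh_Complex complex_cnj complex_mult complex.sel by algebra
  then have num: "Re (?w * cosh ?w * cnj (sinh ?w)) = x * sinh x * cosh x + y * sin y * cos y"
    by (simp add: cosh_square_eq)
  have 1: "(sinh x)\<^sup>2 \<le> x * sinh x * cosh x"
  proof -
    have "\<bar>sinh x\<bar> * \<bar>sinh x\<bar> \<le> \<bar>sinh x\<bar> * (\<bar>x\<bar> * cosh \<bar>x\<bar>)"
      using sinh_le_x_cosh[of "\<bar>x\<bar>"] by (intro mult_left_mono) auto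
    also have "\<dots> = x * sinh x * cosh x"
      by (cases "x \<ge> 0") (auto simp: abs_if)
    finally show ?thesis by (simp add: power2_eq_square)
  qed
  have 2: "(sin y)\<^sup>2 / 2 \<le> y * sin y * cos y"
  proof -
    have s: "0 \<le> sin y" "sin y \<le> y" using sin_ge_half[OF assms(1,2)] sin_x_le_x assms by auto
    have "sin y * (1 / 2) \<le> y * cos y" using s cos_ge_half[OF assms(1,2)] by (intro mult_mono) auto
    then have "sin y * (sin y * (1 / 2)) \<le> sin y * (y * cos y)" using s by (intro mult_left_mono) auto
    then show ?thesis by (simp add: power2_eq_square mult_ac)
  qed
  have "(norm (sinh ?w))\<^sup>2 / 2 \<le> Re (?w * cosh ?w * cnj (sinh ?w))"
  proof -
    have *: "(a + b) / 2 \<le> c + d" if "a \<le> c" "b / 2 \<le> d" "0 \<le> a" for a b c d :: real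
      using that unfolding add_divide_distrib by linarith
    show ?thesis unfolding num norm_sinh_Complex by (rule *[OF 1 2 zero_le_power2])
  qed
  then show ?thesis unfolding Re using nz by (simp add: field_simps)
qed

text \<open>Up to a constant factor, the Fourier transform in \<open>t\<close> of the heat kernel at
  time 1, with \<open>v\<close> standing for \<open>|z|^2\<close>. The companion \<open>hF'\<close>
  is minus the time derivative, computed in \<open>mP_deriv\<close>.\<close>

definition hF :: "nat \<Rightarrow> real \<Rightarrow> complex \<Rightarrow> complex" where
  "hF n v w = ha w ^ n * exp (- (hb w * of_real v))"

definition hF' :: "nat \<Rightarrow> real \<Rightarrow> complex \<Rightarrow> complex" where
  "hF' n v w = (of_nat (4 * n) * hb w - (ha w)\<^sup>2 * of_real (v / 4)) * hF n v w"

text \<open>Large enough for both \<open>hF_bound\<close> and \<open>hF'_bound\<close>: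
  \<open>8 n\<close> is \<open>4 n * 2\<close> from the term with \<open>hb\<close>, and 64 is
  \<open>4 * 16\<close> from the term with \<open>v\<close>.\<close>

definition hC :: "nat \<Rightarrow> real" where "hC n = (8 * real n + 64) * 4 ^ n"

lemma hF_bound0:
  assumes "0 \<le> y" "y \<le> 1" "v \<ge> 0" "n \<ge> 1"
  shows "norm (hF n v (Complex x y)) \<le> 4 ^ n * exp (- \<bar>x\<bar> / 2) * exp (- v / 8)"
proof (cases "Complex x y = 0")
  case True
  then have "hF n v (Complex x y) = 0" using assms by (simp add: hF_def ha_def)
  then show ?thesis by simp
next
  case False
  have "norm (ha (Complex x y)) ^ n \<le> (4 * exp (- \<bar>x\<bar> / 2)) ^ n"
    using ha_bound[OF assms(1,2)] by (intro power_mono) auto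
  also have "\<dots> = 4 ^ n * exp (- \<bar>x\<bar> / 2) ^ n" by (simp add: power_mult_distrib)
  also have "\<dots> \<le> 4 ^ n * exp (- \<bar>x\<bar> / 2) ^ 1"
    using assms by (intro mult_left_mono power_decreasing) auto
  finally have 1: "norm (ha (Complex x y)) ^ n \<le> 4 ^ n * exp (- \<bar>x\<bar> / 2)" by simp
  have "1 / 8 * v \<le> Re (hb (Complex x y)) * v"
    using Re_hb_ge[OF assms(1,2) False] assms by (intro mult_right_mono) auto
  then have 2: "norm (exp (- (hb (Complex x y) * of_real v))) \<le> exp (- v / 8)"
    by (simp add: norm_exp_eq_Re)
  show ?thesis unfolding hF_def norm_mult norm_power using 1 2 by (intro mult_mono) auto
qed

lemma exp_sixteenth: "v \<ge> 0 \<Longrightarrow> v * exp (- v / 8) \<le> 16 * exp (- v / (16::real))"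
proof -
  have "v / 16 \<le> exp (v / 16)" using exp_ge_add_one_self[of "v / 16"] by linarith
  then have "v * exp (- v / 8) \<le> (16 * exp (v / 16)) * exp (- v / 8)" by (intro mult_right_mono) auto
  also have "\<dots> = 16 * exp (- v / 16)" by (simp flip: exp_add)
  finally show ?thesis .
qed

lemma hF_bound:
  assumes "0 \<le> y" "y \<le> 1" "v \<ge> 0" "n \<ge> 1"
  shows "norm (hF n v (Complex x y)) \<le> hC n * exp (- v / 16) * exp (- \<bar>x\<bar> / 4)"
proof -
  have "norm (hF n v (Complex x y)) \<le> 4 ^ n * exp (- \<bar>x\<bar> / 2) * exp (- v / 8)" by (rule hF_bound0[OF assms])
  also have "\<dots> \<le> hC n * exp (- \<bar>x\<bar> / 4) * exp (- v / 16)"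
    using assms by (intro mult_mono) (auto simp: hC_def)
  finally show ?thesis by (simp add: mult_ac)
qed

text \<open>Half of each decay rate in \<open>hF_bound0\<close> is spent: the one in
  \<open>x\<close> pays for the growth of \<open>hb\<close>, the one in \<open>v\<close> for the
  linear factor \<open>v\<close>.\<close>

lemma hF'_bound:
  assumes "0 \<le> y" "y \<le> 1" "v \<ge> 0" "n \<ge> 1"
  shows "norm (hF' n v (Complex x y)) \<le> hC n * exp (- v / 16) * exp (- \<bar>x\<bar> / 4)"
proof -
  let ?w = "Complex x y" and ?e = "exp (- \<bar>x\<bar> / 2)"
  have "norm (of_nat (4 * n) * hb ?w - (ha ?w)\<^sup>2 * of_real (v / 4)) \<le> real (4 * n) * norm (hb ?w) + (norm (ha ?w))\<^sup>2 * (v / 4)"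
    using assms by (intro order_trans[OF norm_triangle_ineq4]) (simp add: norm_mult norm_power)
  also have "\<dots> \<le> real (4 * n) * (2 * exp (\<bar>x\<bar> / 4)) + 4\<^sup>2 * (v / 4)"
  proof (intro add_mono mult_left_mono mult_right_mono power_mono)
    show "norm (ha ?w) \<le> 4" by (rule ha_bound0[OF assms(1,2)])
  qed (use hb_bound[OF assms(1,2)] assms in auto)
  also have "\<dots> = 8 * real n * exp (\<bar>x\<bar> / 4) + 4 * v" by simp
  also have "\<dots> \<le> (8 * real n + 4 * v) * exp (\<bar>x\<bar> / 4)"
    using assms mult_left_mono[of 1 "exp (\<bar>x\<bar> / 4)" "4 * v"] by (simp add: distrib_right)
  finally have "norm (hF' n v ?w) \<le> (8 * real n + 4 * v) * exp (\<bar>x\<bar> / 4) * (4 ^ n * ?e * exp (- v / 8))"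
    unfolding hF'_def norm_mult using hF_bound0[OF assms] assms by (intro mult_mono) auto
  also have "\<dots> = (8 * real n * exp (- v / 8) + 4 * (v * exp (- v / 8))) * (4 ^ n * (exp (\<bar>x\<bar> / 4) * ?e))"
    by (simp add: algebra_simps)
  also have "exp (\<bar>x\<bar> / 4) * ?e = exp (- \<bar>x\<bar> / 4)" by (simp flip: exp_add)
  also have "(8 * real n * exp (- v / 8) + 4 * (v * exp (- v / 8))) * (4 ^ n * exp (- \<bar>x\<bar> / 4))
      \<le> (8 * real n * exp (- v / 16) + 4 * (16 * exp (- v / 16))) * (4 ^ n * exp (- \<bar>x\<bar> / 4))"
    using exp_sixteenth[OF assms(3)] assms by (intro mult_right_mono add_mono mult_left_mono) auto
  also have "\<dots> = hC n * exp (- v / 16) * exp (- \<bar>x\<bar> / 4)" by (simp add: hC_def algebra_simps)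
  finally show ?thesis .
qed

lemma sinh_strip_nonzero:
  assumes "0 < Im w" "Im w < pi" shows "sinh w \<noteq> 0"
proof -
  have "(norm (sinh (Complex (Re w) (Im w))))\<^sup>2 > 0"
    unfolding norm_sinh_Complex using sin_gt_zero[OF assms] by (simp add: add_nonneg_pos)
  then show ?thesis by auto
qed

lemma holomorphic_hF:
  "hF n v holomorphic_on {w. 0 < Im w \<and> Im w < pi}" "hF' n v holomorphic_on {w. 0 < Im w \<and> Im w < pi}"
proof -
  let ?S = "{w. 0 < Im w \<and> Im w < pi}"
  have "sinh holomorphic_on ?S" "cosh holomorphic_on ?S"
    by (auto simp: holomorphic_on_def field_differentiable_def intro!: derivative_eq_intros exI)
  then have ab: "ha holomorphic_on ?S" "hb holomorphic_on ?S"
    unfolding ha_def hb_def using sinh_strip_nonzero by (auto intro!: holomorphic_intros)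
  then show "hF n v holomorphic_on ?S" unfolding hF_def by (intro holomorphic_intros)
  then show "hF' n v holomorphic_on ?S" unfolding hF'_def using ab by (intro holomorphic_intros)
qed

lemma isCont_hF:
  assumes "x \<noteq> 0" shows "isCont (hF n v) (of_real x)" "isCont (hF' n v) (of_real x)"
proof -
  have s: "sinh (complex_of_real x) \<noteq> 0" using assms by (simp add: sinh_of_real_complex)
  have ab: "isCont ha (of_real x)" "isCont hb (of_real x)"
    unfolding ha_def hb_def using s by (auto intro!: continuous_intros isCont_sinh isCont_cosh)
  then show "isCont (hF n v) (of_real x)" unfolding hF_def by (intro continuous_intros)
  then show "isCont (hF' n v) (of_real x)" unfolding hF'_def using ab by (intro continuous_intros)
qed

text \<open>For real frequency \<open>l\<close> and time \<open>s\<close> these are the coefficients of Mehler's formula; the value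
  at \<open>l = 0\<close> is the junk value \<open>0\<close>, which is harmless because \<open>l\<close> is only integrated over.\<close>

definition mA :: "real \<Rightarrow> real \<Rightarrow> real" where "mA s l = l / sinh (s * l)"
definition mB :: "real \<Rightarrow> real \<Rightarrow> real" where "mB s l = l * cosh (s * l) / (4 * sinh (s * l))"
definition mP :: "nat \<Rightarrow> real \<Rightarrow> real \<Rightarrow> real \<Rightarrow> real" where
  "mP n s v l = mA s l ^ n * exp (- (mB s l * v))"
definition mP' :: "nat \<Rightarrow> real \<Rightarrow> real \<Rightarrow> real \<Rightarrow> real" where
  "mP' n s v l = (4 * real n * mB s l - (mA s l)\<^sup>2 * (v / 4)) * mP n s v l"

text \<open>Homogeneity reduces time \<open>s\<close> to time 1: the frequency is multiplied by
  \<open>s\<close> and \<open>v\<close> is divided by it.\<close>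

lemma mP_scale:
  assumes "s > 0"
  shows "complex_of_real (mP n s v l) = hF n (v / s) (of_real (s * l)) / of_real (s ^ n)"
    and "complex_of_real (mP' n s v l) = hF' n (v / s) (of_real (s * l)) / of_real (s ^ Suc n)"
proof -
  have a: "ha (of_real (s * l)) = of_real (s * mA s l)"
    unfolding ha_def sinh_of_real_complex mA_def by simp
  have b: "hb (of_real (s * l)) = of_real (s * mB s l)"
    unfolding hb_def sinh_of_real_complex cosh_of_real_complex mB_def by simp
  have e: "exp (- (complex_of_real (s * mB s l) * of_real (v / s))) = of_real (exp (- (mB s l * v)))"
    using assms by (simp flip: exp_of_real)
  show 1: "complex_of_real (mP n s v l) = hF n (v / s) (of_real (s * l)) / of_real (s ^ n)"
    unfolding hF_def a b e mP_def using assms by (simp add: power_mult_distrib)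
  have "hF' n (v / s) (of_real (s * l)) = of_real (s * (4 * real n * mB s l - (mA s l)\<^sup>2 * (v / 4))) * hF n (v / s) (of_real (s * l))"
    unfolding hF'_def a b using assms by (simp add: field_simps power2_eq_square)
  then show "complex_of_real (mP' n s v l) = hF' n (v / s) (of_real (s * l)) / of_real (s ^ Suc n)"
    unfolding mP'_def of_real_mult 1 using assms by simp
qed

lemma mP_bound:
  assumes "s > 0" "v \<ge> 0" "n \<ge> 1"
  shows "\<bar>mP n s v l\<bar> \<le> hC n / s ^ n * exp (- (v / s) / 16) * exp (- s * \<bar>l\<bar> / 4)"
    and "\<bar>mP' n s v l\<bar> \<le> hC n / s ^ Suc n * exp (- (v / s) / 16) * exp (- s * \<bar>l\<bar> / 4)"
proof -
  have c: "complex_of_real (s * l) = Complex (s * l) 0" by (simp add: complex_of_real_def)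
  have al: "\<bar>s * l\<bar> = s * \<bar>l\<bar>" using assms by (simp add: abs_mult)
  have v: "v / s \<ge> 0" using assms by simp
  have "\<bar>mP n s v l\<bar> = norm (complex_of_real (mP n s v l))" by simp
  also have "\<dots> = norm (hF n (v / s) (Complex (s * l) 0)) / s ^ n"
    unfolding mP_scale[OF assms(1)] c[symmetric] using assms(1) by (simp add: norm_divide norm_power)
  also have "\<dots> \<le> hC n * exp (- (v / s) / 16) * exp (- \<bar>s * l\<bar> / 4) / s ^ n"
    using assms(1) by (intro divide_right_mono hF_bound v assms(3)) auto
  finally show "\<bar>mP n s v l\<bar> \<le> hC n / s ^ n * exp (- (v / s) / 16) * exp (- s * \<bar>l\<bar> / 4)"
    unfolding al by simp
  have "\<bar>mP' n s v l\<bar> = norm (complex_of_real (mP' n s v l))" by simp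
  also have "\<dots> = norm (hF' n (v / s) (Complex (s * l) 0)) / s ^ Suc n"
    unfolding mP_scale[OF assms(1)] c[symmetric] using assms(1)
    by (simp add: norm_divide norm_power norm_mult)
  also have "\<dots> \<le> hC n * exp (- (v / s) / 16) * exp (- \<bar>s * l\<bar> / 4) / s ^ Suc n"
    using assms(1) by (intro divide_right_mono hF'_bound v assms(3)) auto
  finally show "\<bar>mP' n s v l\<bar> \<le> hC n / s ^ Suc n * exp (- (v / s) / 16) * exp (- s * \<bar>l\<bar> / 4)"
    unfolding al by simp
qed

lemma mP_measurable [measurable]:
  "(\<lambda>x. mP n s (f x) (g x)) \<in> borel_measurable M" "(\<lambda>x. mP' n s (f x) (g x)) \<in> borel_measurable M"
  if [measurable]: "f \<in> borel_measurable M" "g \<in> borel_measurable M"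
proof -
  have [measurable]: "(sinh :: real \<Rightarrow> real) \<in> borel_measurable borel" "(cosh :: real \<Rightarrow> real) \<in> borel_measurable borel"
    by (auto intro!: borel_measurable_continuous_onI continuous_intros)
  show "(\<lambda>x. mP n s (f x) (g x)) \<in> borel_measurable M" unfolding mP_def mA_def mB_def by measurable
  then show "(\<lambda>x. mP' n s (f x) (g x)) \<in> borel_measurable M" unfolding mP'_def mA_def mB_def by measurable
qed

text \<open>The coefficients satisfy the system \<open>mA' = - 4 mA mB\<close>,
  \<open>mB' = - mA^2 / 4\<close> in the time variable. The factor in \<open>mP'\<close> is the one
  by which the sublaplacian multiplies the mode in \<open>sublaplacian_hE\<close>, so this is the
  heat equation for one frequency.\<close>

lemma mP_deriv:
  assumes s: "s > 0" and n: "n \<ge> 1"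
  shows "((\<lambda>s. mP n s v l) has_real_derivative - mP' n s v l) (at s)"
proof (cases "l = 0")
  case True
  then show ?thesis using n by (cases n) (simp_all add: mP_def mP'_def mA_def)
next
  case False
  then have nz: "sinh (s * l) \<noteq> 0" using s by simp
  have A: "((\<lambda>s. mA s l) has_real_derivative - 4 * mA s l * mB s l) (at s)"
    unfolding mA_def mB_def using nz
    by (auto intro!: derivative_eq_intros simp: field_simps power2_eq_square)
  have B: "((\<lambda>s. mB s l) has_real_derivative - (mA s l)\<^sup>2 / 4) (at s)"
  proof -
    have "((\<lambda>s. mB s l) has_real_derivative
        (l * (sinh (s * l) * l) * (4 * sinh (s * l)) - l * cosh (s * l) * (4 * (cosh (s * l) * l))) / (4 * sinh (s * l))\<^sup>2) (at s)"
      unfolding mB_def using nz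
      by (auto intro!: derivative_eq_intros simp: power2_eq_square)
    moreover have "(l * (sinh (s * l) * l) * (4 * sinh (s * l)) - l * cosh (s * l) * (4 * (cosh (s * l) * l)))
        = - 4 * l\<^sup>2 * ((cosh (s * l))\<^sup>2 - (sinh (s * l))\<^sup>2)"
      by (simp add: algebra_simps power2_eq_square)
    ultimately show ?thesis
      by (simp add: mA_def hyperbolic_pythagoras power_divide power_mult_distrib mult.commute)
  qed
  have D: "((\<lambda>s. mP n s v l) has_real_derivative
      real n * mA s l ^ (n - 1) * (- 4 * mA s l * mB s l) * exp (- (mB s l * v))
      + exp (- (mB s l * v)) * (- (- (mA s l)\<^sup>2 / 4 * v)) * mA s l ^ n) (at s)"
    unfolding mP_def by (auto intro!: derivative_eq_intros A B)
  show ?thesis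
    by (rule DERIV_cong[OF D]) (use n in \<open>cases n; simp add: mP'_def mP_def algebra_simps\<close>)
qed

text \<open>Up to a positive constant, the heat kernel at time \<open>s\<close> as a function of
  \<open>v = |z|^2\<close> and \<open>t\<close>; \<open>hk'\<close> is minus its time derivative by
  \<open>hk_deriv\<close>.\<close>

definition hk :: "nat \<Rightarrow> real \<Rightarrow> real \<Rightarrow> real \<Rightarrow> complex" where
  "hk n s v t = (\<integral>l. exp (\<i> * of_real (t * l)) * of_real (mP n s v l) \<partial>lborel)"
definition hk' :: "nat \<Rightarrow> real \<Rightarrow> real \<Rightarrow> real \<Rightarrow> complex" where
  "hk' n s v t = (\<integral>l. exp (\<i> * of_real (t * l)) * of_real (mP' n s v l) \<partial>lborel)"

definition hK :: "nat \<Rightarrow> real" where "hK n = hC n * (\<integral>x. exp (- \<bar>x\<bar> / 4) \<partial>lborel)"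

text \<open>After scaling to time 1 the frequency integral is the Fourier transform of a function
  holomorphic in the strip. The contour shift yields the decay in \<open>t\<close>, and
  \<open>Re_hb_ge\<close> the decay in \<open>v\<close>.\<close>

lemma hk_bounds:
  assumes s: "s > 0" and v: "v \<ge> 0" and n: "n \<ge> 1"
  shows "norm (hk n s v t) \<le> hK n / s ^ Suc n * exp (- (v / 16 + \<bar>t\<bar>) / s)"
    and "norm (hk' n s v t) \<le> hK n / s ^ Suc (Suc n) * exp (- (v / 16 + \<bar>t\<bar>) / s)"
proof -
  have sub: "(\<integral>l. exp (\<i> * of_real (t * l)) * (F (complex_of_real (s * l)) / of_real c) \<partial>lborel)
      = (\<integral>l. exp (\<i> * of_real (t / s * l)) * F (of_real l) \<partial>lborel) / of_real (c * s)" for F c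
  proof -
    have "(\<integral>l. exp (\<i> * of_real (t * l)) * (F (complex_of_real (s * l)) / of_real c) \<partial>lborel)
       = \<bar>1 / s\<bar> *\<^sub>R (\<integral>l. exp (\<i> * of_real (t * (0 + 1 / s * l))) * (F (complex_of_real (s * (0 + 1 / s * l))) / of_real c) \<partial>lborel)"
      using s by (intro lborel_integral_real_affine) auto
    also have "\<dots> = (\<integral>l. exp (\<i> * of_real (t / s * l)) * F (of_real l) / of_real c \<partial>lborel) / of_real s"
      using s by (simp add: scaleR_conv_of_real)
    finally show ?thesis by simp
  qed
  have vs: "v / s \<ge> 0" using v s by simp
  have eq: "hC n * exp (- (v / s) / 16) * exp (- \<bar>t / s\<bar>) = hC n * exp (- (v / 16 + \<bar>t\<bar>) / s)"
  proof -
    have "- (v / s) / 16 + - \<bar>t / s\<bar> = - (v / 16 + \<bar>t\<bar>) / s"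
      using s by (simp add: abs_divide add_divide_distrib diff_divide_distrib)
    then show ?thesis by (simp only: mult.assoc exp_add[symmetric])
  qed
  have meas: "(\<lambda>x. hF n (v / s) (of_real x)) \<in> borel_measurable borel" "(\<lambda>x. hF' n (v / s) (of_real x)) \<in> borel_measurable borel"
  proof -
    have "(\<lambda>x. hF n (v / s) (of_real x)) = (\<lambda>x. complex_of_real (mP n 1 (v / s) x))"
      "(\<lambda>x. hF' n (v / s) (of_real x)) = (\<lambda>x. complex_of_real (mP' n 1 (v / s) x))"
      using mP_scale[of 1 n "v / s"] by (simp_all add: fun_eq_iff)
    then show "(\<lambda>x. hF n (v / s) (of_real x)) \<in> borel_measurable borel" "(\<lambda>x. hF' n (v / s) (of_real x)) \<in> borel_measurable borel"
      by simp_all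
  qed
  have ev: "hF n (v / s) (of_real (- x)) = hF n (v / s) (of_real x)" "hF' n (v / s) (of_real (- x)) = hF' n (v / s) (of_real x)" for x
    by (simp_all add: hF_def hF'_def ha_def hb_def)
  have "norm (\<integral>l. exp (\<i> * of_real (t / s * l)) * hF n (v / s) (of_real l) \<partial>lborel)
      \<le> hC n * exp (- (v / s) / 16) * exp (- \<bar>t / s\<bar>) * (\<integral>x. exp (- \<bar>x\<bar> / 4) \<partial>lborel)"
    using hF_bound[OF _ _ vs n] by (intro fourier_decay_of_strip holomorphic_hF isCont_hF meas ev) auto
  then have "norm (\<integral>l. exp (\<i> * of_real (t / s * l)) * hF n (v / s) (of_real l) \<partial>lborel)
      \<le> hK n * exp (- (v / 16 + \<bar>t\<bar>) / s)" unfolding eq by (simp add: hK_def mult_ac)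
  then have "norm (\<integral>l. exp (\<i> * of_real (t / s * l)) * hF n (v / s) (of_real l) \<partial>lborel) / s ^ Suc n
      \<le> hK n * exp (- (v / 16 + \<bar>t\<bar>) / s) / s ^ Suc n" using s by (intro divide_right_mono) auto
  then show "norm (hk n s v t) \<le> hK n / s ^ Suc n * exp (- (v / 16 + \<bar>t\<bar>) / s)"
    unfolding hk_def mP_scale[OF s] sub using s by (simp add: norm_divide norm_mult norm_power mult_ac)
  have "norm (\<integral>l. exp (\<i> * of_real (t / s * l)) * hF' n (v / s) (of_real l) \<partial>lborel)
      \<le> hC n * exp (- (v / s) / 16) * exp (- \<bar>t / s\<bar>) * (\<integral>x. exp (- \<bar>x\<bar> / 4) \<partial>lborel)"
    using hF'_bound[OF _ _ vs n] by (intro fourier_decay_of_strip holomorphic_hF isCont_hF meas ev) auto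
  then have "norm (\<integral>l. exp (\<i> * of_real (t / s * l)) * hF' n (v / s) (of_real l) \<partial>lborel)
      \<le> hK n * exp (- (v / 16 + \<bar>t\<bar>) / s)" unfolding eq by (simp add: hK_def mult_ac)
  then have "norm (\<integral>l. exp (\<i> * of_real (t / s * l)) * hF' n (v / s) (of_real l) \<partial>lborel) / s ^ Suc (Suc n)
      \<le> hK n * exp (- (v / 16 + \<bar>t\<bar>) / s) / s ^ Suc (Suc n)" using s by (intro divide_right_mono) auto
  then show "norm (hk' n s v t) \<le> hK n / s ^ Suc (Suc n) * exp (- (v / 16 + \<bar>t\<bar>) / s)"
    unfolding hk'_def mP_scale[OF s] sub using s by (simp add: norm_divide norm_mult norm_power mult_ac)
qed

lemma hK_nonneg: "hK n \<ge> 0"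
  unfolding hK_def hC_def by simp

lemma hk_measurable [measurable]:
  assumes [measurable]: "f \<in> borel_measurable M" "g \<in> borel_measurable M"
  shows "(\<lambda>x. hk n s (f x) (g x)) \<in> borel_measurable M" "(\<lambda>x. hk' n s (f x) (g x)) \<in> borel_measurable M"
  unfolding hk_def hk'_def by measurable

lemma mP_integrable:
  assumes "s > 0" "v \<ge> 0" "n \<ge> 1"
  shows "integrable lborel (\<lambda>l. exp (\<i> * of_real (t * l)) * complex_of_real (mP n s v l))"
    and "integrable lborel (\<lambda>l. exp (\<i> * of_real (t * l)) * complex_of_real (mP' n s v l))"
proof -
  have i: "integrable lborel (\<lambda>l::real. c * exp (- s * \<bar>l\<bar> / 4))" for c
    using integrable_exp_norm[of "s / 4", where 'a = real] assms by simp
  show "integrable lborel (\<lambda>l. exp (\<i> * of_real (t * l)) * complex_of_real (mP n s v l))"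
  proof (rule Bochner_Integration.integrable_bound[OF i[of "hC n / s ^ n * exp (- (v / s) / 16)"]])
    show "AE l in lborel. norm (exp (\<i> * of_real (t * l)) * complex_of_real (mP n s v l))
        \<le> norm (hC n / s ^ n * exp (- (v / s) / 16) * exp (- s * \<bar>l\<bar> / 4))"
    proof (rule AE_I2)
      fix l
      have "norm (exp (\<i> * of_real (t * l)) * complex_of_real (mP n s v l)) = \<bar>mP n s v l\<bar>"
        by (simp add: norm_mult)
      also have "\<dots> \<le> hC n / s ^ n * exp (- (v / s) / 16) * exp (- s * \<bar>l\<bar> / 4)"
        by (rule mP_bound[OF assms])
      also have "\<dots> \<le> norm \<dots>" by (simp only: real_norm_def abs_ge_self)
      finally show "norm (exp (\<i> * of_real (t * l)) * complex_of_real (mP n s v l))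
        \<le> norm (hC n / s ^ n * exp (- (v / s) / 16) * exp (- s * \<bar>l\<bar> / 4))" .
    qed
  qed simp
  show "integrable lborel (\<lambda>l. exp (\<i> * of_real (t * l)) * complex_of_real (mP' n s v l))"
  proof (rule Bochner_Integration.integrable_bound[OF i[of "hC n / s ^ Suc n * exp (- (v / s) / 16)"]])
    show "AE l in lborel. norm (exp (\<i> * of_real (t * l)) * complex_of_real (mP' n s v l))
        \<le> norm (hC n / s ^ Suc n * exp (- (v / s) / 16) * exp (- s * \<bar>l\<bar> / 4))"
    proof (rule AE_I2)
      fix l
      have "norm (exp (\<i> * of_real (t * l)) * complex_of_real (mP' n s v l)) = \<bar>mP' n s v l\<bar>"
        by (simp add: norm_mult)
      also have "\<dots> \<le> hC n / s ^ Suc n * exp (- (v / s) / 16) * exp (- s * \<bar>l\<bar> / 4)"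
        by (rule mP_bound[OF assms])
      also have "\<dots> \<le> norm \<dots>" by (simp only: real_norm_def abs_ge_self)
      finally show "norm (exp (\<i> * of_real (t * l)) * complex_of_real (mP' n s v l))
        \<le> norm (hC n / s ^ Suc n * exp (- (v / s) / 16) * exp (- s * \<bar>l\<bar> / 4))" .
    qed
  qed simp
qed

lemma hk_deriv:
  assumes s: "s > 0" and v: "v \<ge> 0" and n: "n \<ge> 1"
  shows "((\<lambda>s. hk n s v t) has_vector_derivative - hk' n s v t) (at s)"
proof -
  let ?e = "\<lambda>l. exp (\<i> * complex_of_real (t * l))"
  \<comment> \<open>The bound on \<open>mP'\<close> at the smallest time \<open>s / 2\<close> of the
    interval used below, with the factor in \<open>v\<close> estimated by 1.\<close>
  let ?B = "\<lambda>l. hC n / (s / 2) ^ Suc n * exp (- (s / 8) * norm (l::real))"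
  have "((\<lambda>s. \<integral>l. ?e l * of_real (mP n s v l) \<partial>lborel) has_derivative
      (\<lambda>h. \<integral>l. ?e l * of_real (- h * mP' n s v l) \<partial>lborel)) (at s)"
  proof (rule has_derivative_integral[where U = "{s / 2<..<2 * s}" and B = ?B
        and f' = "\<lambda>s l h. ?e l * of_real (- h * mP' n s v l)"])
    fix p assume p: "p \<in> {s / 2<..<2 * s}"
    then have p0: "p > 0" using s by auto
    show "integrable lborel (\<lambda>l. ?e l * of_real (mP n p v l))" by (rule mP_integrable[OF p0 v n])
    fix l :: real
    have "((\<lambda>s. mP n s v l) has_derivative (\<lambda>h. - h * mP' n p v l)) (at p)"
    proof -
      have "(\<lambda>h. - h * mP' n p v l) = (*) (- mP' n p v l)" by (simp add: fun_eq_iff)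
      then show ?thesis using mP_deriv[OF p0 n, of v l] by (simp only: has_field_derivative_def)
    qed
    then show "((\<lambda>s. ?e l * of_real (mP n s v l)) has_derivative (\<lambda>h. ?e l * of_real (- h * mP' n p v l))) (at p)"
      by (intro has_derivative_mult_right has_derivative_of_real)
    fix h :: real
    have "\<bar>mP' n p v l\<bar> \<le> hC n / p ^ Suc n * exp (- (v / p) / 16) * exp (- p * \<bar>l\<bar> / 4)"
      by (rule mP_bound(2)[OF p0 v n])
    also have "\<dots> \<le> hC n / (s / 2) ^ Suc n * 1 * exp (- (s / 8) * \<bar>l\<bar>)"
    proof (intro mult_mono divide_left_mono power_mono)
      have "s / 8 * \<bar>l\<bar> \<le> p / 4 * \<bar>l\<bar>" using p by (intro mult_right_mono) auto
      then show "exp (- p * \<bar>l\<bar> / 4) \<le> exp (- (s / 8) * \<bar>l\<bar>)" by simp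
    qed (use p p0 s v in \<open>auto simp: hC_def\<close>)
    finally have "\<bar>h\<bar> * \<bar>mP' n p v l\<bar> \<le> \<bar>h\<bar> * ?B l" by (intro mult_left_mono) auto
    then show "norm (?e l * of_real (- h * mP' n p v l)) \<le> ?B l * norm h"
      by (simp add: norm_mult abs_mult mult.commute)
  next
    show "integrable lborel ?B" using integrable_exp_norm[of "s / 8", where 'a = real] s by simp
  qed (use s in auto)
  also have "(\<lambda>h. \<integral>l. ?e l * of_real (- h * mP' n s v l) \<partial>lborel) = (\<lambda>h. h *\<^sub>R - hk' n s v t)"
    by (simp add: hk'_def fun_eq_iff scaleR_conv_of_real mult.left_commute[of _ "of_real h" for h] minus_mult_right[symmetric])
  finally show ?thesis by (simp add: has_vector_derivative_def hk_def)
qed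

text \<open>At the origin the integrand is \<open>(l / sinh l)^n\<close>, positive apart from the
  default value 0 at \<open>l = 0\<close>, a null set. Continuity later extends this positivity to a
  neighbourhood.\<close>

lemma hk_origin_pos:
  assumes n: "n \<ge> 1" shows "Re (hk n 1 0 0) > 0"
proof -
  have i: "integrable lborel (mP n 1 0)"
    using integrable_Re[OF mP_integrable(1)[of 1 0 n 0]] n by simp
  have pos: "mP n 1 0 l > 0" if "l \<noteq> 0" for l
  proof -
    have "l / sinh l > 0" using that by (cases "l > 0") (auto simp: zero_less_divide_iff)
    then show ?thesis by (simp add: mP_def mA_def)
  qed
  then have nn: "mP n 1 0 l \<ge> 0" for l
    using n by (cases "l = 0") (auto simp: mP_def mA_def less_imp_le)
  have "(\<integral>l. mP n 1 0 l \<partial>lborel) \<noteq> 0"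
  proof
    assume "(\<integral>l. mP n 1 0 l \<partial>lborel) = 0"
    then have "AE l in lborel. mP n 1 0 l = 0" using integral_nonneg_eq_0_iff_AE[OF i] nn by auto
    moreover have "AE l in lborel. l \<noteq> (0::real)" by (rule AE_lborel_singleton)
    ultimately have "eventually (\<lambda>l. False) (ae_filter (lborel :: real measure))"
      by (rule eventually_elim2) (use pos in force)
    then have "emeasure lborel (UNIV :: real set) = 0"
      by (simp add: eventually_False ae_filter_eq_bot_iff)
    then show False by simp
  qed
  moreover have "(\<integral>l. mP n 1 0 l \<partial>lborel) \<ge> 0" using nn by simp
  moreover have "hk n 1 0 0 = of_real (\<integral>l. mP n 1 0 l \<partial>lborel)" by (simp add: hk_def)
  ultimately show ?thesis by simp
qed

lemma hk_continuous_origin: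
  assumes n: "n \<ge> 1" and V: "V \<longlonglongrightarrow> 0" "\<And>i. V i \<ge> 0" and T: "T \<longlonglongrightarrow> 0"
  shows "(\<lambda>i. hk n 1 (V i) (T i)) \<longlonglongrightarrow> hk n 1 0 0"
  unfolding hk_def
proof (rule integral_dominated_convergence[where w = "\<lambda>l. hC n * exp (- (1/4) * norm (l::real))"])
  show "integrable lborel (\<lambda>l. hC n * exp (- (1/4) * norm (l::real)))"
    using integrable_exp_norm[of "1/4", where 'a = real] by simp
  show "AE l in lborel. norm (exp (\<i> * of_real (T i * l)) * complex_of_real (mP n 1 (V i) l)) \<le> hC n * exp (- (1/4) * norm l)" for i
  proof (rule AE_I2)
    fix l
    have "\<bar>mP n 1 (V i) l\<bar> \<le> hC n / 1 ^ n * exp (- (V i / 1) / 16) * exp (- 1 * \<bar>l\<bar> / 4)"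
      using V n by (intro mP_bound) auto
    also have "\<dots> \<le> hC n / 1 ^ n * 1 * exp (- 1 * \<bar>l\<bar> / 4)"
      using V(2)[of i] by (intro mult_right_mono mult_left_mono) (auto simp: hC_def)
    finally show "norm (exp (\<i> * of_real (T i * l)) * complex_of_real (mP n 1 (V i) l)) \<le> hC n * exp (- (1/4) * norm l)"
      by (simp add: norm_mult)
  qed
  show "AE l in lborel. (\<lambda>i. exp (\<i> * of_real (T i * l)) * complex_of_real (mP n 1 (V i) l))
      \<longlonglongrightarrow> exp (\<i> * of_real (0 * l)) * complex_of_real (mP n 1 0 l)"
    unfolding mP_def by (intro AE_I2 tendsto_intros V T)
qed auto

subsection \<open>Functions with continuous partial derivatives\<close>

lemma frechet_works:
  "f differentiable (at x) \<Longrightarrow> (f has_derivative (\<lambda>b. partial_deriv b f x)) (at x)"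
  unfolding partial_deriv_def by (subst (asm) frechet_derivative_works) simp

lemma partial_deriv_eq: "(f has_derivative f') (at x) \<Longrightarrow> partial_deriv b f x = f' b"
  unfolding partial_deriv_def by (metis frechet_derivative_at)

lemma partial_deriv_linear:
  assumes "f differentiable (at x)"
  shows "partial_deriv (a + b) f x = partial_deriv a f x + partial_deriv b f x"
    and "partial_deriv (r *\<^sub>R a) f x = r *\<^sub>R partial_deriv a f x"
  using has_derivative_linear[OF frechet_works[OF assms]] by (auto simp: linear_iff)

lemma partial_deriv_mult:
  assumes "f differentiable (at x)" "g differentiable (at x)"
  shows "partial_deriv b (\<lambda>x. f x * g x) x = partial_deriv b f x * g x + f x * partial_deriv b g x"
  by (rule trans[OF partial_deriv_eq[OF has_derivative_mult[OF assms[THEN frechet_works]]]]) simp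

lemma partial_deriv_add:
  assumes "f differentiable (at x)" "g differentiable (at x)"
  shows "partial_deriv b (\<lambda>x. f x + g x) x = partial_deriv b f x + partial_deriv b g x"
  by (rule partial_deriv_eq[OF has_derivative_add[OF assms[THEN frechet_works]]])

lemma partial_deriv_cnj:
  assumes "f differentiable (at x)"
  shows "partial_deriv b (\<lambda>x. cnj (f x)) x = cnj (partial_deriv b f x)"
  by (rule partial_deriv_eq[OF has_derivative_cnj[OF frechet_works[OF assms]]])

lemma partial_deriv_const: "partial_deriv b (\<lambda>x. c) x = 0"
  by (rule trans[OF partial_deriv_eq[OF has_derivative_const]]) simp

text \<open>The recursion over coordinate derivatives makes the closure properties plain inductions
  on the order. Differentiability is demanded at each positive level, so that derivatives along the
  left invariant fields are combinations of coordinate derivatives.\<close>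

primrec Ck :: "nat \<Rightarrow> ('a::euclidean_space \<Rightarrow> complex) \<Rightarrow> bool" where
  "Ck 0 f \<longleftrightarrow> continuous_on UNIV f"
| "Ck (Suc n) f \<longleftrightarrow> (\<forall>x. f differentiable (at x)) \<and> (\<forall>b\<in>Basis. Ck n (partial_deriv b f))"

lemma Ck_SucD: "Ck (Suc n) f \<Longrightarrow> Ck n f"
proof (induction n arbitrary: f)
  case 0
  then show ?case by (auto intro!: continuous_at_imp_continuous_on differentiable_imp_continuous_within)
qed auto

lemma Ck_mono:
  assumes "Ck n f" "m \<le> n" shows "Ck m f"
  using assms(2,1) by (induction n rule: dec_induct) (auto dest: Ck_SucD simp del: Ck.simps)

lemma Ck_continuous: "Ck n f \<Longrightarrow> continuous_on UNIV f"
  using Ck_mono[of n f 0] by simp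

lemma Ck_differentiable: "Ck n f \<Longrightarrow> n \<ge> 1 \<Longrightarrow> f differentiable (at x)"
  by (cases n) auto

lemma Ck_measurable: "Ck n f \<Longrightarrow> f \<in> borel_measurable borel"
  by (rule borel_measurable_continuous_onI[OF Ck_continuous])

lemma Ck_const: "Ck n (\<lambda>x. c)"
proof (induction n arbitrary: c)
  case (Suc n)
  have "partial_deriv b (\<lambda>x::'a. c) = (\<lambda>x. 0)" for b by (simp add: fun_eq_iff partial_deriv_const)
  then show ?case using Suc by simp
qed simp

lemma Ck_add: "Ck n f \<Longrightarrow> Ck n g \<Longrightarrow> Ck n (\<lambda>x. f x + g x)"
proof (induction n arbitrary: f g)
  case (Suc n)
  then have "partial_deriv b (\<lambda>x. f x + g x) = (\<lambda>x. partial_deriv b f x + partial_deriv b g x)" for b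
    by (simp add: fun_eq_iff partial_deriv_add)
  then show ?case using Suc by simp
qed (auto intro: continuous_intros)

lemma Ck_mult: "Ck n f \<Longrightarrow> Ck n g \<Longrightarrow> Ck n (\<lambda>x. f x * g x)"
proof (induction n arbitrary: f g)
  case (Suc n)
  then have "partial_deriv b (\<lambda>x. f x * g x) = (\<lambda>x. partial_deriv b f x * g x + f x * partial_deriv b g x)" for b
    by (simp add: fun_eq_iff partial_deriv_mult)
  then show ?case using Suc Ck_SucD[OF Suc.prems(1)] Ck_SucD[OF Suc.prems(2)] by (simp add: Ck_add)
qed (auto intro: continuous_intros)

lemma Ck_cnj: "Ck n f \<Longrightarrow> Ck n (\<lambda>x. cnj (f x))"
proof (induction n arbitrary: f)
  case (Suc n)
  then have "partial_deriv b (\<lambda>x. cnj (f x)) = (\<lambda>x. cnj (partial_deriv b f x))" for b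
    by (simp add: fun_eq_iff partial_deriv_cnj)
  then show ?case using Suc by (simp add: differentiable_cnj_iff)
qed (auto intro: continuous_intros)

lemma Ck_uminus: "Ck n f \<Longrightarrow> Ck n (\<lambda>x. - f x)"
  using Ck_mult[OF Ck_const[of n "- 1"]] by fastforce

lemma Ck_sum: "(\<And>i. i \<in> A \<Longrightarrow> Ck n (f i)) \<Longrightarrow> Ck n (\<lambda>x. \<Sum>i\<in>A. f i x)"
  by (induction A rule: infinite_finite_induct) (auto simp: Ck_const Ck_add)

lemma Ck_linear:
  assumes "bounded_linear l"
  shows "Ck n (\<lambda>x. complex_of_real (l x))"
proof (cases n)
  case 0
  then show ?thesis using bounded_linear.continuous_on[OF assms continuous_on_id]
    by (auto intro!: continuous_intros)
next
  case (Suc m)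
  have d: "((\<lambda>x. complex_of_real (l x)) has_derivative (\<lambda>h. of_real (l h))) (at x)" for x
    using assms by (intro has_derivative_of_real bounded_linear_imp_has_derivative)
  then have "partial_deriv b (\<lambda>x. complex_of_real (l x)) = (\<lambda>x. of_real (l b))" for b
    by (simp add: fun_eq_iff partial_deriv_eq[OF d])
  then show ?thesis using d Suc by (auto simp: Ck_const differentiable_def)
qed

lemma smooth_Ck:
  assumes "smooth f" shows "Ck n f"
proof -
  have "Ck n (iter_partial bs f)" if "bs \<in> lists Basis" for bs
    using that
  proof (induction n arbitrary: bs)
    case 0
    then show ?case using assms
      by (auto simp: smooth_def intro!: continuous_at_imp_continuous_on differentiable_imp_continuous_within)
  next
    case (Suc n)
    have "Ck n (partial_deriv b (iter_partial bs f))" if "b \<in> Basis" for b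
      using Suc.IH[of "b # bs"] Suc.prems that by simp
    then show ?case using assms Suc.prems by (simp add: smooth_def)
  qed
  from this[of "[]"] show ?thesis by simp
qed

text \<open>All coordinate derivatives of order strictly below \<open>n\<close> vanish, so that
  \<open>taylor_vanishing\<close> gives the power \<open>n\<close> with the same
  \<open>n\<close>.\<close>

primrec vanishing :: "nat \<Rightarrow> 'a::euclidean_space \<Rightarrow> ('a \<Rightarrow> complex) \<Rightarrow> bool" where
  "vanishing 0 x f \<longleftrightarrow> True"
| "vanishing (Suc n) x f \<longleftrightarrow> f x = 0 \<and> (\<forall>b\<in>Basis. vanishing n x (partial_deriv b f))"

lemma vanishing_SucD: "vanishing (Suc n) x f \<Longrightarrow> vanishing n x f"
  by (induction n arbitrary: f) auto

lemma vanishing_infinite_order: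
  assumes "vanishes_to_infinite_order_at f x" shows "vanishing n x f"
proof -
  have "vanishing n x (iter_partial bs f)" if "bs \<in> lists Basis" for bs
    using that
  proof (induction n arbitrary: bs)
    case (Suc n)
    have "vanishing n x (partial_deriv b (iter_partial bs f))" if "b \<in> Basis" for b
      using Suc.IH[of "b # bs"] Suc.prems that by simp
    then show ?case using assms Suc.prems by (simp add: vanishes_to_infinite_order_at_def)
  qed simp
  from this[of "[]"] show ?thesis by simp
qed

lemma vanishing_zero: "vanishing n x (\<lambda>x. 0)"
proof (induction n)
  case (Suc n)
  have "partial_deriv b (\<lambda>x::'a. 0) = (\<lambda>x. 0)" for b by (simp add: fun_eq_iff partial_deriv_const)
  then show ?case using Suc by simp
qed simp

lemma vanishing_add:
  "Ck n f \<Longrightarrow> Ck n g \<Longrightarrow> vanishing n x f \<Longrightarrow> vanishing n x g \<Longrightarrow> vanishing n x (\<lambda>x. f x + g x)"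
proof (induction n arbitrary: f g)
  case (Suc n)
  then have "partial_deriv b (\<lambda>x. f x + g x) = (\<lambda>x. partial_deriv b f x + partial_deriv b g x)" for b
    by (simp add: fun_eq_iff partial_deriv_add)
  then show ?case using Suc by simp
qed simp

lemma vanishing_mult:
  "Ck n f \<Longrightarrow> Ck n g \<Longrightarrow> vanishing n x g \<Longrightarrow> vanishing n x (\<lambda>x. f x * g x)"
proof (induction n arbitrary: f g)
  case (Suc n)
  then have eq: "partial_deriv b (\<lambda>x. f x * g x) = (\<lambda>x. partial_deriv b f x * g x + f x * partial_deriv b g x)" for b
    by (simp add: fun_eq_iff partial_deriv_mult)
  have "Ck n f" "Ck n g" "vanishing n x g" using Suc.prems Ck_SucD vanishing_SucD by blast+
  then have "vanishing n x (\<lambda>x. partial_deriv b f x * g x + f x * partial_deriv b g x)" if "b \<in> Basis" for b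
    using Suc that by (intro vanishing_add Ck_mult Suc.IH) auto
  then show ?case using Suc.prems by (simp add: eq)
qed simp

lemma vanishing_uminus: "Ck n f \<Longrightarrow> vanishing n x f \<Longrightarrow> vanishing n x (\<lambda>x. - f x)"
  using vanishing_mult[OF Ck_const[of n "- 1"]] by fastforce

lemma vanishing_sum:
  "(\<And>i. i \<in> A \<Longrightarrow> Ck n (f i)) \<Longrightarrow> (\<And>i. i \<in> A \<Longrightarrow> vanishing n x (f i)) \<Longrightarrow> vanishing n x (\<lambda>x. \<Sum>i\<in>A. f i x)"
  by (induction A rule: infinite_finite_induct) (auto simp: vanishing_zero Ck_sum intro!: vanishing_add)

lemma norm_partial_deriv_le:
  fixes f :: "'a::euclidean_space \<Rightarrow> complex"
  assumes "f differentiable (at x)"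
  shows "norm (partial_deriv h f x) \<le> (\<Sum>b\<in>Basis. norm (partial_deriv b f x)) * norm h"
proof -
  have lin: "linear (\<lambda>b. partial_deriv b f x)" by (rule has_derivative_linear[OF frechet_works[OF assms]])
  have "partial_deriv h f x = partial_deriv (\<Sum>b\<in>Basis. (h \<bullet> b) *\<^sub>R b) f x" by (simp add: euclidean_representation)
  also have "\<dots> = (\<Sum>b\<in>Basis. (h \<bullet> b) *\<^sub>R partial_deriv b f x)"
    by (simp add: linear_sum[OF lin] linear_cmul[OF lin])
  also have "norm \<dots> \<le> (\<Sum>b\<in>Basis. norm (partial_deriv b f x) * norm h)"
  proof (rule sum_norm_le)
    fix b :: 'a assume "b \<in> Basis"
    then have "\<bar>h \<bullet> b\<bar> * norm (partial_deriv b f x) \<le> norm h * norm (partial_deriv b f x)"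
      by (intro mult_right_mono Basis_le_norm) auto
    then show "norm ((h \<bullet> b) *\<^sub>R partial_deriv b f x) \<le> norm (partial_deriv b f x) * norm h"
      by (simp add: mult.commute)
  qed
  finally show ?thesis by (simp add: sum_distrib_right)
qed

lemma bounded_image_cball:
  fixes f :: "'a::euclidean_space \<Rightarrow> 'b::real_normed_vector"
  assumes "continuous_on UNIV f" shows "bounded (f ` cball x R)"
  using continuous_on_subset[OF assms subset_UNIV]
  by (intro compact_imp_bounded compact_continuous_image compact_cball)

text \<open>By induction the first derivatives are bounded by a multiple of
  \<open>norm x ^ n\<close> on the ball of radius \<open>norm x\<close>, and the mean value
  inequality between 0 and \<open>x\<close> gains one more power.\<close>

lemma taylor_vanishing:
  fixes f :: "'a::euclidean_space \<Rightarrow> complex"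
  assumes "Ck n f" "vanishing n 0 f"
  shows "\<exists>C\<ge>0. \<forall>x. norm x \<le> R \<longrightarrow> norm (f x) \<le> C * norm x ^ n"
  using assms
proof (induction n arbitrary: f)
  case 0
  then have "bounded (f ` cball 0 R)" by (simp add: bounded_image_cball)
  then obtain C where "C > 0" "\<forall>x\<in>cball 0 R. norm (f x) \<le> C" by (auto simp: bounded_pos)
  then show ?case by (intro exI[of _ C]) auto
next
  case (Suc n)
  have "\<forall>b\<in>Basis. \<exists>C\<ge>0. \<forall>x. norm x \<le> R \<longrightarrow> norm (partial_deriv b f x) \<le> C * norm x ^ n"
    using Suc by auto
  then obtain C where C: "\<And>b. b \<in> Basis \<Longrightarrow> C b \<ge> 0"
    "\<And>b x. b \<in> Basis \<Longrightarrow> norm x \<le> R \<Longrightarrow> norm (partial_deriv b f x) \<le> C b * norm x ^ n"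
    by metis
  show ?case
  proof (intro exI[of _ "sum C Basis"] conjI allI impI)
    show "sum C Basis \<ge> 0" using C by (simp add: sum_nonneg)
    fix x :: 'a assume x: "norm x \<le> R"
    have "norm (f x - f 0) \<le> (sum C Basis * norm x ^ n) * norm (x - 0)"
    proof (rule differentiable_bound[of "cball 0 (norm x)"])
      fix y :: 'a assume y: "y \<in> cball 0 (norm x)"
      have d: "f differentiable (at y)" using Suc.prems by simp
      show "(f has_derivative (\<lambda>h. partial_deriv h f y)) (at y within cball 0 (norm x))"
        using frechet_works[OF d] by (rule has_derivative_at_withinI)
      have "(\<Sum>b\<in>Basis. norm (partial_deriv b f y)) \<le> (\<Sum>b\<in>Basis. C b * norm x ^ n)"
      proof (rule sum_mono)
        fix b :: 'a assume b: "b \<in> Basis"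
        have "norm (partial_deriv b f y) \<le> C b * norm y ^ n" using y x by (intro C(2) b) auto
        also have "\<dots> \<le> C b * norm x ^ n" using y C(1)[OF b] by (intro mult_left_mono power_mono) auto
        finally show "norm (partial_deriv b f y) \<le> C b * norm x ^ n" .
      qed
      then have "(\<Sum>b\<in>Basis. norm (partial_deriv b f y)) \<le> sum C Basis * norm x ^ n"
        by (simp add: sum_distrib_right)
      then show "onorm (\<lambda>h. partial_deriv h f y) \<le> sum C Basis * norm x ^ n"
        by (intro onorm_le order_trans[OF norm_partial_deriv_le[OF d]] mult_right_mono) auto
    qed auto
    then show "norm (f x) \<le> sum C Basis * norm x ^ Suc n" using Suc.prems by (simp add: mult_ac)
  qed
qed

section \<open>Compact support and integrals of derivatives\<close>

definition csupp :: "('a::euclidean_space \<Rightarrow> complex) \<Rightarrow> bool" where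
  "csupp f \<longleftrightarrow> (\<exists>R. \<forall>x. norm x > R \<longrightarrow> f x = 0)"

lemma csupp_mult: "csupp f \<Longrightarrow> csupp (\<lambda>x. f x * g x)" "csupp f \<Longrightarrow> csupp (\<lambda>x. g x * f x)"
  unfolding csupp_def by auto

lemma csupp_partial_deriv:
  assumes "csupp f" shows "csupp (\<lambda>x. partial_deriv (b x) f x)"
proof -
  obtain R where R: "\<And>x. norm x > R \<Longrightarrow> f x = 0" using assms by (auto simp: csupp_def)
  have "partial_deriv (b x) f x = 0" if x: "norm x > R" for x
  proof -
    have "open {x::'a. norm x > R}" by (intro open_Collect_less continuous_intros)
    then have "(f has_derivative (\<lambda>h. 0)) (at x)"
      by (rule has_derivative_transform_within_open[OF has_derivative_const[of 0]]) (use x R in auto)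
    then show ?thesis by (simp add: partial_deriv_eq)
  qed
  then show ?thesis by (auto simp: csupp_def)
qed

lemma csupp_bounded:
  assumes "csupp f" "continuous_on UNIV f"
  shows "\<exists>B R. B \<ge> 0 \<and> R \<ge> 0 \<and> (\<forall>x. norm (f x) \<le> B * indicator (cball 0 R) x)"
proof -
  obtain R where R: "\<And>x. norm x > R \<Longrightarrow> f x = 0" using assms by (auto simp: csupp_def)
  have "bounded (f ` cball 0 R)"
    by (rule bounded_image_cball[OF assms(2)])
  then obtain B where B: "B > 0" "\<And>x. norm x \<le> R \<Longrightarrow> norm (f x) \<le> B" by (auto simp: bounded_pos)
  show ?thesis
  proof (intro exI conjI allI)
    fix x show "norm (f x) \<le> B * indicator (cball 0 (max 0 R)) x"
      using B(1) B(2)[of x] R[of x] by (cases "norm x \<le> R") (auto simp: indicator_def)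
  qed (use B in auto)
qed

lemma integrable_indicator_cball: "integrable lborel (\<lambda>x::'a::euclidean_space. B * indicator (cball 0 R) x :: real)"
  by (intro integrable_mult_right integrable_real_indicator emeasure_bounded_finite) auto

lemma csupp_integrable:
  assumes "csupp f" "continuous_on UNIV f" shows "integrable lborel f"
proof -
  obtain B R where B: "B \<ge> 0" "\<And>x. norm (f x) \<le> B * indicator (cball 0 R) x"
    using csupp_bounded[OF assms] by blast
  show ?thesis
    by (rule Bochner_Integration.integrable_bound[OF integrable_indicator_cball[of B R]])
       (use B borel_measurable_continuous_onI[OF assms(2)] in \<open>auto simp: abs_mult\<close>)
qed

lemma has_vector_derivative_quotient:
  assumes "(F has_vector_derivative D) (at 0)"
  shows "((\<lambda>r. (F r - F 0) /\<^sub>R r) \<longlongrightarrow> D) (at 0)"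
proof -
  have "((\<lambda>r. norm (F r - F 0 - r *\<^sub>R D) / norm r) \<longlongrightarrow> 0) (at 0)"
    using assms by (simp add: has_vector_derivative_def has_derivative_iff_norm)
  moreover have "\<forall>\<^sub>F r in at 0. norm (F r - F 0 - r *\<^sub>R D) / norm r = norm ((F r - F 0) /\<^sub>R r - D)"
  proof -
    have "norm (F r - F 0 - r *\<^sub>R D) / norm r = norm ((F r - F 0) /\<^sub>R r - D)" if "r \<noteq> 0" for r
    proof -
      have "(F r - F 0) /\<^sub>R r - D = (F r - F 0 - r *\<^sub>R D) /\<^sub>R r" using that by (simp add: scaleR_diff_right)
      then show ?thesis by (simp add: divide_inverse mult.commute)
    qed
    then show ?thesis by (auto simp: eventually_at_filter)
  qed
  ultimately have "((\<lambda>r. norm ((F r - F 0) /\<^sub>R r - D)) \<longlongrightarrow> 0) (at 0)" by (rule Lim_transform_eventually)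
  then show ?thesis by (simp add: tendsto_norm_zero_iff LIM_zero_iff)
qed

text \<open>By translation invariance of Lebesgue measure every difference quotient of
  \<open>u\<close> has integral 0. The quotients are bounded by a Lipschitz constant and live in a
  fixed ball, so they converge dominatedly to the derivative.\<close>

lemma integral_partial_deriv_csupp:
  fixes u :: "'a::euclidean_space \<Rightarrow> complex"
  assumes "Ck 1 u" "csupp u"
  shows "(\<integral>x. partial_deriv b u x \<partial>lborel) = 0"
proof -
  have d: "u differentiable (at x)" for x using assms by simp
  have cp: "continuous_on UNIV (\<lambda>x. \<Sum>c\<in>Basis. norm (partial_deriv c u x))"
    using assms by (auto intro!: continuous_intros)
  have cb: "continuous_on UNIV (partial_deriv b u)"
  proof -
    have "partial_deriv b u = (\<lambda>x. \<Sum>c\<in>Basis. (b \<bullet> c) *\<^sub>R partial_deriv c u x)"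
    proof
      fix x
      have lin: "linear (\<lambda>b. partial_deriv b u x)" by (rule has_derivative_linear[OF frechet_works[OF d]])
      have "partial_deriv b u x = partial_deriv (\<Sum>c\<in>Basis. (b \<bullet> c) *\<^sub>R c) u x" by (simp add: euclidean_representation)
      then show "partial_deriv b u x = (\<Sum>c\<in>Basis. (b \<bullet> c) *\<^sub>R partial_deriv c u x)"
        by (simp add: linear_sum[OF lin] linear_cmul[OF lin])
    qed
    then show ?thesis using assms by (auto intro!: continuous_intros)
  qed
  obtain R where R: "\<And>x. norm x > R \<Longrightarrow> u x = 0" using assms by (auto simp: csupp_def)
  \<comment> \<open>Points of the ball of radius \<open>R + norm b\<close> moved by at most
    \<open>norm b\<close> stay in this larger ball, on which the Lipschitz constant \<open>L\<close>
    is taken.\<close>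
  have "bounded ((\<lambda>x. \<Sum>c\<in>Basis. norm (partial_deriv c u x)) ` cball 0 (R + 2 * norm b))"
    by (rule bounded_image_cball[OF cp])
  then obtain L where L: "\<And>x. norm x \<le> R + 2 * norm b \<Longrightarrow> (\<Sum>c\<in>Basis. norm (partial_deriv c u x)) \<le> L"
  proof -
    from \<open>bounded _\<close> obtain L where "\<forall>x\<in>cball 0 (R + 2 * norm b). norm (\<Sum>c\<in>Basis. norm (partial_deriv c u x)) \<le> L"
      unfolding bounded_iff by auto
    then show ?thesis by (intro that[of L]) (auto simp: abs_le_iff)
  qed
  have ui: "integrable lborel u" by (rule csupp_integrable[OF assms(2) Ck_continuous[OF assms(1)]])
  define h where "h i = inverse (real (Suc i))" for i
  have h: "0 < h i" "h i \<le> 1" for i by (auto simp: h_def field_simps)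
  have hlim: "filterlim h (at 0) sequentially"
  proof -
    have "h \<longlonglongrightarrow> 0" unfolding h_def by (rule LIMSEQ_inverse_real_of_nat)
    moreover have "h i \<noteq> 0" for i using h(1)[of i] by simp
    ultimately show ?thesis by (simp add: filterlim_at)
  qed
  have um: "u \<in> borel_measurable borel" using Ck_measurable[OF assms(1)] .
  have shift: "integrable lborel (\<lambda>x. u (a + x))" "(\<integral>x. u (a + x) \<partial>lborel) = (\<integral>x. u x \<partial>lborel)" for a
  proof -
    have 1: "distr lborel borel ((+) a) = lborel" by (rule lborel_distr_plus)
    show "integrable lborel (\<lambda>x. u (a + x))"
      using ui integrable_distr_eq[of "(+) a" lborel borel u] um unfolding 1 by simp
    show "(\<integral>x. u (a + x) \<partial>lborel) = (\<integral>x. u x \<partial>lborel)"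
      using integral_distr[of "(+) a" lborel borel u] um unfolding 1 by simp
  qed
  have "(\<lambda>i. \<integral>x. (u (h i *\<^sub>R b + x) - u x) /\<^sub>R h i \<partial>lborel) \<longlonglongrightarrow> (\<integral>x. partial_deriv b u x \<partial>lborel)"
  proof (rule integral_dominated_convergence[where w = "\<lambda>x. (L * norm b) * indicator (cball 0 (R + norm b)) x"])
    show "AE x in lborel. (\<lambda>i. (u (h i *\<^sub>R b + x) - u x) /\<^sub>R h i) \<longlonglongrightarrow> partial_deriv b u x"
    proof (rule AE_I2)
      fix x
      have "((\<lambda>r. u (x + r *\<^sub>R b)) has_vector_derivative partial_deriv b u x) (at 0)"
      proof -
        have "((\<lambda>r. u (x + r *\<^sub>R b)) has_derivative (\<lambda>r. partial_deriv (r *\<^sub>R b) u x)) (at 0)"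
          by (rule has_derivative_compose[where f = "\<lambda>r. x + r *\<^sub>R b" and s = UNIV and x = 0, simplified])
             (auto intro!: derivative_eq_intros frechet_works d)
        then show ?thesis by (simp add: has_vector_derivative_def partial_deriv_linear[OF d])
      qed
      then have "((\<lambda>r. (u (x + r *\<^sub>R b) - u x) /\<^sub>R r) \<longlongrightarrow> partial_deriv b u x) (at 0)"
        by (rule has_vector_derivative_quotient[where F = "\<lambda>r. u (x + r *\<^sub>R b)", simplified])
      then show "(\<lambda>i. (u (h i *\<^sub>R b + x) - u x) /\<^sub>R h i) \<longlonglongrightarrow> partial_deriv b u x"
        using filterlim_compose[OF _ hlim] by (fastforce simp: add.commute)
    qed
    show "AE x in lborel. norm ((u (h i *\<^sub>R b + x) - u x) /\<^sub>R h i) \<le> (L * norm b) * indicator (cball 0 (R + norm b)) x" for i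
    proof (rule AE_I2)
      fix x
      have hb: "norm (h i *\<^sub>R b) \<le> norm b" using h[of i] by (simp add: mult_left_le_one_le)
      show "norm ((u (h i *\<^sub>R b + x) - u x) /\<^sub>R h i) \<le> (L * norm b) * indicator (cball 0 (R + norm b)) x"
      proof (cases "norm x \<le> R + norm b")
        case False
        then have n: "norm x > R + norm b" by simp
        have "norm (h i *\<^sub>R b + x) > R"
          using hb n norm_diff_ineq[of x "h i *\<^sub>R b"] unfolding add.commute[of x] by linarith
        moreover have "norm x > R" using n norm_ge_zero[of b] by linarith
        ultimately show ?thesis using R False by simp
      next
        case True
        have "norm (u (h i *\<^sub>R b + x) - u x) \<le> L * norm (h i *\<^sub>R b + x - x)"
        proof (rule differentiable_bound[of "cball 0 (R + 2 * norm b)"])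
          fix y :: 'a assume y: "y \<in> cball 0 (R + 2 * norm b)"
          show "(u has_derivative (\<lambda>h. partial_deriv h u y)) (at y within cball 0 (R + 2 * norm b))"
            using frechet_works[OF d] by (rule has_derivative_at_withinI)
          show "onorm (\<lambda>h. partial_deriv h u y) \<le> L"
            using L[of y] y
            by (intro onorm_le order_trans[OF norm_partial_deriv_le[OF d]] mult_right_mono) auto
        next
          show "h i *\<^sub>R b + x \<in> cball 0 (R + 2 * norm b)"
            using True hb norm_triangle_ineq[of "h i *\<^sub>R b" x] by simp
          show "x \<in> cball 0 (R + 2 * norm b)" using True norm_ge_zero[of b] by (simp del: norm_ge_zero)
        qed auto
        then have "norm (u (h i *\<^sub>R b + x) - u x) / h i \<le> L * (h i * norm b) / h i"
          using h[of i] by (intro divide_right_mono) auto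
        moreover have "norm ((u (h i *\<^sub>R b + x) - u x) /\<^sub>R h i) = norm (u (h i *\<^sub>R b + x) - u x) / h i"
          using h[of i] unfolding norm_scaleR by (simp add: divide_inverse mult.commute)
        ultimately show ?thesis using h[of i] True by simp
      qed
    qed
    show "partial_deriv b u \<in> borel_measurable lborel" using borel_measurable_continuous_onI[OF cb] by simp
    show "(\<lambda>x. (u (h i *\<^sub>R b + x) - u x) /\<^sub>R h i) \<in> borel_measurable lborel" for i
      using um by simp
  qed (rule integrable_indicator_cball)
  moreover have "(\<integral>x. (u (h i *\<^sub>R b + x) - u x) /\<^sub>R h i \<partial>lborel) = 0" for i
    using ui shift[of "h i *\<^sub>R b"] by simp
  ultimately have "(\<lambda>i::nat. 0) \<longlonglongrightarrow> (\<integral>x. partial_deriv b u x \<partial>lborel)" by (simp only:)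
  then show ?thesis by (simp only: LIMSEQ_const_iff)
qed

lemma Ck_partial: "Ck (Suc n) f \<Longrightarrow> b \<in> Basis \<Longrightarrow> Ck n (partial_deriv b f)"
  by simp

lemma Ck_1_partial: "Ck 1 f \<Longrightarrow> b \<in> Basis \<Longrightarrow> continuous_on UNIV (partial_deriv b f)"
  by simp

lemma vanishing_partial: "vanishing (Suc n) x f \<Longrightarrow> b \<in> Basis \<Longrightarrow> vanishing n x (partial_deriv b f)"
  by simp

declare Ck.simps [simp del] vanishing.simps [simp del]

subsection \<open>The sublaplacian\<close>

declare split_paired_All [simp del] split_paired_Ex [simp del] split_paired_all [simp del]

text \<open>The sum type treats the \<open>2n\<close> fields alike: \<open>Inl j\<close> stands for
  \<open>X_j\<close> and \<open>Inr j\<close> for \<open>Y_j\<close>, and the sublaplacian becomes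
  minus a single sum of squares.\<close>

primrec heis_field :: "'n::finite + 'n \<Rightarrow> 'n heis \<Rightarrow> 'n heis" where
  "heis_field (Inl j) p = (axis j 1, Im (fst p $ j) / 2)"
| "heis_field (Inr j) p = (axis j \<i>, - Re (fst p $ j) / 2)"

definition Z :: "'n::finite + 'n \<Rightarrow> ('n heis \<Rightarrow> complex) \<Rightarrow> 'n heis \<Rightarrow> complex" where
  "Z i f p = partial_deriv (heis_field i p) f p"

primrec heis_base :: "'n::finite + 'n \<Rightarrow> 'n heis" where
  "heis_base (Inl j) = (axis j 1, 0)"
| "heis_base (Inr j) = (axis j \<i>, 0)"

primrec heis_coeff :: "'n::finite + 'n \<Rightarrow> 'n heis \<Rightarrow> real" where
  "heis_coeff (Inl j) p = Im (fst p $ j) / 2"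
| "heis_coeff (Inr j) p = - Re (fst p $ j) / 2"

lemma heis_field_eq: "heis_field i p = heis_base i + heis_coeff i p *\<^sub>R (0, 1)"
  by (cases i) auto

lemma bounded_linear_heis_coeff: "bounded_linear (heis_coeff i)"
proof -
  have "bounded_linear (\<lambda>p::'a heis. fst p $ j)" for j
    by (rule bounded_linear_compose[OF bounded_linear_vec_nth bounded_linear_fst])
  then have "bounded_linear (\<lambda>p::'a heis. Im (fst p $ j))" "bounded_linear (\<lambda>p::'a heis. Re (fst p $ j))" for j
    using bounded_linear_compose[OF bounded_linear_Im] bounded_linear_compose[OF bounded_linear_Re] by blast+
  then have "bounded_linear (\<lambda>p::'a heis. Im (fst p $ j) / 2)" "bounded_linear (\<lambda>p::'a heis. - (Re (fst p $ j)) / 2)" for j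
    using bounded_linear_compose[OF bounded_linear_divide[of 2]] bounded_linear_minus by blast+
  moreover have "heis_coeff (Inl j) = (\<lambda>p::'a heis. Im (fst p $ j) / 2)" "heis_coeff (Inr j) = (\<lambda>p::'a heis. - (Re (fst p $ j)) / 2)" for j
    by (rule ext, simp)+
  ultimately show ?thesis by (cases i) simp_all
qed

lemma heis_base_Basis: "heis_base i \<in> Basis" "(0, 1) \<in> (Basis :: 'n::finite heis set)"
  by (cases i) (auto simp: Basis_prod_def Basis_complex_def axis_in_Basis_iff)

lemma Z_eq:
  assumes "f differentiable (at p)"
  shows "Z i f p = partial_deriv (heis_base i) f p + of_real (heis_coeff i p) * partial_deriv (0, 1) f p"
  unfolding Z_def heis_field_eq using assms by (simp only: partial_deriv_linear scaleR_conv_of_real)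

lemma heis_XY_eq:
  assumes "\<And>p. f differentiable (at p)"
  shows "heis_X j f = Z (Inl j) f" "heis_Y j f = Z (Inr j) f"
  using Z_eq[OF assms] by (auto simp: fun_eq_iff heis_X_def heis_Y_def)

lemma Ck_coeff: "Ck n (\<lambda>p. of_real (heis_coeff i p))"
  by (rule Ck_linear[OF bounded_linear_heis_coeff])

lemma Ck_Z: assumes "Ck (Suc n) f" shows "Ck n (Z i f)"
proof -
  have "Z i f = (\<lambda>p. partial_deriv (heis_base i) f p + of_real (heis_coeff i p) * partial_deriv (0, 1) f p)"
    using Z_eq[OF Ck_differentiable[OF assms]] by (simp add: fun_eq_iff)
  then show ?thesis using heis_base_Basis
    by (auto intro!: Ck_add Ck_mult Ck_coeff Ck_partial[OF assms])
qed

lemma Ck_Z2: "Ck 2 f \<Longrightarrow> Ck 1 (Z i f)" and Ck_Z1: "Ck 1 f \<Longrightarrow> Ck 0 (Z i f)"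
  using Ck_Z[of 1 f] Ck_Z[of 0 f] by (simp_all add: numeral_2_eq_2)

lemma Ck_21: "Ck 2 f \<Longrightarrow> Ck 1 f" by (rule Ck_mono) auto

lemma vanishing_Z:
  assumes "Ck (Suc n) f" "vanishing (Suc n) x f" shows "vanishing n x (Z i f)"
proof -
  have "Z i f = (\<lambda>p. partial_deriv (heis_base i) f p + of_real (heis_coeff i p) * partial_deriv (0, 1) f p)"
    using Z_eq[OF Ck_differentiable[OF assms(1)]] by (simp add: fun_eq_iff)
  then show ?thesis using heis_base_Basis
    by (auto intro!: vanishing_add vanishing_mult Ck_mult Ck_coeff Ck_partial[OF assms(1)] vanishing_partial[OF assms(2)])
qed

lemma sublaplacian_eq:
  assumes "Ck 2 f" shows "sublaplacian f = (\<lambda>p. - (\<Sum>i\<in>UNIV. Z i (Z i f) p))"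
proof
  fix p
  have d: "\<And>p. f differentiable (at p)" "\<And>i p. Z i f differentiable (at p)"
    using Ck_differentiable[OF assms] Ck_differentiable[OF Ck_Z2[OF assms]] by auto
  show "sublaplacian f p = - (\<Sum>i\<in>UNIV. Z i (Z i f) p)"
    unfolding sublaplacian_def heis_XY_eq[OF d(1)] heis_XY_eq[OF d(2)]
    by (simp add: sum.distrib UNIV_Plus_UNIV[symmetric] sum.Plus del: UNIV_Plus_UNIV)
qed

lemma Ck_sublaplacian: assumes "Ck (Suc (Suc n)) f" shows "Ck n (sublaplacian f)"
proof -
  have "Ck 2 f" by (rule Ck_mono[OF assms]) simp
  then show ?thesis unfolding sublaplacian_eq[OF \<open>Ck 2 f\<close>]
    using assms by (intro Ck_uminus Ck_sum Ck_Z)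
qed

lemma vanishing_sublaplacian:
  assumes "Ck (Suc (Suc n)) f" "vanishing (Suc (Suc n)) x f" shows "vanishing n x (sublaplacian f)"
proof -
  have "Ck 2 f" by (rule Ck_mono[OF assms(1)]) simp
  then show ?thesis unfolding sublaplacian_eq[OF \<open>Ck 2 f\<close>]
    using assms by (intro vanishing_uminus vanishing_sum Ck_sum Ck_Z vanishing_Z)
qed

lemma funpow_sublaplacian:
  assumes "\<And>n. Ck n f"
  shows "Ck n ((sublaplacian ^^ k) f)"
    and "(\<And>n. vanishing n x f) \<Longrightarrow> vanishing n x ((sublaplacian ^^ k) f)"
proof -
  have 1: "Ck n ((sublaplacian ^^ k) f)" for n k
    by (induction k arbitrary: n) (auto simp: assms intro!: Ck_sublaplacian)
  show "Ck n ((sublaplacian ^^ k) f)" by (rule 1)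
  show "vanishing n x ((sublaplacian ^^ k) f)" if "\<And>n. vanishing n x f"
  proof (induction k arbitrary: n)
    case (Suc k)
    then show ?case using vanishing_sublaplacian[OF 1 Suc.IH] by simp
  qed (simp add: that)
qed

lemma Z_mult:
  assumes "Ck 1 f" "Ck 1 g" shows "Z i (\<lambda>p. f p * g p) p = Z i f p * g p + f p * Z i g p"
  unfolding Z_def by (rule partial_deriv_mult[OF assms[THEN Ck_differentiable]]) auto

lemma Z_add:
  assumes "Ck 1 f" "Ck 1 g" shows "Z i (\<lambda>p. f p + g p) p = Z i f p + Z i g p"
  unfolding Z_def by (rule partial_deriv_add[OF assms[THEN Ck_differentiable]]) auto

lemma Z_cnj: "Ck 1 f \<Longrightarrow> Z i (\<lambda>p. cnj (f p)) p = cnj (Z i f p)"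
  unfolding Z_def by (rule partial_deriv_cnj[OF Ck_differentiable]) auto

lemma csupp_Z: "csupp f \<Longrightarrow> csupp (Z i f)"
  unfolding Z_def[abs_def] by (rule csupp_partial_deriv)

text \<open>The coefficient of the \<open>t\<close> derivative in each field depends on
  \<open>z\<close> only, so the field is divergence free and \<open>Z i u\<close> is a sum of two
  coordinate derivatives of compactly supported functions.\<close>

lemma integral_Z_csupp:
  fixes u :: "'n::finite heis \<Rightarrow> complex"
  assumes u: "Ck 1 u" "csupp u" shows "(\<integral>p. Z i u p \<partial>lborel) = 0"
proof -
  let ?c = "\<lambda>p. complex_of_real (heis_coeff i p)"
  have d: "u differentiable (at p)" for p using Ck_differentiable[OF u(1)] by simp
  have cd: "(?c has_derivative (\<lambda>h. of_real (heis_coeff i h))) (at p)" for p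
    by (intro has_derivative_of_real bounded_linear_imp_has_derivative bounded_linear_heis_coeff)
  have c0: "heis_coeff i (0, 1) = 0" by (cases i) auto
  have "Z i u p = partial_deriv (heis_base i) u p + partial_deriv (0, 1) (\<lambda>p. ?c p * u p) p" for p
  proof -
    have "partial_deriv (0, 1) (\<lambda>p. ?c p * u p) p = partial_deriv (0, 1) ?c p * u p + ?c p * partial_deriv (0, 1) u p"
      by (rule partial_deriv_mult[OF differentiableI[OF cd] d])
    then show ?thesis using partial_deriv_eq[OF cd] c0 by (simp add: Z_eq[OF d])
  qed
  moreover have cu: "Ck 1 (\<lambda>p. ?c p * u p)" "csupp (\<lambda>p. ?c p * u p)"
    using Ck_mult[OF Ck_coeff u(1)] csupp_mult(2)[OF u(2)] by auto
  moreover have "integrable lborel (partial_deriv (heis_base i) u)"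
    by (rule csupp_integrable[OF csupp_partial_deriv[OF u(2)] Ck_1_partial[OF u(1) heis_base_Basis(1)]])
  moreover have "integrable lborel (partial_deriv (0, 1) (\<lambda>p. ?c p * u p))"
    by (rule csupp_integrable[OF csupp_partial_deriv[OF cu(2)] Ck_1_partial[OF cu(1) heis_base_Basis(2)]])
  ultimately show ?thesis using integral_partial_deriv_csupp[OF u] integral_partial_deriv_csupp[OF cu] by simp
qed

lemma integration_by_parts:
  fixes u :: "'n::finite heis \<Rightarrow> complex"
  assumes "Ck 1 u" "Ck 1 v" "csupp u \<or> csupp v"
  shows "(\<integral>p. Z i u p * v p \<partial>lborel) = - (\<integral>p. u p * Z i v p \<partial>lborel)"
proof -
  have c: "continuous_on UNIV u" "continuous_on UNIV v" "continuous_on UNIV (Z i u)" "continuous_on UNIV (Z i v)"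
    using assms Ck_Z1 Ck_continuous by blast+
  have i: "integrable lborel (\<lambda>p. Z i u p * v p)" "integrable lborel (\<lambda>p. u p * Z i v p)"
    using assms(3) c by (auto intro!: csupp_integrable continuous_intros intro: csupp_mult csupp_Z)
  have "0 = (\<integral>p. Z i (\<lambda>p. u p * v p) p \<partial>lborel)"
    using assms csupp_mult by (intro integral_Z_csupp[symmetric] Ck_mult) auto
  also have "\<dots> = (\<integral>p. Z i u p * v p + u p * Z i v p \<partial>lborel)"
    using assms by (intro Bochner_Integration.integral_cong refl Z_mult)
  also have "\<dots> = (\<integral>p. Z i u p * v p \<partial>lborel) + (\<integral>p. u p * Z i v p \<partial>lborel)" using i by simp
  finally show ?thesis by (simp add: eq_neg_iff_add_eq_0)
qed

text \<open>Compact support is asked of \<open>u\<close> alone, because \<open>v\<close> will be an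
  oscillating mode \<open>hE\<close>, which is not even square integrable.\<close>

lemma sublaplacian_symmetric_csupp:
  fixes u :: "'n::finite heis \<Rightarrow> complex"
  assumes u: "Ck 2 u" "csupp u" and v: "Ck 2 v"
  shows "(\<integral>p. sublaplacian u p * v p \<partial>lborel) = (\<integral>p. u p * sublaplacian v p \<partial>lborel)"
proof -
  have Z1: "Ck 1 u" "Ck 1 v" "Ck 1 (Z i u)" "Ck 1 (Z i v)" for i
    using u v Ck_21 Ck_Z2 by blast+
  have Z0: "continuous_on UNIV (Z i (Z i u))" "continuous_on UNIV (Z i (Z i v))" "continuous_on UNIV u" "continuous_on UNIV v" for i
    using Z1 Ck_Z1 Ck_continuous by blast+
  have i: "integrable lborel (\<lambda>p. Z i (Z i u) p * v p)" "integrable lborel (\<lambda>p. u p * Z i (Z i v) p)" for i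
    using Z0 u by (auto intro!: csupp_integrable continuous_intros intro: csupp_mult csupp_Z)
  have eq: "(\<integral>p. Z i (Z i u) p * v p \<partial>lborel) = (\<integral>p. u p * Z i (Z i v) p \<partial>lborel)" for i
  proof -
    have "(\<integral>p. Z i (Z i u) p * v p \<partial>lborel) = - (\<integral>p. Z i u p * Z i v p \<partial>lborel)"
      using Z1 u csupp_Z by (intro integration_by_parts) auto
    also have "(\<integral>p. Z i u p * Z i v p \<partial>lborel) = - (\<integral>p. u p * Z i (Z i v) p \<partial>lborel)"
      using Z1 u by (intro integration_by_parts) auto
    finally show ?thesis by simp
  qed
  have "(\<integral>p. sublaplacian u p * v p \<partial>lborel) = - (\<Sum>i\<in>UNIV. (\<integral>p. Z i (Z i u) p * v p \<partial>lborel))"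
    unfolding sublaplacian_eq[OF u(1)] using i by (simp add: sum_distrib_right)
  also have "\<dots> = (\<integral>p. u p * sublaplacian v p \<partial>lborel)"
    unfolding sublaplacian_eq[OF v] using i by (simp add: sum_distrib_left eq)
  finally show ?thesis .
qed

section \<open>Chain rules along the left invariant fields\<close>

lemma has_derivative_exp_compose:
  fixes f :: "'a::real_normed_vector \<Rightarrow> complex"
  assumes "(f has_derivative f') (at p)"
  shows "((\<lambda>p. exp (f p)) has_derivative (\<lambda>b. f' b * exp (f p))) (at p)"
  using has_derivative_compose[OF assms DERIV_exp[unfolded has_field_derivative_def, of "f p"]]
  by (simp add: mult.commute)

lemma Ck_exp: "Ck n f \<Longrightarrow> Ck n (\<lambda>p. exp (f p))"
proof (induction n arbitrary: f)
  case (Suc n)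
  have d: "((\<lambda>p. exp (f p)) has_derivative (\<lambda>b. partial_deriv b f p * exp (f p))) (at p)" for p
    by (rule has_derivative_exp_compose[OF frechet_works[OF Ck_differentiable[OF Suc.prems]]]) simp
  then have "partial_deriv b (\<lambda>p. exp (f p)) = (\<lambda>p. partial_deriv b f p * exp (f p))" for b
    by (simp add: fun_eq_iff partial_deriv_eq[OF d])
  moreover have "Ck n (\<lambda>p. partial_deriv b f p * exp (f p))" if "b \<in> Basis" for b
    by (rule Ck_mult[OF Ck_partial[OF Suc.prems that] Suc.IH[OF Ck_SucD[OF Suc.prems]]])
  ultimately show ?case using d by (auto simp: Ck.simps differentiable_def)
qed (auto simp: Ck.simps intro: continuous_intros)

lemma Z_exp:
  assumes "Ck 1 f" shows "Z i (\<lambda>p. exp (f p)) p = Z i f p * exp (f p)"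
  unfolding Z_def
  by (rule partial_deriv_eq[OF has_derivative_exp_compose[OF frechet_works[OF Ck_differentiable[OF assms]]]]) simp

text \<open>\<open>Ck\<close> and \<open>Z\<close> concern complex-valued functions, so the real
  function \<open>S\<close> appears embedded; its derivative has to be recognised as real before the
  real function \<open>c\<close> can be composed with it.\<close>

lemma has_derivative_real_compose:
  assumes S: "Ck 1 (\<lambda>p. complex_of_real (S p))" and c: "\<And>x. (c has_real_derivative c' x) (at x)"
  shows "((\<lambda>p. complex_of_real (c (S p))) has_derivative
      (\<lambda>b. of_real (c' (S p)) * partial_deriv b (\<lambda>p. complex_of_real (S p)) p)) (at p)"
proof -
  let ?D = "\<lambda>b. partial_deriv b (\<lambda>p. complex_of_real (S p)) p"
  have d: "((\<lambda>p. complex_of_real (S p)) has_derivative ?D) (at p)"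
    by (rule frechet_works[OF Ck_differentiable[OF S]]) simp
  have dR: "(S has_derivative (\<lambda>b. Re (?D b))) (at p)" using has_derivative_Re[OF d] by simp
  have "((\<lambda>p. complex_of_real (S p)) has_derivative (\<lambda>b. complex_of_real (Re (?D b)))) (at p)"
    by (rule has_derivative_of_real[OF dR])
  then have eq: "?D b = complex_of_real (Re (?D b))" for b by (rule partial_deriv_eq)
  have "((\<lambda>p. c (S p)) has_derivative (\<lambda>b. c' (S p) * Re (?D b))) (at p)"
    using has_derivative_compose[OF dR c[unfolded has_field_derivative_def]] .
  then have "((\<lambda>p. complex_of_real (c (S p))) has_derivative (\<lambda>b. complex_of_real (c' (S p) * Re (?D b)))) (at p)"
    by (rule has_derivative_of_real)
  then show ?thesis by (subst eq) simp
qed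

lemma Ck_real_compose_1:
  assumes S: "Ck 1 (\<lambda>p. complex_of_real (S p))" and c: "\<And>x. (c has_real_derivative c' x) (at x)"
    and c': "continuous_on UNIV c'"
  shows "Ck 1 (\<lambda>p. complex_of_real (c (S p)))"
proof -
  note d = has_derivative_real_compose[OF S c]
  have "continuous_on UNIV S"
    using continuous_on_Re[OF Ck_continuous[OF S]] by simp
  then have "continuous_on UNIV (\<lambda>p. of_real (c' (S p)) * partial_deriv b (\<lambda>p. complex_of_real (S p)) p)"
    if "b \<in> Basis" for b
    using Ck_1_partial[OF S that]
    by (intro continuous_intros continuous_on_compose2[OF c']) auto
  moreover have "partial_deriv b (\<lambda>p. complex_of_real (c (S p)))
      = (\<lambda>p. of_real (c' (S p)) * partial_deriv b (\<lambda>p. complex_of_real (S p)) p)" for b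
    by (simp add: fun_eq_iff partial_deriv_eq[OF d])
  ultimately show ?thesis using d by (auto simp: Ck.simps differentiable_def)
qed

lemma Ck_real_compose_2:
  assumes S: "Ck 2 (\<lambda>p. complex_of_real (S p))" and c: "\<And>x. (c has_real_derivative c' x) (at x)"
    and c': "\<And>x. (c' has_real_derivative c'' x) (at x)" and c'': "continuous_on UNIV c''"
  shows "Ck 2 (\<lambda>p. complex_of_real (c (S p)))"
proof -
  have S1: "Ck 1 (\<lambda>p. complex_of_real (S p))" by (rule Ck_mono[OF S]) simp
  note d = has_derivative_real_compose[OF S1 c]
  have "Ck (Suc 0) (\<lambda>p. of_real (c' (S p)) * partial_deriv b (\<lambda>p. complex_of_real (S p)) p)" if "b \<in> Basis" for b
    using Ck_real_compose_1[OF S1 c' c''] Ck_partial[OF _ that, of 1 "\<lambda>p. complex_of_real (S p)"] S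
    by (intro Ck_mult) (auto simp: numeral_2_eq_2)
  moreover have "partial_deriv b (\<lambda>p. complex_of_real (c (S p)))
      = (\<lambda>p. of_real (c' (S p)) * partial_deriv b (\<lambda>p. complex_of_real (S p)) p)" for b
    by (simp add: fun_eq_iff partial_deriv_eq[OF d])
  ultimately show ?thesis using d by (auto simp: numeral_2_eq_2 Ck.simps(2)[of "Suc 0"] differentiable_def)
qed

lemma Z_real_compose:
  assumes S: "Ck 1 (\<lambda>p. complex_of_real (S p))" and c: "\<And>x. (c has_real_derivative c' x) (at x)"
  shows "Z i (\<lambda>p. complex_of_real (c (S p))) p = of_real (c' (S p)) * Z i (\<lambda>p. complex_of_real (S p)) p"
  unfolding Z_def by (rule partial_deriv_eq[OF has_derivative_real_compose[OF S c]])

primrec heis_coord :: "'n::finite + 'n \<Rightarrow> 'n heis \<Rightarrow> real" where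
  "heis_coord (Inl j) p = Re (fst p $ j)"
| "heis_coord (Inr j) p = Im (fst p $ j)"

definition hq :: "'n::finite heis \<Rightarrow> real" where "hq p = (norm (fst p))\<^sup>2"

lemma bounded_linear_heis_coord: "bounded_linear (heis_coord i)"
proof -
  have "bounded_linear (\<lambda>p::'a heis. fst p $ j)" for j
    by (rule bounded_linear_compose[OF bounded_linear_vec_nth bounded_linear_fst])
  then have "bounded_linear (\<lambda>p::'a heis. Im (fst p $ j))" "bounded_linear (\<lambda>p::'a heis. Re (fst p $ j))" for j
    using bounded_linear_compose[OF bounded_linear_Im] bounded_linear_compose[OF bounded_linear_Re] by blast+
  moreover have "heis_coord (Inl j) = (\<lambda>p::'a heis. Re (fst p $ j))" "heis_coord (Inr j) = (\<lambda>p::'a heis. Im (fst p $ j))" for j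
    by (rule ext, simp)+
  ultimately show ?thesis by (cases i) simp_all
qed

lemma sum_sum_type:
  fixes f :: "'n::finite + 'n \<Rightarrow> 'b::comm_monoid_add"
  shows "(\<Sum>i\<in>UNIV. f i) = (\<Sum>j\<in>UNIV. f (Inl j)) + (\<Sum>j\<in>UNIV. f (Inr j))"
  by (simp add: UNIV_Plus_UNIV[symmetric] sum.Plus del: UNIV_Plus_UNIV)

lemma hq_eq: "hq p = (\<Sum>i\<in>UNIV. (heis_coord i p)\<^sup>2)"
  unfolding hq_def power2_norm_eq_inner inner_vec_def sum_sum_type
  by (simp add: inner_complex_def power2_eq_square sum.distrib)

text \<open>The vector of the \<open>heis_coeff i p\<close> is half of \<open>z\<close> rotated by a
  right angle, hence orthogonal to \<open>z\<close> and of half its length.\<close>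

lemma sum_coeff: "(\<Sum>i\<in>UNIV. (heis_coeff i p)\<^sup>2) = hq p / 4" "(\<Sum>i\<in>UNIV. heis_coord i p * heis_coeff i p) = 0"
  unfolding hq_eq sum_sum_type
  by (simp_all add: power_divide sum_divide_distrib[symmetric] add.commute sum_negf mult.commute add_divide_distrib)

lemma coord_le: "(heis_coord i p)\<^sup>2 \<le> hq p" "(heis_coeff i p)\<^sup>2 \<le> hq p / 4"
  unfolding sum_coeff(1)[symmetric] unfolding hq_eq by (rule member_le_sum; simp)+

lemma hq_nonneg: "hq p \<ge> 0" by (simp add: hq_def)

lemma Z_linear:
  assumes "bounded_linear l" shows "Z i (\<lambda>p. complex_of_real (l p)) p = of_real (l (heis_field i p))"
  unfolding Z_def
  by (rule partial_deriv_eq) (intro has_derivative_of_real bounded_linear_imp_has_derivative assms)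

lemma Z_const: "Z i (\<lambda>p. c) p = 0"
  by (simp add: Z_def partial_deriv_const)

lemma Z_coord_self: "Z i (\<lambda>p. complex_of_real (heis_coord i p)) p = 1"
  and Z_coeff_self: "Z i (\<lambda>p. complex_of_real (heis_coeff i p)) p = 0"
  and Z_snd: "Z i (\<lambda>p. complex_of_real (snd p)) p = of_real (heis_coeff i p)"
proof -
  show "Z i (\<lambda>p. complex_of_real (heis_coord i p)) p = 1"
    unfolding Z_linear[OF bounded_linear_heis_coord] by (cases i) simp_all
  show "Z i (\<lambda>p. complex_of_real (heis_coeff i p)) p = 0"
    unfolding Z_linear[OF bounded_linear_heis_coeff] by (cases i) simp_all
  show "Z i (\<lambda>p. complex_of_real (snd p)) p = of_real (heis_coeff i p)"
    unfolding Z_linear[OF bounded_linear_snd] by (cases i) simp_all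
qed

lemma Ck_coord: "Ck n (\<lambda>p. complex_of_real (heis_coord i p))"
  by (rule Ck_linear[OF bounded_linear_heis_coord])

lemma Ck_snd: "Ck n (\<lambda>p. complex_of_real (snd p))"
  by (rule Ck_linear[OF bounded_linear_snd])

lemma Ck_hq: "Ck n (\<lambda>p. complex_of_real (hq p))"
  unfolding hq_eq of_real_sum power2_eq_square of_real_mult by (intro Ck_sum Ck_mult Ck_coord)

lemma Z_hq: "Z i (\<lambda>p. complex_of_real (hq p)) p = of_real (2 * heis_coord i p)"
proof -
  have "((\<lambda>p. complex_of_real (hq p)) has_derivative (\<lambda>h. of_real (2 * (fst p \<bullet> fst h)))) (at p)"
    unfolding hq_def power2_norm_eq_inner
    by (intro has_derivative_of_real) (auto intro!: derivative_eq_intros simp: inner_commute)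
  then have "Z i (\<lambda>p. complex_of_real (hq p)) p = of_real (2 * (fst p \<bullet> fst (heis_field i p)))"
    unfolding Z_def by (rule partial_deriv_eq)
  also have "fst p \<bullet> fst (heis_field i p) = heis_coord i p"
    by (cases i) (simp_all add: inner_axis inner_complex_def)
  finally show ?thesis .
qed

text \<open>The square of the gauge \<open>N\<close>; being a polynomial in the coordinates, it is
  smooth at the origin too.\<close>

definition hN :: "'n::finite heis \<Rightarrow> real" where "hN p = (hq p)\<^sup>2 + (snd p)\<^sup>2"

lemma Ck_hN: "Ck n (\<lambda>p. complex_of_real (hN p))"
  unfolding hN_def of_real_add power2_eq_square of_real_mult by (intro Ck_add Ck_mult Ck_hq Ck_snd)

lemma Z_hN: "Z i (\<lambda>p. complex_of_real (hN p)) = (\<lambda>p. of_real (4 * hq p * heis_coord i p + 2 * snd p * heis_coeff i p))"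
proof
  fix p
  show "Z i (\<lambda>p. complex_of_real (hN p)) p = of_real (4 * hq p * heis_coord i p + 2 * snd p * heis_coeff i p)"
    by (simp add: hN_def Z_add Z_mult Z_hq Z_snd Ck_mult Ck_hq Ck_snd power2_eq_square)
qed

lemma ZZ_hN: "Z i (Z i (\<lambda>p. complex_of_real (hN p))) p = of_real (8 * (heis_coord i p)\<^sup>2 + 4 * hq p + 2 * (heis_coeff i p)\<^sup>2)"
  unfolding Z_hN
  by (simp add: Z_add Z_mult Z_const Z_hq Z_snd Z_coord_self Z_coeff_self
      Ck_mult Ck_hq Ck_snd Ck_coord Ck_coeff Ck_const power2_eq_square)

text \<open>The truncated cube is twice continuously differentiable, the regularity that two
  applications of a field require; a truncated square would only have one continuous
  derivative.\<close>

definition cut :: "real \<Rightarrow> real" where "cut s = (max 0 (1 - s)) ^ 3"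
definition cut' :: "real \<Rightarrow> real" where "cut' s = - 3 * (max 0 (1 - s)) ^ 2"
definition cut'' :: "real \<Rightarrow> real" where "cut'' s = 6 * max 0 (1 - s)"

lemma max_power_deriv:
  "((\<lambda>s. (max 0 (1 - s)) ^ Suc (Suc n)) has_real_derivative - (real (Suc (Suc n))) * (max 0 (1 - s)) ^ Suc n) (at (s::real))"
proof -
  consider "s < 1" | "s > 1" | "s = 1" by linarith
  then show ?thesis
  proof cases
    case 1
    have "((\<lambda>s. (1 - s) ^ Suc (Suc n)) has_real_derivative - (real (Suc (Suc n))) * (max 0 (1 - s)) ^ Suc n) (at s)"
      using 1 by (intro DERIV_cong[OF DERIV_power[where f = "\<lambda>s. 1 - s" and D = "- 1"]])
        (auto intro!: derivative_eq_intros simp: algebra_simps)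
    then show ?thesis
      by (rule has_field_derivative_transform_within_open[where S = "{..<1}"]) (use 1 in auto)
  next
    case 2
    have "((\<lambda>s. 0) has_real_derivative - (real (Suc (Suc n))) * (max 0 (1 - s)) ^ Suc n) (at s)"
      using 2 by (auto intro!: derivative_eq_intros)
    then show ?thesis
      by (rule has_field_derivative_transform_within_open[where S = "{1<..}"]) (use 2 in auto)
  next
    case 3
    have "((\<lambda>h. (max 0 (- h)) ^ Suc (Suc n) / h) \<longlongrightarrow> 0) (at (0::real))"
    proof (rule Lim_null_comparison)
      show "\<forall>\<^sub>F h in at 0. norm ((max 0 (- h)) ^ Suc (Suc n) / h) \<le> \<bar>h\<bar> ^ Suc n"
        by (auto simp: eventually_at_filter max_def abs_mult intro!: always_eventually)
      show "((\<lambda>h. \<bar>h\<bar> ^ Suc n) \<longlongrightarrow> 0) (at (0::real))"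
        by (rule tendsto_eq_intros refl | simp)+
    qed
    then show ?thesis using 3 by (simp add: DERIV_def)
  qed
qed

lemma cut_deriv: "(cut has_real_derivative cut' s) (at s)" "(cut' has_real_derivative cut'' s) (at s)"
proof -
  show "(cut has_real_derivative cut' s) (at s)"
    using max_power_deriv[of 1 s] unfolding cut_def[abs_def] cut'_def by (simp add: numeral_eq_Suc)
  show "(cut' has_real_derivative cut'' s) (at s)"
    using DERIV_cmult[OF max_power_deriv[of 0 s], of "- 3"] unfolding cut'_def[abs_def] cut''_def by (simp add: numeral_eq_Suc)
qed

lemma cut_continuous: "continuous_on UNIV cut''"
  unfolding cut''_def by (intro continuous_intros)

lemma cut_bounds:
  assumes "s \<ge> 0"
  shows "0 \<le> cut s" "cut s \<le> 1" "\<bar>cut' s\<bar> \<le> 3" "\<bar>cut'' s\<bar> \<le> 6"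
  using assms power_le_one[of "max 0 (1 - s)" 3] power_le_one[of "max 0 (1 - s)" 2]
  by (auto simp: cut_def cut'_def cut''_def)

lemma cut_support: "s \<ge> 1 \<Longrightarrow> cut s = 0" "s \<ge> 1 \<Longrightarrow> cut' s = 0" "s \<ge> 1 \<Longrightarrow> cut'' s = 0"
  by (auto simp: cut_def cut'_def cut''_def)

text \<open>A cutoff in terms of the gauge respects the dilations: on its support
  \<open>|z|^2\<close> and \<open>|t|\<close> are at most \<open>R\<close>, and its first and second
  field derivatives are of order \<open>R^(-1/2)\<close> or smaller.\<close>

definition chi :: "real \<Rightarrow> 'n::finite heis \<Rightarrow> complex" where
  "chi R p = of_real (cut (hN p / R\<^sup>2))"

lemma Ck_hNR: "Ck n (\<lambda>p. complex_of_real (hN p / R\<^sup>2))"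
  unfolding divide_inverse of_real_mult by (intro Ck_mult Ck_hN Ck_const)

lemma Z_hNR: "Z i (\<lambda>p. complex_of_real (hN p / R\<^sup>2)) = (\<lambda>p. Z i (\<lambda>p. complex_of_real (hN p)) p * of_real (1 / R\<^sup>2))"
proof
  fix p
  have "Z i (\<lambda>p. complex_of_real (hN p) * of_real (1 / R\<^sup>2)) p = Z i (\<lambda>p. complex_of_real (hN p)) p * of_real (1 / R\<^sup>2)"
    by (subst Z_mult[OF Ck_hN Ck_const]) (simp add: Z_const)
  then show "Z i (\<lambda>p. complex_of_real (hN p / R\<^sup>2)) p = Z i (\<lambda>p. complex_of_real (hN p)) p * of_real (1 / R\<^sup>2)"
    by simp
qed

lemma Ck_chi: "Ck 2 (chi R)"
  unfolding chi_def[abs_def] by (rule Ck_real_compose_2[OF Ck_hNR cut_deriv cut_continuous])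

lemma Z_chi: "Z i (chi R) = (\<lambda>p. of_real (cut' (hN p / R\<^sup>2)) * (Z i (\<lambda>p. complex_of_real (hN p)) p * of_real (1 / R\<^sup>2)))"
  unfolding chi_def[abs_def] by (rule ext) (simp only: Z_real_compose[OF Ck_hNR cut_deriv(1)] Z_hNR)

lemma ZZ_chi:
  "Z i (Z i (chi R)) p = of_real (cut'' (hN p / R\<^sup>2)) * (Z i (\<lambda>p. complex_of_real (hN p)) p * of_real (1 / R\<^sup>2))\<^sup>2
     + of_real (cut' (hN p / R\<^sup>2)) * (Z i (Z i (\<lambda>p. complex_of_real (hN p))) p * of_real (1 / R\<^sup>2))"
proof -
  have c1: "Ck 1 (Z i (\<lambda>p. complex_of_real (hN p)))" by (rule Ck_Z2[OF Ck_hN])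
  have c2: "Ck 1 (\<lambda>p. complex_of_real (cut' (hN p / R\<^sup>2)))"
    by (rule Ck_real_compose_1[OF Ck_hNR cut_deriv(2) cut_continuous])
  have "Z i (Z i (chi R)) p
      = Z i (\<lambda>p. of_real (cut' (hN p / R\<^sup>2))) p * (Z i (\<lambda>p. complex_of_real (hN p)) p * of_real (1 / R\<^sup>2))
      + of_real (cut' (hN p / R\<^sup>2)) * Z i (\<lambda>p. Z i (\<lambda>p. complex_of_real (hN p)) p * of_real (1 / R\<^sup>2)) p"
    unfolding Z_chi by (rule Z_mult[OF c2 Ck_mult[OF c1 Ck_const]])
  also have "Z i (\<lambda>p. of_real (cut' (hN p / R\<^sup>2))) p = of_real (cut'' (hN p / R\<^sup>2)) * (Z i (\<lambda>p. complex_of_real (hN p)) p * of_real (1 / R\<^sup>2))"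
    by (simp only: Z_real_compose[OF Ck_hNR cut_deriv(2)] Z_hNR)
  also have "Z i (\<lambda>p. Z i (\<lambda>p. complex_of_real (hN p)) p * of_real (1 / R\<^sup>2)) p = Z i (Z i (\<lambda>p. complex_of_real (hN p))) p * of_real (1 / R\<^sup>2)"
    by (subst Z_mult[OF c1 Ck_const]) (simp add: Z_const)
  finally show ?thesis by (simp add: power2_eq_square)
qed

subsection \<open>Energy estimates\<close>

lemma coord_bounds:
  assumes "R > 0" "hN p \<le> R\<^sup>2"
  shows "hq p \<le> R" "\<bar>snd p\<bar> \<le> R" "\<bar>heis_coord i p\<bar> \<le> sqrt R" "\<bar>heis_coeff i p\<bar> \<le> sqrt R / 2"
proof -
  have "(hq p)\<^sup>2 \<le> R\<^sup>2" "\<bar>snd p\<bar>\<^sup>2 \<le> R\<^sup>2"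
    using assms(2) zero_le_power2[of "hq p"] zero_le_power2[of "snd p"] unfolding hN_def power2_abs by linarith+
  then show q: "hq p \<le> R" and "\<bar>snd p\<bar> \<le> R" using assms(1) by (auto intro: power2_le_imp_le)
  have "\<bar>heis_coord i p\<bar>\<^sup>2 \<le> (sqrt R)\<^sup>2"
    using coord_le(1)[where p = p and i = i] q assms(1) by simp
  then show "\<bar>heis_coord i p\<bar> \<le> sqrt R" by (rule power2_le_imp_le) (use assms(1) in simp)
  have "\<bar>heis_coeff i p\<bar>\<^sup>2 \<le> (sqrt R / 2)\<^sup>2"
    using coord_le(2)[where p = p and i = i] q assms(1) by (simp add: power_divide)
  then show "\<bar>heis_coeff i p\<bar> \<le> sqrt R / 2" by (rule power2_le_imp_le) (use assms(1) in simp)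
qed

lemma chi_norm: "norm (chi R p) \<le> 1"
  using cut_bounds[of "hN p / R\<^sup>2"] by (simp add: chi_def hN_def)

lemma csupp_chi: assumes "R > 0" shows "csupp (chi R)"
  unfolding csupp_def
proof (intro exI allI impI)
  fix p :: "'a heis" assume p: "norm p > R + 1"
  have "hN p > R\<^sup>2"
  proof (rule ccontr)
    assume "\<not> hN p > R\<^sup>2"
    then have h: "hq p \<le> R" "\<bar>snd p\<bar> \<le> R" using coord_bounds(1,2)[OF assms, of p] by simp_all
    have "(norm p)\<^sup>2 = hq p + \<bar>snd p\<bar>\<^sup>2" by (simp add: norm_prod_def hq_def)
    also have "\<dots> \<le> R + R\<^sup>2" using h by (intro add_mono power_mono) auto
    also have "\<dots> \<le> (R + 1)\<^sup>2" using assms by (simp add: power2_sum)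
    finally show False using p power2_le_imp_le[of "norm p" "R + 1"] assms by auto
  qed
  then show "chi R p = 0" using assms by (simp add: chi_def cut_support field_simps)
qed

lemma Z_hN_bounds:
  assumes "R > 0" "hN p \<le> R\<^sup>2"
  shows "norm (Z i (\<lambda>p. complex_of_real (hN p)) p * of_real (1 / R\<^sup>2)) \<le> 5 / sqrt R"
    and "norm (Z i (Z i (\<lambda>p. complex_of_real (hN p))) p * of_real (1 / R\<^sup>2)) \<le> 13 / R"
proof -
  note b = coord_bounds[OF assms]
  have "\<bar>4 * hq p * heis_coord i p + 2 * snd p * heis_coeff i p\<bar>
      \<le> 4 * (\<bar>hq p\<bar> * \<bar>heis_coord i p\<bar>) + 2 * (\<bar>snd p\<bar> * \<bar>heis_coeff i p\<bar>)"
    by (rule order_trans[OF abs_triangle_ineq]) (simp add: abs_mult)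
  also have "\<dots> \<le> 4 * (R * sqrt R) + 2 * (R * (sqrt R / 2))"
    using b(1,2) b(3,4)[of i] hq_nonneg[of p] assms(1) by (intro add_mono mult_left_mono mult_mono) auto
  also have "\<dots> = 5 * (R * sqrt R)" by simp
  finally have "\<bar>4 * hq p * heis_coord i p + 2 * snd p * heis_coeff i p\<bar> * (1 / R\<^sup>2) \<le> 5 * (R * sqrt R) * (1 / R\<^sup>2)"
    by (intro mult_right_mono) auto
  also have "5 * (R * sqrt R) * (1 / R\<^sup>2) = 5 / sqrt R"
    using assms(1) real_sqrt_mult_self[of R] by (simp add: field_simps power2_eq_square)
  finally show "norm (Z i (\<lambda>p. complex_of_real (hN p)) p * of_real (1 / R\<^sup>2)) \<le> 5 / sqrt R"
    unfolding Z_hN of_real_mult[symmetric] norm_of_real by (simp only: abs_mult abs_divide abs_one abs_power2)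
  have "8 * (heis_coord i p)\<^sup>2 + 4 * hq p + 2 * (heis_coeff i p)\<^sup>2 \<le> 13 * R"
    using coord_le[where p = p and i = i] b(1) assms(1) by linarith
  moreover have "8 * (heis_coord i p)\<^sup>2 + 4 * hq p + 2 * (heis_coeff i p)\<^sup>2 \<ge> 0" using hq_nonneg[of p] by simp
  ultimately have "\<bar>8 * (heis_coord i p)\<^sup>2 + 4 * hq p + 2 * (heis_coeff i p)\<^sup>2\<bar> * (1 / R\<^sup>2) \<le> 13 * R * (1 / R\<^sup>2)"
    by (intro mult_right_mono) auto
  also have "13 * R * (1 / R\<^sup>2) = 13 / R" using assms(1) by (simp add: power2_eq_square)
  finally show "norm (Z i (Z i (\<lambda>p. complex_of_real (hN p))) p * of_real (1 / R\<^sup>2)) \<le> 13 / R"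
    unfolding ZZ_hN of_real_mult[symmetric] norm_of_real by (simp only: abs_mult abs_divide abs_one abs_power2)
qed

text \<open>The computation gives \<open>3 * 5 = 15\<close> over \<open>sqrt R\<close> for one field
  and \<open>6 * 25 + 3 * 13 = 189\<close> over \<open>R\<close> for two; both are rounded up to a
  common bound.\<close>

lemma Z_chi_bounds:
  assumes "R \<ge> 1"
  shows "norm (Z i (chi R) p) \<le> 200 / sqrt R" "norm (Z i (Z i (chi R)) p) \<le> 200 / sqrt R"
proof -
  have R: "R > 0" "sqrt R \<ge> 1" "sqrt R \<le> R"
    using assms real_sqrt_le_mono[of 1 R] real_sqrt_le_mono[of R "R\<^sup>2"] by (auto simp: power2_eq_square)
  let ?s = "hN p / R\<^sup>2"
  have "norm (Z i (chi R) p) \<le> 200 / sqrt R \<and> norm (Z i (Z i (chi R)) p) \<le> 200 / sqrt R"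
    proof (cases "hN p \<le> R\<^sup>2")
      case False
      then have s: "?s \<ge> 1" using R by (simp add: field_simps)
      have "norm (Z i (chi R) p) \<le> 200 / sqrt R" unfolding Z_chi cut_support(2,3)[OF s] using R by simp
      moreover have "norm (Z i (Z i (chi R)) p) \<le> 200 / sqrt R" unfolding ZZ_chi cut_support(2,3)[OF s] using R by simp
      ultimately show ?thesis ..
    next
      case True
      let ?A = "norm (Z i (\<lambda>p. complex_of_real (hN p)) p * of_real (1 / R\<^sup>2))"
      let ?B = "norm (Z i (Z i (\<lambda>p. complex_of_real (hN p))) p * of_real (1 / R\<^sup>2))"
      note b = Z_hN_bounds[OF R(1) True, of i] and c = cut_bounds[of ?s]
      have s0: "?s \<ge> 0" by (simp add: hN_def)
      have "norm (Z i (chi R) p) = \<bar>cut' ?s\<bar> * ?A"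
        unfolding Z_chi norm_mult[of "complex_of_real (cut' ?s)"] norm_of_real ..
      also have "\<dots> \<le> 3 * (5 / sqrt R)" using b(1) c(3)[OF s0] by (intro mult_mono) auto
      also have "\<dots> \<le> 200 / sqrt R" using R by (simp add: divide_right_mono)
      finally have 1: "norm (Z i (chi R) p) \<le> 200 / sqrt R" .
      have "norm (Z i (Z i (chi R)) p) \<le> \<bar>cut'' ?s\<bar> * ?A\<^sup>2 + \<bar>cut' ?s\<bar> * ?B"
        unfolding ZZ_chi by (rule order_trans[OF norm_triangle_ineq])
          (simp only: norm_mult[of "complex_of_real (cut'' ?s)"] norm_mult[of "complex_of_real (cut' ?s)"] norm_of_real norm_power)
      also have "\<dots> \<le> 6 * (5 / sqrt R)\<^sup>2 + 3 * (13 / R)"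
        using b c(3,4)[OF s0] by (intro add_mono mult_mono power_mono) auto
      also have "\<dots> = 189 / R" using R by (simp add: power_divide field_simps)
      also have "\<dots> \<le> 200 / sqrt R" using R by (intro frac_le) auto
      finally show ?thesis using 1 by blast
    qed
  then show "norm (Z i (chi R) p) \<le> 200 / sqrt R" "norm (Z i (Z i (chi R)) p) \<le> 200 / sqrt R" by blast+
qed

lemma chi_tendsto: "(\<lambda>m. chi (real (Suc m)) p) \<longlonglongrightarrow> 1"
proof -
  have "isCont cut 0" by (rule DERIV_isCont[OF cut_deriv(1)])
  moreover have "(\<lambda>m. hN p / (real (Suc m))\<^sup>2) \<longlonglongrightarrow> 0" by real_asymp
  ultimately have "(\<lambda>m. cut (hN p / (real (Suc m))\<^sup>2)) \<longlonglongrightarrow> cut 0" by (rule isCont_tendsto_compose)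
  then have "(\<lambda>m. complex_of_real (cut (hN p / (real (Suc m))\<^sup>2))) \<longlonglongrightarrow> of_real (cut 0)" by (rule tendsto_of_real)
  then show ?thesis by (simp add: chi_def cut_def)
qed

lemma Z_chi_tendsto:
  "(\<lambda>m. Z i (chi (real (Suc m))) p) \<longlonglongrightarrow> 0" "(\<lambda>m. Z i (Z i (chi (real (Suc m)))) p) \<longlonglongrightarrow> 0"
proof -
  have l: "(\<lambda>m. 200 / sqrt (real (Suc m))) \<longlonglongrightarrow> 0" by real_asymp
  show "(\<lambda>m. Z i (chi (real (Suc m))) p) \<longlonglongrightarrow> 0" "(\<lambda>m. Z i (Z i (chi (real (Suc m)))) p) \<longlonglongrightarrow> 0"
    by (rule Lim_null_comparison[OF _ l], intro always_eventually allI Z_chi_bounds, simp)+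
qed

lemma in_L2_measurable [measurable_dest]: "in_L2 u \<Longrightarrow> u \<in> borel_measurable borel"
  by (simp add: in_L2_def)

lemma in_L2_mult:
  assumes "in_L2 u" "in_L2 v" shows "integrable lborel (\<lambda>p. u p * v p)"
proof (rule Bochner_Integration.integrable_bound)
  show "integrable lborel (\<lambda>p. (cmod (u p))\<^sup>2 + (cmod (v p))\<^sup>2)" using assms by (simp add: in_L2_def)
  show "(\<lambda>p. u p * v p) \<in> borel_measurable lborel" using assms[THEN in_L2_measurable] by simp
  show "AE p in lborel. norm (u p * v p) \<le> norm ((cmod (u p))\<^sup>2 + (cmod (v p))\<^sup>2)"
  proof (rule AE_I2)
    fix p
    have "2 * (cmod (u p) * cmod (v p)) \<le> (cmod (u p))\<^sup>2 + (cmod (v p))\<^sup>2"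
      using sum_squares_bound[of "cmod (u p)" "cmod (v p)"] by simp
    moreover have "cmod (u p) * cmod (v p) \<ge> 0" by simp
    ultimately show "norm (u p * v p) \<le> norm ((cmod (u p))\<^sup>2 + (cmod (v p))\<^sup>2)"
      unfolding norm_mult real_norm_def by linarith
  qed
qed

lemma in_L2_cnj: assumes "in_L2 v" shows "in_L2 (\<lambda>p. cnj (v p))"
proof -
  have "(\<lambda>p. cnj (v p)) \<in> borel_measurable borel"
    by (rule measurable_compose[OF in_L2_measurable[OF assms]
          borel_measurable_continuous_onI[OF continuous_on_cnj[OF continuous_on_id]]])
  then show ?thesis using assms by (simp add: in_L2_def)
qed

text \<open>Energy estimate: with the squared cutoff, integration by parts expresses the energy of
  \<open>u\<close> by the pairing of \<open>u\<close> with \<open>sublaplacian u\<close> and a cross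
  term containing \<open>Z i (chi R)\<close>. Half of the energy absorbs the cross term, the
  resulting bound is uniform in \<open>R\<close>, and Fatou's lemma removes the cutoff.\<close>

lemma caccioppoli:
  fixes u :: "'n::finite heis \<Rightarrow> complex"
  assumes u: "Ck 2 u" and L: "in_L2 u" "in_L2 (sublaplacian u)"
  shows "in_L2 (Z i u)"
proof -
  \<comment> \<open>The outer factor 2 comes from moving half of the energy to the left. The
    constant 80000 is \<open>400^2 / 2\<close>, where 400 is twice the bound 200 on
    \<open>Z i (chi R)\<close>.\<close>
  define K where "K = 2 * ((\<integral>p. (cmod (u p))\<^sup>2 \<partial>lborel) + (\<integral>p. (cmod (sublaplacian u p))\<^sup>2 \<partial>lborel)
    + real CARD('n + 'n) * (80000 * (\<integral>p. (cmod (u p))\<^sup>2 \<partial>lborel)))"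
  have u1: "Ck 1 u" "Ck 1 (Z i u)" for i using u Ck_21 Ck_Z2 by blast+
  have cont: "continuous_on UNIV u" "continuous_on UNIV (Z i u)" "continuous_on UNIV (Z i (Z i u))" for i
    using u1 Ck_Z1 Ck_continuous by blast+
  have Lc: "continuous_on UNIV (sublaplacian u)"
    unfolding sublaplacian_eq[OF u] by (intro continuous_intros cont)
  have main: "(\<Sum>i\<in>UNIV. \<integral>p. (cmod (chi R p))\<^sup>2 * (cmod (Z i u p))\<^sup>2 \<partial>lborel) \<le> K"
    and int1: "integrable lborel (\<lambda>p. (cmod (chi R p))\<^sup>2 * (cmod (Z i u p))\<^sup>2)" if R: "R \<ge> 1" for R i
  proof -
    let ?c = "chi R"
    have R0: "R > 0" using R by simp
    have cs: "csupp ?c" by (rule csupp_chi[OF R0])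
    have c1: "Ck 1 ?c" "Ck 1 (\<lambda>p. ?c p * ?c p)" using Ck_21[OF Ck_chi] Ck_mult by blast+
    have cc: "continuous_on UNIV ?c" "continuous_on UNIV (Z i ?c)" for i
      using Ck_continuous[OF c1(1)] Ck_continuous[OF Ck_Z1[OF c1(1)]] by auto
    have creal: "?c p * ?c p = of_real ((cmod (?c p))\<^sup>2)" for p
      by (simp add: chi_def power2_eq_square)
    have int: "integrable lborel (\<lambda>p. ?c p * g p)" if "continuous_on UNIV g" for g
      using that cs cc by (intro csupp_integrable csupp_mult continuous_intros)
    define A where "A i = (\<integral>p. (cmod (?c p))\<^sup>2 * (cmod (Z i u p))\<^sup>2 \<partial>lborel)" for i
    have intA: "integrable lborel (\<lambda>p. (cmod (?c p))\<^sup>2 * (cmod (Z i u p))\<^sup>2)" for i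
    proof -
      have "integrable lborel (\<lambda>p. cmod (?c p * (?c p * (Z i u p * Z i u p))))"
        by (intro integrable_norm int continuous_intros cont cc)
      then show ?thesis by (simp add: norm_mult power2_eq_square mult_ac)
    qed
    show "integrable lborel (\<lambda>p. (cmod (chi R p))\<^sup>2 * (cmod (Z i u p))\<^sup>2)" for i by (rule intA)
    have A1: "of_real (A i) = - (\<integral>p. ?c p * (u p * (2 * Z i ?c p * cnj (Z i u p))) \<partial>lborel)
        - (\<integral>p. ?c p * (?c p * (u p * cnj (Z i (Z i u) p))) \<partial>lborel)" for i
    proof -
      have "complex_of_real (A i) = (\<integral>p. Z i u p * ((?c p * ?c p) * cnj (Z i u p)) \<partial>lborel)"
        unfolding A_def integral_complex_of_real[symmetric]
      proof (intro Bochner_Integration.integral_cong refl)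
        fix p
        have "Z i u p * ((?c p * ?c p) * cnj (Z i u p)) = (?c p * ?c p) * (Z i u p * cnj (Z i u p))" by (simp add: mult_ac)
        then show "complex_of_real ((cmod (?c p))\<^sup>2 * (cmod (Z i u p))\<^sup>2) = Z i u p * ((?c p * ?c p) * cnj (Z i u p))"
          by (simp only: creal complex_norm_square of_real_mult)
      qed
      also have "\<dots> = - (\<integral>p. u p * Z i (\<lambda>p. (?c p * ?c p) * cnj (Z i u p)) p \<partial>lborel)"
        using cs by (intro integration_by_parts u1 Ck_mult c1 Ck_cnj disjI2 csupp_mult)
      also have "(\<lambda>p. u p * Z i (\<lambda>p. (?c p * ?c p) * cnj (Z i u p)) p)
          = (\<lambda>p. ?c p * (u p * (2 * Z i ?c p * cnj (Z i u p))) + ?c p * (?c p * (u p * cnj (Z i (Z i u) p))))"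
        by (simp add: fun_eq_iff Z_mult Z_cnj c1 u1 Ck_cnj Ck_mult algebra_simps del: One_nat_def)
      also have "(\<integral>p. ?c p * (u p * (2 * Z i ?c p * cnj (Z i u p))) + ?c p * (?c p * (u p * cnj (Z i (Z i u) p))) \<partial>lborel)
          = (\<integral>p. ?c p * (u p * (2 * Z i ?c p * cnj (Z i u p))) \<partial>lborel) + (\<integral>p. ?c p * (?c p * (u p * cnj (Z i (Z i u) p))) \<partial>lborel)"
        by (intro Bochner_Integration.integral_add int continuous_intros cont cc)
      finally show ?thesis by simp
    qed
    have sumL: "(\<Sum>i\<in>UNIV. \<integral>p. ?c p * (?c p * (u p * cnj (Z i (Z i u) p))) \<partial>lborel)
        = - (\<integral>p. ?c p * (?c p * (u p * cnj (sublaplacian u p))) \<partial>lborel)"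
    proof -
      have "(\<integral>p. ?c p * (?c p * (u p * cnj (sublaplacian u p))) \<partial>lborel)
        = (\<integral>p. (\<Sum>i\<in>UNIV. - (?c p * (?c p * (u p * cnj (Z i (Z i u) p))))) \<partial>lborel)"
        unfolding sublaplacian_eq[OF u] by (simp add: sum_distrib_left sum_negf)
      also have "\<dots> = (\<Sum>i\<in>UNIV. \<integral>p. - (?c p * (?c p * (u p * cnj (Z i (Z i u) p)))) \<partial>lborel)"
        by (intro Bochner_Integration.integral_sum integrable_minus int continuous_intros cont cc)
      finally show ?thesis by (simp add: sum_negf)
    qed
    have "complex_of_real (\<Sum>i\<in>UNIV. A i)
        = (\<integral>p. ?c p * (?c p * (u p * cnj (sublaplacian u p))) \<partial>lborel)
          - (\<Sum>i\<in>UNIV. \<integral>p. ?c p * (u p * (2 * Z i ?c p * cnj (Z i u p))) \<partial>lborel)"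
      unfolding of_real_sum A1 using sumL by (simp add: sum_subtractf sum_negf)
    then have "norm (complex_of_real (\<Sum>i\<in>UNIV. A i))
        \<le> norm (\<integral>p. ?c p * (?c p * (u p * cnj (sublaplacian u p))) \<partial>lborel)
          + norm (\<Sum>i\<in>UNIV. \<integral>p. ?c p * (u p * (2 * Z i ?c p * cnj (Z i u p))) \<partial>lborel)"
      by (simp only: norm_triangle_ineq4)
    also have "norm (\<integral>p. ?c p * (?c p * (u p * cnj (sublaplacian u p))) \<partial>lborel)
        \<le> (\<integral>p. (cmod (u p))\<^sup>2 + (cmod (sublaplacian u p))\<^sup>2 \<partial>lborel)"
    proof (rule order_trans[OF integral_norm_bound])
      show "(\<integral>p. norm (?c p * (?c p * (u p * cnj (sublaplacian u p)))) \<partial>lborel)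
        \<le> (\<integral>p. (cmod (u p))\<^sup>2 + (cmod (sublaplacian u p))\<^sup>2 \<partial>lborel)"
      proof (rule integral_mono)
        show "integrable lborel (\<lambda>p. norm (?c p * (?c p * (u p * cnj (sublaplacian u p)))))"
          by (intro integrable_norm int continuous_intros cont cc Lc)
        show "integrable lborel (\<lambda>p. (cmod (u p))\<^sup>2 + (cmod (sublaplacian u p))\<^sup>2)"
          using L by (simp add: in_L2_def)
        fix p
        have "norm (?c p * (?c p * (u p * cnj (sublaplacian u p)))) \<le> 1 * (1 * (cmod (u p) * cmod (sublaplacian u p)))"
          unfolding norm_mult complex_mod_cnj by (intro mult_mono chi_norm) auto
        also have "\<dots> \<le> (cmod (u p))\<^sup>2 + (cmod (sublaplacian u p))\<^sup>2"
        proof -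
          have "2 * (cmod (u p) * cmod (sublaplacian u p)) \<le> (cmod (u p))\<^sup>2 + (cmod (sublaplacian u p))\<^sup>2"
            using sum_squares_bound[of "cmod (u p)" "cmod (sublaplacian u p)"] by simp
          moreover have "cmod (u p) * cmod (sublaplacian u p) \<ge> 0" by simp
          ultimately show ?thesis by linarith
        qed
        finally show "norm (?c p * (?c p * (u p * cnj (sublaplacian u p)))) \<le> (cmod (u p))\<^sup>2 + (cmod (sublaplacian u p))\<^sup>2" .
      qed
    qed
    also have "\<dots> = (\<integral>p. (cmod (u p))\<^sup>2 \<partial>lborel) + (\<integral>p. (cmod (sublaplacian u p))\<^sup>2 \<partial>lborel)"
      using L by (simp add: in_L2_def)
    also have "norm (\<Sum>i\<in>UNIV. \<integral>p. ?c p * (u p * (2 * Z i ?c p * cnj (Z i u p))) \<partial>lborel)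
        \<le> (\<Sum>i\<in>UNIV. 80000 * (\<integral>p. (cmod (u p))\<^sup>2 \<partial>lborel) + A i / 2)"
    proof (rule sum_norm_le, rule order_trans[OF integral_norm_bound])
      fix i
      have "(\<integral>p. norm (?c p * (u p * (2 * Z i ?c p * cnj (Z i u p)))) \<partial>lborel)
          \<le> (\<integral>p. 80000 * (cmod (u p))\<^sup>2 + ((cmod (?c p))\<^sup>2 * (cmod (Z i u p))\<^sup>2) / 2 \<partial>lborel)"
      proof (rule integral_mono)
        show "integrable lborel (\<lambda>p. norm (?c p * (u p * (2 * Z i ?c p * cnj (Z i u p)))))"
          by (intro integrable_norm int continuous_intros cont cc)
        show "integrable lborel (\<lambda>p. 80000 * (cmod (u p))\<^sup>2 + ((cmod (?c p))\<^sup>2 * (cmod (Z i u p))\<^sup>2) / 2)"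
          using L intA by (simp add: in_L2_def)
        fix p
        have z: "norm (Z i ?c p) \<le> 200"
          using Z_chi_bounds(1)[OF R, of i p] R real_sqrt_le_mono[of 1 R] by (simp add: divide_le_eq order_trans)
        have "norm (?c p * (u p * (2 * Z i ?c p * cnj (Z i u p))))
            = 2 * ((norm (Z i ?c p) * cmod (u p)) * (cmod (?c p) * cmod (Z i u p)))"
          by (simp add: norm_mult)
        also have "\<dots> \<le> 2 * ((200 * cmod (u p)) * (cmod (?c p) * cmod (Z i u p)))"
          using z by (intro mult_left_mono mult_right_mono) auto
        also have "\<dots> = 2 * (400 * cmod (u p)) * (cmod (?c p) * cmod (Z i u p)) / 2" by simp
        also have "\<dots> \<le> ((400 * cmod (u p))\<^sup>2 + (cmod (?c p) * cmod (Z i u p))\<^sup>2) / 2"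
          by (intro divide_right_mono sum_squares_bound) auto
        also have "\<dots> = 80000 * (cmod (u p))\<^sup>2 + ((cmod (?c p))\<^sup>2 * (cmod (Z i u p))\<^sup>2) / 2"
          by (simp add: power_mult_distrib add_divide_distrib)
        finally show "norm (?c p * (u p * (2 * Z i ?c p * cnj (Z i u p))))
          \<le> 80000 * (cmod (u p))\<^sup>2 + ((cmod (?c p))\<^sup>2 * (cmod (Z i u p))\<^sup>2) / 2" .
      qed
      also have "\<dots> = 80000 * (\<integral>p. (cmod (u p))\<^sup>2 \<partial>lborel) + A i / 2"
        using L intA by (simp add: in_L2_def A_def)
      finally show "(\<integral>p. norm (?c p * (u p * (2 * Z i ?c p * cnj (Z i u p)))) \<partial>lborel)
        \<le> 80000 * (\<integral>p. (cmod (u p))\<^sup>2 \<partial>lborel) + A i / 2" .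
    qed
    also have "\<dots> = real CARD('n + 'n) * (80000 * (\<integral>p. (cmod (u p))\<^sup>2 \<partial>lborel)) + (\<Sum>i\<in>UNIV. A i) / 2"
      by (simp only: sum.distrib sum_constant sum_divide_distrib)
    finally have *: "norm (complex_of_real (\<Sum>i\<in>UNIV. A i))
      \<le> (\<integral>p. (cmod (u p))\<^sup>2 \<partial>lborel) + (\<integral>p. (cmod (sublaplacian u p))\<^sup>2 \<partial>lborel)
        + (real CARD('n + 'n) * (80000 * (\<integral>p. (cmod (u p))\<^sup>2 \<partial>lborel)) + (\<Sum>i\<in>UNIV. A i) / 2)" by simp
    have "K / 2 = (\<integral>p. (cmod (u p))\<^sup>2 \<partial>lborel) + (\<integral>p. (cmod (sublaplacian u p))\<^sup>2 \<partial>lborel)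
        + real CARD('n + 'n) * (80000 * (\<integral>p. (cmod (u p))\<^sup>2 \<partial>lborel))"
      unfolding K_def by (rule nonzero_mult_div_cancel_left) simp
    with * have "norm (complex_of_real (\<Sum>i\<in>UNIV. A i)) \<le> K / 2 + (\<Sum>i\<in>UNIV. A i) / 2"
      by (simp only: add.assoc)
    then have "(\<Sum>i\<in>UNIV. A i) \<le> K / 2 + (\<Sum>i\<in>UNIV. A i) / 2"
      unfolding norm_of_real by linarith
    then show "(\<Sum>i\<in>UNIV. \<integral>p. (cmod (?c p))\<^sup>2 * (cmod (Z i u p))\<^sup>2 \<partial>lborel) \<le> K"
      unfolding A_def by linarith
  qed
  have Am: "(\<integral>p. (cmod (chi (real (Suc m)) p))\<^sup>2 * (cmod (Z i u p))\<^sup>2 \<partial>lborel) \<le> K" for m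
  proof -
    have "(\<integral>p. (cmod (chi (real (Suc m)) p))\<^sup>2 * (cmod (Z i u p))\<^sup>2 \<partial>lborel)
        \<le> (\<Sum>i\<in>UNIV. \<integral>p. (cmod (chi (real (Suc m)) p))\<^sup>2 * (cmod (Z i u p))\<^sup>2 \<partial>lborel)"
      by (rule member_le_sum[of i UNIV "\<lambda>i. \<integral>p. (cmod (chi (real (Suc m)) p))\<^sup>2 * (cmod (Z i u p))\<^sup>2 \<partial>lborel"]) auto
    also have "\<dots> \<le> K" by (rule main) simp
    finally show ?thesis .
  qed
  have "(\<integral>\<^sup>+p. ennreal ((cmod (Z i u p))\<^sup>2) \<partial>lborel)
      = (\<integral>\<^sup>+p. liminf (\<lambda>m. ennreal ((cmod (chi (real (Suc m)) p))\<^sup>2 * (cmod (Z i u p))\<^sup>2)) \<partial>lborel)"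
  proof (rule nn_integral_cong)
    fix p
    have "(\<lambda>m. (cmod (chi (real (Suc m)) p))\<^sup>2 * (cmod (Z i u p))\<^sup>2) \<longlonglongrightarrow> (cmod 1)\<^sup>2 * (cmod (Z i u p))\<^sup>2"
      by (intro tendsto_intros chi_tendsto)
    then have "(\<lambda>m. ennreal ((cmod (chi (real (Suc m)) p))\<^sup>2 * (cmod (Z i u p))\<^sup>2)) \<longlonglongrightarrow> ennreal ((cmod (Z i u p))\<^sup>2)"
      by (intro tendsto_ennrealI) simp
    then show "ennreal ((cmod (Z i u p))\<^sup>2) = liminf (\<lambda>m. ennreal ((cmod (chi (real (Suc m)) p))\<^sup>2 * (cmod (Z i u p))\<^sup>2))"
      by (rule lim_imp_Liminf[OF sequentially_bot, symmetric])
  qed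
  also have "\<dots> \<le> liminf (\<lambda>m. \<integral>\<^sup>+p. ennreal ((cmod (chi (real (Suc m)) p))\<^sup>2 * (cmod (Z i u p))\<^sup>2) \<partial>lborel)"
    using int1 by (intro nn_integral_liminf) (auto dest: borel_measurable_integrable)
  also have "\<dots> \<le> liminf (\<lambda>m. ennreal K)"
  proof (intro Liminf_mono always_eventually allI)
    fix m
    have "(\<integral>\<^sup>+p. ennreal ((cmod (chi (real (Suc m)) p))\<^sup>2 * (cmod (Z i u p))\<^sup>2) \<partial>lborel)
        = ennreal (\<integral>p. (cmod (chi (real (Suc m)) p))\<^sup>2 * (cmod (Z i u p))\<^sup>2 \<partial>lborel)"
      by (intro nn_integral_eq_integral int1) auto
    also have "\<dots> \<le> ennreal K" by (intro ennreal_leI Am)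
    finally show "(\<integral>\<^sup>+p. ennreal ((cmod (chi (real (Suc m)) p))\<^sup>2 * (cmod (Z i u p))\<^sup>2) \<partial>lborel) \<le> ennreal K" .
  qed
  also have "\<dots> = ennreal K" by (simp add: Liminf_const)
  finally have fin: "(\<integral>\<^sup>+p. ennreal ((cmod (Z i u p))\<^sup>2) \<partial>lborel) < \<infinity>"
    using ennreal_less_top le_less_trans by (metis infinity_ennreal_def)
  have m: "Z i u \<in> borel_measurable lborel" using borel_measurable_continuous_onI[OF cont(2)] by simp
  show ?thesis unfolding in_L2_def
    using fin m by (auto intro!: integrableI_nonneg)
qed

lemma chi_dominated:
  assumes F: "integrable lborel F" and c: "\<And>m. c m \<in> borel_measurable borel" "\<And>m p. norm (c m p) \<le> B"
    and lim: "\<And>p. (\<lambda>m. c m p) \<longlonglongrightarrow> l"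
  shows "(\<lambda>m. \<integral>p. c m p * F p \<partial>lborel) \<longlonglongrightarrow> (\<integral>p. l * F p \<partial>(lborel :: 'n::finite heis measure) :: complex)"
proof (rule integral_dominated_convergence[where w = "\<lambda>p. B * norm (F p)"])
  show "integrable lborel (\<lambda>p. B * norm (F p))" using F by simp
  show "AE p in lborel. (\<lambda>m. c m p * F p) \<longlonglongrightarrow> l * F p" by (intro AE_I2 tendsto_intros lim)
  show "AE p in lborel. norm (c m p * F p) \<le> B * norm (F p)" for m
    using c by (auto simp: norm_mult intro!: AE_I2 mult_right_mono)
qed (use F c in \<open>auto dest: borel_measurable_integrable\<close>)

lemma chi_limits:
  fixes F :: "'n::finite heis \<Rightarrow> complex"
  assumes F: "integrable lborel F"
  shows "(\<lambda>m. \<integral>p. chi (real (Suc m)) p * F p \<partial>lborel) \<longlonglongrightarrow> (\<integral>p. F p \<partial>lborel)"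
    and "(\<lambda>m. \<integral>p. Z i (chi (real (Suc m))) p * F p \<partial>lborel) \<longlonglongrightarrow> 0"
    and "(\<lambda>m. \<integral>p. Z i (Z i (chi (real (Suc m)))) p * F p \<partial>lborel) \<longlonglongrightarrow> 0"
proof -
  have m: "chi (real (Suc m)) \<in> borel_measurable borel" "Z i (chi (real (Suc m))) \<in> borel_measurable borel"
    "Z i (Z i (chi (real (Suc m)))) \<in> borel_measurable borel" for m
    using Ck_measurable[OF Ck_chi] Ck_measurable[OF Ck_Z2[OF Ck_chi]] Ck_measurable[OF Ck_Z1[OF Ck_Z2[OF Ck_chi]]] by blast+
  have b: "norm (Z i (chi (real (Suc m))) p) \<le> 200" "norm (Z i (Z i (chi (real (Suc m)))) p) \<le> 200" for m and p :: "'n heis"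
  proof -
    have "200 / sqrt (real (Suc m)) \<le> 200" by (simp add: divide_le_eq)
    then show "norm (Z i (chi (real (Suc m))) p) \<le> 200" "norm (Z i (Z i (chi (real (Suc m)))) p) \<le> 200"
      using Z_chi_bounds[of "real (Suc m)" i p] by linarith+
  qed
  show "(\<lambda>m. \<integral>p. chi (real (Suc m)) p * F p \<partial>lborel) \<longlonglongrightarrow> (\<integral>p. F p \<partial>lborel)"
    using chi_dominated[where c = "\<lambda>m. chi (real (Suc m))", OF F m(1) chi_norm chi_tendsto] by simp
  show "(\<lambda>m. \<integral>p. Z i (chi (real (Suc m))) p * F p \<partial>lborel) \<longlonglongrightarrow> 0"
    using chi_dominated[where c = "\<lambda>m. Z i (chi (real (Suc m)))", OF F m(2) b(1) Z_chi_tendsto(1)] by simp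
  show "(\<lambda>m. \<integral>p. Z i (Z i (chi (real (Suc m)))) p * F p \<partial>lborel) \<longlonglongrightarrow> 0"
    using chi_dominated[where c = "\<lambda>m. Z i (Z i (chi (real (Suc m))))", OF F m(3) b(2) Z_chi_tendsto(2)] by simp
qed

text \<open>\<open>caccioppoli\<close> makes the energy pairings and the terms with a derivative of
  the cutoff integrable, and the latter tend to 0 as the cutoff opens up. Symmetry and positivity of
  the sublaplacian on the orbit of \<open>f\<close> are read off from the right-hand side.\<close>

lemma sublaplacian_form:
  fixes u v :: "'n::finite heis \<Rightarrow> complex"
  assumes u: "Ck 2 u" "in_L2 u" "in_L2 (sublaplacian u)" and v: "Ck 2 v" "in_L2 v" "in_L2 (sublaplacian v)"
  shows "(\<integral>p. sublaplacian u p * cnj (v p) \<partial>lborel) = (\<Sum>i\<in>UNIV. \<integral>p. Z i u p * cnj (Z i v p) \<partial>lborel)"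
proof -
  have u1: "Ck 1 u" "Ck 1 (Z i u)" and v1: "Ck 1 v" "Ck 1 (\<lambda>p. cnj (v p))" for i
    using u v Ck_21 Ck_Z2 Ck_cnj by blast+
  have cont: "continuous_on UNIV u" "continuous_on UNIV (Z i u)" "continuous_on UNIV (Z i (Z i u))"
    "continuous_on UNIV v" "continuous_on UNIV (Z i v)" for i
    using u1 v1 Ck_Z1 Ck_continuous by blast+
  have iL: "integrable lborel (\<lambda>p. sublaplacian u p * cnj (v p))" "integrable lborel (\<lambda>p. Z i u p * cnj (Z i v p))"
    "integrable lborel (\<lambda>p. Z i u p * cnj (v p))" for i
    using u v by (auto intro!: in_L2_mult in_L2_cnj caccioppoli)
  have eq: "(\<integral>p. chi R p * (sublaplacian u p * cnj (v p)) \<partial>lborel)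
      = (\<Sum>i\<in>UNIV. (\<integral>p. Z i (chi R) p * (Z i u p * cnj (v p)) \<partial>lborel) + (\<integral>p. chi R p * (Z i u p * cnj (Z i v p)) \<partial>lborel))"
    if R: "R > 0" for R
  proof -
    have cs: "csupp (chi R)" by (rule csupp_chi[OF R])
    have c1: "Ck 1 (chi R)" by (rule Ck_21[OF Ck_chi])
    have cc: "continuous_on UNIV (chi R)" "continuous_on UNIV (Z i (chi R))" for i
      using Ck_continuous[OF c1] Ck_continuous[OF Ck_Z1[OF c1]] by auto
    have int: "integrable lborel (\<lambda>p. chi R p * g p)" "integrable lborel (\<lambda>p. Z i (chi R) p * g p)" if "continuous_on UNIV g" for g i
      by (rule csupp_integrable[OF csupp_mult(1)[OF cs] continuous_on_mult[OF cc(1) that]]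
          csupp_integrable[OF csupp_mult(1)[OF csupp_Z[OF cs]] continuous_on_mult[OF cc(2) that]])+
    have "(\<integral>p. chi R p * (sublaplacian u p * cnj (v p)) \<partial>lborel)
        = (\<integral>p. (\<Sum>i\<in>UNIV. - (chi R p * (Z i (Z i u) p * cnj (v p)))) \<partial>lborel)"
      unfolding sublaplacian_eq[OF u(1)] by (simp add: sum_distrib_left sum_distrib_right sum_negf)
    also have "\<dots> = (\<Sum>i\<in>UNIV. \<integral>p. - (chi R p * (Z i (Z i u) p * cnj (v p))) \<partial>lborel)"
      by (intro Bochner_Integration.integral_sum integrable_minus int continuous_intros cont)
    also have "\<dots> = (\<Sum>i\<in>UNIV. (\<integral>p. Z i (chi R) p * (Z i u p * cnj (v p)) \<partial>lborel) + (\<integral>p. chi R p * (Z i u p * cnj (Z i v p)) \<partial>lborel))"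
    proof (rule sum.cong[OF refl])
      fix i
      have "(\<integral>p. - (chi R p * (Z i (Z i u) p * cnj (v p))) \<partial>lborel) = - (\<integral>p. Z i (Z i u) p * (chi R p * cnj (v p)) \<partial>lborel)"
        by (simp add: mult_ac)
      also have "(\<integral>p. Z i (Z i u) p * (chi R p * cnj (v p)) \<partial>lborel) = - (\<integral>p. Z i u p * Z i (\<lambda>p. chi R p * cnj (v p)) p \<partial>lborel)"
        using cs by (intro integration_by_parts u1 Ck_mult c1 v1 disjI2 csupp_mult)
      also have "(\<lambda>p. Z i u p * Z i (\<lambda>p. chi R p * cnj (v p)) p)
          = (\<lambda>p. Z i (chi R) p * (Z i u p * cnj (v p)) + chi R p * (Z i u p * cnj (Z i v p)))"
        by (simp only: fun_eq_iff Z_mult[OF c1 v1(2)] Z_cnj[OF v1(1)]) (simp add: algebra_simps)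
      also have "(\<integral>p. Z i (chi R) p * (Z i u p * cnj (v p)) + chi R p * (Z i u p * cnj (Z i v p)) \<partial>lborel)
          = (\<integral>p. Z i (chi R) p * (Z i u p * cnj (v p)) \<partial>lborel) + (\<integral>p. chi R p * (Z i u p * cnj (Z i v p)) \<partial>lborel)"
        by (intro Bochner_Integration.integral_add int continuous_intros cont)
      finally show "(\<integral>p. - (chi R p * (Z i (Z i u) p * cnj (v p))) \<partial>lborel)
        = (\<integral>p. Z i (chi R) p * (Z i u p * cnj (v p)) \<partial>lborel) + (\<integral>p. chi R p * (Z i u p * cnj (Z i v p)) \<partial>lborel)"
        by simp
    qed
    finally show ?thesis .
  qed
  have "(\<lambda>m. \<integral>p. chi (real (Suc m)) p * (sublaplacian u p * cnj (v p)) \<partial>lborel) \<longlonglongrightarrow> (\<integral>p. sublaplacian u p * cnj (v p) \<partial>lborel)"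
    by (rule chi_limits(1)[OF iL(1)])
  moreover have "(\<lambda>m. \<integral>p. chi (real (Suc m)) p * (sublaplacian u p * cnj (v p)) \<partial>lborel)
      \<longlonglongrightarrow> (\<Sum>i\<in>UNIV. 0 + (\<integral>p. Z i u p * cnj (Z i v p) \<partial>lborel))"
    unfolding eq[OF of_nat_0_less_iff[THEN iffD2, OF zero_less_Suc]]
    by (intro tendsto_sum tendsto_add chi_limits iL)
  ultimately show ?thesis using LIMSEQ_unique by fastforce
qed

text \<open>The identity \<open>weak\<close> is applied to \<open>chi R\<close> times
  \<open>h\<close>, so that all derivatives stay on \<open>h\<close> and the cutoff. The terms with
  derivatives of the cutoff disappear in the limit, because \<open>h\<close> and the
  \<open>Z i h\<close> are square integrable.\<close>

lemma weak_kernel_extend: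
  fixes h K K' :: "'n::finite heis \<Rightarrow> complex"
  assumes h: "Ck 2 h" "in_L2 h" "in_L2 (sublaplacian h)" and K: "in_L2 K" "in_L2 K'"
    and weak: "\<And>u. Ck 2 u \<Longrightarrow> csupp u \<Longrightarrow> (\<integral>p. sublaplacian u p * K p \<partial>lborel) = (\<integral>p. u p * K' p \<partial>lborel)"
  shows "(\<integral>p. sublaplacian h p * K p \<partial>lborel) = (\<integral>p. h p * K' p \<partial>lborel)"
proof -
  have h1: "Ck 1 h" "Ck 1 (Z i h)" for i using h Ck_21 Ck_Z2 by blast+
  have iL: "integrable lborel (\<lambda>p. sublaplacian h p * K p)" "integrable lborel (\<lambda>p. Z i h p * K p)"
    "integrable lborel (\<lambda>p. h p * K p)" "integrable lborel (\<lambda>p. h p * K' p)" for i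
    using h K by (auto intro!: in_L2_mult caccioppoli)
  have bm: "integrable lborel (\<lambda>p. c p * F p)" if "integrable lborel F" "c \<in> borel_measurable borel" "\<And>p. norm (c p) \<le> B"
    for c F :: "'n heis \<Rightarrow> complex" and B
  proof (rule Bochner_Integration.integrable_bound)
    show "integrable lborel (\<lambda>p. B * norm (F p))" using that by simp
    show "AE p in lborel. norm (c p * F p) \<le> norm (B * norm (F p))"
      using that(3) by (auto simp: norm_mult intro!: AE_I2 order_trans[OF mult_right_mono abs_ge_self])
  qed (use that in \<open>auto dest: borel_measurable_integrable\<close>)
  have eq: "(\<integral>p. chi R p * (sublaplacian h p * K p) \<partial>lborel)
      - (\<Sum>i\<in>UNIV. 2 * (\<integral>p. Z i (chi R) p * (Z i h p * K p) \<partial>lborel) + (\<integral>p. Z i (Z i (chi R)) p * (h p * K p) \<partial>lborel))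
      = (\<integral>p. chi R p * (h p * K' p) \<partial>lborel)" if R: "R \<ge> 1" for R
  proof -
    let ?c = "chi R :: 'n heis \<Rightarrow> complex"
    have c1: "Ck 1 ?c" "Ck 1 (Z i ?c)" for i using Ck_21[OF Ck_chi] Ck_Z2[OF Ck_chi] by blast+
    have m: "?c \<in> borel_measurable borel" "Z i ?c \<in> borel_measurable borel" "Z i (Z i ?c) \<in> borel_measurable borel" for i
      using Ck_measurable c1 Ck_Z1 by blast+
    have int: "integrable lborel (\<lambda>p. ?c p * (sublaplacian h p * K p))" "integrable lborel (\<lambda>p. Z i ?c p * (Z i h p * K p))"
      "integrable lborel (\<lambda>p. Z i (Z i ?c) p * (h p * K p))" for i
      by (rule bm[OF iL(1) m(1) chi_norm] bm[OF iL(2) m(2) Z_chi_bounds(1)[OF R]] bm[OF iL(3) m(3) Z_chi_bounds(2)[OF R]])+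
    have C2: "Ck 2 (\<lambda>p. ?c p * h p)" by (intro Ck_mult Ck_chi h)
    have "sublaplacian (\<lambda>p. ?c p * h p) p
        = ?c p * sublaplacian h p - (\<Sum>i\<in>UNIV. 2 * (Z i ?c p * Z i h p) + Z i (Z i ?c) p * h p)" for p
    proof -
      have "Z i (Z i (\<lambda>p. ?c p * h p)) p = Z i (Z i ?c) p * h p + 2 * (Z i ?c p * Z i h p) + ?c p * Z i (Z i h) p" for i
      proof -
        have "Z i (\<lambda>p. ?c p * h p) = (\<lambda>p. Z i ?c p * h p + ?c p * Z i h p)"
          by (rule ext, rule Z_mult[OF c1(1) h1(1)])
        then have "Z i (Z i (\<lambda>p. ?c p * h p)) p = Z i (\<lambda>p. Z i ?c p * h p) p + Z i (\<lambda>p. ?c p * Z i h p) p"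
          by (simp only: Z_add[OF Ck_mult[OF c1(2) h1(1)] Ck_mult[OF c1(1) h1(2)]])
        also have "\<dots> = (Z i (Z i ?c) p * h p + Z i ?c p * Z i h p) + (Z i ?c p * Z i h p + ?c p * Z i (Z i h) p)"
          by (simp only: Z_mult[OF c1(2) h1(1)] Z_mult[OF c1(1) h1(2)])
        finally show ?thesis by simp
      qed
      then show ?thesis
        unfolding sublaplacian_eq[OF C2] sublaplacian_eq[OF h(1)]
        by (simp add: sum.distrib sum_distrib_left algebra_simps)
    qed
    then have "(\<integral>p. sublaplacian (\<lambda>p. ?c p * h p) p * K p \<partial>lborel)
        = (\<integral>p. ?c p * (sublaplacian h p * K p)
            - (\<Sum>i\<in>UNIV. 2 * (Z i ?c p * (Z i h p * K p)) + Z i (Z i ?c) p * (h p * K p)) \<partial>lborel)"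
      by (simp add: left_diff_distrib sum_distrib_right distrib_right mult.assoc)
    also have "\<dots> = (\<integral>p. ?c p * (sublaplacian h p * K p) \<partial>lborel)
        - (\<integral>p. (\<Sum>i\<in>UNIV. 2 * (Z i ?c p * (Z i h p * K p)) + Z i (Z i ?c) p * (h p * K p)) \<partial>lborel)"
      by (intro Bochner_Integration.integral_diff int Bochner_Integration.integrable_sum Bochner_Integration.integrable_add integrable_mult_right)
    also have "(\<integral>p. (\<Sum>i\<in>UNIV. 2 * (Z i ?c p * (Z i h p * K p)) + Z i (Z i ?c) p * (h p * K p)) \<partial>lborel)
        = (\<Sum>i\<in>UNIV. \<integral>p. 2 * (Z i ?c p * (Z i h p * K p)) + Z i (Z i ?c) p * (h p * K p) \<partial>lborel)"
      by (intro Bochner_Integration.integral_sum int Bochner_Integration.integrable_add integrable_mult_right)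
    also have "\<dots> = (\<Sum>i\<in>UNIV. 2 * (\<integral>p. Z i ?c p * (Z i h p * K p) \<partial>lborel) + (\<integral>p. Z i (Z i ?c) p * (h p * K p) \<partial>lborel))"
      using int by (intro sum.cong refl) simp
    finally have "(\<integral>p. sublaplacian (\<lambda>p. ?c p * h p) p * K p \<partial>lborel) = (\<integral>p. ?c p * (sublaplacian h p * K p) \<partial>lborel)
      - (\<Sum>i\<in>UNIV. 2 * (\<integral>p. Z i ?c p * (Z i h p * K p) \<partial>lborel) + (\<integral>p. Z i (Z i ?c) p * (h p * K p) \<partial>lborel))" .
    moreover have "(\<integral>p. sublaplacian (\<lambda>p. ?c p * h p) p * K p \<partial>lborel) = (\<integral>p. (?c p * h p) * K' p \<partial>lborel)"
      using R by (intro weak C2 csupp_mult csupp_chi) auto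
    ultimately show ?thesis by (simp add: mult.assoc)
  qed
  have "(\<lambda>m. (\<integral>p. chi (real (Suc m)) p * (sublaplacian h p * K p) \<partial>lborel)
      - (\<Sum>i\<in>UNIV. 2 * (\<integral>p. Z i (chi (real (Suc m))) p * (Z i h p * K p) \<partial>lborel)
          + (\<integral>p. Z i (Z i (chi (real (Suc m)))) p * (h p * K p) \<partial>lborel)))
      \<longlonglongrightarrow> (\<integral>p. sublaplacian h p * K p \<partial>lborel) - (\<Sum>i\<in>(UNIV :: ('n + 'n) set). 2 * 0 + 0)"
    by (intro tendsto_diff tendsto_sum tendsto_add tendsto_mult tendsto_const chi_limits iL)
  moreover have "(\<lambda>m. (\<integral>p. chi (real (Suc m)) p * (sublaplacian h p * K p) \<partial>lborel)
      - (\<Sum>i\<in>UNIV. 2 * (\<integral>p. Z i (chi (real (Suc m))) p * (Z i h p * K p) \<partial>lborel)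
          + (\<integral>p. Z i (Z i (chi (real (Suc m)))) p * (h p * K p) \<partial>lborel)))
      \<longlonglongrightarrow> (\<integral>p. h p * K' p \<partial>lborel)"
  proof (rule Lim_transform_eventually[OF chi_limits(1)[OF iL(4)]], intro always_eventually allI)
    show "(\<integral>p. chi (real (Suc m)) p * (h p * K' p) \<partial>lborel)
      = (\<integral>p. chi (real (Suc m)) p * (sublaplacian h p * K p) \<partial>lborel)
      - (\<Sum>i\<in>UNIV. 2 * (\<integral>p. Z i (chi (real (Suc m))) p * (Z i h p * K p) \<partial>lborel)
          + (\<integral>p. Z i (Z i (chi (real (Suc m)))) p * (h p * K p) \<partial>lborel))" for m
      by (rule eq[symmetric]) simp
  qed
  ultimately show ?thesis using LIMSEQ_unique by fastforce
qed

text \<open>A Fourier mode in \<open>t\<close> of the heat kernel, without the amplitude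
  \<open>mA s l ^ n\<close>.\<close>

definition hE :: "real \<Rightarrow> real \<Rightarrow> 'n::finite heis \<Rightarrow> complex" where
  "hE s l p = exp (of_real (- mB s l) * of_real (hq p) + (\<i> * of_real l) * of_real (snd p))"

lemma Ck_hE: "Ck n (hE s l)"
  unfolding hE_def[abs_def] by (intro Ck_exp Ck_add Ck_mult Ck_const Ck_hq Ck_snd)

lemma mB_square: assumes "s > 0" "l \<noteq> 0" shows "16 * (mB s l)\<^sup>2 = l\<^sup>2 + (mA s l)\<^sup>2"
proof -
  have "sinh (s * l) \<noteq> 0" using assms by simp
  then show ?thesis
    by (simp add: mB_def mA_def power_divide power_mult_distrib cosh_square_eq field_simps)
qed

text \<open>The fields map the exponent to \<open>w i\<close>. In the sum of the squares the
  imaginary parts cancel by the orthogonality in \<open>sum_coeff\<close>, and the rest collapses to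
  \<open>mA^2 |z|^2 / 4\<close> by \<open>mB_square\<close>. The outcome is the factor in
  \<open>mP'\<close>.\<close>

lemma sublaplacian_hE:
  assumes "s > 0" "l \<noteq> 0"
  shows "sublaplacian (hE s l :: 'n::finite heis \<Rightarrow> complex) p
    = of_real (4 * real CARD('n) * mB s l - (mA s l)\<^sup>2 * (hq p / 4)) * hE s l p"
proof -
  let ?B = "mB s l"
  define w where "w i p = of_real (- 2 * ?B) * complex_of_real (heis_coord i p) + (\<i> * of_real l) * of_real (heis_coeff i p)"
    for i and p :: "'n heis"
  define \<phi> where "\<phi> p = of_real (- mB s l) * of_real (hq p) + (\<i> * of_real l) * complex_of_real (snd p)" for p :: "'n heis"
  have hE: "hE s l = (\<lambda>p::'n heis. exp (\<phi> p))" by (simp add: fun_eq_iff hE_def \<phi>_def)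
  have Z\<phi>: "Z i \<phi> = w i" for i
  proof
    fix p
    have "Z i \<phi> p = Z i (\<lambda>p. of_real (- mB s l) * complex_of_real (hq p)) p
        + Z i (\<lambda>p. (\<i> * of_real l) * complex_of_real (snd p)) p"
      unfolding \<phi>_def[abs_def] by (rule Z_add) (intro Ck_mult Ck_const Ck_hq Ck_snd)+
    also have "\<dots> = w i p"
      by (simp only: Z_mult[OF Ck_const Ck_hq] Z_mult[OF Ck_const Ck_snd] Z_const Z_hq Z_snd) (simp add: w_def)
    finally show "Z i \<phi> p = w i p" .
  qed
  have C\<phi>: "Ck 1 \<phi>" unfolding \<phi>_def[abs_def] by (intro Ck_add Ck_mult Ck_const Ck_hq Ck_snd)
  have Cw: "Ck 1 (w i)" for i unfolding w_def[abs_def]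
    by (intro Ck_add Ck_mult Ck_const Ck_coord Ck_coeff)
  have Zw: "Z i (w i) p = of_real (- 2 * ?B)" for i p
  proof -
    have "Z i (w i) p = Z i (\<lambda>p. of_real (- 2 * ?B) * complex_of_real (heis_coord i p)) p
        + Z i (\<lambda>p. (\<i> * of_real l) * of_real (heis_coeff i p)) p"
      unfolding w_def[abs_def] by (rule Z_add) (intro Ck_mult Ck_const Ck_coord Ck_coeff)+
    also have "\<dots> = of_real (- 2 * ?B)"
      by (simp only: Z_mult[OF Ck_const Ck_coord] Z_mult[OF Ck_const Ck_coeff] Z_const Z_coord_self Z_coeff_self) simp
    finally show ?thesis .
  qed
  have ZE: "Z i (\<lambda>p. exp (\<phi> p)) = (\<lambda>p. w i p * exp (\<phi> p))" for i
    by (rule ext) (simp only: Z_exp[OF C\<phi>] Z\<phi>)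
  have ZZ: "Z i (Z i (\<lambda>p. exp (\<phi> p))) p = (of_real (- 2 * ?B) + (w i p)\<^sup>2) * exp (\<phi> p)" for i p
    unfolding ZE Z_mult[OF Cw Ck_exp[OF C\<phi>]] Zw by (simp add: power2_eq_square algebra_simps)
  have wsq: "(w i p)\<^sup>2 = of_real (4 * ?B\<^sup>2 * (heis_coord i p)\<^sup>2 - l\<^sup>2 * (heis_coeff i p)\<^sup>2)
      + \<i> * of_real (- 4 * ?B * l * (heis_coord i p * heis_coeff i p))" for i
    by (simp add: w_def complex_eq_iff power2_eq_square algebra_simps)
  have "(\<Sum>i\<in>UNIV. (w i p)\<^sup>2) = of_real (4 * ?B\<^sup>2 * hq p - l\<^sup>2 * (hq p / 4))"
    unfolding wsq sum.distrib of_real_sum[symmetric] sum_distrib_left[symmetric] sum_subtractf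
    unfolding sum_coeff(1) sum_coeff(2) unfolding hq_eq[symmetric] by simp
  also have "4 * ?B\<^sup>2 * hq p - l\<^sup>2 * (hq p / 4) = (mA s l)\<^sup>2 * (hq p / 4)"
  proof -
    have "4 * ?B\<^sup>2 * hq p - l\<^sup>2 * (hq p / 4) = (16 * ?B\<^sup>2 - l\<^sup>2) * (hq p / 4)" by (simp add: algebra_simps)
    then show ?thesis using mB_square[OF assms] by simp
  qed
  finally have sw: "(\<Sum>i\<in>UNIV. (w i p)\<^sup>2) = of_real ((mA s l)\<^sup>2 * (hq p / 4))" .
  have "sublaplacian (hE s l) p = - ((\<Sum>i\<in>(UNIV::('n + 'n) set). of_real (- 2 * ?B) + (w i p)\<^sup>2) * exp (\<phi> p))"
    unfolding sublaplacian_eq[OF Ck_hE] unfolding hE ZZ sum_distrib_right[symmetric] ..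
  also have "(\<Sum>i\<in>(UNIV::('n + 'n) set). of_real (- 2 * ?B) + (w i p)\<^sup>2) = of_real (- 4 * real CARD('n) * ?B + (mA s l)\<^sup>2 * (hq p / 4))"
    unfolding sum.distrib sw by simp
  finally show ?thesis unfolding hE by (simp add: algebra_simps)
qed

subsection \<open>Pairings with the heat kernel\<close>

lemma in_L2_abs_mult:
  assumes "in_L2 u" "in_L2 v" shows "integrable lborel (\<lambda>p. cmod (u p) * cmod (v p))"
  using integrable_norm[OF in_L2_mult[OF assms]] by (simp add: norm_mult)

lemma L2_norm_square: "(L2_norm u)\<^sup>2 = (\<integral>p. (cmod (u p))\<^sup>2 \<partial>lborel)"
  unfolding L2_norm_def by simp

lemma L2_norm_nonneg: "L2_norm u \<ge> 0"
  unfolding L2_norm_def by simp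

text \<open>Integrates \<open>2 a b \<le> r a^2 + b^2 / r\<close>. The best \<open>r\<close> is the
  quotient of the two norms; adding \<open>e\<close> to both keeps it meaningful when a norm is 0,
  and \<open>e\<close> then tends to 0.\<close>

lemma L2_cauchy_schwarz:
  assumes "in_L2 u" "in_L2 v"
  shows "(\<integral>p. cmod (u p) * cmod (v p) \<partial>lborel) \<le> L2_norm u * L2_norm v"
proof -
  let ?I = "\<integral>p. cmod (u p) * cmod (v p) \<partial>lborel"
  have *: "2 * ?I \<le> r * (L2_norm u)\<^sup>2 + (L2_norm v)\<^sup>2 / r" if r: "r > 0" for r
  proof -
    have "2 * ?I = (\<integral>p. 2 * (cmod (u p) * cmod (v p)) \<partial>lborel)" by simp
    also have "\<dots> \<le> (\<integral>p. r * (cmod (u p))\<^sup>2 + (cmod (v p))\<^sup>2 / r \<partial>lborel)"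
    proof (rule integral_mono)
      fix p
      have "2 * (sqrt r * cmod (u p)) * (cmod (v p) / sqrt r) \<le> (sqrt r * cmod (u p))\<^sup>2 + (cmod (v p) / sqrt r)\<^sup>2"
        by (rule sum_squares_bound)
      then show "2 * (cmod (u p) * cmod (v p)) \<le> r * (cmod (u p))\<^sup>2 + (cmod (v p))\<^sup>2 / r"
        using r by (simp add: power_mult_distrib power_divide)
    qed (use assms in_L2_abs_mult[OF assms] in \<open>auto simp: in_L2_def\<close>)
    also have "\<dots> = r * (L2_norm u)\<^sup>2 + (L2_norm v)\<^sup>2 / r"
      using assms by (simp add: in_L2_def L2_norm_square)
    finally show ?thesis .
  qed
  define a b where "a = L2_norm u" and "b = L2_norm v"
  have ab: "a \<ge> 0" "b \<ge> 0" by (simp_all add: a_def b_def L2_norm_nonneg)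
  have **: "?I \<le> (a + e) * (b + e)" if e: "e > 0" for e
  proof -
    have p: "a + e > 0" "b + e > 0" using ab e by auto
    have "2 * ?I \<le> (b + e) / (a + e) * a\<^sup>2 + b\<^sup>2 / ((b + e) / (a + e))"
      using *[of "(b + e) / (a + e)"] p by (simp add: a_def b_def)
    also have "\<dots> \<le> (b + e) / (a + e) * (a + e)\<^sup>2 + (b + e)\<^sup>2 / ((b + e) / (a + e))"
      using ab e p by (intro add_mono mult_left_mono divide_right_mono power_mono) auto
    also have "\<dots> = 2 * (a + e) * (b + e)" using p by (simp add: power2_eq_square)
    finally show ?thesis by (simp only: mult.assoc mult_le_cancel_left_pos[OF zero_less_numeral])
  qed
  have "?I \<le> (a + inverse (real (Suc m))) * (b + inverse (real (Suc m)))" for m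
    by (rule **) simp
  moreover have "(\<lambda>m. (a + inverse (real (Suc m))) * (b + inverse (real (Suc m)))) \<longlonglongrightarrow> (a + 0) * (b + 0)"
    by (intro tendsto_intros LIMSEQ_inverse_real_of_nat)
  ultimately have "?I \<le> (a + 0) * (b + 0)" by (intro LIMSEQ_le_const) auto
  then show ?thesis by (simp add: a_def b_def)
qed

text \<open>The automorphic dilations, parametrised by the square of the usual factor so that
  \<open>s\<close> is heat kernel time: the gauge and the decay exponent scale by \<open>s\<close>,
  Lebesgue measure by \<open>s^(n + 1)\<close>.\<close>

definition dil :: "real \<Rightarrow> 'n::finite heis \<Rightarrow> 'n heis" where
  "dil s p = (sqrt s *\<^sub>R fst p, s * snd p)"

lemma hq_dil: "s > 0 \<Longrightarrow> hq (dil s p) = s * hq p"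
  by (simp add: hq_def dil_def power_mult_distrib)

lemma lborel_dil:
  assumes s: "s > 0"
  shows "lborel = density (distr lborel borel (dil s)) (\<lambda>_::'n::finite heis. ennreal (s ^ (CARD('n) + 1)))"
proof -
  \<comment> \<open>A basis vector with vanishing first component is the \<open>t\<close> direction.
    The \<open>2n\<close> real directions of \<open>z\<close> contribute \<open>s^n\<close> to the
    determinant.\<close>
  define c where "c j = (if fst j = 0 then s else sqrt s)" for j :: "'n heis"
  have T: "(\<lambda>x. 0 + (\<Sum>j\<in>Basis. (c j * (x \<bullet> j)) *\<^sub>R j)) = (dil s :: 'n heis \<Rightarrow> 'n heis)"
  proof
    fix x :: "'n heis"
    have "(\<Sum>j\<in>Basis. (c j * (x \<bullet> j)) *\<^sub>R j)
        = (\<Sum>i\<in>Basis. (c (i, 0) * (x \<bullet> (i, 0))) *\<^sub>R (i, 0)) + (\<Sum>i\<in>Basis. (c (0, i) * (x \<bullet> (0, i))) *\<^sub>R (0, i))"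
      by (rule sum_Basis_prod_eq)
    also have "(\<Sum>i\<in>Basis. (c (i, 0) * (x \<bullet> (i, 0))) *\<^sub>R (i, 0 :: real)) = (\<Sum>i\<in>Basis. (sqrt s *\<^sub>R ((fst x \<bullet> i) *\<^sub>R i), 0))"
      by (intro sum.cong refl) (auto simp: c_def inner_prod_def nonzero_Basis)
    also have "\<dots> = (sqrt s *\<^sub>R fst x, 0)"
      unfolding sum_prod by (simp add: euclidean_representation flip: scaleR_sum_right scaleR_scaleR)
    also have "(\<Sum>i\<in>Basis. (c (0, i) * (x \<bullet> (0, i))) *\<^sub>R (0 :: complex ^ 'n, i)) = (0, s * snd x)"
      by (simp add: c_def inner_prod_def)
    finally show "0 + (\<Sum>j\<in>Basis. (c j * (x \<bullet> j)) *\<^sub>R j) = dil s x" by (simp add: dil_def)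
  qed
  have "(\<Prod>j\<in>Basis. \<bar>c j\<bar>) = (\<Prod>j\<in>(\<lambda>u. (u, 0)) ` (Basis :: (complex ^ 'n) set). \<bar>c j\<bar>) * (\<Prod>j\<in>(\<lambda>u. (0, u)) ` (Basis :: real set). \<bar>c j\<bar>)"
    unfolding Basis_prod_def by (rule prod.union_disjoint) auto
  also have "(\<Prod>j\<in>(\<lambda>u. (u, 0)) ` (Basis :: (complex ^ 'n) set). \<bar>c j\<bar>) = (\<Prod>u\<in>(Basis :: (complex ^ 'n) set). sqrt s)"
    using s by (subst prod.reindex) (auto simp: inj_on_def c_def nonzero_Basis intro!: prod.cong)
  also have "\<dots> = s ^ CARD('n)"
    using s by (simp add: power_mult mult.commute[of 2] flip: real_sqrt_power)
  also have "(\<Prod>j\<in>(\<lambda>u. (0, u)) ` (Basis :: real set). \<bar>c j\<bar>) = s"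
    using s by (simp add: c_def)
  finally have P: "(\<Prod>j\<in>(Basis :: 'n heis set). \<bar>c j\<bar>) = s ^ (CARD('n) + 1)" by simp
  have "lborel = density (distr lborel borel (\<lambda>x. 0 + (\<Sum>j\<in>Basis. (c j * (x \<bullet> j)) *\<^sub>R j))) (\<lambda>_::'n heis. ennreal (\<Prod>j\<in>Basis. \<bar>c j\<bar>))"
    using s by (intro lborel_affine_euclidean) (auto simp: c_def)
  then show ?thesis unfolding T P .
qed

lemma dil_measurable [measurable]: "dil s \<in> borel_measurable borel"
  unfolding dil_def[abs_def] by (intro borel_measurable_continuous_onI continuous_intros)

lemma integral_dil:
  fixes F :: "'n::finite heis \<Rightarrow> 'b::{banach, second_countable_topology}"
  assumes s: "s > 0" and [measurable]: "F \<in> borel_measurable borel"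
  shows "(\<integral>p. F p \<partial>lborel) = s ^ (CARD('n) + 1) *\<^sub>R (\<integral>p. F (dil s p) \<partial>lborel)"
proof -
  have "(\<integral>p. F p \<partial>lborel) = (\<integral>p. F p \<partial>density (distr lborel borel (dil s)) (\<lambda>_::'n heis. ennreal (s ^ (CARD('n) + 1))))"
    using lborel_dil[OF s, where 'n = 'n] by simp
  also have "\<dots> = (\<integral>p. s ^ (CARD('n) + 1) *\<^sub>R F p \<partial>distr lborel borel (dil s))"
    using s by (intro integral_density) auto
  also have "\<dots> = (\<integral>p. s ^ (CARD('n) + 1) *\<^sub>R F (dil s p) \<partial>lborel)"
    by (intro integral_distr) auto
  finally show ?thesis by simp
qed

text \<open>The decay exponent of \<open>hk_bounds\<close>. It has degree 1 under
  \<open>dil\<close>, and dominates the gauge up to the factor 16.\<close>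

definition hw :: "'n::finite heis \<Rightarrow> real" where "hw p = hq p / 16 + \<bar>snd p\<bar>"

lemma hw_dil: "s > 0 \<Longrightarrow> hw (dil s p) = s * hw p"
  unfolding hw_def by (subst hq_dil) (auto simp: dil_def abs_mult algebra_simps)

lemma hw_nonneg: "hw p \<ge> 0"
  by (simp add: hw_def hq_nonneg)

text \<open>From \<open>r^2 \<ge> 2 r - 1\<close> with \<open>r\<close> the norm of
  \<open>z\<close>. Linear growth is what integrability of the exponential requires.\<close>

lemma hw_ge: "hw p \<ge> norm p / 8 - 1 / 16"
proof -
  have "(norm (fst p) - 1)\<^sup>2 \<ge> 0" by simp
  then have "hq p \<ge> 2 * norm (fst p) - 1" by (simp add: hq_def power2_diff)
  moreover have "norm p \<le> norm (fst p) + norm (snd p)" by (metis norm_Pair_le prod.collapse)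
  ultimately show ?thesis by (simp add: hw_def)
qed

lemma hq_measurable [measurable]: "(hq :: 'n::finite heis \<Rightarrow> real) \<in> borel_measurable borel"
  unfolding hq_def[abs_def] by (intro borel_measurable_continuous_onI continuous_intros)

lemma heis_snd_measurable: "(snd :: 'n::finite heis \<Rightarrow> real) \<in> borel_measurable borel"
  by (intro borel_measurable_continuous_onI continuous_intros)

lemma hw_measurable [measurable]: "(hw :: 'n::finite heis \<Rightarrow> real) \<in> borel_measurable borel"
  unfolding hw_def[abs_def] by (intro borel_measurable_continuous_onI continuous_intros) (auto simp: hq_def intro!: continuous_intros)

lemma integrable_exp_hw:
  assumes a: "a > 0" shows "integrable lborel (\<lambda>p::'n::finite heis. exp (- a * hw p))"
proof (rule Bochner_Integration.integrable_bound)
  show "integrable lborel (\<lambda>p::'n heis. exp (a / 16) * exp (- (a / 8) * norm p))"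
    using integrable_exp_norm[of "a / 8"] a by simp
  show "AE p in lborel. norm (exp (- a * hw p)) \<le> norm (exp (a / 16) * exp (- (a / 8) * norm (p::'n heis)))"
  proof (rule AE_I2)
    fix p :: "'n heis"
    have "a * (norm p / 8 - 1 / 16) \<le> a * hw p" using hw_ge[of p] a by (intro mult_left_mono) auto
    then show "norm (exp (- a * hw p)) \<le> norm (exp (a / 16) * exp (- (a / 8) * norm p))"
      by (simp add: algebra_simps flip: exp_add)
  qed
qed simp

lemma in_L2_exp_hw:
  assumes a: "a > 0" shows "in_L2 (\<lambda>p::'n::finite heis. complex_of_real (exp (- a * hw p)))"
proof -
  have "(\<lambda>p::'n heis. (cmod (complex_of_real (exp (- a * hw p))))\<^sup>2) = (\<lambda>p. exp (- (2 * a) * hw p))"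
    by (simp add: fun_eq_iff flip: exp_double)
  then show ?thesis using integrable_exp_hw[of "2 * a"] a by (simp add: in_L2_def)
qed

section \<open>The heat kernel on the group and its weak equation\<close>

definition heatk :: "real \<Rightarrow> 'n::finite heis \<Rightarrow> complex" where
  "heatk s p = hk CARD('n) s (hq p) (snd p)"
definition heatk' :: "real \<Rightarrow> 'n::finite heis \<Rightarrow> complex" where
  "heatk' s p = hk' CARD('n) s (hq p) (snd p)"

lemma card_ge_1: "CARD('n::finite) \<ge> 1"
  by (simp add: Suc_le_eq)

lemma heatk_bounds:
  fixes p :: "'n::finite heis"
  assumes "s > 0"
  shows "norm (heatk s p) \<le> hK CARD('n) / s ^ (CARD('n) + 1) * exp (- hw p / s)"
    and "norm (heatk' s p) \<le> hK CARD('n) / s ^ (CARD('n) + 2) * exp (- hw p / s)"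
  using hk_bounds[where n = "CARD('n)" and t = "snd p", OF assms hq_nonneg[of p] card_ge_1]
  by (simp_all add: heatk_def heatk'_def hw_def)

lemma heatk_measurable [measurable]:
  "(heatk s :: 'n::finite heis \<Rightarrow> complex) \<in> borel_measurable borel"
  "(heatk' s :: 'n::finite heis \<Rightarrow> complex) \<in> borel_measurable borel"
  unfolding heatk_def[abs_def] heatk'_def[abs_def]
  by (rule hk_measurable[OF hq_measurable heis_snd_measurable])+

lemma in_L2_bound:
  assumes "in_L2 v" "u \<in> borel_measurable borel" "\<And>p. norm (u p) \<le> C * norm (v p)"
  shows "in_L2 u"
  unfolding in_L2_def
proof
  show "integrable lborel (\<lambda>p. (cmod (u p))\<^sup>2)"
  proof (rule Bochner_Integration.integrable_bound)
    show "integrable lborel (\<lambda>p. C\<^sup>2 * (cmod (v p))\<^sup>2)" using assms by (simp add: in_L2_def)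
    show "AE p in lborel. norm ((cmod (u p))\<^sup>2) \<le> norm (C\<^sup>2 * (cmod (v p))\<^sup>2)"
    proof (rule AE_I2)
      fix p
      have "(cmod (u p))\<^sup>2 \<le> (C * cmod (v p))\<^sup>2" using assms(3)[of p] by (intro power_mono) auto
      then show "norm ((cmod (u p))\<^sup>2) \<le> norm (C\<^sup>2 * (cmod (v p))\<^sup>2)" by (simp add: power_mult_distrib)
    qed
  qed (use assms in simp)
qed (use assms in simp)

lemma in_L2_heatk:
  assumes s: "s > 0"
  shows "in_L2 (heatk s :: 'n::finite heis \<Rightarrow> complex)" "in_L2 (heatk' s :: 'n::finite heis \<Rightarrow> complex)"
proof -
  have e: "in_L2 (\<lambda>p::'n heis. complex_of_real (exp (- (1 / s) * hw p)))" by (rule in_L2_exp_hw) (use s in simp)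
  show "in_L2 (heatk s :: 'n heis \<Rightarrow> complex)"
    by (rule in_L2_bound[OF e heatk_measurable(1), of _ "hK CARD('n) / s ^ (CARD('n) + 1)"]) (use heatk_bounds(1)[OF s] in simp)
  show "in_L2 (heatk' s :: 'n heis \<Rightarrow> complex)"
    by (rule in_L2_bound[OF e heatk_measurable(2), of _ "hK CARD('n) / s ^ (CARD('n) + 2)"]) (use heatk_bounds(2)[OF s] in simp)
qed

text \<open>The pairing with the kernel becomes an integral over frequencies of pairings with the
  modes, on which the sublaplacian acts by an explicit factor. Fubini applies since the amplitudes
  are bounded by an integrable function of \<open>l\<close>, uniformly in the point.\<close>

lemma heatk_fubini:
  fixes g :: "'n::finite heis \<Rightarrow> complex"
  assumes s: "s > 0" and g: "integrable lborel g"
  shows "(\<integral>p. g p * heatk s p \<partial>lborel) = (\<integral>l. of_real (mA s l ^ CARD('n)) * (\<integral>p. g p * hE s l p \<partial>lborel) \<partial>lborel)"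
    and "(\<integral>p. g p * heatk' s p \<partial>lborel)
      = (\<integral>l. of_real (mA s l ^ CARD('n)) * (\<integral>p. g p * (of_real (4 * real CARD('n) * mB s l - (mA s l)\<^sup>2 * (hq p / 4)) * hE s l p) \<partial>lborel) \<partial>lborel)"
proof -
  have gm [measurable]: "g \<in> borel_measurable borel" using borel_measurable_integrable[OF g] by simp
  \<comment> \<open>A general amplitude \<open>m\<close> covers \<open>mP\<close> and
    \<open>mP'\<close> at once.\<close>
  have main: "(\<integral>p. g p * (\<integral>l. exp (\<i> * of_real (snd p * l)) * of_real (m (hq p) l) \<partial>lborel) \<partial>lborel)
      = (\<integral>l. (\<integral>p. g p * (exp (\<i> * of_real (snd p * l)) * of_real (m (hq p) l)) \<partial>lborel) \<partial>lborel)"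
    if mm: "(\<lambda>x. m (hq (fst x)) (snd x)) \<in> borel_measurable (lborel \<Otimes>\<^sub>M lborel :: ('n heis \<times> real) measure)"
      and b: "\<And>p l. \<bar>m (hq (p::'n heis)) l\<bar> \<le> C * exp (- s * \<bar>l\<bar> / 4)"
      and mi: "\<And>p. integrable lborel (\<lambda>l. exp (\<i> * of_real (snd p * l)) * complex_of_real (m (hq (p::'n heis)) l))" for m C
  proof -
    let ?F = "\<lambda>x. g (fst x) * (exp (\<i> * of_real (snd (fst x) * snd x)) * complex_of_real (m (hq (fst x)) (snd x)))"
    have ei: "integrable lborel (\<lambda>l::real. C * exp (- s * \<bar>l\<bar> / 4))"
      using integrable_exp_norm[of "s / 4", where 'a = real] s by simp
    have mult: "(\<lambda>x. A x * (exp (\<i> * of_real (B x)) * complex_of_real (D x))) \<in> borel_measurable (lborel \<Otimes>\<^sub>M lborel)"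
      if [measurable]: "A \<in> borel_measurable (lborel \<Otimes>\<^sub>M lborel)" "B \<in> borel_measurable (lborel \<Otimes>\<^sub>M lborel)"
        "D \<in> borel_measurable (lborel \<Otimes>\<^sub>M lborel)" for A and B D :: "'n heis \<times> real \<Rightarrow> real"
      by measurable
    have f1: "(\<lambda>x. g (fst x)) \<in> borel_measurable (lborel \<Otimes>\<^sub>M lborel :: ('n heis \<times> real) measure)"
      "(\<lambda>x. snd (fst x)) \<in> borel_measurable (lborel \<Otimes>\<^sub>M lborel :: ('n heis \<times> real) measure)"
      using measurable_compose[OF measurable_fst[of lborel lborel], of g borel]
        measurable_compose[OF measurable_fst[of lborel lborel], of snd borel] gm heis_snd_measurable by simp_all
    have f2: "snd \<in> borel_measurable (lborel \<Otimes>\<^sub>M lborel :: ('n heis \<times> real) measure)"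
      using measurable_snd[of "lborel :: 'n heis measure" "lborel :: real measure"] by simp
    have Fm [measurable]: "?F \<in> borel_measurable (lborel \<Otimes>\<^sub>M lborel)"
      by (rule mult[OF f1(1) borel_measurable_times[OF f1(2) f2] mm])
    have "integrable (lborel \<Otimes>\<^sub>M lborel) ?F"
    proof (rule lborel_pair.Fubini_integrable[OF Fm])
      show "integrable lborel (\<lambda>p. \<integral>l. norm (?F (p, l)) \<partial>lborel)"
      proof (rule Bochner_Integration.integrable_bound)
        show "integrable lborel (\<lambda>p. norm (g p) * (\<integral>l. C * exp (- s * \<bar>l\<bar> / 4) \<partial>lborel))"
          using integrable_norm[OF g] by simp
        show "(\<lambda>p. \<integral>l. norm (?F (p, l)) \<partial>lborel) \<in> borel_measurable lborel"
          by (rule lborel.borel_measurable_lebesgue_integral) (use measurable_compose[OF Fm borel_measurable_norm] in \<open>simp add: case_prod_beta'\<close>)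
        show "AE p in lborel. norm (\<integral>l. norm (?F (p, l)) \<partial>lborel) \<le> norm (norm (g p) * (\<integral>l. C * exp (- s * \<bar>l\<bar> / 4) \<partial>lborel))"
        proof (rule AE_I2)
          fix p
          have "(\<integral>l. norm (?F (p, l)) \<partial>lborel) = norm (g p) * (\<integral>l. \<bar>m (hq p) l\<bar> \<partial>lborel)"
            by (simp add: norm_mult)
          also have "\<dots> \<le> norm (g p) * (\<integral>l. C * exp (- s * \<bar>l\<bar> / 4) \<partial>lborel)"
            by (intro mult_left_mono integral_mono' ei order_trans[OF abs_ge_zero b] b norm_ge_zero)
          finally show "norm (\<integral>l. norm (?F (p, l)) \<partial>lborel) \<le> norm (norm (g p) * (\<integral>l. C * exp (- s * \<bar>l\<bar> / 4) \<partial>lborel))"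
            by (simp add: abs_of_nonneg integral_nonneg_AE)
        qed
      qed
      show "AE p in lborel. integrable lborel (\<lambda>l. ?F (p, l))"
        using mi by (intro AE_I2) simp
    qed
    then have "(\<integral>l. (\<integral>p. ?F (p, l) \<partial>lborel) \<partial>lborel) = (\<integral>p. (\<integral>l. ?F (p, l) \<partial>lborel) \<partial>lborel)"
      by (intro lborel_pair.Fubini_integral) (simp add: case_prod_beta')
    then show ?thesis by simp
  qed
  have v: "hq p / s \<ge> 0" for p :: "'n heis" using hq_nonneg[of p] s by simp
  have e1: "exp (- (hq p / s) / 16) \<le> 1" for p :: "'n heis" using v[of p] by simp
  have b1: "\<bar>mP CARD('n) s (hq p) l\<bar> \<le> hC CARD('n) / s ^ CARD('n) * exp (- s * \<bar>l\<bar> / 4)" for l and p :: "'n heis"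
  proof -
    have "\<bar>mP CARD('n) s (hq p) l\<bar> \<le> hC CARD('n) / s ^ CARD('n) * exp (- (hq p / s) / 16) * exp (- s * \<bar>l\<bar> / 4)"
      by (rule mP_bound(1)[OF s hq_nonneg card_ge_1])
    also have "\<dots> \<le> hC CARD('n) / s ^ CARD('n) * 1 * exp (- s * \<bar>l\<bar> / 4)"
      using e1 s by (intro mult_right_mono mult_left_mono) (auto simp: hC_def)
    finally show ?thesis by simp
  qed
  have b2: "\<bar>mP' CARD('n) s (hq p) l\<bar> \<le> hC CARD('n) / s ^ Suc CARD('n) * exp (- s * \<bar>l\<bar> / 4)" for l and p :: "'n heis"
  proof -
    have "\<bar>mP' CARD('n) s (hq p) l\<bar> \<le> hC CARD('n) / s ^ Suc CARD('n) * exp (- (hq p / s) / 16) * exp (- s * \<bar>l\<bar> / 4)"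
      by (rule mP_bound(2)[OF s hq_nonneg card_ge_1])
    also have "\<dots> \<le> hC CARD('n) / s ^ Suc CARD('n) * 1 * exp (- s * \<bar>l\<bar> / 4)"
      using e1 s by (intro mult_right_mono mult_left_mono) (auto simp: hC_def)
    finally show ?thesis by simp
  qed
  have hqf: "(\<lambda>x. hq (fst x)) \<in> borel_measurable (lborel \<Otimes>\<^sub>M lborel :: ('n heis \<times> real) measure)"
    using measurable_compose[OF measurable_fst[of lborel lborel], of hq borel] hq_measurable by simp
  have sn: "snd \<in> borel_measurable (lborel \<Otimes>\<^sub>M lborel :: ('n heis \<times> real) measure)"
    using measurable_snd[of "lborel :: 'n heis measure" "lborel :: real measure"] by simp
  have mm1: "(\<lambda>x. mP CARD('n) s (hq (fst x)) (snd x)) \<in> borel_measurable (lborel \<Otimes>\<^sub>M lborel :: ('n heis \<times> real) measure)"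
    and mm2: "(\<lambda>x. mP' CARD('n) s (hq (fst x)) (snd x)) \<in> borel_measurable (lborel \<Otimes>\<^sub>M lborel :: ('n heis \<times> real) measure)"
    by (rule mP_measurable[OF hqf sn])+
  have E: "exp (\<i> * of_real (snd p * l)) * of_real (exp (- (mB s l * hq p))) = hE s l p" for p :: "'n heis" and l
    unfolding hE_def exp_of_real[symmetric] exp_add[symmetric] by (simp add: algebra_simps)
  have P1: "exp (\<i> * of_real (snd p * l)) * of_real (mP CARD('n) s (hq p) l) = of_real (mA s l ^ CARD('n)) * hE s l p" for p :: "'n heis" and l
    unfolding E[symmetric] mP_def by (simp add: mult_ac)
  have P2: "exp (\<i> * of_real (snd p * l)) * of_real (mP' CARD('n) s (hq p) l)
      = of_real (mA s l ^ CARD('n)) * (of_real (4 * real CARD('n) * mB s l - (mA s l)\<^sup>2 * (hq p / 4)) * hE s l p)" for p :: "'n heis" and l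
    unfolding mP'_def of_real_mult using P1[of p l] by (simp add: mult_ac)
  have "(\<integral>p. g p * heatk s p \<partial>lborel) = (\<integral>l. (\<integral>p. g p * (exp (\<i> * of_real (snd p * l)) * of_real (mP CARD('n) s (hq p) l)) \<partial>lborel) \<partial>lborel)"
    unfolding heatk_def hk_def by (rule main[where m = "mP CARD('n) s", OF mm1 b1 mP_integrable(1)[OF s hq_nonneg card_ge_1]])
  also have "\<dots> = (\<integral>l. (\<integral>p. of_real (mA s l ^ CARD('n)) * (g p * hE s l p) \<partial>lborel) \<partial>lborel)"
    unfolding P1 by (simp only: mult.left_commute)
  finally show "(\<integral>p. g p * heatk s p \<partial>lborel) = (\<integral>l. of_real (mA s l ^ CARD('n)) * (\<integral>p. g p * hE s l p \<partial>lborel) \<partial>lborel)"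
    by (simp only: integral_mult_right_zero)
  have "(\<integral>p. g p * heatk' s p \<partial>lborel) = (\<integral>l. (\<integral>p. g p * (exp (\<i> * of_real (snd p * l)) * of_real (mP' CARD('n) s (hq p) l)) \<partial>lborel) \<partial>lborel)"
    unfolding heatk'_def hk'_def by (rule main[where m = "mP' CARD('n) s", OF mm2 b2 mP_integrable(2)[OF s hq_nonneg card_ge_1]])
  also have "\<dots> = (\<integral>l. (\<integral>p. of_real (mA s l ^ CARD('n)) * (g p * (of_real (4 * real CARD('n) * mB s l - (mA s l)\<^sup>2 * (hq p / 4)) * hE s l p)) \<partial>lborel) \<partial>lborel)"
    unfolding P2 by (simp only: mult.left_commute)
  finally show "(\<integral>p. g p * heatk' s p \<partial>lborel)
      = (\<integral>l. of_real (mA s l ^ CARD('n)) * (\<integral>p. g p * (of_real (4 * real CARD('n) * mB s l - (mA s l)\<^sup>2 * (hq p / 4)) * hE s l p) \<partial>lborel) \<partial>lborel)"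
    by (simp only: integral_mult_right_zero)
qed

text \<open>The equation between \<open>heatk\<close> and \<open>heatk'\<close> in the sense of
  distributions: inside the frequency integral the sublaplacian moves from \<open>u\<close> to the
  smooth mode \<open>hE\<close>.\<close>

lemma heatk_weak:
  fixes u :: "'n::finite heis \<Rightarrow> complex"
  assumes s: "s > 0" and u: "Ck 2 u" "csupp u"
  shows "(\<integral>p. sublaplacian u p * heatk s p \<partial>lborel) = (\<integral>p. u p * heatk' s p \<partial>lborel)"
proof -
  have "Ck 0 (sublaplacian u)" using Ck_sublaplacian[of 0 u] u(1) by (simp add: numeral_2_eq_2)
  moreover have "csupp (sublaplacian u)"
  proof -
    have "csupp (\<lambda>p. \<Sum>i\<in>A. Z i (Z i u) p)" if "finite A" for A :: "('n + 'n) set"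
      using that
    proof induction
      case (insert i A)
      from csupp_Z[OF csupp_Z[OF u(2)], of i i] obtain R where "\<forall>p. norm p > R \<longrightarrow> Z i (Z i u) p = 0" by (auto simp: csupp_def)
      moreover from insert obtain R' where "\<forall>p. norm p > R' \<longrightarrow> (\<Sum>i\<in>A. Z i (Z i u) p) = 0" by (auto simp: csupp_def)
      ultimately show ?case using insert by (auto simp: csupp_def intro!: exI[of _ "max R R'"])
    qed (auto simp: csupp_def)
    then have "csupp (\<lambda>p. (- 1) * (\<Sum>i\<in>UNIV. Z i (Z i u) p))" by (intro csupp_mult) auto
    then show ?thesis unfolding sublaplacian_eq[OF u(1)] by simp
  qed
  ultimately have Li: "integrable lborel (sublaplacian u)" by (intro csupp_integrable) (auto dest: Ck_continuous)
  have ui: "integrable lborel u" using u by (intro csupp_integrable Ck_continuous)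
  have "(\<integral>p. sublaplacian u p * heatk s p \<partial>lborel) = (\<integral>l. of_real (mA s l ^ CARD('n)) * (\<integral>p. sublaplacian u p * hE s l p \<partial>lborel) \<partial>lborel)"
    by (rule heatk_fubini(1)[OF s Li])
  also have "\<dots> = (\<integral>l. of_real (mA s l ^ CARD('n)) * (\<integral>p. u p * (of_real (4 * real CARD('n) * mB s l - (mA s l)\<^sup>2 * (hq p / 4)) * hE s l p) \<partial>lborel) \<partial>lborel)"
  proof (rule Bochner_Integration.integral_cong[OF refl])
    fix l :: real
    show "of_real (mA s l ^ CARD('n)) * (\<integral>p. sublaplacian u p * hE s l p \<partial>lborel)
        = of_real (mA s l ^ CARD('n)) * (\<integral>p. u p * (of_real (4 * real CARD('n) * mB s l - (mA s l)\<^sup>2 * (hq p / 4)) * hE s l p) \<partial>lborel)"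
    \<comment> \<open>At \<open>l = 0\<close> the default value \<open>mA s 0 = 0\<close>
      annihilates both sides.\<close>
    proof (cases "l = 0")
      case False
      show ?thesis
        unfolding sublaplacian_symmetric_csupp[OF u Ck_hE] sublaplacian_hE[OF s False] ..
    qed (simp add: mA_def)
  qed
  also have "\<dots> = (\<integral>p. u p * heatk' s p \<partial>lborel)" by (rule heatk_fubini(2)[OF s ui, symmetric])
  finally show ?thesis .
qed

subsection \<open>Density of polynomials on an orbit of the sublaplacian\<close>

text \<open>The linear extension of the assignment of \<open>a i\<close> to \<open>X^i\<close>. The
  same operation produces the moment functional, the function \<open>p(L) f\<close> and its pairing
  with the heat kernel.\<close>

definition plin :: "(nat \<Rightarrow> 'v::real_vector) \<Rightarrow> real poly \<Rightarrow> 'v" where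
  "plin a p = (\<Sum>i\<le>degree p. coeff p i *\<^sub>R a i)"

lemma plin_0 [simp]: "plin a 0 = 0"
  by (simp add: plin_def)

lemma plin_pCons [simp]: "plin a (pCons c p) = c *\<^sub>R a 0 + plin (\<lambda>i. a (Suc i)) p"
  by (cases "p = 0") (simp_all add: plin_def sum.atMost_Suc_shift del: sum.atMost_Suc)

lemma plin_add: "plin a (p + q) = plin a p + plin a q"
proof (induction p arbitrary: a q rule: pCons_induct)
  case (pCons c p)
  obtain d q' where "q = pCons d q'" by (rule pCons_cases)
  then show ?case by (simp add: pCons.IH algebra_simps)
qed simp

lemma plin_smult: "plin a (smult c p) = c *\<^sub>R plin a p"
  by (induction p arbitrary: a rule: pCons_induct) (simp_all add: algebra_simps)

text \<open>A factor \<open>X^i\<close> acts on the sequence as a shift by \<open>i\<close>.\<close>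

lemma plin_mult: "plin a (p * q) = plin (\<lambda>i. plin (\<lambda>j. a (i + j)) q) p"
proof (induction p arbitrary: a rule: pCons_induct)
  case (pCons c p)
  then show ?case by (simp add: mult_pCons_left plin_add plin_smult)
qed simp

lemma plin_eqI: "(\<And>i. a i = b i) \<Longrightarrow> plin a p = plin b p"
  by (simp add: plin_def)

lemma in_L2_add:
  assumes "in_L2 u" "in_L2 v" shows "in_L2 (\<lambda>p. u p + v p)"
  unfolding in_L2_def
proof
  have m: "u \<in> borel_measurable borel" "v \<in> borel_measurable borel" using assms by (auto simp: in_L2_def)
  show um: "(\<lambda>p. u p + v p) \<in> borel_measurable lborel" using m by simp
  show "integrable lborel (\<lambda>p. (cmod (u p + v p))\<^sup>2)"
  proof (rule Bochner_Integration.integrable_bound)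
    show "integrable lborel (\<lambda>p. 2 * (cmod (u p))\<^sup>2 + 2 * (cmod (v p))\<^sup>2)" using assms by (simp add: in_L2_def)
    show "AE p in lborel. norm ((cmod (u p + v p))\<^sup>2) \<le> norm (2 * (cmod (u p))\<^sup>2 + 2 * (cmod (v p))\<^sup>2)"
    proof (rule AE_I2)
      fix p
      have "(cmod (u p + v p))\<^sup>2 \<le> (cmod (u p) + cmod (v p))\<^sup>2" by (intro power_mono norm_triangle_ineq) simp
      also have "\<dots> \<le> 2 * (cmod (u p))\<^sup>2 + 2 * (cmod (v p))\<^sup>2"
        using sum_squares_bound[of "cmod (u p)" "cmod (v p)"] by (simp add: power2_sum)
      finally show "norm ((cmod (u p + v p))\<^sup>2) \<le> norm (2 * (cmod (u p))\<^sup>2 + 2 * (cmod (v p))\<^sup>2)" by simp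
    qed
  qed (use um in simp)
qed

lemma in_L2_scaleR: "in_L2 u \<Longrightarrow> in_L2 (\<lambda>p. c *\<^sub>R u p)"
  unfolding in_L2_def by (auto simp: power_mult_distrib)

lemma L2_norm_scaleR: "L2_norm (\<lambda>p. c *\<^sub>R u p) = \<bar>c\<bar> * L2_norm u"
  unfolding L2_norm_def by (simp add: power_mult_distrib real_sqrt_mult)

lemma L2_norm_triangle:
  assumes u: "in_L2 u" and v: "in_L2 v"
  shows "L2_norm (\<lambda>p. u p + v p) \<le> L2_norm u + L2_norm v"
proof (rule power2_le_imp_le)
  have i: "integrable lborel (\<lambda>p. (cmod (u p))\<^sup>2)" "integrable lborel (\<lambda>p. (cmod (v p))\<^sup>2)"
    "integrable lborel (\<lambda>p. 2 * (cmod (u p) * cmod (v p)))"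
    using assms in_L2_abs_mult[OF assms] by (auto simp: in_L2_def)
  have "(L2_norm (\<lambda>p. u p + v p))\<^sup>2 \<le> (\<integral>p. (cmod (u p))\<^sup>2 + (cmod (v p))\<^sup>2 + 2 * (cmod (u p) * cmod (v p)) \<partial>lborel)"
    unfolding L2_norm_square
  proof (rule integral_mono)
    show "integrable lborel (\<lambda>p. (cmod (u p + v p))\<^sup>2)" using in_L2_add[OF assms] by (simp add: in_L2_def)
    show "(cmod (u p + v p))\<^sup>2 \<le> (cmod (u p))\<^sup>2 + (cmod (v p))\<^sup>2 + 2 * (cmod (u p) * cmod (v p))" for p
      using power_mono[OF norm_triangle_ineq[of "u p" "v p"], of 2] by (simp add: power2_sum mult.assoc)
  qed (use i in simp)
  also have "\<dots> = (L2_norm u)\<^sup>2 + (L2_norm v)\<^sup>2 + 2 * (\<integral>p. cmod (u p) * cmod (v p) \<partial>lborel)"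
    using i by (simp add: L2_norm_square)
  also have "\<dots> \<le> (L2_norm u + L2_norm v)\<^sup>2"
    using L2_cauchy_schwarz[OF assms] by (simp add: power2_sum)
  finally show "(L2_norm (\<lambda>p. u p + v p))\<^sup>2 \<le> (L2_norm u + L2_norm v)\<^sup>2" .
qed (simp add: L2_norm_nonneg)

lemma Ck_scaleR: "Ck n u \<Longrightarrow> Ck n (\<lambda>p. c *\<^sub>R u p)"
  using Ck_mult[OF Ck_const[of n "complex_of_real c"]] by (simp add: scaleR_conv_of_real)

lemma sublaplacian_add:
  assumes "Ck 2 u" "Ck 2 v" shows "sublaplacian (\<lambda>p. u p + v p) = (\<lambda>p. sublaplacian u p + sublaplacian v p)"
proof -
  have 1: "Ck 1 u" "Ck 1 v" "Ck 1 (Z i u)" "Ck 1 (Z i v)" for i using assms Ck_21 Ck_Z2 by blast+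
  have Z1: "Z i (\<lambda>p. u p + v p) = (\<lambda>p. Z i u p + Z i v p)" for i by (rule ext Z_add[OF 1(1,2)])+
  have "Z i (Z i (\<lambda>p. u p + v p)) p = Z i (Z i u) p + Z i (Z i v) p" for i p
    unfolding Z1 by (rule Z_add[OF 1(3,4)])
  then show ?thesis
    unfolding sublaplacian_eq[OF assms(1)] sublaplacian_eq[OF assms(2)] sublaplacian_eq[OF Ck_add[OF assms]]
    by (simp add: sum.distrib)
qed

lemma sublaplacian_scaleR:
  assumes "Ck 2 u" shows "sublaplacian (\<lambda>p. c *\<^sub>R u p) = (\<lambda>p. c *\<^sub>R sublaplacian u p)"
proof -
  have 1: "Ck 1 u" "Ck 1 (Z i u)" for i using assms Ck_21 Ck_Z2 by blast+
  have Zs: "Z i (\<lambda>p. c *\<^sub>R v p) = (\<lambda>p. c *\<^sub>R Z i v p)" if "Ck 1 v" for v i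
    using Z_mult[OF Ck_const[of 1 "complex_of_real c"] that] by (simp add: fun_eq_iff scaleR_conv_of_real Z_const del: One_nat_def)
  show ?thesis
    unfolding sublaplacian_eq[OF assms] sublaplacian_eq[OF Ck_scaleR[OF assms]] Zs[OF 1(1)] Zs[OF 1(2)]
    by (simp add: scaleR_sum_right)
qed

locale L2_orbit =
  fixes f :: "'n::finite heis \<Rightarrow> complex"
  assumes Ck_f: "\<And>n. Ck n f" and L2_f: "\<And>k. in_L2 ((sublaplacian ^^ k) f)"
begin

definition "H k = (sublaplacian ^^ k) f"
definition lin :: "real poly \<Rightarrow> 'n heis \<Rightarrow> complex" where "lin p x = plin (\<lambda>i. H i x) p"
definition "mu k = Re (\<integral>x. H k x * cnj (f x) \<partial>lborel)"
definition "S p = plin mu p"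

lemma Ck_H: "Ck n (H k)" unfolding H_def by (rule funpow_sublaplacian(1)[OF Ck_f])
lemma L2_H: "in_L2 (H k)" unfolding H_def by (rule L2_f)
lemma H_Suc: "H (Suc k) = sublaplacian (H k)" by (simp add: H_def)
lemma H_0: "H 0 = f" by (simp add: H_def)

text \<open>The claims are proved together: in the induction step the third uses the second, and the
  fourth uses the first, each for the shifted sequence.\<close>

lemma plin_fun:
  fixes U :: "nat \<Rightarrow> 'n heis \<Rightarrow> complex"
  assumes "\<And>i. in_L2 (U i)" "\<And>i. Ck 2 (U i)"
  shows "in_L2 (\<lambda>x. plin (\<lambda>i. U i x) p)" "Ck 2 (\<lambda>x. plin (\<lambda>i. U i x) p)"
    "sublaplacian (\<lambda>x. plin (\<lambda>i. U i x) p) = (\<lambda>x. plin (\<lambda>i. sublaplacian (U i) x) p)"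
    "in_L2 v \<Longrightarrow> (\<integral>x. plin (\<lambda>i. U i x) p * v x \<partial>lborel) = plin (\<lambda>i. \<integral>x. U i x * v x \<partial>lborel) p"
  using assms
proof (induction p arbitrary: U rule: pCons_induct)
  case 0
  case 1 show ?case by (simp add: in_L2_def)
  case 2 show ?case by (simp add: Ck_const)
  case 3
  have "sublaplacian (\<lambda>x::'n heis. 0 *\<^sub>R (0::complex)) = (\<lambda>x. 0 *\<^sub>R sublaplacian (\<lambda>x. 0) x)"
    by (rule sublaplacian_scaleR[OF Ck_const])
  then show ?case by simp
  case 4 show ?case by simp
next
  case (pCons c p)
  case 1
  have "in_L2 (\<lambda>x. plin (\<lambda>i. U (Suc i) x) p)" by (rule pCons.IH(1)[of "\<lambda>i. U (Suc i)"]) (rule 1)+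
  then show ?case unfolding plin_pCons by (intro in_L2_add in_L2_scaleR 1)
  case 2
  have "Ck 2 (\<lambda>x. plin (\<lambda>i. U (Suc i) x) p)" by (rule pCons.IH(2)[of "\<lambda>i. U (Suc i)"]) (rule 2)+
  then show ?case unfolding plin_pCons by (intro Ck_add Ck_scaleR 2)
  case 3
  have "sublaplacian (\<lambda>x. c *\<^sub>R U 0 x + plin (\<lambda>i. U (Suc i) x) p)
    = (\<lambda>x. sublaplacian (\<lambda>x. c *\<^sub>R U 0 x) x + sublaplacian (\<lambda>x. plin (\<lambda>i. U (Suc i) x) p) x)"
    using pCons.IH(2)[of "\<lambda>i. U (Suc i)"] 3 by (intro sublaplacian_add Ck_scaleR) auto
  with pCons.IH(3)[of "\<lambda>i. U (Suc i)"] 3 show ?case by (simp add: sublaplacian_scaleR)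
  case 4
  have i: "integrable lborel (\<lambda>x. U 0 x * v x)" "integrable lborel (\<lambda>x. plin (\<lambda>i. U (Suc i) x) p * v x)"
    using 4 pCons.IH(1)[of "\<lambda>i. U (Suc i)"] by (auto intro: in_L2_mult)
  have "(\<integral>x. plin (\<lambda>i. U i x) (pCons c p) * v x \<partial>lborel)
    = (\<integral>x. c *\<^sub>R (U 0 x * v x) + plin (\<lambda>i. U (Suc i) x) p * v x \<partial>lborel)" by (simp add: algebra_simps)
  also have "\<dots> = c *\<^sub>R (\<integral>x. U 0 x * v x \<partial>lborel) + (\<integral>x. plin (\<lambda>i. U (Suc i) x) p * v x \<partial>lborel)"
    using i by (subst Bochner_Integration.integral_add) auto
  also have "\<dots> = plin (\<lambda>i. \<integral>x. U i x * v x \<partial>lborel) (pCons c p)" using pCons.IH(4)[of "\<lambda>i. U (Suc i)"] 4 by simp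
  finally show ?case .
qed

lemma L2_lin: "in_L2 (lin p)" and Ck_lin: "Ck 2 (lin p)"
  unfolding lin_def[abs_def] using plin_fun(1,2)[OF L2_H Ck_H] by auto

lemma lin_polyX: "lin (polyX * p) = sublaplacian (lin p)"
  unfolding lin_def[abs_def] plin_fun(3)[OF L2_H Ck_H] by (simp add: H_Suc)

lemma lin_add: "lin (p + q) = (\<lambda>x. lin p x + lin q x)"
  and lin_smult: "lin (smult c p) = (\<lambda>x. c *\<^sub>R lin p x)"
  by (simp_all add: lin_def[abs_def] plin_add plin_smult)

text \<open>Both sides equal the energy pairing of \<open>H i\<close> and \<open>H j\<close>, by
  \<open>sublaplacian_form\<close> and conjugate symmetry. Hence the real Gram matrix of the orbit
  is a Hankel matrix of moments.\<close>

lemma gram_shift: "(\<integral>x. H (Suc i) x * cnj (H j x) \<partial>lborel) = (\<integral>x. H i x * cnj (H (Suc j) x) \<partial>lborel)"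
proof -
  have L2: "in_L2 (sublaplacian (H k))" for k using L2_H[of "Suc k"] by (simp only: H_Suc)
  have form: "(\<integral>p. H (Suc i) p * cnj (H j p) \<partial>lborel) = (\<Sum>m\<in>UNIV. \<integral>p. Z m (H i) p * cnj (Z m (H j) p) \<partial>lborel)" for i j
    unfolding H_Suc by (rule sublaplacian_form[OF Ck_H L2_H L2 Ck_H L2_H L2])
  have "(\<integral>x. H i x * cnj (H (Suc j) x) \<partial>lborel) = cnj (\<integral>x. H (Suc j) x * cnj (H i x) \<partial>lborel)"
    by (subst Bochner_Integration.integral_cnj[symmetric]) (simp only: complex_cnj_mult complex_cnj_cnj mult.commute)
  also have "\<dots> = (\<Sum>m\<in>UNIV. \<integral>p. Z m (H i) p * cnj (Z m (H j) p) \<partial>lborel)"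
    unfolding form cnj_sum by (intro sum.cong refl, subst Bochner_Integration.integral_cnj[symmetric]) (simp only: complex_cnj_mult complex_cnj_cnj mult.commute)
  finally show ?thesis unfolding form by simp
qed

lemma gram: "Re (\<integral>x. H i x * cnj (H j x) \<partial>lborel) = mu (i + j)"
  by (induction j arbitrary: i) (simp_all add: mu_def H_0 flip: gram_shift)

lemma S_mult: "S (p * q) = Re (\<integral>x. lin p x * cnj (lin q x) \<partial>lborel)"
proof -
  have Re_plin: "Re (plin a p) = plin (\<lambda>i. Re (a i)) p" and cnj_plin: "cnj (plin a p) = plin (\<lambda>i. cnj (a i)) p" for a p
    by (simp_all add: plin_def)
  have L2c: "in_L2 (\<lambda>x. cnj (lin q x))" "in_L2 (\<lambda>x. cnj (H i x))" for i by (rule in_L2_cnj L2_lin L2_H)+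
  have "(\<integral>x. lin p x * cnj (lin q x) \<partial>lborel) = plin (\<lambda>i. \<integral>x. H i x * cnj (lin q x) \<partial>lborel) p"
    unfolding lin_def[of p] by (rule plin_fun(4)[OF L2_H Ck_H L2c(1)])
  also have "\<dots> = plin (\<lambda>i. plin (\<lambda>j. \<integral>x. H i x * cnj (H j x) \<partial>lborel) q) p"
  proof (rule plin_eqI)
    fix i
    have "(\<integral>x. H i x * cnj (lin q x) \<partial>lborel) = (\<integral>x. plin (\<lambda>j. cnj (H j x)) q * H i x \<partial>lborel)"
      by (simp add: lin_def cnj_plin mult.commute)
    also have "\<dots> = plin (\<lambda>j. \<integral>x. cnj (H j x) * H i x \<partial>lborel) q"
      by (rule plin_fun(4)[OF L2c(2) Ck_cnj[OF Ck_H] L2_H])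
    finally show "(\<integral>x. H i x * cnj (lin q x) \<partial>lborel) = plin (\<lambda>j. \<integral>x. H i x * cnj (H j x) \<partial>lborel) q"
      by (simp add: mult.commute)
  qed
  finally show ?thesis by (simp add: S_def plin_mult Re_plin gram)
qed

lemma S_square: "S (p * p) = (L2_norm (lin p))\<^sup>2"
proof -
  have "(\<integral>x. lin p x * cnj (lin p x) \<partial>lborel) = complex_of_real (\<integral>x. (cmod (lin p x))\<^sup>2 \<partial>lborel)"
    by (simp only: complex_norm_square[symmetric] integral_complex_of_real)
  then show ?thesis by (simp add: S_mult L2_norm_square)
qed

text \<open>The two positivity conditions are the nonnegativity of the squared norm of
  \<open>lin p\<close> and of its energy, the sum of the squared norms of the
  \<open>Z i (lin p)\<close>.\<close>

sublocale stieltjes_functional S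
proof
  fix p q :: "real poly" and a :: real
  show "S (p + q) = S p + S q" "S (smult a p) = a * S p" by (simp_all add: S_def plin_add plin_smult)
  show "S (p * p) \<ge> 0" by (simp add: S_square)
  have L2: "in_L2 (sublaplacian (lin p))" using L2_lin[of "polyX * p"] by (simp only: lin_polyX)
  have "S (polyX * (p * p)) = Re (\<integral>x. sublaplacian (lin p) x * cnj (lin p x) \<partial>lborel)"
    unfolding mult.assoc[symmetric] S_mult lin_polyX ..
  also have "\<dots> = (\<Sum>i\<in>UNIV. Re (\<integral>x. Z i (lin p) x * cnj (Z i (lin p) x) \<partial>lborel))"
    unfolding sublaplacian_form[OF Ck_lin L2_lin L2 Ck_lin L2_lin L2] by simp
  also have "\<dots> = (\<Sum>i\<in>UNIV. \<integral>x. (cmod (Z i (lin p) x))\<^sup>2 \<partial>lborel)"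
    by (simp only: complex_norm_square[symmetric] integral_complex_of_real Re_complex_of_real)
  finally show "S (polyX * (p * p)) \<ge> 0" by (simp add: sum_nonneg)
qed

lemma S_polyX_le: "S (polyX * (p * p)) \<le> L2_norm (lin (polyX * p)) * L2_norm (lin p)"
proof -
  have L2: "in_L2 (\<lambda>x. cnj (lin p x))" by (rule in_L2_cnj L2_lin)+
  have "S (polyX * (p * p)) = Re (\<integral>x. lin (polyX * p) x * cnj (lin p x) \<partial>lborel)"
    unfolding mult.assoc[symmetric] S_mult ..
  also have "\<dots> \<le> cmod (\<integral>x. lin (polyX * p) x * cnj (lin p x) \<partial>lborel)" by (rule complex_Re_le_cmod)
  also have "\<dots> \<le> (\<integral>x. norm (lin (polyX * p) x * cnj (lin p x)) \<partial>lborel)" by (rule integral_norm_bound)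
  also have "\<dots> \<le> L2_norm (lin (polyX * p)) * L2_norm (lin p)"
    using L2_cauchy_schwarz[OF L2_lin L2_lin] by (simp add: norm_mult)
  finally show ?thesis .
qed

text \<open>Expanding \<open>(X + c)^J\<close> produces the norms of \<open>H k\<close> up to
  \<open>H (k + J)\<close>; the coarse factor \<open>(1 + c)^J\<close> bounds every binomial
  weight.\<close>

lemma norm_shifted:
  assumes c: "c > 0" and M: "\<And>k. L2_norm (H k) \<le> M k"
  shows "L2_norm (lin ([:c, 1:] ^ J * polyX ^ k)) \<le> (1 + c) ^ J * (\<Sum>i\<le>J. M (k + i))"
proof (induction J arbitrary: k)
  case 0
  have "lin (polyX ^ k) = H k"
  proof (induction k)
    case 0
    show ?case by (simp add: lin_def[abs_def] H_def one_pCons)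
  next
    case (Suc k)
    then show ?case by (simp only: power_Suc lin_polyX H_Suc)
  qed
  then show ?case using M by simp
next
  case (Suc J)
  have M0: "M i \<ge> 0" for i using M[of i] L2_norm_nonneg[of "H i"] by linarith
  have "[:c, 1:] ^ Suc J * polyX ^ k = smult c ([:c, 1:] ^ J * polyX ^ k) + [:c, 1:] ^ J * polyX ^ Suc k"
    by (simp add: algebra_simps)
  then have "L2_norm (lin ([:c, 1:] ^ Suc J * polyX ^ k))
    \<le> c * L2_norm (lin ([:c, 1:] ^ J * polyX ^ k)) + L2_norm (lin ([:c, 1:] ^ J * polyX ^ Suc k))"
    using L2_norm_triangle[OF L2_lin L2_lin, of "smult c ([:c, 1:] ^ J * polyX ^ k)" "[:c, 1:] ^ J * polyX ^ Suc k"] c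
    by (simp add: lin_add lin_smult L2_norm_scaleR del: power_Suc)
  also have "\<dots> \<le> c * ((1 + c) ^ J * (\<Sum>i\<le>J. M (k + i))) + (1 + c) ^ J * (\<Sum>i\<le>J. M (Suc k + i))"
    by (intro add_mono mult_left_mono Suc.IH) (use c in auto)
  also have "\<dots> \<le> c * ((1 + c) ^ J * (\<Sum>i\<le>Suc J. M (k + i))) + (1 + c) ^ J * (\<Sum>i\<le>Suc J. M (k + i))"
  proof -
    have "(\<Sum>i\<le>J. M (Suc k + i)) \<le> (\<Sum>i\<le>Suc J. M (k + i))"
      unfolding sum.atMost_Suc_shift using M0 by simp
    then show ?thesis using c M0 by (intro add_mono mult_left_mono) auto
  qed
  finally show ?case by (simp add: algebra_simps)
qed

text \<open>Carleman's theorem is applied to \<open>T p = S ((X + c)^(2 J + 1) p)\<close>. With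
  \<open>w\<close> for multiplication by \<open>(X + c)^J\<close>, the expansions show that
  \<open>T (q * q)\<close> dominates \<open>c\<close> times the squared norm of
  \<open>lin (w q)\<close>, while \<open>T (polyX * (q * q))\<close> dominates that of
  \<open>lin (w (polyX * q))\<close>. The divergence for the moments of \<open>T\<close> comes from
  \<open>carleman_shift\<close>.\<close>

lemma lin_density:
  assumes c: "c > 0" and eps: "\<epsilon> > 0" and M: "\<And>k. M k > 0" "log_convex M" and bd: "\<And>k. L2_norm (H k) \<le> M k"
    and div: "\<not> summable (\<lambda>k. M k powr (- 1 / (2 * real k)))"
  shows "\<exists>r. poly r (- c) = 1 \<and> (L2_norm (lin ([:c, 1:] ^ J * r)))\<^sup>2 < \<epsilon>"
proof -
  define w where "w p = [:c, 1:] ^ J * p" for p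
  define T where "T p = S (w (w ([:c, 1:] * p)))" for p
  have expand: "T (p * p) = S (polyX * (w p * w p)) + c * S (w p * w p)" for p
  proof -
    have "w (w ([:c, 1:] * (p * p))) = polyX * (w p * w p) + smult c (w p * w p)" by (simp add: w_def algebra_simps)
    then show ?thesis unfolding T_def by (simp only: add smult)
  qed
  have expandX: "T (polyX * (p * p)) = S (w (polyX * p) * w (polyX * p)) + c * S (polyX * (w p * w p))" for p
  proof -
    have "w (w ([:c, 1:] * (polyX * (p * p)))) = w (polyX * p) * w (polyX * p) + smult c (polyX * (w p * w p))"
      by (simp add: w_def algebra_simps)
    then show ?thesis unfolding T_def by (simp only: add smult)
  qed
  interpret T: stieltjes_functional T
  proof
    fix p q :: "real poly" and a :: real
    have "w (w ([:c, 1:] * (p + q))) = w (w ([:c, 1:] * p)) + w (w ([:c, 1:] * q))" by (simp only: w_def distrib_left)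
    then show "T (p + q) = T p + T q" by (simp add: T_def add)
    have "w (w ([:c, 1:] * smult a p)) = smult a (w (w ([:c, 1:] * p)))" by (simp only: w_def mult_smult_right)
    then show "T (smult a p) = a * T p" by (simp add: T_def smult)
    show "T (p * p) \<ge> 0" unfolding expand by (intro add_nonneg_nonneg mult_nonneg_nonneg pos posX less_imp_le[OF c])
    show "T (polyX * (p * p)) \<ge> 0" unfolding expandX by (intro add_nonneg_nonneg mult_nonneg_nonneg pos posX less_imp_le[OF c])
  qed
  let ?W = "\<lambda>k. (1 + c) ^ (J + 1) * (\<Sum>i\<le>J + 1. M (k + i))"
  have W: "?W k > 0" for k using c M by (intro mult_pos_pos sum_pos) auto
  \<comment> \<open>Even moments of \<open>T\<close> consist of norms and energies, hence are
    bounded by blocks of \<open>M\<close>. Passing to them is legitimate, as a subseries of a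
    convergent series with nonnegative terms converges.\<close>
  have "T (polyX ^ (2 * k)) \<le> (1 + c) * (?W k)\<^sup>2" for k
  proof -
    let ?p = "polyX ^ k"
    have Wl: "(1 + c) ^ J * (\<Sum>i\<le>J. M (k + i)) \<le> ?W k" "(1 + c) ^ J * (\<Sum>i\<le>J. M (Suc k + i)) \<le> ?W k"
    proof -
      have s: "(\<Sum>i\<le>J. M (k + i)) \<le> (\<Sum>i\<le>J + 1. M (k + i))" "(\<Sum>i\<le>J. M (Suc k + i)) \<le> (\<Sum>i\<le>J + 1. M (k + i))"
        using less_imp_le[OF M(1), of k] less_imp_le[OF M(1), of "Suc (k + J)"] sum.atMost_Suc_shift[of "\<lambda>i. M (k + i)" J] by simp_all
      have "(1 + c) ^ J \<le> (1 + c) ^ (J + 1)" using c by (intro power_increasing) auto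
      then show "(1 + c) ^ J * (\<Sum>i\<le>J. M (k + i)) \<le> ?W k" "(1 + c) ^ J * (\<Sum>i\<le>J. M (Suc k + i)) \<le> ?W k"
        using c less_imp_le[OF M(1)] by (intro mult_mono s sum_nonneg zero_le_power; simp)+
    qed
    have n1: "L2_norm (lin (w ?p)) \<le> ?W k"
      using norm_shifted[OF c bd, of J k] Wl(1) unfolding w_def by linarith
    have n2: "L2_norm (lin (polyX * w ?p)) \<le> ?W k"
    proof -
      have "polyX * w ?p = [:c, 1:] ^ J * polyX ^ Suc k" by (simp add: w_def mult.left_commute)
      then show ?thesis using norm_shifted[OF c bd, of J "Suc k"] Wl(2) by simp
    qed
    have "polyX ^ (2 * k) = ?p * ?p" by (simp add: mult_2 power_add)
    then have "T (polyX ^ (2 * k)) = S (polyX * (w ?p * w ?p)) + c * (L2_norm (lin (w ?p)))\<^sup>2"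
      by (simp only: expand S_square)
    also have "\<dots> \<le> ?W k * ?W k + c * (?W k)\<^sup>2"
      using n1 n2 c W[of k] S_polyX_le[of "w ?p"] L2_norm_nonneg
      by (intro add_mono mult_left_mono power_mono order_trans[OF S_polyX_le] mult_mono) (auto simp: less_imp_le)
    finally show ?thesis by (simp add: algebra_simps power2_eq_square)
  qed
  \<comment> \<open>The stray factor \<open>1 + c\<close> is enlarged to a square and put into the
    block, so that the bound is a perfect square and the root taken in the series is exact.\<close>
  also have "(1 + c) * (?W k)\<^sup>2 \<le> ((1 + c) ^ (J + 2) * (\<Sum>i\<le>J + 1. M (k + i)))\<^sup>2" for k
  proof -
    have "(1 + c) * (?W k)\<^sup>2 \<le> (1 + c)\<^sup>2 * (?W k)\<^sup>2" using c by (intro mult_right_mono) (auto simp: power2_eq_square)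
    then show ?thesis by (simp add: power_mult_distrib mult_ac power2_eq_square)
  qed
  finally have TW: "T (polyX ^ (2 * k)) \<le> ((1 + c) ^ (J + 2) * (\<Sum>i\<le>J + 1. M (k + i)))\<^sup>2" for k .
  have "\<not> summable (\<lambda>k. T (polyX ^ k) powr (- 1 / (2 * real k)))" if Tp: "\<And>k. T (polyX ^ k) > 0"
  proof
    let ?V = "\<lambda>k. (1 + c) ^ (J + 2) * (\<Sum>i\<le>J + 1. M (k + i))"
    have V: "?V k > 0" for k using c M by (intro mult_pos_pos sum_pos) auto
    assume "summable (\<lambda>k. T (polyX ^ k) powr (- 1 / (2 * real k)))"
    then have "summable ((\<lambda>k. T (polyX ^ k) powr (- 1 / (2 * real k))) \<circ> (\<lambda>k. 2 * k))"
      by (rule summable_reindex) (auto simp: inj_on_def)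
    then have "summable (\<lambda>k. ?V k powr (- 1 / (2 * real k)))"
    proof (rule summable_comparison_test')
      fix k :: nat assume "k \<ge> 0"
      have "?V k powr (- 1 / (2 * real k)) = (?V k)\<^sup>2 powr (- 1 / (2 * real (2 * k)))"
      proof -
        have "(?V k)\<^sup>2 = ?V k powr 2" using powr_realpow[OF V[of k], of 2] by simp
        then have "(?V k)\<^sup>2 powr (- 1 / (2 * real (2 * k))) = ?V k powr (2 * (- 1 / (2 * real (2 * k))))"
          by (simp only: powr_powr)
        also have "2 * (- 1 / (2 * real (2 * k))) = - 1 / (2 * real k)" by simp
        finally show ?thesis by simp
      qed
      also have "\<dots> \<le> T (polyX ^ (2 * k)) powr (- 1 / (2 * real (2 * k)))"
        using TW[of k] Tp[of "2 * k"] by (intro powr_mono2') auto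
      finally show "norm (?V k powr (- 1 / (2 * real k))) \<le> ((\<lambda>k. T (polyX ^ k) powr (- 1 / (2 * real k))) \<circ> (\<lambda>k. 2 * k)) k"
        by simp
    qed
    moreover have "\<not> summable (\<lambda>k. ?V k powr (- 1 / (2 * real k)))"
      using c by (intro carleman_shift[OF M _ div]) auto
    ultimately show False by contradiction
  qed
  \<comment> \<open>The thresholds anticipate the two cases: the first loses a factor
    \<open>c\<close>, the second a factor \<open>c^2\<close> through the normalisation by
    \<open>- 1 / c\<close>.\<close>
  then obtain q where q: "poly q (- c) = 1" and "T (q * q) < min (\<epsilon> * c) (\<epsilon> * c\<^sup>2) \<or> T (polyX * (q * q)) < min (\<epsilon> * c) (\<epsilon> * c\<^sup>2)"
    using T.stieltjes_carleman_density[OF c, of "min (\<epsilon> * c) (\<epsilon> * c\<^sup>2)"] eps c by auto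
  then consider "T (q * q) < \<epsilon> * c" | "T (polyX * (q * q)) < \<epsilon> * c\<^sup>2" by auto
  then show ?thesis
  proof cases
    case 1
    then have "c * (L2_norm (lin (w q)))\<^sup>2 < c * \<epsilon>"
      unfolding expand S_square using posX[of "w q"] by (simp add: mult.commute)
    with c have "(L2_norm (lin (w q)))\<^sup>2 < \<epsilon>" by simp
    with q show ?thesis unfolding w_def by blast
  next
    case 2
    let ?r = "smult (- 1 / c) (polyX * q)"
    have "(L2_norm (lin (w (polyX * q))))\<^sup>2 < \<epsilon> * c\<^sup>2"
      using 2 c posX[of "w q"] mult_nonneg_nonneg[of c "S (polyX * (w q * w q))"] unfolding expandX S_square by linarith
    moreover have "(L2_norm (lin (w ?r)))\<^sup>2 = (L2_norm (lin (w (polyX * q))))\<^sup>2 / c\<^sup>2"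
    proof -
      have "w ?r = smult (- 1 / c) (w (polyX * q))" by (simp only: w_def mult_smult_right)
      then have "L2_norm (lin (w ?r)) = \<bar>- 1 / c\<bar> * L2_norm (lin (w (polyX * q)))"
        by (simp only: lin_smult L2_norm_scaleR)
      then show ?thesis by (simp only: power_mult_distrib power2_abs) (simp add: power_divide)
    qed
    ultimately have "(L2_norm (lin (w ?r)))\<^sup>2 < \<epsilon>"
      using c by (simp only: pos_divide_less_eq zero_less_power)
    moreover have "poly ?r (- c) = 1" using q c by simp
    ultimately show ?thesis unfolding w_def by blast
  qed
qed

end

subsection \<open>Heat flow of a flat function\<close>

lemma positive_integral_open:
  fixes F :: "'a::euclidean_space \<Rightarrow> real"
  assumes F: "integrable lborel F" "\<And>x. F x \<ge> 0" and B: "open B" "B \<noteq> {}" and pos: "\<And>x. x \<in> B \<Longrightarrow> F x > 0"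
  shows "(\<integral>x. F x \<partial>lborel) > 0"
proof (rule ccontr)
  assume "\<not> ?thesis"
  moreover have "0 \<le> (\<integral>x. F x \<partial>lborel)" by (rule Bochner_Integration.integral_nonneg) (use F(2) in simp)
  ultimately have "(\<integral>x. F x \<partial>lborel) = 0" by simp
  then have "AE x in lborel. F x = 0" using F by (subst (asm) integral_nonneg_eq_0_iff_AE) auto
  then have "AE x in lborel. x \<notin> B" by eventually_elim (use pos in force)
  then have "B \<in> null_sets lborel" using AE_iff_null_sets[of B lborel] B(1) by simp
  then have "negligible B" by (simp add: negligible_iff_null_sets null_sets_completionI)
  then show False using open_not_negligible[OF B] by simp
qed

text \<open>\<open>exponential_moments_unique\<close> sees only sets of values of \<open>u\<close>.
  The left inverse \<open>v\<close> turns the open set on which \<open>k\<close> has the sign of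
  \<open>k x\<close> into such a set, and the integral over it would not vanish. With
  \<open>u\<close> the identity this inverts Laplace transforms, with \<open>u = - ln\<close> Mellin
  transforms.\<close>

lemma moments_zero_continuous:
  fixes k u v :: "real \<Rightarrow> real"
  assumes cont: "continuous_on {0<..} k" and k0: "\<And>x. x \<le> 0 \<Longrightarrow> k x = 0"
    and u: "u \<in> borel_measurable borel" and v: "v \<in> borel_measurable borel" "\<And>x. x > 0 \<Longrightarrow> v (u x) = x"
    and int: "\<And>s. s \<in> {a<..<b} \<Longrightarrow> integrable lborel (\<lambda>x. k x * exp (s * u x))"
    and inf: "infinite {s\<in>{c..d}. (\<integral>x. k x * exp (s * u x) \<partial>lborel) = 0}" and cd: "a < c" "d < b"
  shows "k x = 0"
proof (rule ccontr)
  assume kx: "k x \<noteq> 0"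
  then have x0: "x > 0" using k0[of x] by (cases "x \<le> 0") auto
  have "(\<lambda>x. indicator {0<..} x *\<^sub>R k x) \<in> borel_measurable borel"
    by (rule borel_measurable_continuous_on_indicator[OF _ cont]) simp
  also have "(\<lambda>x. indicator {0<..} x *\<^sub>R k x) = k" using k0 by (fastforce simp: indicator_def)
  finally have km: "k \<in> borel_measurable borel" .
  define B where "B = {y\<in>{0<..}. sgn (k x) * k y \<in> {0<..}}"
  have oB: "open B"
  proof -
    have "open ({0<..} \<inter> (\<lambda>y. sgn (k x) * k y) -` {0<..})"
      by (intro continuous_open_preimage continuous_intros cont)
    also have "{0<..} \<inter> (\<lambda>y. sgn (k x) * k y) -` {0<..} = B" by (auto simp: B_def)
    finally show ?thesis .
  qed
  have xB: "x \<in> B" using x0 kx by (auto simp: B_def sgn_real_def)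
  have A: "v -` B \<in> sets borel" using measurable_sets[OF v(1), of B] oB by simp
  have cc: "c \<in> {a<..<b}"
  proof -
    have "{c..d} \<noteq> {}" using inf by (metis (no_types, lifting) Collect_empty_eq empty_iff finite.emptyI)
    then show ?thesis using cd by auto
  qed
  let ?F = "\<lambda>y. sgn (k x) * (k y * exp (c * u y) * indicator (v -` B) (u y))"
  have "(\<integral>y. k y * exp (c * u y) * indicator (v -` B) (u y) \<partial>lborel) = 0"
    by (rule exponential_moments_unique[OF _ _ int inf cd A cc]) (use km u in simp_all)
  then have "(\<integral>y. ?F y \<partial>lborel) = 0" by simp
  moreover have "(\<integral>y. ?F y \<partial>lborel) > 0"
  proof (rule positive_integral_open[OF _ _ oB])
    show "integrable lborel ?F"
    proof (rule Bochner_Integration.integrable_bound[OF integrable_norm[OF int[OF cc]]])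
      have "(\<lambda>y. indicator (v -` B) (u y) :: real) \<in> borel_measurable borel"
        using measurable_compose[OF u borel_measurable_indicator[OF A]] .
      then show "?F \<in> borel_measurable lborel" using km u by simp
    qed (auto simp: abs_mult indicator_def sgn_real_def)
    show "?F y > 0" if "y \<in> B" for y
      using that v(2)[of y] by (auto simp: B_def mult.assoc[symmetric] indicator_def)
    then show "?F y \<ge> 0" for y
      using v(2)[of y] k0[of y] by (cases "y > 0") (fastforce simp: indicator_def)+
  qed (use xB in auto)
  ultimately show False by (simp only: less_irrefl)
qed

lemma power_le_fact_exp:
  assumes "x \<ge> (0::real)" shows "x ^ j \<le> fact j * exp x"
proof -
  have "(\<Sum>n\<in>{j}. x ^ n /\<^sub>R fact n) \<le> exp x"
    unfolding exp_def using assms by (intro sum_le_suminf summable_exp_generic) auto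
  then show ?thesis by (simp add: field_simps)
qed

text \<open>Half of the exponential pays for the power.\<close>

lemma power_exp_le:
  assumes "x \<ge> (0::real)" "c > 0"
  shows "x ^ j * exp (- c * x) \<le> fact j * (2 / c) ^ j * exp (- (c / 2) * x)"
proof -
  have "x ^ j = (2 / c) ^ j * (c / 2 * x) ^ j" using assms by (simp flip: power_mult_distrib)
  also have "\<dots> \<le> (2 / c) ^ j * (fact j * exp (c / 2 * x))"
    using assms by (intro mult_left_mono power_le_fact_exp) auto
  finally have "x ^ j * exp (- c * x) \<le> (2 / c) ^ j * (fact j * exp (c / 2 * x)) * exp (- c * x)"
    by (intro mult_right_mono) auto
  also have "\<dots> = fact j * (2 / c) ^ j * (exp (c / 2 * x) * exp (- c * x))" by (simp add: mult_ac)
  also have "exp (c / 2 * x) * exp (- c * x) = exp (- (c / 2) * x)" by (simp flip: exp_add)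
  finally show ?thesis .
qed

lemma half_line_exp_integrable:
  assumes c: "c > 0" shows "set_integrable lborel {0<..} (\<lambda>s::real. C * exp (- c * s))"
  unfolding set_integrable_def
proof (rule Bochner_Integration.integrable_bound)
  show "integrable lborel (\<lambda>s::real. \<bar>C\<bar> * exp (- c * norm s))" using integrable_exp_norm[OF c, where 'a = real] by simp
qed (auto simp: indicator_def abs_mult)

text \<open>The bound on \<open>F\<close> makes the boundary values vanish, by the factor
  \<open>s\<close> at 0 and by the exponential at infinity.\<close>

lemma ftc_half_line:
  fixes F f :: "real \<Rightarrow> complex"
  assumes F: "\<And>s. s > 0 \<Longrightarrow> (F has_vector_derivative f s) (at s)" and f: "\<And>s. s > 0 \<Longrightarrow> isCont f s"
    and int: "set_integrable lborel {0<..} f"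
    and bd: "\<And>s. s > 0 \<Longrightarrow> norm (F s) \<le> C * (s * exp (- c * s))" and c: "c > 0"
  shows "(LINT s:{0<..}|lborel. f s) = 0"
proof -
  have e: "einterval 0 \<infinity> = {0<..}" by (auto simp: einterval_def zero_ereal_def)
  have "(LBINT s=0..\<infinity>. f s) = 0 - 0"
  proof (rule interval_integral_FTC_integrable)
    show "((F \<circ> real_of_ereal) \<longlongrightarrow> 0) (at_right 0)"
      unfolding zero_ereal_def ereal_tendsto_simps
    proof (rule Lim_null_comparison)
      show "\<forall>\<^sub>F s in at_right 0. norm (F s) \<le> C * (s * exp (- c * s))"
        using bd by (auto simp: eventually_at_right_field intro!: exI[of _ 1])
      show "((\<lambda>s. C * (s * exp (- c * s))) \<longlongrightarrow> 0) (at_right 0)" by real_asymp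
    qed
    show "((F \<circ> real_of_ereal) \<longlongrightarrow> 0) (at_left \<infinity>)"
      unfolding ereal_tendsto_simps
    proof (rule Lim_null_comparison)
      show "\<forall>\<^sub>F s in at_top. norm (F s) \<le> C * (s * exp (- c * s))"
        using bd by (auto simp: eventually_at_top_linorder intro!: exI[of _ 1])
      have "((\<lambda>s. s * exp (- c * s)) \<longlongrightarrow> 0) at_top" using c by real_asymp
      then show "((\<lambda>s. C * (s * exp (- c * s))) \<longlongrightarrow> 0) at_top" by (rule tendsto_mult_right_zero)
    qed
  qed (use F f int e in \<open>auto simp: zero_ereal_def\<close>)
  then show ?thesis by (simp add: interval_lebesgue_integral_def e)
qed

text \<open>The squared amplitude of the pointwise bound is of size \<open>s^(-2 (n + 1))\<close>,
  and integrating the exponential gives back the Jacobian \<open>s^(n + 1)\<close> of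
  \<open>dil\<close>.\<close>

lemma L2_norm_heatk:
  "\<exists>C\<ge>0. \<forall>s>0. L2_norm (heatk s :: 'n::finite heis \<Rightarrow> complex) \<le> C / sqrt (s ^ (CARD('n) + 1))"
proof -
  let ?E = "\<integral>p. exp (- 2 * hw (p :: 'n heis)) \<partial>lborel"
  have E: "?E \<ge> 0" by simp
  have "L2_norm (heatk s :: 'n heis \<Rightarrow> complex) \<le> sqrt ((hK CARD('n))\<^sup>2 * ?E) / sqrt (s ^ (CARD('n) + 1))" if s: "s > 0" for s
  proof -
    let ?d = "s ^ (CARD('n) + 1)"
    have d: "?d > 0" using s by simp
    have i: "integrable lborel (\<lambda>p::'n heis. exp (- (2 / s) * hw p))" using s by (intro integrable_exp_hw) simp
    have "(L2_norm (heatk s :: 'n heis \<Rightarrow> complex))\<^sup>2 \<le> (\<integral>p. (hK CARD('n) / ?d)\<^sup>2 * exp (- (2 / s) * hw (p :: 'n heis)) \<partial>lborel)"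
      unfolding L2_norm_square
    proof (rule integral_mono)
      fix p :: "'n heis"
      have "(cmod (heatk s p))\<^sup>2 \<le> (hK CARD('n) / ?d * exp (- hw p / s))\<^sup>2"
        using heatk_bounds(1)[OF s, of p] by (intro power_mono) auto
      also have "\<dots> = (hK CARD('n) / ?d)\<^sup>2 * exp (- (2 / s) * hw p)"
        by (simp add: power_mult_distrib power_divide flip: exp_double)
      finally show "(cmod (heatk s p))\<^sup>2 \<le> (hK CARD('n) / ?d)\<^sup>2 * exp (- (2 / s) * hw p)" .
    qed (use in_L2_heatk(1)[OF s] i in \<open>auto simp: in_L2_def\<close>)
    also have "\<dots> = (hK CARD('n) / ?d)\<^sup>2 * (\<integral>p. exp (- (2 / s) * hw (p :: 'n heis)) \<partial>lborel)" by simp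
    also have "(\<integral>p. exp (- (2 / s) * hw (p :: 'n heis)) \<partial>lborel) = ?d * ?E"
      by (subst integral_dil[OF s]) (use s in \<open>simp_all add: hw_dil\<close>)
    also have "(hK CARD('n) / ?d)\<^sup>2 * (?d * ?E) = (hK CARD('n))\<^sup>2 * ?E / ?d"
      using d by (simp add: power2_eq_square divide_simps)
    finally have "sqrt ((L2_norm (heatk s :: 'n heis \<Rightarrow> complex))\<^sup>2) \<le> sqrt ((hK CARD('n))\<^sup>2 * ?E / ?d)" by (rule real_sqrt_le_mono)
    then show ?thesis by (simp add: L2_norm_nonneg real_sqrt_divide del: power_Suc)
  qed
  then show ?thesis using E by (intro exI[of _ "sqrt ((hK CARD('n))\<^sup>2 * ?E)"]) auto
qed

locale flat_orbit = L2_orbit +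
  assumes flat: "\<And>n. vanishing n 0 f"
begin

text \<open>The shape of the bound merges two regions. Where \<open>hw x \<le> 1\<close>, flatness
  gives Taylor's estimate of order \<open>2 * j\<close>, and
  \<open>norm x \<le> 5 * sqrt (hw x)\<close> converts it. Elsewhere \<open>hw x ^ j \<ge> 1\<close>
  and the function bounds itself, which keeps the estimate square integrable.\<close>

lemma H_le_hw: "\<exists>C\<ge>0. \<forall>x. cmod (H k x) \<le> hw x ^ j * (C + cmod (H k x))"
proof -
  have "vanishing (2 * j) 0 (H k)" unfolding H_def by (rule funpow_sublaplacian(2)[OF Ck_f flat])
  from taylor_vanishing[OF Ck_H this, of 5] obtain C where C: "C \<ge> 0" "\<And>x. norm x \<le> 5 \<Longrightarrow> norm (H k x) \<le> C * norm x ^ (2 * j)" by blast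
  have "cmod (H k x) \<le> hw x ^ j * (C * 25 ^ j + cmod (H k x))" for x
  proof (cases "hw x \<le> 1")
    case True
    have "norm (fst x) = sqrt (hq x)" by (simp add: hq_def)
    also have "\<dots> \<le> sqrt (16 * hw x)" by (simp add: hw_def)
    also have "\<dots> = 4 * sqrt (hw x)" by (simp add: real_sqrt_mult)
    finally have 1: "norm (fst x) \<le> 4 * sqrt (hw x)" .
    have "hw x \<le> sqrt (hw x)"
    proof (rule real_le_rsqrt)
      show "(hw x)\<^sup>2 \<le> hw x" using True hw_nonneg[of x] by (simp add: power2_eq_square mult_left_le)
    qed
    then have 2: "norm (snd x) \<le> sqrt (hw x)" using hq_nonneg[of x] by (simp add: hw_def)
    have "norm x \<le> norm (fst x) + norm (snd x)" by (metis norm_Pair_le prod.collapse)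
    with 1 2 have n: "norm x \<le> 5 * sqrt (hw x)" by simp
    have "sqrt (hw x) \<le> 1" using True by simp
    with n have "norm (H k x) \<le> C * norm x ^ (2 * j)" by (intro C(2)) linarith
    also have "\<dots> \<le> C * (5 * sqrt (hw x)) ^ (2 * j)" using n C(1) by (intro mult_left_mono power_mono) auto
    also have "(5 * sqrt (hw x)) ^ (2 * j) = 25 ^ j * hw x ^ j"
      using hw_nonneg[of x] by (simp add: power_mult power_mult_distrib)
    finally have "cmod (H k x) \<le> hw x ^ j * (C * 25 ^ j)" by (simp add: mult_ac)
    also have "\<dots> \<le> hw x ^ j * (C * 25 ^ j + cmod (H k x))" using hw_nonneg[of x] by (intro mult_left_mono) auto
    finally show ?thesis .
  next
    case False
    then have "1 * cmod (H k x) \<le> hw x ^ j * (C * 25 ^ j + cmod (H k x))"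
      using C(1) by (intro mult_mono) auto
    then show ?thesis by simp
  qed
  then show ?thesis using C(1) by (intro exI[of _ "C * 25 ^ j"]) auto
qed

text \<open>For small \<open>s\<close> the flatness factor \<open>hw ^ (m + n + 1)\<close> against
  \<open>exp (- hw / s)\<close> is worth \<open>s ^ (m + n + 1)\<close>, of which
  \<open>s ^ (n + 1)\<close> compensates the amplitude of the kernel. For \<open>s \<ge> 1\<close>
  Cauchy-Schwarz and the norm of the kernel give boundedness.\<close>

lemma heat_integral_bound:
  "\<exists>C\<ge>0. \<forall>s>0. (\<integral>x. cmod (H k x) * cmod (heatk s x) \<partial>lborel) \<le> C * s ^ m \<and> (\<integral>x. cmod (H k x) * cmod (heatk s x) \<partial>lborel) \<le> C"
proof -
  let ?n = "CARD('a) + 1"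
  let ?I = "\<lambda>s. \<integral>x. cmod (H k x) * cmod (heatk s x) \<partial>lborel"
  obtain C0 where C0: "C0 \<ge> 0" "\<And>s. s > 0 \<Longrightarrow> L2_norm (heatk s :: 'a heis \<Rightarrow> complex) \<le> C0 / sqrt (s ^ ?n)"
    using L2_norm_heatk[where 'n = 'a] by blast
  have large: "?I s \<le> L2_norm (H k) * C0" if "s \<ge> 1" for s
  proof -
    have "?I s \<le> L2_norm (H k) * L2_norm (heatk s :: 'a heis \<Rightarrow> complex)"
      using that by (intro L2_cauchy_schwarz L2_H in_L2_heatk) auto
    also have "L2_norm (heatk s :: 'a heis \<Rightarrow> complex) \<le> C0 / sqrt (s ^ ?n)" using that by (intro C0(2)) simp
    also have "C0 / sqrt (s ^ ?n) \<le> C0 / 1"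
      using that C0(1) one_le_power[OF that, of ?n] by (intro divide_left_mono) auto
    finally show ?thesis by (simp add: mult_left_mono L2_norm_nonneg)
  qed
  obtain D where D: "D \<ge> 0" "\<And>x. cmod (H k x) \<le> hw x ^ (m + ?n) * (D + cmod (H k x))" using H_le_hw[of k "m + ?n"] by blast
  let ?G = "\<lambda>x. (D + cmod (H k x)) * exp (- (1 / 2) * hw x)"
  let ?c = "hK CARD('a) * (fact (m + ?n) * 2 ^ (m + ?n))"
  have c0: "?c \<ge> 0" using hK_nonneg by simp
  have G: "integrable lborel ?G"
  proof -
    have "integrable lborel (\<lambda>x. cmod (H k x) * cmod (complex_of_real (exp (- (1 / 2) * hw x))))"
      by (intro in_L2_abs_mult L2_H in_L2_exp_hw) simp
    moreover have "integrable lborel (\<lambda>x::'a heis. D * exp (- (1 / 2) * hw x))"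
      using integrable_exp_hw[of "1 / 2", where 'n = 'a] by simp
    ultimately show ?thesis by (simp add: distrib_right)
  qed
  have small: "?I s \<le> ?c * (\<integral>x. ?G x \<partial>lborel) * s ^ m" if s: "s > 0" "s \<le> 1" for s
  proof -
    have "?I s \<le> (\<integral>x. ?c * s ^ m * ?G x \<partial>lborel)"
    proof (rule integral_mono)
      show "integrable lborel (\<lambda>x. cmod (H k x) * cmod (heatk s x))"
        using s by (intro in_L2_abs_mult L2_H in_L2_heatk) auto
      show "integrable lborel (\<lambda>x. ?c * s ^ m * ?G x)" using G by simp
      fix x
      let ?g = "D + cmod (H k x)"
      have g: "?g \<ge> 0" using D(1) by simp
      have "cmod (H k x) * cmod (heatk s x) \<le> (hw x ^ (m + ?n) * ?g) * (hK CARD('a) / s ^ ?n * exp (- hw x / s))"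
        using D(2)[of x] heatk_bounds(1)[OF s(1), of x] hw_nonneg[of x] g by (intro mult_mono) auto
      also have "\<dots> = hK CARD('a) / s ^ ?n * ?g * (hw x ^ (m + ?n) * exp (- (1 / s) * hw x))" by simp
      also have "\<dots> \<le> hK CARD('a) / s ^ ?n * ?g * (fact (m + ?n) * (2 / (1 / s)) ^ (m + ?n) * exp (- (1 / s / 2) * hw x))"
        using s g hK_nonneg hw_nonneg[of x] by (intro mult_left_mono power_exp_le) auto
      also have "\<dots> \<le> hK CARD('a) / s ^ ?n * ?g * (fact (m + ?n) * (2 / (1 / s)) ^ (m + ?n) * exp (- (1 / 2) * hw x))"
      proof -
        have "1 * hw x \<le> 1 / s * hw x" using s hw_nonneg[of x] by (intro mult_right_mono) auto
        then have "exp (- (1 / s / 2) * hw x) \<le> exp (- (1 / 2) * hw x)" by simp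
        then show ?thesis using s g hK_nonneg by (intro mult_left_mono) auto
      qed
      also have "\<dots> = ?c * s ^ m * ?G x"
        using s by (simp add: power_add power_mult_distrib)
      finally show "cmod (H k x) * cmod (heatk s x) \<le> ?c * s ^ m * ?G x" .
    qed
    also have "\<dots> = ?c * (\<integral>x. ?G x \<partial>lborel) * s ^ m" by simp
    finally show ?thesis .
  qed
  define A B where "A = L2_norm (H k) * C0" and "B = ?c * (\<integral>x. ?G x \<partial>lborel)"
  note large = large[folded A_def] and small = small[folded B_def]
  have A: "A \<ge> 0" unfolding A_def using C0(1) L2_norm_nonneg[of "H k"] by (intro mult_nonneg_nonneg)
  have B: "B \<ge> 0" unfolding B_def by (rule mult_nonneg_nonneg[OF c0 Bochner_Integration.integral_nonneg]) (use D(1) in simp)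
  have "?I s \<le> (A + B) * s ^ m \<and> ?I s \<le> A + B" if s: "s > 0" for s
  proof (cases "s \<le> 1")
    case True
    have p: "0 \<le> s ^ m" "s ^ m \<le> 1" using s True by (auto intro: power_le_one)
    have "B * s ^ m \<le> (A + B) * s ^ m" using A p by (intro mult_right_mono) auto
    moreover have "B * s ^ m \<le> B" using B p by (simp add: mult_left_le)
    ultimately show ?thesis using small[OF s True] A by linarith
  next
    case False
    then have "1 \<le> s ^ m" by (simp add: one_le_power)
    then have "(A + B) * 1 \<le> (A + B) * s ^ m" using A B by (intro mult_left_mono) auto
    then have "A + B \<le> (A + B) * s ^ m" by simp
    moreover have "?I s \<le> A" by (rule large) (use False in simp)
    then have "?I s \<le> A + B" using B by (rule add_increasing2[rotated])
    ultimately show ?thesis by (blast intro: order_trans)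
  qed
  then show ?thesis using A B by (intro exI[of _ "A + B"]) auto
qed

section \<open>Pairings of the orbit with the heat kernel and their Laplace transforms\<close>

definition "y k s = (\<integral>x. H k x * heatk s x \<partial>lborel)"
definition "Y p s = plin (\<lambda>k. y k s) p"

text \<open>The time derivative falls on the kernel and gives \<open>- heatk'\<close>;
  \<open>weak_kernel_extend\<close> together with \<open>heatk_weak\<close> turns it into one more
  sublaplacian on \<open>H k\<close>.\<close>

lemma y_deriv:
  assumes s: "s > 0" shows "(y k has_vector_derivative - y (Suc k) s) (at s)"
proof -
  let ?U = "{s / 2<..<2 * s}"
  let ?K = "hK CARD('a) / (s / 2) ^ (CARD('a) + 2)"
  let ?B = "\<lambda>x. cmod (H k x) * (?K * exp (- (1 / (2 * s)) * hw x))"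
  have "((\<lambda>s. \<integral>x. H k x * heatk s x \<partial>lborel) has_derivative (\<lambda>h. \<integral>x. h *\<^sub>R (H k x * - heatk' s x) \<partial>lborel)) (at s)"
  proof (rule has_derivative_integral[of ?U])
    show "open ?U" "convex ?U" "s \<in> ?U" using s by auto
    fix r assume "r \<in> ?U"
    then have r: "r > 0" "s / 2 \<le> r" "r \<le> 2 * s" using s by auto
    show "integrable lborel (\<lambda>x. H k x * heatk r x)" using r by (intro in_L2_mult L2_H in_L2_heatk) auto
    fix x :: "'a heis"
    have "((\<lambda>r. heatk r x) has_vector_derivative - heatk' r x) (at r)"
      unfolding heatk_def heatk'_def by (rule hk_deriv[OF r(1) hq_nonneg card_ge_1])
    from has_vector_derivative_mult_right[OF this, of "H k x"]
    show "((\<lambda>r. H k x * heatk r x) has_derivative (\<lambda>h. h *\<^sub>R (H k x * - heatk' r x))) (at r)"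
      by (simp add: has_vector_derivative_def)
    fix h :: real
    have "norm (heatk' r x) \<le> hK CARD('a) / r ^ (CARD('a) + 2) * exp (- hw x / r)" by (rule heatk_bounds(2)[OF r(1)])
    also have "\<dots> \<le> ?K * exp (- (1 / (2 * s)) * hw x)"
    proof (rule mult_mono)
      show "hK CARD('a) / r ^ (CARD('a) + 2) \<le> ?K"
        using r s hK_nonneg by (intro divide_left_mono power_mono mult_pos_pos zero_less_power) auto
      have "hw x / (2 * s) \<le> hw x / r" using r s hw_nonneg[of x] by (intro divide_left_mono) auto
      then show "exp (- hw x / r) \<le> exp (- (1 / (2 * s)) * hw x)" by simp
    qed (use s hK_nonneg in auto)
    finally have "\<bar>h\<bar> * (cmod (H k x) * norm (heatk' r x)) \<le> \<bar>h\<bar> * ?B x" by (intro mult_left_mono) auto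
    then show "norm (h *\<^sub>R (H k x * - heatk' r x)) \<le> ?B x * norm h" by (simp add: norm_mult mult.commute)
  next
    have "H k \<in> borel_measurable borel" by (rule Ck_measurable[OF Ck_H])
    then show "(\<lambda>x. h *\<^sub>R (H k x * - heatk' s x)) \<in> borel_measurable lborel" for h using heatk_measurable(2) by simp
    have "integrable lborel (\<lambda>x. cmod (H k x) * cmod (complex_of_real (exp (- (1 / (2 * s)) * hw x))))"
      using s by (intro in_L2_abs_mult L2_H in_L2_exp_hw) simp
    then have "integrable lborel (\<lambda>x. ?K * (cmod (H k x) * cmod (complex_of_real (exp (- (1 / (2 * s)) * hw x)))))" by (rule integrable_mult_right)
    then show "integrable lborel ?B" by (simp add: mult_ac)
  qed
  then have "(y k has_vector_derivative (\<integral>x. H k x * - heatk' s x \<partial>lborel)) (at s)"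
    by (simp add: has_vector_derivative_def y_def[abs_def])
  moreover have "y (Suc k) s = (\<integral>x. H k x * heatk' s x \<partial>lborel)"
    unfolding y_def H_Suc
  proof (rule weak_kernel_extend[OF Ck_H L2_H _ in_L2_heatk[OF s] heatk_weak[OF s]])
    show "in_L2 (sublaplacian (H k))" using L2_H[of "Suc k"] by (simp only: H_Suc)
  qed
  ultimately show ?thesis by simp
qed

lemma Y_deriv:
  assumes "s > 0" shows "(Y p has_vector_derivative - Y (polyX * p) s) (at s)"
proof -
  have "((\<lambda>s. \<Sum>i\<le>degree p. coeff p i *\<^sub>R y i s) has_vector_derivative (\<Sum>i\<le>degree p. coeff p i *\<^sub>R - y (Suc i) s)) (at s)"
    by (intro has_vector_derivative_sum bounded_linear.has_vector_derivative[OF bounded_linear_scaleR_right] y_deriv assms)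
  moreover have "Y (polyX * p) s = (\<Sum>i\<le>degree p. coeff p i *\<^sub>R y (Suc i) s)"
    unfolding Y_def by (simp add: plin_def[of _ p])
  ultimately show ?thesis by (simp add: Y_def[abs_def] plin_def sum_negf)
qed

text \<open>One power of \<open>s\<close> is what removes the boundary terms at 0 in the
  integrations by parts of \<open>lap_parts\<close>.\<close>

lemma Y_bound: "\<exists>C\<ge>0. \<forall>s>0. cmod (Y p s) \<le> C * s"
proof -
  have "\<exists>C\<ge>0. \<forall>s>0. cmod (y k s) \<le> C * s" for k
  proof -
    obtain C where C: "C \<ge> 0" "\<And>s. s > 0 \<Longrightarrow> (\<integral>x. cmod (H k x) * cmod (heatk s x) \<partial>lborel) \<le> C * s ^ 1"
      using heat_integral_bound[of k 1] by blast
    have "cmod (y k s) \<le> C * s" if "s > 0" for s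
      using integral_norm_bound[of lborel "\<lambda>x. H k x * heatk s x"] C(2)[OF that] by (simp add: y_def norm_mult)
    with C(1) show ?thesis by blast
  qed
  then obtain C where C: "\<And>k. C k \<ge> 0" "\<And>k s. s > 0 \<Longrightarrow> cmod (y k s) \<le> C k * s" by metis
  have "cmod (Y p s) \<le> (\<Sum>i\<le>degree p. \<bar>coeff p i\<bar> * C i) * s" if "s > 0" for s
  proof -
    have "cmod (Y p s) \<le> (\<Sum>i\<le>degree p. norm (coeff p i *\<^sub>R y i s))" unfolding Y_def plin_def by (rule norm_sum)
    also have "\<dots> \<le> (\<Sum>i\<le>degree p. \<bar>coeff p i\<bar> * (C i * s))"
      using C(2)[OF that] by (intro sum_mono) (simp add: mult_left_mono)
    finally show ?thesis by (simp add: sum_distrib_right mult.assoc)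
  qed
  then show ?thesis using C(1) by (intro exI[of _ "\<Sum>i\<le>degree p. \<bar>coeff p i\<bar> * C i"]) (auto intro!: sum_nonneg)
qed

lemma Y_L2_bound:
  assumes s: "s > 0" shows "cmod (Y p s) \<le> L2_norm (lin p) * L2_norm (heatk s :: 'a heis \<Rightarrow> complex)"
proof -
  have "Y p s = (\<integral>x. lin p x * heatk s x \<partial>lborel)"
    unfolding Y_def lin_def y_def by (rule plin_fun(4)[OF L2_H Ck_H in_L2_heatk(1)[OF s], symmetric])
  then have "cmod (Y p s) \<le> (\<integral>x. norm (lin p x * heatk s x) \<partial>lborel)" by simp
  also have "\<dots> \<le> L2_norm (lin p) * L2_norm (heatk s :: 'a heis \<Rightarrow> complex)"
    using L2_cauchy_schwarz[OF L2_lin in_L2_heatk(1)[OF s]] by (simp add: norm_mult)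
  finally show ?thesis .
qed

definition "lap c j p = (LINT s:{0<..}|lborel. (s ^ j * exp (- c * s)) *\<^sub>R Y p s)"

lemma Y_cont: "s > 0 \<Longrightarrow> isCont (Y p) s"
  by (rule has_vector_derivative_continuous[OF Y_deriv])

lemma lap_bound:
  assumes c: "c > 0"
  shows "\<exists>C. \<forall>s>0. norm ((s ^ j * exp (- c * s)) *\<^sub>R Y p s) \<le> C * (s * exp (- (c / 2) * s))"
proof -
  obtain C where C: "C \<ge> 0" "\<And>s. s > 0 \<Longrightarrow> cmod (Y p s) \<le> C * s" using Y_bound by blast
  have "norm ((s ^ j * exp (- c * s)) *\<^sub>R Y p s) \<le> C * (fact j * (2 / c) ^ j) * (s * exp (- (c / 2) * s))" if s: "s > 0" for s
  proof -
    have "norm ((s ^ j * exp (- c * s)) *\<^sub>R Y p s) = (s ^ j * exp (- c * s)) * cmod (Y p s)" using s by (simp add: abs_mult)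
    also have "\<dots> \<le> (fact j * (2 / c) ^ j * exp (- (c / 2) * s)) * (C * s)"
      using s c C by (intro mult_mono power_exp_le) auto
    finally show ?thesis by (simp add: mult_ac)
  qed
  then show ?thesis by blast
qed

lemma lap_integrable:
  assumes c: "c > 0"
  shows "set_integrable lborel {0<..} (\<lambda>s. (s ^ j * exp (- c * s)) *\<^sub>R Y p s)"
proof -
  obtain C where C: "\<And>s. s > 0 \<Longrightarrow> norm ((s ^ j * exp (- c * s)) *\<^sub>R Y p s) \<le> C * (s * exp (- (c / 2) * s))"
    using lap_bound[OF c] by blast
  have b: "norm ((s ^ j * exp (- c * s)) *\<^sub>R Y p s) \<le> \<bar>C\<bar> * (4 / c) * exp (- (c / 4) * s)" if s: "s > 0" for s
  proof -
    have "s ^ 1 * exp (- (c / 2) * s) \<le> fact 1 * (2 / (c / 2)) ^ 1 * exp (- (c / 2 / 2) * s)"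
      using s c by (intro power_exp_le) auto
    then have "\<bar>C\<bar> * (s * exp (- (c / 2) * s)) \<le> \<bar>C\<bar> * (4 / c * exp (- (c / 4) * s))" by (intro mult_left_mono) auto
    moreover have "C * (s * exp (- (c / 2) * s)) \<le> \<bar>C\<bar> * (s * exp (- (c / 2) * s))" using s by (intro mult_right_mono) auto
    ultimately show ?thesis using C[OF s] by simp
  qed
  show ?thesis
  proof (rule set_integrable_bound[OF half_line_exp_integrable[of "c / 4" "\<bar>C\<bar> * (4 / c)"]])
    show "set_borel_measurable lborel {0<..} (\<lambda>s. (s ^ j * exp (- c * s)) *\<^sub>R Y p s)"
      unfolding set_borel_measurable_def
      by (subst measurable_lborel2, intro borel_measurable_continuous_on_indicator continuous_at_imp_continuous_on ballI continuous_intros Y_cont) auto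
    show "AE s\<in>{0<..} in lborel. norm ((s ^ j * exp (- c * s)) *\<^sub>R Y p s) \<le> norm (\<bar>C\<bar> * (4 / c) * exp (- (c / 4) * s))"
      using b c by (intro AE_I2) auto
  qed (use c in simp)
qed

lemma lap_add:
  assumes "c > 0" shows "lap c j (p + q) = lap c j p + lap c j q"
  unfolding lap_def by (subst set_integral_add(2)[OF lap_integrable lap_integrable, OF assms assms, symmetric])
    (simp add: Y_def plin_add scaleR_add_right)

text \<open>By \<open>Y_deriv\<close> the derivative of \<open>exp (- c s) Y p s\<close> is
  \<open>- exp (- c s) Y ((X + c) p) s\<close>. Integrating it over the half-line, without and with
  a power of \<open>s\<close> in front, gives the two identities.\<close>

lemma lap_parts:
  assumes c: "c > 0"
  shows "lap c 0 ([:c, 1:] * p) = 0" and "lap c (Suc j) ([:c, 1:] * p) = of_nat (Suc j) * lap c j p"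
proof -
  have YX: "Y ([:c, 1:] * p) s = c *\<^sub>R Y p s + Y (polyX * p) s" for s
  proof -
    have "[:c, 1:] * p = smult c p + polyX * p" by simp
    then show ?thesis by (simp only: Y_def plin_add plin_smult)
  qed
  have d: "((\<lambda>s. exp (- c * s) *\<^sub>R Y p s) has_vector_derivative - (exp (- c * s) *\<^sub>R Y ([:c, 1:] * p) s)) (at s)" if "s > 0" for s
    unfolding YX
    by (rule has_vector_derivative_eq_rhs[OF has_vector_derivative_scaleR[OF _ Y_deriv[OF that]]])
      (auto intro!: derivative_eq_intros simp: algebra_simps)
  obtain C where C: "\<And>s. s > 0 \<Longrightarrow> norm ((s ^ 0 * exp (- c * s)) *\<^sub>R Y p s) \<le> C * (s * exp (- (c / 2) * s))"
    using lap_bound[OF c, of 0 p] by blast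
  have "(LINT s:{0<..}|lborel. - (exp (- c * s) *\<^sub>R Y ([:c, 1:] * p) s)) = 0"
  proof (rule ftc_half_line[OF d])
    show "isCont (\<lambda>s. - (exp (- c * s) *\<^sub>R Y ([:c, 1:] * p) s)) s" if "s > 0" for s
      by (intro continuous_intros Y_cont that)
    show "set_integrable lborel {0<..} (\<lambda>s. - (exp (- c * s) *\<^sub>R Y ([:c, 1:] * p) s))"
      using set_integrable_mult_right[of "- 1", OF lap_integrable[OF c, of 0 "[:c, 1:] * p"]] by (simp del: mult_pCons_left)
    show "norm (exp (- c * s) *\<^sub>R Y p s) \<le> C * (s * exp (- (c / 2) * s))" if "s > 0" for s using C[OF that] by simp
  qed (use c in auto)
  then show "lap c 0 ([:c, 1:] * p) = 0" by (simp add: lap_def set_lebesgue_integral_def del: mult_pCons_left)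
  have d': "((\<lambda>s. (s ^ Suc j * exp (- c * s)) *\<^sub>R Y p s) has_vector_derivative
      of_nat (Suc j) * ((s ^ j * exp (- c * s)) *\<^sub>R Y p s) - (s ^ Suc j * exp (- c * s)) *\<^sub>R Y ([:c, 1:] * p) s) (at s)" if "s > 0" for s
  proof -
    have "((\<lambda>s. s ^ Suc j *\<^sub>R (exp (- c * s) *\<^sub>R Y p s)) has_vector_derivative
      s ^ Suc j *\<^sub>R - (exp (- c * s) *\<^sub>R Y ([:c, 1:] * p) s) + (real (Suc j) * s ^ j) *\<^sub>R (exp (- c * s) *\<^sub>R Y p s)) (at s)"
      by (rule has_vector_derivative_scaleR[OF _ d[OF that]]) (use DERIV_pow[of "Suc j" s] in simp)
    then show ?thesis by (simp add: scaleR_conv_of_real mult_ac del: mult_pCons_left power_Suc of_nat_Suc)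
  qed
  obtain C' where C': "\<And>s. s > 0 \<Longrightarrow> norm ((s ^ Suc j * exp (- c * s)) *\<^sub>R Y p s) \<le> C' * (s * exp (- (c / 2) * s))"
    using lap_bound[OF c, of "Suc j" p] by blast
  have i1: "set_integrable lborel {0<..} (\<lambda>s. of_nat (Suc j) * ((s ^ j * exp (- c * s)) *\<^sub>R Y p s))"
    by (intro set_integrable_mult_right lap_integrable c)
  have "(LINT s:{0<..}|lborel. of_nat (Suc j) * ((s ^ j * exp (- c * s)) *\<^sub>R Y p s) - (s ^ Suc j * exp (- c * s)) *\<^sub>R Y ([:c, 1:] * p) s) = 0"
  proof (rule ftc_half_line[OF d' _ _ C'])
    show "isCont (\<lambda>s. of_nat (Suc j) * ((s ^ j * exp (- c * s)) *\<^sub>R Y p s) - (s ^ Suc j * exp (- c * s)) *\<^sub>R Y ([:c, 1:] * p) s) s" if "s > 0" for s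
      by (intro continuous_intros Y_cont that)
    show "set_integrable lborel {0<..} (\<lambda>s. of_nat (Suc j) * ((s ^ j * exp (- c * s)) *\<^sub>R Y p s) - (s ^ Suc j * exp (- c * s)) *\<^sub>R Y ([:c, 1:] * p) s)"
      by (rule set_integral_diff(1)[OF i1 lap_integrable[OF c]])
  qed (use c in auto)
  then show "lap c (Suc j) ([:c, 1:] * p) = of_nat (Suc j) * lap c j p"
    unfolding set_integral_diff(2)[OF i1 lap_integrable[OF c]] lap_def by (simp only: set_integral_mult_right) simp
qed

lemma lap_iterate:
  assumes "c > 0" shows "lap c J ([:c, 1:] ^ J * p) = of_nat (fact J) * lap c 0 p"
proof (induction J arbitrary: p)
  case (Suc J)
  have "lap c (Suc J) ([:c, 1:] ^ Suc J * p) = lap c (Suc J) ([:c, 1:] * ([:c, 1:] ^ J * p))" by (simp only: power_Suc mult.assoc)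
  also have "\<dots> = of_nat (fact (Suc J)) * lap c 0 p"
    unfolding lap_parts(2)[OF assms] Suc.IH by (simp add: algebra_simps)
  finally show ?case .
qed simp

text \<open>A polynomial \<open>r\<close> with value 1 at \<open>- c\<close> differs from 1 by a
  multiple of \<open>X + c\<close>, so \<open>lap c 0 r = lap c 0 1\<close>. Passing to
  \<open>lap c ?J\<close> by \<open>lap_iterate\<close> brings in the weight \<open>s ^ ?J\<close>,
  which outweighs the kernel norm at 0, and \<open>lin_density\<close> makes the resulting bound
  arbitrarily small.\<close>

lemma lap_zero:
  assumes c: "c > 0" and M: "\<And>k. M k > 0" "log_convex M" and bd: "\<And>k. L2_norm (H k) \<le> M k"
    and div: "\<not> summable (\<lambda>k. M k powr (- 1 / (2 * real k)))"
  shows "lap c 0 1 = 0"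
proof -
  let ?J = "CARD('a) + 1"
  obtain C0 where C0: "C0 \<ge> 0" "\<And>s. s > 0 \<Longrightarrow> L2_norm (heatk s :: 'a heis \<Rightarrow> complex) \<le> C0 / sqrt (s ^ ?J)"
    using L2_norm_heatk[where 'n = 'a] by blast
  let ?K = "C0 * (1 + fact ?J * (2 / c) ^ ?J)"
  \<comment> \<open>The weight \<open>s ^ ?J\<close> against the kernel norm leaves
    \<open>sqrt (s ^ ?J)\<close>. It is at most \<open>1 + s ^ ?J\<close>, and half of the
    exponential absorbs the power.\<close>
  have wt: "s ^ ?J * exp (- c * s) * (C0 / sqrt (s ^ ?J)) \<le> ?K * exp (- (c / 2) * s)" if s: "s > 0" for s
  proof -
    have "s ^ ?J / sqrt (s ^ ?J) = sqrt (s ^ ?J)" by (rule real_div_sqrt) (use s in simp)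
    then have "s ^ ?J * exp (- c * s) * (C0 / sqrt (s ^ ?J)) = C0 * (sqrt (s ^ ?J) * exp (- c * s))"
      by (metis (no_types, lifting) mult.assoc mult.commute times_divide_eq_right)
    also have "\<dots> \<le> C0 * ((1 + s ^ ?J) * exp (- c * s))"
    proof -
      have "sqrt (s ^ ?J) \<le> 1 + s ^ ?J" by (rule real_le_lsqrt) (use s in \<open>auto simp: power2_eq_square algebra_simps\<close>)
      then show ?thesis using C0(1) by (intro mult_left_mono mult_right_mono) auto
    qed
    also have "\<dots> \<le> C0 * (1 * exp (- (c / 2) * s) + fact ?J * (2 / c) ^ ?J * exp (- (c / 2) * s))"
    proof -
      have "c / 2 * s \<le> c * s" using s c by simp
      then have "exp (- c * s) \<le> exp (- (c / 2) * s)" by simp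
      moreover have "s ^ ?J * exp (- c * s) \<le> fact ?J * (2 / c) ^ ?J * exp (- (c / 2) * s)"
        using s c by (intro power_exp_le) auto
      ultimately show ?thesis using C0(1) unfolding distrib_right by (intro mult_left_mono add_mono) auto
    qed
    finally show ?thesis by (simp only: distrib_right mult.assoc)
  qed
  define D where "D = (LINT s:{0<..}|lborel. ?K * exp (- (c / 2) * s))"
  have lapJ: "cmod (lap c ?J p) \<le> L2_norm (lin p) * D" for p
  proof -
    have "cmod (lap c ?J p) \<le> (LINT s:{0<..}|lborel. L2_norm (lin p) * (?K * exp (- (c / 2) * s)))"
      unfolding lap_def set_lebesgue_integral_def
    proof (rule Bochner_Integration.integral_norm_bound_integral)
      show "integrable lborel (\<lambda>s. indicat_real {0<..} s *\<^sub>R ((s ^ ?J * exp (- c * s)) *\<^sub>R Y p s))"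
        using lap_integrable[OF c] unfolding set_integrable_def .
      show "integrable lborel (\<lambda>s. indicat_real {0<..} s *\<^sub>R (L2_norm (lin p) * (?K * exp (- (c / 2) * s))))"
        using half_line_exp_integrable[of "c / 2" "L2_norm (lin p) * ?K"] c unfolding set_integrable_def by (simp add: mult.assoc)
      fix s
      show "norm (indicat_real {0<..} s *\<^sub>R ((s ^ ?J * exp (- c * s)) *\<^sub>R Y p s))
        \<le> indicat_real {0<..} s *\<^sub>R (L2_norm (lin p) * (?K * exp (- (c / 2) * s)))"
      proof (cases "s > 0")
        case True
        have "norm ((s ^ ?J * exp (- c * s)) *\<^sub>R Y p s) = s ^ ?J * exp (- c * s) * cmod (Y p s)" using True by (simp add: abs_mult)
        also have "\<dots> \<le> s ^ ?J * exp (- c * s) * (L2_norm (lin p) * (C0 / sqrt (s ^ ?J)))"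
          using True C0(2)[OF True] L2_norm_nonneg[of "lin p"]
          by (intro mult_left_mono order_trans[OF Y_L2_bound[OF True]]) auto
        also have "\<dots> = L2_norm (lin p) * (s ^ ?J * exp (- c * s) * (C0 / sqrt (s ^ ?J)))" by (simp only: mult_ac)
        also have "\<dots> \<le> L2_norm (lin p) * (?K * exp (- (c / 2) * s))"
          using wt[OF True] L2_norm_nonneg[of "lin p"] by (intro mult_left_mono)
        finally show ?thesis using True by simp
      qed simp
    qed
    then show ?thesis unfolding D_def by simp
  qed
  have "(cmod (lap c 0 1))\<^sup>2 \<le> \<epsilon> * D\<^sup>2" if e: "\<epsilon> > 0" for \<epsilon>
  proof -
    obtain r where r: "poly r (- c) = 1" "(L2_norm (lin ([:c, 1:] ^ ?J * r)))\<^sup>2 < \<epsilon>"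
      using lin_density[OF c e M bd div, of ?J] by blast
    have "[:- (- c), 1:] dvd r - 1" using r(1) by (subst poly_eq_0_iff_dvd[symmetric]) simp
    then obtain u where "r - 1 = [:c, 1:] * u" unfolding minus_minus by (rule dvdE)
    then have "r = 1 + [:c, 1:] * u" by (metis add_diff_cancel_left' add.commute diff_add_cancel)
    then have "lap c 0 r = lap c 0 1" by (simp only: lap_add[OF c] lap_parts(1)[OF c] add_0_right)
    then have "cmod (lap c 0 1) * 1 \<le> cmod (lap c 0 1) * fact ?J" by (intro mult_left_mono fact_ge_1) simp
    also have "\<dots> = cmod (lap c ?J ([:c, 1:] ^ ?J * r))"
      unfolding lap_iterate[OF c] \<open>lap c 0 r = lap c 0 1\<close> by (simp only: norm_mult of_nat_fact norm_fact mult.commute)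
    also have "\<dots> \<le> L2_norm (lin ([:c, 1:] ^ ?J * r)) * D" by (rule lapJ)
    finally have "(cmod (lap c 0 1))\<^sup>2 \<le> (L2_norm (lin ([:c, 1:] ^ ?J * r)) * D)\<^sup>2" by (intro power_mono) auto
    also have "\<dots> \<le> \<epsilon> * D\<^sup>2" unfolding power_mult_distrib using r(2) by (intro mult_right_mono) auto
    finally show ?thesis .
  qed
  then have "(cmod (lap c 0 1))\<^sup>2 \<le> inverse (real (Suc m)) * D\<^sup>2" for m by simp
  moreover have "(\<lambda>m. inverse (real (Suc m)) * D\<^sup>2) \<longlonglongrightarrow> 0 * D\<^sup>2"
    by (intro tendsto_intros LIMSEQ_inverse_real_of_nat)
  ultimately have "(cmod (lap c 0 1))\<^sup>2 \<le> 0 * D\<^sup>2" by (intro LIMSEQ_le_const) auto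
  then show ?thesis by simp
qed

text \<open>The exponents from \<open>- 3\<close> to \<open>- 1\<close> are minus the Laplace
  variable, and \<open>lap_zero\<close> applies to each of them. Real and imaginary parts are
  treated together through a real functional \<open>P\<close>.\<close>

lemma y_zero:
  assumes M: "\<And>k. M k > 0" "log_convex M" and bd: "\<And>k. L2_norm (H k) \<le> M k"
    and div: "\<not> summable (\<lambda>k. M k powr (- 1 / (2 * real k)))" and s: "s > 0"
  shows "y 0 s = 0"
proof -
  have Y1: "Y 1 = y 0" by (simp add: Y_def[abs_def] one_pCons)
  have i: "integrable lborel (\<lambda>s. (indicat_real {0<..} s * exp (- c * s)) *\<^sub>R y 0 s)" if "c > 0" for c
    using lap_integrable[OF that, of 0 1] unfolding set_integrable_def Y1 by simp
  have z: "(\<integral>s. (indicat_real {0<..} s * exp (- c * s)) *\<^sub>R y 0 s \<partial>lborel) = 0" if "c > 0" for c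
    using lap_zero[OF that M bd div] unfolding lap_def set_lebesgue_integral_def Y1 by simp
  have co: "continuous_on {0<..} (y 0)"
    by (intro continuous_at_imp_continuous_on ballI) (use Y_cont[of _ 1] Y1 in auto)
  have "indicat_real {0<..} s * P (y 0 s) = 0" if P: "bounded_linear P" for P :: "complex \<Rightarrow> real"
  proof (rule moments_zero_continuous[where k = "\<lambda>s. indicat_real {0<..} s * P (y 0 s)" and u = "\<lambda>x. x" and v = "\<lambda>x. x" and a = "- 4" and b = 0 and c = "- 3" and d = "- 1"])
    have "continuous_on {0<..} (\<lambda>s. P (y 0 s))" by (rule bounded_linear.continuous_on[OF P co])
    then show "continuous_on {0<..} (\<lambda>s. indicat_real {0<..} s * P (y 0 s))"
      by (rule continuous_on_eq) simp
    have eq: "indicat_real {0<..} s * P (y 0 s) * exp (c * s) = P ((indicat_real {0<..} s * exp (- (- c) * s)) *\<^sub>R y 0 s)" for s c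
      by (simp add: linear_scale[OF bounded_linear.linear[OF P]])
    show "integrable lborel (\<lambda>s. indicat_real {0<..} s * P (y 0 s) * exp (c * s))" if "c \<in> {- 4<..<0}" for c
      unfolding eq by (rule integrable_bounded_linear[OF P i]) (use that in simp)
    have "{c\<in>{- 3..- 1}. (\<integral>s. indicat_real {0<..} s * P (y 0 s) * exp (c * s) \<partial>lborel) = 0} = {- 3..- 1}"
    proof -
      have "(\<integral>s. indicat_real {0<..} s * P (y 0 s) * exp (c * s) \<partial>lborel) = 0" if "c \<in> {- 3..- 1}" for c
      proof -
        have c: "- c > 0" using that by simp
        show ?thesis unfolding eq integral_bounded_linear[OF P i[OF c]] z[OF c] by (rule linear_0[OF bounded_linear.linear[OF P]])
      qed
      then show ?thesis by blast
    qed
    then show "infinite {c\<in>{- 3..- 1}. (\<integral>s. indicat_real {0<..} s * P (y 0 s) * exp (c * s) \<partial>lborel) = 0}"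
      by (simp add: infinite_Icc)
  qed auto
  from this[OF bounded_linear_Re] this[OF bounded_linear_Im] s show ?thesis by (simp add: complex_eq_iff)
qed

end

subsection \<open>Radial functions and Mellin transforms\<close>

definition koranyi :: "'n::finite heis \<Rightarrow> real" where "koranyi p = sqrt ((hq p)\<^sup>2 + (snd p)\<^sup>2)"

lemma koranyi_nonneg: "koranyi p \<ge> 0"
  by (simp add: koranyi_def)

lemma hq_le_koranyi: "hq p \<le> koranyi p" and snd_le_koranyi: "\<bar>snd p\<bar> \<le> koranyi p"
  by (auto simp: koranyi_def intro: real_le_rsqrt abs_le_square_iff[THEN iffD1] real_sqrt_sum_squares_ge1 real_sqrt_sum_squares_ge2)

lemma koranyi_le_hw: "koranyi p \<le> 16 * hw p"
proof -
  have "koranyi p \<le> \<bar>hq p\<bar> + \<bar>snd p\<bar>" unfolding koranyi_def by (rule sqrt_sum_squares_le_sum_abs)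
  then show ?thesis using hq_nonneg[of p] by (simp add: hw_def)
qed

lemma koranyi_pos: assumes "p \<noteq> 0" shows "koranyi p > 0"
proof (rule ccontr)
  assume "\<not> ?thesis"
  then have "koranyi p = 0" using koranyi_nonneg[of p] by linarith
  then have "hq p = 0" "snd p = 0" using hq_le_koranyi[of p] snd_le_koranyi[of p] hq_nonneg[of p] by auto
  then show False using assms by (simp add: hq_def prod_eq_iff)
qed

lemma koranyi_dil: "s > 0 \<Longrightarrow> koranyi (dil s p) = s * koranyi p"
proof -
  assume s: "s > 0"
  have "(hq (dil s p))\<^sup>2 + (snd (dil s p))\<^sup>2 = s\<^sup>2 * ((hq p)\<^sup>2 + (snd p)\<^sup>2)"
    unfolding hq_dil[OF s] by (simp add: dil_def power_mult_distrib algebra_simps)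
  then show ?thesis using s by (simp add: koranyi_def real_sqrt_mult)
qed

lemma koranyi_measurable [measurable]: "(koranyi :: 'n::finite heis \<Rightarrow> real) \<in> borel_measurable borel"
  unfolding koranyi_def[abs_def] using hq_measurable heis_snd_measurable by measurable

lemma open_koranyi_ball: "open {p :: 'n::finite heis. p \<noteq> 0 \<and> koranyi p < d}"
proof -
  have "continuous_on UNIV (koranyi :: 'n heis \<Rightarrow> real)"
    unfolding koranyi_def[abs_def] hq_def[abs_def] by (intro continuous_intros)
  then have "open (koranyi -` {..<d} :: 'n heis set)" by (intro open_vimage) auto
  then have "open ((koranyi -` {..<d}) \<inter> - {0} :: 'n heis set)" by (intro open_Int) auto
  moreover have "(koranyi -` {..<d}) \<inter> - {0} = {p :: 'n heis. p \<noteq> 0 \<and> koranyi p < d}" by auto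
  ultimately show ?thesis by simp
qed

lemma koranyi_ball_nonempty: assumes "d > 0" shows "{p :: 'n::finite heis. p \<noteq> 0 \<and> koranyi p < d} \<noteq> {}"
proof -
  have "(0, d / 2) \<in> {p :: 'n heis. p \<noteq> 0 \<and> koranyi p < d}" using assms by (simp add: koranyi_def hq_def zero_prod_def)
  then show ?thesis by blast
qed

lemma hk_dil:
  assumes s: "s > 0" shows "hk n s (s * v) (s * t) = hk n 1 v t / of_real (s ^ Suc n)"
proof -
  have m: "complex_of_real (mP n s (s * v) (0 + 1 / s * l)) = of_real (mP n 1 v l) / of_real (s ^ n)" for l
    using s by (simp add: mP_scale del: of_real_power)
  have "hk n s (s * v) (s * t) = \<bar>1 / s\<bar> *\<^sub>R (\<integral>l. exp (\<i> * of_real (s * t * (0 + 1 / s * l))) * of_real (mP n s (s * v) (0 + 1 / s * l)) \<partial>lborel)"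
    unfolding hk_def using s by (intro lborel_integral_real_affine) auto
  also have "\<dots> = \<bar>1 / s\<bar> *\<^sub>R (\<integral>l. exp (\<i> * of_real (t * l)) * of_real (mP n 1 v l) / of_real (s ^ n) \<partial>lborel)"
    unfolding m using s by (simp del: of_real_power)
  also have "\<dots> = hk n 1 v t / of_real (s ^ Suc n)"
    unfolding hk_def integral_divide_zero using s by (simp add: scaleR_conv_of_real)
  finally show ?thesis .
qed

lemma heatk_dil:
  fixes x :: "'n::finite heis"
  assumes s: "s > 0" shows "heatk s (dil s x) = heatk 1 x / of_real (s ^ (CARD('n) + 1))"
  unfolding heatk_def hq_dil[OF s] using hk_dil[OF s, of "CARD('n)" "hq x" "snd x"] by (simp add: dil_def)

text \<open>Points with gauge tending to 0 and nonpositive real part of the kernel would contradict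
  \<open>hk_continuous_origin\<close> and \<open>hk_origin_pos\<close>.\<close>

lemma heatk_pos_near_0: "\<exists>d>0. \<forall>x::'n::finite heis. koranyi x < d \<longrightarrow> Re (heatk 1 x) > 0"
proof (rule ccontr)
  assume "\<not> ?thesis"
  then have "\<exists>x::'n heis. koranyi x < inverse (real (Suc i)) \<and> Re (heatk 1 x) \<le> 0" for i
    by (metis inverse_positive_iff_positive not_less of_nat_0_less_iff zero_less_Suc)
  then obtain x :: "nat \<Rightarrow> 'n heis" where x: "\<And>i. koranyi (x i) < inverse (real (Suc i))" "\<And>i. Re (heatk 1 (x i)) \<le> 0"
    by metis
  have lim: "V \<longlonglongrightarrow> 0" if "\<And>i. \<bar>V i\<bar> \<le> koranyi (x i)" for V :: "nat \<Rightarrow> real"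
  proof (rule Lim_null_comparison[OF _ LIMSEQ_inverse_real_of_nat])
    show "\<forall>\<^sub>F i in sequentially. norm (V i) \<le> inverse (real (Suc i))"
      using that x(1) by (intro always_eventually allI) (metis less_imp_le order_trans real_norm_def)
  qed
  have "(\<lambda>i. hk CARD('n) 1 (hq (x i)) (snd (x i))) \<longlonglongrightarrow> hk CARD('n) 1 0 0"
    by (rule hk_continuous_origin[OF card_ge_1 lim hq_nonneg lim[OF snd_le_koranyi]])
      (simp only: abs_of_nonneg[OF hq_nonneg] hq_le_koranyi)
  then have "(\<lambda>i. Re (heatk 1 (x i))) \<longlonglongrightarrow> Re (hk CARD('n) 1 0 0)" unfolding heatk_def by (rule tendsto_Re)
  then have "Re (hk CARD('n) 1 0 0) \<le> 0" using x(2) by (intro LIMSEQ_le_const2) auto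
  then show False using hk_origin_pos[OF card_ge_1[where 'n = 'n]] by linarith
qed

text \<open>Powers of the gauge are written \<open>exp (p * ln N)\<close> to match
  \<open>exponential_moments_unique\<close>. For \<open>p < 4\<close> they are at most 1 or at most
  the fourth power, which the exponential decay absorbs.\<close>

lemma integrable_heatk_koranyi:
  assumes p: "0 < p" "p < 4"
  shows "integrable lborel (\<lambda>x::'n::finite heis. cmod (heatk 1 x) * exp (p * ln (koranyi x)))"
proof (rule Bochner_Integration.integrable_bound)
  let ?K = "hK CARD('n) * (1 + 16 ^ 4 * (fact 4 * 2 ^ 4))"
  show "integrable lborel (\<lambda>x::'n heis. ?K * exp (- (1 / 2) * hw x))"
    by (intro integrable_mult_right integrable_exp_hw) simp
  show "(\<lambda>x::'n heis. cmod (heatk 1 x) * exp (p * ln (koranyi x))) \<in> borel_measurable lborel" by simp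
  have "cmod (heatk 1 x) * exp (p * ln (koranyi x)) \<le> ?K * exp (- (1 / 2) * hw x)" for x :: "'n heis"
  proof -
    have h: "cmod (heatk 1 x) \<le> hK CARD('n) * exp (- hw x)" using heatk_bounds(1)[of 1 x] by simp
    have e: "exp (p * ln (koranyi x)) \<le> 1 + (16 * hw x) ^ 4"
    proof (cases "koranyi x \<le> 1")
      case True
      then have "ln (koranyi x) \<le> 0" using koranyi_nonneg[of x] by (cases "koranyi x = 0") auto
      then have "exp (p * ln (koranyi x)) \<le> 1" using p by (simp add: mult_nonneg_nonpos)
      moreover have "(16 * hw x) ^ 4 \<ge> 0" using hw_nonneg[of x] by simp
      ultimately show ?thesis by linarith
    next
      case False
      then have "exp (p * ln (koranyi x)) \<le> exp (4 * ln (koranyi x))" using p by simp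
      also have "\<dots> = koranyi x ^ 4" using False exp_of_nat_mult[of 4 "ln (koranyi x)"] by simp
      also have "\<dots> \<le> (16 * hw x) ^ 4" using koranyi_le_hw[of x] koranyi_nonneg[of x] by (intro power_mono)
      finally show ?thesis by simp
    qed
    have "cmod (heatk 1 x) * exp (p * ln (koranyi x)) \<le> (hK CARD('n) * exp (- hw x)) * (1 + (16 * hw x) ^ 4)"
      using h e hK_nonneg by (intro mult_mono) auto
    also have "\<dots> = hK CARD('n) * (1 * exp (- hw x) + 16 ^ 4 * (hw x ^ 4 * exp (- 1 * hw x)))"
      by (simp add: algebra_simps power_mult_distrib)
    also have "\<dots> \<le> hK CARD('n) * (1 * exp (- (1 / 2) * hw x) + 16 ^ 4 * (fact 4 * (2 / 1) ^ 4 * exp (- (1 / 2) * hw x)))"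
      using hK_nonneg hw_nonneg[of x] by (intro mult_left_mono add_mono power_exp_le) auto
    also have "\<dots> = ?K * exp (- (1 / 2) * hw x)" by (simp add: algebra_simps)
    finally show ?thesis .
  qed
  then show "AE x in lborel. norm (cmod (heatk 1 x) * exp (p * ln (koranyi x))) \<le> norm (?K * exp (- (1 / 2) * hw (x :: 'n heis)))"
    using hK_nonneg by (intro AE_I2) (simp add: abs_mult)
qed

lemma integrable_dil:
  fixes F :: "'n::finite heis \<Rightarrow> 'b::{banach, second_countable_topology}"
  assumes s: "s > 0" and F: "integrable lborel F"
  shows "integrable lborel (\<lambda>p. F (dil s p))"
proof -
  have [measurable]: "F \<in> borel_measurable borel" using borel_measurable_integrable[OF F] by simp
  have "integrable (density (distr lborel borel (dil s)) (\<lambda>_::'n heis. ennreal (s ^ (CARD('n) + 1)))) F"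
    using F lborel_dil[OF s, where 'n = 'n] by simp
  then have "integrable (distr lborel borel (dil s)) (\<lambda>p. s ^ (CARD('n) + 1) *\<^sub>R F p)"
    using s by (subst (asm) integrable_density) auto
  then have "integrable (distr lborel borel (dil s)) (\<lambda>p. inverse (s ^ (CARD('n) + 1)) *\<^sub>R (s ^ (CARD('n) + 1) *\<^sub>R F p))"
    by (rule integrable_scaleR_right)
  moreover have "inverse (s ^ (CARD('n) + 1)) *\<^sub>R (s ^ (CARD('n) + 1) *\<^sub>R v) = v" for v :: 'b
    by (subst scaleR_scaleR, subst left_inverse) (use s in auto)
  ultimately have "integrable (distr lborel borel (dil s)) F" by (simp only:)
  then show ?thesis by (subst (asm) integrable_distr_eq) auto
qed

text \<open>The curves of the invariance condition run inside level sets of the gauge. With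
  \<open>\<rho>^2 = N\<close>, \<open>cos \<theta> = t / N\<close> and
  \<open>sin \<theta> = |z|^2 / N\<close> the curve passes through \<open>p\<close>, and at
  \<open>\<theta> = 0\<close> through \<open>(0, N)\<close>.\<close>

lemma heis_class_radial:
  assumes f: "f \<in> heis_class M" and p: "p \<noteq> 0"
  shows "f p = f (0, koranyi p)"
proof -
  have cls: "f ((\<rho> * sqrt (sin \<theta>)) *\<^sub>R \<omega>, \<rho>\<^sup>2 * cos \<theta>) = f (\<rho> *\<^sub>R \<omega>, 0)"
    if "\<rho> > 0" "\<omega> \<in> sphere 0 1" "\<theta> \<in> {0..pi}" for \<rho> \<omega> \<theta>
    using f that unfolding heis_class_def by blast
  let ?N = "koranyi p"
  have N: "?N > 0" by (rule koranyi_pos[OF p])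
  have t: "\<bar>snd p / ?N\<bar> \<le> 1" using N snd_le_koranyi[of p] by (simp add: abs_divide)
  let ?\<theta> = "arccos (snd p / ?N)" and ?\<rho> = "sqrt ?N"
  have N2: "?N\<^sup>2 = (hq p)\<^sup>2 + (snd p)\<^sup>2" by (simp add: koranyi_def)
  have t1: "- 1 \<le> snd p / ?N" "snd p / ?N \<le> 1" using abs_le_D1[OF t] abs_le_D2[OF t] by linarith+
  have "1 - (snd p / ?N)\<^sup>2 = (hq p / ?N)\<^sup>2"
  proof -
    have "(hq p)\<^sup>2 = ?N\<^sup>2 - (snd p)\<^sup>2" using N2 by simp
    then show ?thesis using N by (simp add: power_divide diff_divide_distrib)
  qed
  then have sin: "sin ?\<theta> = hq p / ?N"
    using sin_arccos[OF t1] \<open>1 - (snd p / ?N)\<^sup>2 = (hq p / ?N)\<^sup>2\<close> N hq_nonneg[of p] by simp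
  have cos: "cos ?\<theta> = snd p / ?N" by (rule cos_arccos[OF t1])
  obtain \<omega> :: "complex ^ 'a" where \<omega>: "norm \<omega> = 1" "norm (fst p) *\<^sub>R \<omega> = fst p"
  proof (cases "fst p = 0")
    \<comment> \<open>On the \<open>t\<close> axis \<open>sin \<theta>\<close> is 0, so any unit
      vector serves as direction.\<close>
    case True
    obtain b :: "complex ^ 'a" where "b \<in> Basis" using nonempty_Basis by blast
    with True show ?thesis by (intro that[of b]) auto
  next
    case False
    then show ?thesis by (intro that[of "fst p /\<^sub>R norm (fst p)"]) auto
  qed
  have "?\<rho> * sqrt (sin ?\<theta>) = norm (fst p)" unfolding sin real_sqrt_mult[symmetric] using N by (simp add: hq_def)
  moreover have "?\<rho>\<^sup>2 * cos ?\<theta> = snd p" unfolding cos using N by simp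
  ultimately have "f p = f (?\<rho> *\<^sub>R \<omega>, 0)"
    using cls[of ?\<rho> \<omega> ?\<theta>] N \<omega> arccos_lbound[OF t1] arccos_ubound[OF t1] by simp
  also have "\<dots> = f (0, ?N)" using cls[of ?\<rho> \<omega> 0] N \<omega> by simp
  finally show ?thesis .
qed

lemma weighted_tail_integrable:
  "integrable lborel (\<lambda>s::real. indicat_real {0<..} s * (1 / (1 + s\<^sup>2)))"
proof -
  have "einterval 0 \<infinity> = {0<..}" by (auto simp: einterval_def zero_ereal_def)
  then show ?thesis using integrable_I0i_1_div_plus_square
    by (simp add: interval_lebesgue_integrable_def set_integrable_def)
qed

text \<open>This fixes the range of \<open>p\<close>: near 0 vanishing of order 5 outweighs
  \<open>s^(- p - 1)\<close> because \<open>p < 4\<close>, and for \<open>s > 1\<close> the weight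
  is at most \<open>s^(-2)\<close> because \<open>p > 1\<close>.\<close>

lemma weight_bound:
  fixes p s I C :: real
  assumes p: "1 < p" "p < 4" and s: "s > 0" and I: "I \<le> C * s ^ 5" "I \<le> C" and C: "C \<ge> 0"
  shows "exp (- (p + 1) * ln s) * I \<le> 2 * C * (1 / (1 + s\<^sup>2))"
proof (cases "s \<le> 1")
  case True
  then have l: "ln s \<le> 0" using s by simp
  have "exp (- (p + 1) * ln s) * I \<le> exp (- (p + 1) * ln s) * (C * s ^ 5)" using I by (intro mult_left_mono) auto
  also have "s ^ 5 = exp (5 * ln s)" using s exp_of_nat_mult[of 5 "ln s"] by simp
  also have "exp (- (p + 1) * ln s) * (C * exp (5 * ln s)) = C * exp ((4 - p) * ln s)"
    by (simp add: algebra_simps flip: exp_add)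
  also have "\<dots> \<le> C * 1" using l p C by (intro mult_left_mono) (auto simp: mult_nonneg_nonpos)
  also have "C * 1 \<le> 2 * C * (1 / (1 + s\<^sup>2))"
  proof -
    have s2: "s\<^sup>2 \<le> 1" using True s by (simp add: power_le_one)
    have "0 < 1 + s\<^sup>2" by (simp add: add_pos_nonneg)
    then show ?thesis using s2 mult_left_mono[OF s2 C] by (simp add: pos_le_divide_eq algebra_simps)
  qed
  finally show ?thesis .
next
  case False
  have "exp (- (p + 1) * ln s) * I \<le> exp (- (p + 1) * ln s) * C" using I(2) by (intro mult_left_mono) auto
  also have "\<dots> \<le> exp (- 2 * ln s) * C"
  proof -
    have "2 * ln s \<le> (p + 1) * ln s" using p False s by (intro mult_right_mono) auto
    then have "- (p + 1) * ln s \<le> - 2 * ln s" by (simp only: mult_minus_left neg_le_iff_le)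
    then show ?thesis by (intro mult_right_mono[OF iffD2[OF exp_le_cancel_iff] C])
  qed
  also have "exp (- 2 * ln s) = 1 / s\<^sup>2" using s exp_of_nat_mult[of 2 "ln s"] by (simp add: exp_minus divide_inverse)
  also have "1 / s\<^sup>2 * C \<le> 2 * C * (1 / (1 + s\<^sup>2))"
  proof -
    have s2: "1 \<le> s\<^sup>2" using False by (simp add: one_le_power)
    have "C * (1 + s\<^sup>2) \<le> 2 * C * s\<^sup>2" using mult_left_mono[OF s2 C] by (simp add: algebra_simps)
    then show ?thesis using s by (simp add: divide_simps add_pos_nonneg)
  qed
  finally show ?thesis .
qed

locale radial_flat_orbit = flat_orbit +
  fixes g :: "real \<Rightarrow> complex"
  assumes radial: "\<And>p. p \<noteq> 0 \<Longrightarrow> f p = g (koranyi p)"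
    and g_def: "\<And>s. g s = f (0, s)"
    and heat_zero: "\<And>s. s > 0 \<Longrightarrow> y 0 s = 0"
begin

lemma f_koranyi: "f p = g (koranyi p)"
  by (cases "p = 0") (simp_all add: radial g_def koranyi_def hq_def zero_prod_def)

lemma g_cont: "continuous_on UNIV g"
proof -
  have "continuous_on UNIV f" by (rule Ck_continuous[OF Ck_f])
  then have "continuous_on UNIV (\<lambda>s::real. f (0, s))"
    by (rule continuous_on_compose2) (auto intro: continuous_intros)
  then show ?thesis unfolding g_def[symmetric] .
qed

lemma g_measurable [measurable]: "g \<in> borel_measurable borel"
  by (rule borel_measurable_continuous_onI[OF g_cont])

lemma f_heatk_dil:
  "s > 0 \<Longrightarrow> f (dil s x) * heatk s (dil s x) = (g (s * koranyi x) * heatk 1 x) / of_real (s ^ (CARD('a) + 1))" for x :: "'a heis"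
  unfolding f_koranyi koranyi_dil heatk_dil by simp

text \<open>Pulling the pairing of \<open>f\<close> with \<open>heatk s\<close> back by
  \<open>dil s\<close> brings the kernel to time 1 and moves \<open>s\<close> into the argument of
  \<open>g\<close>.\<close>

lemma kernel_orthogonal:
  assumes s: "s > 0"
  shows "(\<integral>x. g (s * koranyi (x :: 'a heis)) * heatk 1 x \<partial>lborel) = 0"
    and "integrable lborel (\<lambda>x::'a heis. g (s * koranyi x) * heatk 1 x)"
    and "(\<integral>x. norm (g (s * koranyi (x :: 'a heis)) * heatk 1 x) \<partial>lborel) = (\<integral>x. cmod (H 0 x) * cmod (heatk s x) \<partial>lborel)"
proof -
  let ?d = "s ^ (CARD('a) + 1)"
  have d: "?d > 0" using s by simp
  have fm: "f \<in> borel_measurable borel" by (rule Ck_measurable[OF Ck_f])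
  have i: "integrable lborel (\<lambda>x. f x * heatk s x)" using L2_H[of 0] in_L2_heatk(1)[OF s] unfolding H_0 by (rule in_L2_mult)
  have "0 = (\<integral>x. f x * heatk s x \<partial>lborel)" using heat_zero[OF s] by (simp add: y_def H_0)
  also have "\<dots> = ?d *\<^sub>R (\<integral>x. f (dil s x) * heatk s (dil s x) \<partial>lborel)"
    using fm by (intro integral_dil[OF s]) simp
  also have "\<dots> = ?d *\<^sub>R ((\<integral>x. g (s * koranyi (x :: 'a heis)) * heatk 1 x \<partial>lborel) / of_real ?d)"
    unfolding f_heatk_dil[OF s] by (simp only: integral_divide_zero)
  finally show "(\<integral>x. g (s * koranyi (x :: 'a heis)) * heatk 1 x \<partial>lborel) = 0" using s by simp
  have "integrable lborel (\<lambda>x::'a heis. (g (s * koranyi x) * heatk 1 x) / of_real ?d)"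
    using integrable_dil[OF s i] unfolding f_heatk_dil[OF s] .
  then have "integrable lborel (\<lambda>x::'a heis. of_real ?d * ((g (s * koranyi x) * heatk 1 x) / of_real ?d))"
    by (rule integrable_mult_right)
  then show "integrable lborel (\<lambda>x::'a heis. g (s * koranyi x) * heatk 1 x)" using s by simp
  have "(\<integral>x. cmod (H 0 x) * cmod (heatk s x) \<partial>lborel) = (\<integral>x. norm (f x * heatk s x) \<partial>lborel)"
    by (simp add: norm_mult H_0)
  also have "\<dots> = ?d *\<^sub>R (\<integral>x. norm (f (dil s x) * heatk s (dil s x)) \<partial>lborel)"
    using fm by (intro integral_dil[OF s]) simp
  also have "\<dots> = ?d *\<^sub>R ((\<integral>x. norm (g (s * koranyi (x :: 'a heis)) * heatk 1 x) \<partial>lborel) / ?d)"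
  proof -
    have "norm (f (dil s x) * heatk s (dil s x)) = norm (g (s * koranyi x) * heatk 1 x) / ?d" for x :: "'a heis"
      unfolding f_heatk_dil[OF s] norm_divide using d by (simp only: norm_of_real abs_of_pos)
    then show ?thesis by (simp only: integral_divide_zero)
  qed
  finally show "(\<integral>x. norm (g (s * koranyi (x :: 'a heis)) * heatk 1 x) \<partial>lborel) = (\<integral>x. cmod (H 0 x) * cmod (heatk s x) \<partial>lborel)"
    using s by simp
qed

text \<open>The weight \<open>s^(- p - 1)\<close> on the half-line, so that
  \<open>mellin_g p\<close> is the Mellin transform of \<open>g\<close> at \<open>- p\<close>, and
  \<open>mellin_k p\<close> the \<open>p\<close>-th moment of the gauge under the kernel.\<close>

definition wt :: "real \<Rightarrow> real \<Rightarrow> real" where "wt p s = indicat_real {0<..} s * exp (- (p + 1) * ln s)"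
definition mellin_g :: "real \<Rightarrow> complex" where "mellin_g p = (\<integral>s. wt p s *\<^sub>R g s \<partial>lborel)"
definition mellin_k :: "real \<Rightarrow> complex" where
  "mellin_k p = (\<integral>x. exp (p * ln (koranyi (x :: 'a heis))) *\<^sub>R heatk 1 x \<partial>lborel)"

lemma wt_measurable [measurable]: "wt p \<in> borel_measurable borel"
  unfolding wt_def[abs_def] by measurable

text \<open>The inner integral of the norm is the quantity of \<open>heat_integral_bound\<close>,
  used with order 5 as \<open>weight_bound\<close> demands.\<close>

lemma fubini_integrable:
  assumes p: "1 < p" "p < 4"
  shows "integrable (lborel \<Otimes>\<^sub>M lborel) (\<lambda>(s, x::'a heis). wt p s *\<^sub>R (g (s * koranyi x) * heatk 1 x))" (is "integrable _ ?F")
proof (rule lborel_pair.Fubini_integrable)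
  have gm: "(\<lambda>z. koranyi (snd z)) \<in> borel_measurable (lborel \<Otimes>\<^sub>M lborel :: (real \<times> 'a heis) measure)"
    using measurable_compose[OF measurable_snd[of lborel lborel], of koranyi borel] koranyi_measurable by simp
  have km: "(\<lambda>z. heatk 1 (snd z)) \<in> borel_measurable (lborel \<Otimes>\<^sub>M lborel :: (real \<times> 'a heis) measure)"
    using measurable_compose[OF measurable_snd[of lborel lborel], of "heatk 1" borel] heatk_measurable(1) by simp
  have sm: "fst \<in> borel_measurable (lborel \<Otimes>\<^sub>M lborel :: (real \<times> 'a heis) measure)"
    using measurable_fst[of "lborel :: real measure" "lborel :: 'a heis measure"] by simp
  have "(\<lambda>z. wt p (fst z) *\<^sub>R (g (fst z * koranyi (snd z)) * heatk 1 (snd z))) \<in> borel_measurable (lborel \<Otimes>\<^sub>M lborel :: (real \<times> 'a heis) measure)"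
    by (intro borel_measurable_scaleR borel_measurable_times km measurable_compose[OF sm wt_measurable]
        measurable_compose[OF borel_measurable_times[OF sm gm] g_measurable])
  then show Fm: "?F \<in> borel_measurable (lborel \<Otimes>\<^sub>M lborel)" by (simp add: case_prod_beta')
  obtain C where C: "C \<ge> 0" "\<And>s. s > 0 \<Longrightarrow> (\<integral>x. cmod (H 0 x) * cmod (heatk s x) \<partial>lborel) \<le> C * s ^ 5"
      "\<And>s. s > 0 \<Longrightarrow> (\<integral>x. cmod (H 0 x) * cmod (heatk s x) \<partial>lborel) \<le> C"
    using heat_integral_bound[of 0 5] by blast
  show "integrable lborel (\<lambda>s. \<integral>x. norm (?F (s, x)) \<partial>lborel)"
  proof (rule Bochner_Integration.integrable_bound)
    show "integrable lborel (\<lambda>s. 2 * C * (indicat_real {0<..} s * (1 / (1 + s\<^sup>2))))"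
      using weighted_tail_integrable by (rule integrable_mult_right)
    show "(\<lambda>s. \<integral>x. norm (?F (s, x)) \<partial>lborel) \<in> borel_measurable lborel"
      by (rule lborel.borel_measurable_lebesgue_integral) (use measurable_compose[OF Fm borel_measurable_norm] in \<open>simp add: case_prod_beta'\<close>)
    have "norm (\<integral>x. norm (?F (s, x)) \<partial>lborel) \<le> norm (2 * C * (indicat_real {0<..} s * (1 / (1 + s\<^sup>2))))" for s
    proof (cases "s > 0")
      case True
      have "(\<integral>x. norm (?F (s, x)) \<partial>lborel) = exp (- (p + 1) * ln s) * (\<integral>x. cmod (H 0 x) * cmod (heatk s x) \<partial>lborel)"
        unfolding kernel_orthogonal(3)[OF True, symmetric] using True by (simp add: wt_def)
      also have "\<dots> \<le> 2 * C * (1 / (1 + s\<^sup>2))"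
        by (rule weight_bound[OF p True C(2)[OF True] C(3)[OF True] C(1)])
      finally have "(\<integral>x. norm (?F (s, x)) \<partial>lborel) \<le> 2 * C * (1 / (1 + s\<^sup>2))" .
      moreover have "0 \<le> (\<integral>x. norm (?F (s, x)) \<partial>lborel)" by (rule Bochner_Integration.integral_nonneg) simp
      ultimately show ?thesis using True C(1) by (simp add: abs_mult)
    qed (simp add: wt_def)
    then show "AE s in lborel. norm (\<integral>x. norm (?F (s, x)) \<partial>lborel) \<le> norm (2 * C * (indicat_real {0<..} s * (1 / (1 + s\<^sup>2))))" by simp
  qed
  have "integrable lborel (\<lambda>x. ?F (s, x))" for s
    by (cases "s > 0") (auto simp: wt_def intro!: integrable_scaleR_right kernel_orthogonal(2))
  then show "AE s in lborel. integrable lborel (\<lambda>x. ?F (s, x))" by simp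
qed

lemma wt_dil:
  assumes "v > 0" shows "wt p (0 + 1 / v * s) = exp ((p + 1) * ln v) * wt p s"
proof (cases "s > 0")
  case True
  then have "ln (s / v) = ln s - ln v" using assms by (simp add: ln_div)
  then have "wt p (0 + 1 / v * s) = exp (- (p + 1) * (ln s - ln v))" using True assms by (simp add: wt_def)
  also have "\<dots> = exp ((p + 1) * ln v) * wt p s" using True by (simp add: wt_def algebra_simps flip: exp_add)
  finally show ?thesis .
next
  case False
  then have "\<not> 0 < s / v" using assms by (simp add: zero_less_divide_iff)
  with False show ?thesis by (simp add: wt_def)
qed

lemma inner_mellin:
  assumes v: "v > 0"
  shows "(\<integral>s. wt p s *\<^sub>R g (s * v) \<partial>lborel) = exp (p * ln v) *\<^sub>R mellin_g p"
    and "integrable lborel (\<lambda>s. wt p s *\<^sub>R g (s * v)) \<Longrightarrow> integrable lborel (\<lambda>s. wt p s *\<^sub>R g s)"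
proof -
  have eq: "wt p (0 + 1 / v * s) *\<^sub>R g ((0 + 1 / v * s) * v) = exp ((p + 1) * ln v) *\<^sub>R (wt p s *\<^sub>R g s)" for s
    unfolding wt_dil[OF v] using v by simp
  have "(\<integral>s. wt p s *\<^sub>R g (s * v) \<partial>lborel) = \<bar>1 / v\<bar> *\<^sub>R (\<integral>s. wt p (0 + 1 / v * s) *\<^sub>R g ((0 + 1 / v * s) * v) \<partial>lborel)"
    using v by (intro lborel_integral_real_affine) auto
  also have "\<dots> = (1 / v * exp ((p + 1) * ln v)) *\<^sub>R mellin_g p"
    unfolding eq integral_scaleR_right mellin_g_def using v by simp
  also have "1 / v * exp ((p + 1) * ln v) = exp (p * ln v)" using v by (simp add: distrib_right exp_add)
  finally show "(\<integral>s. wt p s *\<^sub>R g (s * v) \<partial>lborel) = exp (p * ln v) *\<^sub>R mellin_g p" .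
  assume "integrable lborel (\<lambda>s. wt p s *\<^sub>R g (s * v))"
  then have "integrable lborel (\<lambda>s. wt p (0 + 1 / v * s) *\<^sub>R g ((0 + 1 / v * s) * v))"
    using v by (intro lborel_integrable_real_affine) auto
  then have "integrable lborel (\<lambda>s. exp (- ((p + 1) * ln v)) *\<^sub>R (exp ((p + 1) * ln v) *\<^sub>R (wt p s *\<^sub>R g s)))"
    unfolding eq by (rule integrable_scaleR_right)
  moreover have "exp (- ((p + 1) * ln v)) *\<^sub>R (exp ((p + 1) * ln v) *\<^sub>R z) = z" for z :: complex
    by (simp flip: exp_add)
  ultimately show "integrable lborel (\<lambda>s. wt p s *\<^sub>R g s)" by (simp only:)
qed

text \<open>After the interchange of integrals, the substitution in \<open>inner_mellin\<close>
  turns the integral over \<open>s\<close> into \<open>N^p\<close> times \<open>mellin_g p\<close>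
  for every point except the origin.\<close>

lemma mellin_product:
  assumes p: "1 < p" "p < 4" shows "mellin_k p * mellin_g p = 0"
proof -
  have [measurable]: "{0} \<in> sets (lborel :: 'a heis measure)" by simp
  have "0 = (\<integral>s. (\<integral>x. wt p s *\<^sub>R (g (s * koranyi (x :: 'a heis)) * heatk 1 x) \<partial>lborel) \<partial>lborel)"
  proof -
    have "(\<integral>x. wt p s *\<^sub>R (g (s * koranyi (x :: 'a heis)) * heatk 1 x) \<partial>lborel) = 0" for s
      by (cases "s > 0") (simp_all add: wt_def kernel_orthogonal(1))
    then show ?thesis by (simp only: Bochner_Integration.integral_zero)
  qed
  also have "\<dots> = (\<integral>x. (\<integral>s. wt p s *\<^sub>R (g (s * koranyi (x :: 'a heis)) * heatk 1 x) \<partial>lborel) \<partial>lborel)"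
    by (rule lborel_pair.Fubini_integral[OF fubini_integrable[OF p], symmetric])
  also have "\<dots> = (\<integral>x. (exp (p * ln (koranyi (x :: 'a heis))) *\<^sub>R heatk 1 x) * mellin_g p \<partial>lborel)"
  proof (rule integral_cong_AE)
    have "AE x in lborel. x \<noteq> (0 :: 'a heis)" by (rule AE_lborel_singleton)
    then show "AE x in lborel. (\<integral>s. wt p s *\<^sub>R (g (s * koranyi (x :: 'a heis)) * heatk 1 x) \<partial>lborel) = (exp (p * ln (koranyi x)) *\<^sub>R heatk 1 x) * mellin_g p"
    proof eventually_elim
      case (elim x)
      have "(\<integral>s. wt p s *\<^sub>R (g (s * koranyi x) * heatk 1 x) \<partial>lborel) = (\<integral>s. (wt p s *\<^sub>R g (s * koranyi x)) * heatk 1 x \<partial>lborel)" by simp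
      also have "\<dots> = (exp (p * ln (koranyi x)) *\<^sub>R mellin_g p) * heatk 1 x"
        unfolding integral_mult_left_zero inner_mellin(1)[OF koranyi_pos[OF elim]] ..
      finally show ?case by (simp add: mult.commute)
    qed
    show "(\<lambda>x::'a heis. \<integral>s. wt p s *\<^sub>R (g (s * koranyi x) * heatk 1 x) \<partial>lborel) \<in> borel_measurable lborel"
      using lborel_pair.integrable_snd[OF fubini_integrable[OF p]] by (rule borel_measurable_integrable)
  qed simp
  also have "\<dots> = mellin_k p * mellin_g p" by (simp only: integral_mult_left_zero mellin_k_def)
  finally show ?thesis by simp
qed

text \<open>Almost every slice of the double integral is integrable in \<open>s\<close>. The kernel
  is nonzero on an open set near the origin, so one such slice can be divided by its kernel
  value.\<close>

lemma mellin_g_integrable: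
  assumes p: "1 < p" "p < 4" shows "integrable lborel (\<lambda>s. wt p s *\<^sub>R g s)"
proof -
  obtain d where d: "d > 0" "\<And>x::'a heis. koranyi x < d \<Longrightarrow> Re (heatk 1 x) > 0" using heatk_pos_near_0[where 'n = 'a] by blast
  let ?B = "{x :: 'a heis. x \<noteq> 0 \<and> koranyi x < d}"
  have AE: "AE x in lborel. integrable lborel (\<lambda>s. wt p s *\<^sub>R (g (s * koranyi (x :: 'a heis)) * heatk 1 x))"
    by (rule lborel_pair.AE_integrable_snd[OF fubini_integrable[OF p]])
  have "\<exists>x\<in>?B. integrable lborel (\<lambda>s. wt p s *\<^sub>R (g (s * koranyi x) * heatk 1 x))"
  proof (rule ccontr)
    assume "\<not> ?thesis"
    with AE have "AE x in lborel. x \<notin> ?B" by (elim eventually_mono) blast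
    then have "?B \<in> null_sets lborel" using AE_iff_null_sets[of ?B lborel] open_koranyi_ball[of d] by simp
    then have "negligible ?B" by (simp add: negligible_iff_null_sets null_sets_completionI)
    then show False using open_not_negligible[OF open_koranyi_ball koranyi_ball_nonempty[OF d(1), where 'n = 'a]] by simp
  qed
  then obtain x :: "'a heis" where x: "x \<noteq> 0" "koranyi x < d" "integrable lborel (\<lambda>s. wt p s *\<^sub>R (g (s * koranyi x) * heatk 1 x))" by blast
  have "heatk 1 x \<noteq> 0" using d(2)[OF x(2)] by auto
  moreover have "integrable lborel (\<lambda>s. (wt p s *\<^sub>R (g (s * koranyi x) * heatk 1 x)) * inverse (heatk 1 x))"
    using x(3) by (rule integrable_mult_left)
  moreover have "(wt p s *\<^sub>R (g (s * koranyi x) * heatk 1 x)) * inverse (heatk 1 x) = wt p s *\<^sub>R g (s * koranyi x)" for s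
    using calculation(1) by (simp add: mult.assoc)
  ultimately have "integrable lborel (\<lambda>s. wt p s *\<^sub>R g (s * koranyi x))" by (simp only:)
  then show ?thesis by (rule inner_mellin(2)[OF koranyi_pos[OF x(1)]])
qed

text \<open>Infinitely many zeros would force, through \<open>exponential_moments_unique\<close>
  with \<open>u = ln N\<close>, a vanishing integral of the real part of the kernel times
  \<open>N^2\<close> over a gauge ball around the origin, where the integrand is positive.\<close>

lemma mellin_k_zeros_finite: "finite {p\<in>{2..3}. mellin_k p = 0}"
proof (rule ccontr)
  assume inf: "infinite {p\<in>{2..3}. mellin_k p = 0}"
  obtain d where d: "d > 0" "\<And>x::'a heis. koranyi x < d \<Longrightarrow> Re (heatk 1 x) > 0" using heatk_pos_near_0[where 'n = 'a] by blast
  let ?k = "\<lambda>x::'a heis. Re (heatk 1 x)" and ?u = "\<lambda>x::'a heis. ln (koranyi x)"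
  have ic: "integrable lborel (\<lambda>x::'a heis. exp (p * ?u x) *\<^sub>R heatk 1 x)" if "p \<in> {1<..<4}" for p
  proof -
    have "integrable lborel (\<lambda>x::'a heis. cmod (heatk 1 x) * exp (p * ?u x))" using that by (intro integrable_heatk_koranyi) auto
    then show ?thesis by (rule Bochner_Integration.integrable_bound) (simp_all add: mult.commute)
  qed
  have eq: "?k x * exp (p * ?u x) = Re (exp (p * ?u x) *\<^sub>R heatk 1 x)" for p x by simp
  have i: "integrable lborel (\<lambda>x::'a heis. ?k x * exp (p * ?u x))" if "p \<in> {1<..<4}" for p
    unfolding eq by (rule integrable_Re[OF ic[OF that]])
  have "{p\<in>{2..3}. mellin_k p = 0} \<subseteq> {p\<in>{2..3}. (\<integral>x. ?k x * exp (p * ?u x) \<partial>lborel) = 0}"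
  proof safe
    fix p :: real assume p: "p \<in> {2..3}" "mellin_k p = 0"
    have "(\<integral>x. ?k x * exp (p * ?u x) \<partial>lborel) = Re (mellin_k p)"
      unfolding eq mellin_k_def using p by (intro integral_Re ic) simp
    then show "(\<integral>x. ?k x * exp (p * ?u x) \<partial>lborel) = 0" using p by simp
  qed
  then have inf': "infinite {p\<in>{2..3}. (\<integral>x. ?k x * exp (p * ?u x) \<partial>lborel) = 0}" using inf infinite_super by blast
  let ?F = "\<lambda>x::'a heis. ?k x * exp (2 * ?u x) * indicator {..<ln d} (?u x)"
  have "(\<integral>x. ?F x \<partial>lborel) = 0"
    by (rule exponential_moments_unique[where a = 1 and b = 4 and c = 2 and d = 3, OF _ _ i inf']) simp_all
  moreover have "(\<integral>x. ?F x \<partial>lborel) > 0"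
  proof (rule positive_integral_open[OF _ _ open_koranyi_ball koranyi_ball_nonempty[OF d(1)]])
    show "integrable lborel ?F"
      by (rule Bochner_Integration.integrable_bound[OF integrable_norm[OF i[of 2]]]) (auto simp: indicator_def)
    show "?F x \<ge> 0" for x
    proof (cases "?u x < ln d")
      case True
      have "koranyi x < d"
      proof (cases "koranyi x = 0")
        case False
        then have "koranyi x > 0" using koranyi_nonneg[of x] by linarith
        then show ?thesis using True d(1) by simp
      qed (use d in simp)
      then show ?thesis using d(2)[of x] by (simp add: less_imp_le)
    qed simp
    show "?F x > 0" if "x \<in> {x. x \<noteq> 0 \<and> koranyi x < d}" for x
    proof -
      have "?u x < ln d" using that d(1) koranyi_pos[of x] by simp
      then show ?thesis using d(2)[of x] that by simp
    qed
  qed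
  ultimately show False by (simp only: less_irrefl)
qed

lemma f_zero: "f p = 0"
proof -
  have "{2..3::real} \<subseteq> {p\<in>{2..3}. mellin_k p = 0} \<union> {p\<in>{2..3}. mellin_g p = 0}"
  proof
    fix p :: real assume p: "p \<in> {2..3}"
    then have "mellin_k p * mellin_g p = 0" by (intro mellin_product) auto
    then show "p \<in> {p\<in>{2..3}. mellin_k p = 0} \<union> {p\<in>{2..3}. mellin_g p = 0}" using p by simp
  qed
  then have inf: "infinite {p\<in>{2..3}. mellin_g p = 0}"
    using mellin_k_zeros_finite infinite_Icc[of "2::real" 3] by (meson finite_UnI finite_subset one_less_numeral_iff numeral_less_iff semiring_norm)
  \<comment> \<open>With \<open>u = - ln s\<close> the weight \<open>s^(- p - 1)\<close> is
    \<open>exp (p * u) / s\<close>, which explains the factor \<open>inverse s\<close>.\<close>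
  have g: "indicat_real {0<..} s * (inverse s * P (g s)) = 0" if P: "bounded_linear P" for P :: "complex \<Rightarrow> real" and s
  proof (rule moments_zero_continuous[where k = "\<lambda>s. indicat_real {0<..} s * (inverse s * P (g s))" and u = "\<lambda>s. - ln s"
        and v = "\<lambda>x. exp (- x)" and a = 1 and b = 4 and c = 2 and d = 3])
    have "continuous_on {0<..} (\<lambda>s. P (g s))" by (rule bounded_linear.continuous_on[OF P continuous_on_subset[OF g_cont]]) simp
    then have "continuous_on {0<..} (\<lambda>s. inverse s * P (g s))" by (intro continuous_intros) auto
    then show "continuous_on {0<..} (\<lambda>s. indicat_real {0<..} s * (inverse s * P (g s)))"
      by (rule continuous_on_eq) simp
    have eq: "indicat_real {0<..} s * (inverse s * P (g s)) * exp (p * - ln s) = P (wt p s *\<^sub>R g s)" for s p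
    proof (cases "s > 0")
      case True
      then have "exp (- (p + 1) * ln s) = inverse s * exp (p * - ln s)"
        by (simp add: algebra_simps exp_diff exp_minus divide_inverse)
      then show ?thesis using True by (simp add: wt_def linear_scale[OF bounded_linear.linear[OF P]])
    qed (simp add: wt_def linear_0[OF bounded_linear.linear[OF P]])
    show "integrable lborel (\<lambda>s. indicat_real {0<..} s * (inverse s * P (g s)) * exp (p * - ln s))" if "p \<in> {1<..<4}" for p
      unfolding eq by (rule integrable_bounded_linear[OF P mellin_g_integrable]) (use that in auto)
    have "{p\<in>{2..3}. mellin_g p = 0} \<subseteq> {p\<in>{2..3}. (\<integral>s. indicat_real {0<..} s * (inverse s * P (g s)) * exp (p * - ln s) \<partial>lborel) = 0}"
    proof safe
      fix p :: real assume p: "p \<in> {2..3}" "mellin_g p = 0"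
      have "(\<integral>s. P (wt p s *\<^sub>R g s) \<partial>lborel) = P (mellin_g p)"
        unfolding mellin_g_def using p by (intro integral_bounded_linear[OF P] mellin_g_integrable) auto
      then show "(\<integral>s. indicat_real {0<..} s * (inverse s * P (g s)) * exp (p * - ln s) \<partial>lborel) = 0"
        unfolding eq using p linear_0[OF bounded_linear.linear[OF P]] by simp
    qed
    then show "infinite {p\<in>{2..3}. (\<integral>s. indicat_real {0<..} s * (inverse s * P (g s)) * exp (p * - ln s) \<partial>lborel) = 0}"
      using inf infinite_super by blast
  qed auto
  have "g s = 0" if "s > 0" for s
    using g[OF bounded_linear_Re, of s] g[OF bounded_linear_Im, of s] that by (simp add: complex_eq_iff)
  moreover have "f 0 = 0" using flat[of "Suc 0"] unfolding vanishing.simps by simp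
  ultimately show ?thesis using radial[of p] koranyi_pos[of p] by (cases "p = 0") simp_all
qed

end

theorem corollary1p6:
  fixes M :: "nat \<Rightarrow> real" and f :: "(complex ^ 'n::finite) \<times> real \<Rightarrow> complex"
  assumes "\<And>k. M k > 0"
    and "log_convex M"
    and "filterlim (\<lambda>N. \<Sum>k=1..N. M k powr (- 1 / (2 * real k))) at_top sequentially"
    and "f \<in> heis_class M"
    and "vanishes_to_infinite_order_at f 0"
  shows "\<forall>p. f p = 0"
proof -
  interpret flat_orbit f
  proof
    show "Ck n f" for n using assms(4) by (intro smooth_Ck) (simp add: heis_class_def)
    show "in_L2 ((sublaplacian ^^ k) f)" for k using assms(4) by (simp add: heis_class_def)
    show "vanishing n 0 f" for n by (rule vanishing_infinite_order[OF assms(5)])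
  qed
  obtain c where c: "c > 0" "\<And>k. L2_norm (H k) \<le> M k * c ^ k"
    using assms(4) unfolding heis_class_def H_def by blast
  \<comment> \<open>The geometric factor is absorbed into the sequence: log convexity persists, and
    for \<open>k \<ge> 1\<close> the terms of the series change only by the constant factor
    \<open>c powr (- 1 / 2)\<close>.\<close>
  let ?M = "\<lambda>k. M k * c ^ k"
  have pos: "?M k > 0" for k using assms(1) c(1) by simp
  have lc: "log_convex ?M"
    unfolding log_convex_def
  proof (intro allI impI)
    fix k :: nat assume k: "1 \<le> k"
    have "(M k)\<^sup>2 * c ^ (2 * k) \<le> M (k - 1) * M (k + 1) * c ^ (2 * k)"
      using assms(2) k c(1) by (intro mult_right_mono) (auto simp: log_convex_def)
    moreover have "c ^ (2 * k) = c ^ (k - 1) * c ^ (k + 1)"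
    proof -
      have "k - 1 + (k + 1) = 2 * k" using k by simp
      then show ?thesis by (simp only: power_add[symmetric])
    qed
    moreover have "(c ^ k)\<^sup>2 = c ^ (2 * k)" by (simp add: mult.commute flip: power_mult)
    ultimately show "(?M k)\<^sup>2 \<le> ?M (k - 1) * ?M (k + 1)" by (simp add: power_mult_distrib mult_ac)
  qed
  have div: "\<not> summable (\<lambda>k. ?M k powr (- 1 / (2 * real k)))"
  proof
    let ?a = "\<lambda>k. M k powr (- 1 / (2 * real k))"
    assume "summable (\<lambda>k. ?M k powr (- 1 / (2 * real k)))"
    then have "summable (\<lambda>k. c powr (1 / 2) * ?M k powr (- 1 / (2 * real k)))" by (rule summable_mult)
    then have "summable ?a"
    proof (rule summable_comparison_test'[where N = 1])
      fix k :: nat assume k: "1 \<le> k"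
      have "(c ^ k) powr (- 1 / (2 * real k)) = c powr (real k * (- 1 / (2 * real k)))"
        using c(1) by (simp only: powr_powr flip: powr_realpow)
      also have "real k * (- 1 / (2 * real k)) = - (1 / 2)" using k by simp
      finally have "c powr (1 / 2) * ?M k powr (- 1 / (2 * real k)) = ?a k"
        using c(1) by (simp add: powr_mult powr_minus field_simps)
      then show "norm (?a k) \<le> c powr (1 / 2) * ?M k powr (- 1 / (2 * real k))" by simp
    qed
    \<comment> \<open>The full sum also contains \<open>k = 0\<close>, where the exponent is
      \<open>- 1 / 0 = 0\<close> by default; this term is nonnegative and cannot spoil the
      bound.\<close>
    then have "(\<Sum>k=1..N. ?a k) \<le> suminf ?a" for N by (intro sum_le_suminf) auto
    moreover have "\<forall>\<^sub>F N in sequentially. suminf ?a < (\<Sum>k=1..N. ?a k)"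
      using assms(3) by (simp add: filterlim_at_top_dense)
    ultimately show False by (simp add: not_less[symmetric] eventually_sequentially)
  qed
  interpret radial_flat_orbit f "\<lambda>s. f (0, s)"
  proof
    show "f p = f (0, koranyi p)" if "p \<noteq> 0" for p by (rule heis_class_radial[OF assms(4) that])
    show "y 0 s = 0" if "s > 0" for s by (rule y_zero[OF pos lc c(2) div that])
  qed simp
  show ?thesis using f_zero by blast
qed

end
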